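(* Let $D=\mathbb T^d$ and $s>d/2$. Assume $u_0\in H^{s+1}(D;\mathbb R^d)$ is divergence free and $\rho_0\in H^{s+1}(D)$ is a density satisfying $0<C_1^{-1}\le\rho_0(a)\le C_1<\infty$ for all $a\in D$, for some $C_1>1$. Let $u$ be the (local-in-time $H^{s+1}$) solution, with initial data $(u_0,\rho_0)$, of the inhomogeneous incompressible Euler equations $$\partial_t(\rho u)+\nabla\cdot(\rho u\otimes u)+\nabla p=0,\qquad \nabla\cdot u=0,\qquad \partial_t\rho+u\cdot\nabla\rho=0,$$ and let $X$ be its Lagrangian flow, $\dot X_t(a)=u(t,X_t(a))$, $X_0(a)=a$. Then there exists $T_*>0$ such that $X$ is analytic in time on $(0,T_* )$: for every $a\in D$ the trajectory $t\mapsto X_t(a)$ is real-analytic for $t\in(0,T_* )$.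
   Context: A density is a function $\rho_0$ on $D$ with $\int_D\rho_0\,dx=1$. It is known that for $s>d/2$ the system is locally well-posed for $(u,\rho)\in H^{s+1}\times H^{s+1}$ with $\rho_0$ bounded above and away from zero; "the solution" refers to this local solution. Analyticity of $t\mapsto X_t(a)\in\mathbb T^d$ is understood as analyticity of the displacement $t\mapsto X_t(a)-a\in\mathbb R^d$. *)

theory Defs
  imports "HOL-Analysis.Analysis"
begin

section \<open>Functions on the torus\<close>

text \<open>
  The torus is \<open>\<real>\<^sup>d / \<int>\<^sup>d\<close>, of total volume 1, with \<open>d = CARD('n)\<close>.  A function on it is
  represented by its \<open>\<int>\<^sup>d\<close>-periodic lift to \<open>\<real>\<^sup>d\<close>, so that a statement about all points of
  the torus becomes one about all points of \<open>\<real>\<^sup>d\<close>.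
\<close>

definition torus_fun :: "(real^'n \<Rightarrow> 'b) \<Rightarrow> bool" where
  "torus_fun f \<longleftrightarrow> (\<forall>x. \<forall>i. f (x + axis i 1) = f x)"

definition unit_cube :: "(real^'n) set" where
  "unit_cube = cbox 0 (\<chi> i. 1)"

definition fourier_coeff :: "(real^'n \<Rightarrow> real) \<Rightarrow> int^'n \<Rightarrow> complex" where
  "fourier_coeff f k =
     (LINT x:unit_cube|lebesgue. cis (- 2 * pi * (\<Sum>i\<in>UNIV. of_int (k $ i) * x $ i)) * of_real (f x))"

text \<open>
  One summand of the squared Sobolev norm of order \<open>r\<close>.  The codomain is a Euclidean space, to
  treat scalar and vector fields at once; the inner sum runs over the components of \<open>f\<close>.
\<close>

definition sobolev_term :: "real \<Rightarrow> (real^'n \<Rightarrow> 'b::euclidean_space) \<Rightarrow> int^'n \<Rightarrow> real" where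
  "sobolev_term r f k =
     (1 + (\<Sum>i\<in>UNIV. (of_int (k $ i))\<^sup>2)) powr r *
     (\<Sum>b\<in>Basis. (cmod (fourier_coeff (\<lambda>x. f x \<bullet> b) k))\<^sup>2)"

text \<open>The space \<open>H\<^sup>r\<close> of the torus, meant for \<open>r \<ge> 0\<close>.\<close>

definition sobolev_space :: "real \<Rightarrow> (real^'n \<Rightarrow> 'b::euclidean_space) set" where
  "sobolev_space r =
     {f. torus_fun f \<and> f \<in> borel_measurable lebesgue \<and>
         set_integrable lebesgue unit_cube (\<lambda>x. (norm (f x))\<^sup>2) \<and>
         sobolev_term r f summable_on UNIV}"

definition sobolev_norm :: "real \<Rightarrow> (real^'n \<Rightarrow> 'b::euclidean_space) \<Rightarrow> real" where
  "sobolev_norm r f = sqrt (\<Sum>\<^sub>\<infinity>k. sobolev_term r f k)"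

text \<open>The class \<open>C([0,T); H\<^sup>r)\<close>.\<close>

definition continuous_in_sobolev ::
    "real \<Rightarrow> real \<Rightarrow> (real \<Rightarrow> real^'n \<Rightarrow> 'b::euclidean_space) \<Rightarrow> bool" where
  "continuous_in_sobolev T r f \<longleftrightarrow>
     (\<forall>t\<in>{0..<T}. f t \<in> sobolev_space r \<and>
        ((\<lambda>\<tau>. sobolev_norm r (\<lambda>x. f \<tau> x - f t x)) \<longlongrightarrow> 0) (at t within {0..<T}))"


section \<open>Differential operators\<close>

definition partial_deriv :: "'n \<Rightarrow> (real^'n \<Rightarrow> real) \<Rightarrow> real^'n \<Rightarrow> real" where
  "partial_deriv i f x = frechet_derivative f (at x) (axis i 1)"

definition grad :: "(real^'n \<Rightarrow> real) \<Rightarrow> real^'n \<Rightarrow> real^'n" where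
  "grad f x = (\<chi> i. partial_deriv i f x)"

definition divergence :: "(real^'n \<Rightarrow> real^'n) \<Rightarrow> real^'n \<Rightarrow> real" where
  "divergence v x = (\<Sum>i\<in>UNIV. partial_deriv i (\<lambda>y. v y $ i) x)"

text \<open>Row-wise divergence of a matrix field: component \<open>i\<close> is \<open>\<Sum>\<^sub>j \<partial>\<^sub>j M\<^sub>i\<^sub>j\<close>.\<close>

definition matrix_divergence :: "(real^'n \<Rightarrow> real^'n^'n) \<Rightarrow> real^'n \<Rightarrow> real^'n" where
  "matrix_divergence M x = (\<chi> i. divergence (\<lambda>y. M y $ i) x)"

definition tensor :: "real^'n \<Rightarrow> real^'n \<Rightarrow> real^'n^'n" where
  "tensor v w = (\<chi> i j. v $ i * w $ j)"

definition divergence_free :: "(real^'n \<Rightarrow> real^'n) \<Rightarrow> bool" where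
  "divergence_free v \<longleftrightarrow> (\<forall>x. v differentiable (at x) \<and> divergence v x = 0)"


section \<open>Solutions and their flow\<close>

text \<open>
  An \<open>H\<^sup>r\<close> solution on \<open>[0,T)\<close> with velocity \<open>u\<close>, density \<open>\<rho>\<close> and pressure \<open>p\<close>.  For \<open>r > d/2 + 1\<close>
  the space \<open>H\<^sup>r\<close> embeds into \<open>C\<^sup>1\<close>, so the equations hold pointwise for the continuous
  representatives; the differentiability conditions select these representatives, and then
  \<open>u\<close>, \<open>\<rho>\<close> and their spatial gradients are jointly continuous in time and space.  With the
  continuity of the pressure gradient, the solution is a classical one.  The pressure is itself
  a function on the torus.  At time 0 the time derivatives are one-sided.
\<close>

definition inhomogeneous_euler_solution ::
    "real \<Rightarrow> real \<Rightarrow> (real \<Rightarrow> real^'n \<Rightarrow> real^'n) \<Rightarrow> (real \<Rightarrow> real^'n \<Rightarrow> real) \<Rightarrow>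
     (real \<Rightarrow> real^'n \<Rightarrow> real) \<Rightarrow> bool" where
  "inhomogeneous_euler_solution r T u \<rho> p \<longleftrightarrow>
     continuous_in_sobolev T r u \<and>
     continuous_in_sobolev T r \<rho> \<and>
     continuous_on ({0..<T} \<times> UNIV) (\<lambda>(t, x). grad (p t) x) \<and>
     (\<forall>t\<in>{0..<T}.
        torus_fun (p t) \<and> divergence_free (u t) \<and>
        (\<forall>x. \<rho> t differentiable (at x) \<and> p t differentiable (at x) \<and>
          ((\<lambda>\<tau>. \<rho> \<tau> x *\<^sub>R u \<tau> x) has_vector_derivative
             - matrix_divergence (\<lambda>y. \<rho> t y *\<^sub>R tensor (u t y) (u t y)) x - grad (p t) x)
            (at t within {0..<T}) \<and>
          ((\<lambda>\<tau>. \<rho> \<tau> x) has_real_derivative - (u t x \<bullet> grad (\<rho> t) x))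
            (at t within {0..<T})))"

text \<open>
  \<open>X t a\<close> is the lift to \<open>\<real>\<^sup>d\<close>, starting at \<open>a\<close>, of the trajectory in the torus; hence
  \<open>X t a - a\<close> is the displacement.
\<close>

definition lagrangian_flow ::
    "real \<Rightarrow> (real \<Rightarrow> real^'n \<Rightarrow> real^'n) \<Rightarrow> (real \<Rightarrow> real^'n \<Rightarrow> real^'n) \<Rightarrow> bool" where
  "lagrangian_flow T u X \<longleftrightarrow>
     (\<forall>a. X 0 a = a \<and>
        (\<forall>t\<in>{0..<T}. ((\<lambda>\<tau>. X \<tau> a) has_vector_derivative u t (X t a)) (at t within {0..<T})))"

text \<open>Real analyticity, meant for open \<open>S\<close>.\<close>

definition real_analytic_on :: "(real \<Rightarrow> 'b::real_normed_vector) \<Rightarrow> real set \<Rightarrow> bool" where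
  "real_analytic_on f S \<longleftrightarrow>
     (\<forall>t\<^sub>0\<in>S. \<exists>c. \<exists>\<epsilon>>0. \<forall>t. \<bar>t - t\<^sub>0\<bar> < \<epsilon> \<longrightarrow> (\<lambda>n. (t - t\<^sub>0) ^ n *\<^sub>R c n) sums f t)"

end

theory Submission
  imports Defs "HOL-Complex_Analysis.Cauchy_Integral_Formula"
begin

text \<open>
  Write the flow as \<open>Y\<^sub>t = id + \<xi>\<^sub>t\<close>.  The density is transported, so \<open>\<rho>(t, Y\<^sub>t) = \<rho>\<^sub>0\<close>, and the
  momentum equation says that \<open>(I + D\<xi>)\<^sup>T \<rho>\<^sub>0 \<partial>\<^sub>t\<^sup>2\<xi>\<close> is a gradient, while incompressibility says that
  \<open>tr ((I + D\<xi>)\<^sup>-\<^sup>1 D\<partial>\<^sub>t\<xi>) = 0\<close>.  Differentiating the second relation in time and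
  comparing powers of \<open>t\<close> gives a div-curl system for every Taylor coefficient of \<open>\<partial>\<^sub>t\<^sup>2\<xi>\<close> in terms of the
  earlier ones, and no derivative is lost.  With \<open>\<rho>\<^sub>0 = C\<^sub>1 (1 - g)\<close> and \<open>|g| \<le> 1 - C\<^sub>1\<^sup>-\<^sup>2 < 1\<close> the
  system is solved by a Neumann series around the Leray projection, in the algebra of functions
  whose Fourier coefficients \<open>f\<^sub>k\<close> satisfy \<open>\<Sum>\<^sub>k (1 + |k|) |f\<^sub>k| < \<infinity>\<close>; it contains \<open>H\<^sup>s\<^sup>+\<^sup>1\<close>.  The bounds
  are geometric in the order, so there is a flow analytic in \<open>t\<close>.  An energy estimate in
  Lagrangian coordinates shows that it carries the given solution, and by Gronwall it is the given flow.
\<close>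

section \<open>Integration over the torus\<close>

unbundle no fps_syntax

text \<open>Two obstacles shape the proof. The bound |g| < 1 is pointwise, so multiplication by g
  followed by the Leray projection is a contraction in L2 only; in \<open>A1\<close> the norm of g
  may exceed 1. The powers of this operator are therefore compared with multiplication by powers of
  g, up to an error measured in a weaker norm: high powers of g are small in \<open>A1\<close>, the
  error interpolates between \<open>A1\<close> and L2, and the decay in L2 makes the Neumann series
  summable. The second obstacle is frequency 0. A divergence has mean zero, so the divergence of the
  acceleration can be prescribed at nonzero frequencies only. The construction thus yields merely
  that tr(B H), with B the inverse Jacobian and H the velocity gradient, is constant in space. Then
  so is the Jacobian determinant, whose mean is 1 by change of variables for a map that commutes
  with integer translations. Hence it equals 1, and only then does the trace vanish. The same mean
  value, perturbed, gives a weak Piola identity, which removes the pressure from the energy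
  estimate.\<close>

definition int_vec :: "int^'n \<Rightarrow> real^'n" where
  "int_vec k = (\<chi> i. of_int (k $ i))"

lemma int_vec_nth [simp]: "int_vec k $ i = of_int (k $ i)"
  by (simp add: int_vec_def)

lemma int_vec_simps: "int_vec 0 = 0" "int_vec (k + l) = int_vec k + int_vec l"
  "int_vec (- k) = - int_vec k" "int_vec (k - l) = int_vec k - int_vec l"
  by (simp_all add: vec_eq_iff)

lemma torus_fun_axis:
  assumes "torus_fun f"
  shows "f (x + of_int m *\<^sub>R axis i 1) = f x"
proof (induction m rule: int_induct [of _ 0])
  case (step1 j)
  have "f (x + of_int (j + 1) *\<^sub>R axis i 1) = f ((x + of_int j *\<^sub>R axis i 1) + axis i 1)"
    by (simp add: algebra_simps)
  with step1 assms show ?case by (simp add: torus_fun_def)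
next
  case (step2 j)
  have "f (x + of_int (j - 1) *\<^sub>R axis i 1) = f ((x + of_int (j - 1) *\<^sub>R axis i 1) + axis i 1)"
    using assms by (simp add: torus_fun_def)
  also have "\<dots> = f (x + of_int j *\<^sub>R axis i 1)"
    by (simp add: algebra_simps)
  also have "\<dots> = f x" by (rule step2.IH)
  finally show ?case .
qed simp

lemma torus_fun_int_vec:
  assumes "torus_fun f"
  shows "f (x + int_vec k) = f x"
proof -
  have *: "f (x + (\<Sum>i\<in>S. of_int (k $ i) *\<^sub>R axis i 1)) = f x" if "finite S" for S
    using that
  proof (induction S arbitrary: x rule: finite_induct)
    case (insert j S)
    have "f (x + (\<Sum>i\<in>insert j S. of_int (k $ i) *\<^sub>R axis i 1))
       = f ((x + of_int (k $ j) *\<^sub>R axis j 1) + (\<Sum>i\<in>S. of_int (k $ i) *\<^sub>R axis i 1))"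
      using insert.hyps by (simp add: add.assoc)
    also have "\<dots> = f (x + of_int (k $ j) *\<^sub>R axis j 1)" by (rule insert.IH)
    finally show ?case using torus_fun_axis[OF assms] by simp
  qed simp
  have "(\<Sum>i\<in>UNIV. of_int (k $ i) *\<^sub>R axis i 1) = int_vec k"
    by (simp add: vec_eq_iff axis_def if_distrib cong: if_cong)
  with *[of UNIV] show ?thesis by simp
qed

text \<open>The cube is half open so that it contains exactly one point of each orbit of the integer
  translations; it differs from \<open>unit_cube\<close> by a null set.\<close>

definition half_open_cube :: "(real^'n) set" where
  "half_open_cube = {x. \<forall>i. 0 \<le> x $ i \<and> x $ i < 1}"

lemma half_open_cube_fundamental: "\<exists>!k. x - int_vec k \<in> half_open_cube"
proof (intro ex1I)
  show "x - int_vec (\<chi> i. \<lfloor>x $ i\<rfloor>) \<in> half_open_cube"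
    by (auto simp: half_open_cube_def) linarith
  fix k assume k: "x - int_vec k \<in> half_open_cube"
  show "k = (\<chi> i. \<lfloor>x $ i\<rfloor>)"
    using k by (auto simp: half_open_cube_def vec_eq_iff algebra_simps intro!: floor_unique[symmetric])
qed

lemma torus_fun_reduce:
  assumes "torus_fun f"
  obtains y where "y \<in> unit_cube" "f y = f x"
proof -
  obtain k where "x - int_vec k \<in> half_open_cube"
    using half_open_cube_fundamental by blast
  then have "x - int_vec k \<in> unit_cube"
    by (auto simp: half_open_cube_def unit_cube_def mem_box_cart intro: less_imp_le)
  moreover have "f (x - int_vec k) = f x"
    using torus_fun_int_vec[OF assms, of x "-k"] by (simp add: int_vec_simps)
  ultimately show ?thesis using that by blast
qed

lemma half_open_cube_lebesgue [measurable]: "(half_open_cube :: (real^'n) set) \<in> sets lebesgue"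
proof -
  have "(half_open_cube :: (real^'n) set) = (\<Inter>i. {x::real^'n. 0 \<le> x $ i} \<inter> {x. x $ i < 1})"
    by (auto simp: half_open_cube_def)
  moreover have "(\<Inter>i. {x::real^'n. 0 \<le> x $ i} \<inter> {x. x $ i < 1}) \<in> sets borel"
    by (intro sets.countable_INT' sets.Int)
       (auto intro: borel_closed borel_open closed_halfspace_component_ge_cart open_halfspace_component_lt_cart)
  ultimately show ?thesis by (intro sets_completionI_sets) simp
qed

lemma box_subset_half_open_cube: "box 0 (\<chi> i. 1) \<subseteq> half_open_cube"
  and half_open_cube_subset: "half_open_cube \<subseteq> unit_cube"
  by (auto simp: half_open_cube_def unit_cube_def mem_box_cart less_imp_le)

lemma has_integral_half_open_cube:
  fixes f :: "real^'n \<Rightarrow> 'b::banach"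
  shows "(f has_integral I) half_open_cube \<longleftrightarrow> (f has_integral I) unit_cube"
proof (rule has_integral_spike_set_eq)
  have "negligible (unit_cube - box 0 (\<chi> i. 1) :: (real^'n) set)"
    unfolding unit_cube_def by (rule negligible_frontier_interval)
  then show "negligible {x \<in> half_open_cube - unit_cube. f x \<noteq> 0}" 
    "negligible {x \<in> unit_cube - half_open_cube. f x \<noteq> 0}"
    using box_subset_half_open_cube half_open_cube_subset
    by (auto intro: negligible_subset)
qed

lemma emeasure_half_open_cube: "emeasure lebesgue (half_open_cube :: (real^'n) set) = 1"
proof -
  have "Henstock_Kurzweil_Integration.content (cbox 0 ((\<chi> i. 1) :: real^'n)) = 1"
    by (subst content_cbox_cart) (auto simp: interval_ne_empty_cart)
  then have "((\<lambda>x. 1::real) has_integral 1) (unit_cube :: (real^'n) set)"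
    using has_integral_const[of "1::real" 0 "(\<chi> i. 1) :: real^'n"] unfolding unit_cube_def
    by (metis scaleR_one)
  then have "((\<lambda>x. 1::real) has_integral 1) (half_open_cube :: (real^'n) set)"
    by (simp add: has_integral_half_open_cube)
  then have m: "(half_open_cube :: (real^'n) set) \<in> lmeasurable"
    and "measure lebesgue (half_open_cube :: (real^'n) set) = 1"
    using lmeasurable_iff_integrable_on lmeasure_integral by (metis has_integral_integrable, metis has_integral_integrable integral_unique)
  then show ?thesis using emeasure_eq_measure2[OF m] by (metis ennreal_1)
qed

text \<open>Cut \<open>S\<close> along the integer translates of \<open>S'\<close>. The piece of
  \<open>S\<close> in the translate by k, moved back by -k, is the piece of \<open>S'\<close> in the
  translate of \<open>S\<close> by -k, and both families are countable partitions.\<close>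

lemma emeasure_fundamental_domain:
  fixes S S' :: "(real^'n) set"
  assumes S: "S \<in> sets lebesgue" "\<And>x. \<exists>!k. x - int_vec k \<in> S"
    and S': "S' \<in> sets lebesgue" "\<And>x. \<exists>!k. x - int_vec k \<in> S'"
  shows "emeasure lebesgue S = emeasure lebesgue S'"
proof -
  let ?X = "\<lambda>k. S \<inter> (\<lambda>x. int_vec k + x) ` S'"
  let ?Y = "\<lambda>k. S' \<inter> (\<lambda>x. - int_vec k + x) ` S"
  have S'k: "(\<lambda>x. int_vec k + x) ` S' \<in> sets lebesgue" for k
    by (rule lebesgue_sets_translation[OF S'(1)])
  have Sk: "(\<lambda>x. - int_vec k + x) ` S \<in> sets lebesgue" for k
    by (rule lebesgue_sets_translation[OF S(1)])
  have memS': "y \<in> (\<lambda>x. int_vec k + x) ` S' \<longleftrightarrow> y - int_vec k \<in> S'" for y k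
    by (auto simp: image_iff intro!: bexI[of _ "y - int_vec k"])
  have memS: "y \<in> (\<lambda>x. - int_vec k + x) ` S \<longleftrightarrow> y - int_vec (-k) \<in> S" for y k
    by (auto simp: image_iff int_vec_simps algebra_simps intro!: bexI[of _ "y + int_vec k"])
  have X: "S = (\<Union>k. ?X k)"
  proof (intro equalityI subsetI)
    fix x assume "x \<in> S"
    moreover obtain k where "x - int_vec k \<in> S'" using S'(2)[of x] by (elim ex1E)
    ultimately show "x \<in> (\<Union>k. ?X k)" using memS' by (intro UN_I[of k]) auto
  qed auto
  have Y: "S' = (\<Union>k. ?Y k)"
  proof (intro equalityI subsetI)
    fix x assume "x \<in> S'"
    moreover obtain k where "x - int_vec (- (- k)) \<in> S" using S(2)[of x] by (elim ex1E) simp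
    ultimately show "x \<in> (\<Union>k. ?Y k)" using memS by (intro UN_I[of "-k"]) auto
  qed auto
  have dX: "disjoint_family ?X"
    unfolding disjoint_family_on_def
  proof (intro ballI impI)
    fix m n :: "int^'n" assume "m \<noteq> n"
    then have "\<not> (x - int_vec m \<in> S' \<and> x - int_vec n \<in> S')" for x
      using S'(2)[of x] by (elim ex1E) metis
    then show "?X m \<inter> ?X n = {}" using memS' by auto
  qed
  have dY: "disjoint_family ?Y"
    unfolding disjoint_family_on_def
  proof (intro ballI impI)
    fix m n :: "int^'n" assume "m \<noteq> n"
    then have "\<not> (x - int_vec (-m) \<in> S \<and> x - int_vec (-n) \<in> S)" for x
      using S(2)[of x] by (elim ex1E) (metis minus_equation_iff)
    then show "?Y m \<inter> ?Y n = {}" using memS by auto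
  qed
  have eq: "emeasure lebesgue (?X k) = emeasure lebesgue (?Y k)" for k
  proof -
    have "?Y k = (\<lambda>x. - int_vec k + x) ` ?X k"
      using memS'[of _ k] by (auto simp: image_iff)
    moreover have "emeasure lebesgue ((\<lambda>x. - int_vec k + x) ` ?X k) = emeasure lebesgue (?X k)"
      using emeasure_lebesgue_affine[of 1 "- int_vec k" "?X k"] by (simp add: image_image)
    ultimately show ?thesis by simp
  qed
  have "emeasure lebesgue S = (\<integral>\<^sup>+k. emeasure lebesgue (?X k) \<partial>count_space UNIV)"
    using S(1) S'k by (subst X, subst emeasure_UN_countable) (auto simp: dX)
  also have "\<dots> = (\<integral>\<^sup>+k. emeasure lebesgue (?Y k) \<partial>count_space UNIV)" by (simp add: eq)
  also have "\<dots> = emeasure lebesgue (\<Union>k. ?Y k)"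
    by (rule emeasure_UN_countable[symmetric]) (use S'(1) Sk dY in \<open>blast | simp only: countableI_type\<close>)+
  also have "\<dots> = emeasure lebesgue S'" using Y by (rule arg_cong[symmetric])
  finally show ?thesis .
qed

section \<open>Mean Jacobian determinant of small periodic perturbations of the identity\<close>

text \<open>Homotopy argument: each I + sA with s in [0,1] is injective because sA at most halves
  lengths, so the determinant never vanishes on the path that starts at I.\<close>

lemma det_add_nonneg:
  fixes A :: "real^'n^'n"
  assumes A: "\<And>h. norm (A *v h) \<le> norm h / 2"
  shows "det (mat 1 + A) > 0"
proof (rule ccontr)
  assume "\<not> det (mat 1 + A) > 0"
  moreover have "continuous_on {0..1} (\<lambda>s. det (mat 1 + s *\<^sub>R A))"
    unfolding det_def by (intro continuous_intros)
  ultimately obtain s where s: "0 \<le> s" "s \<le> 1" "det (mat 1 + s *\<^sub>R A) = 0"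
    using IVT2'[of "\<lambda>s. det (mat 1 + s *\<^sub>R A)" 1 0 0] by auto
  have "inj ((*v) (mat 1 + s *\<^sub>R A))"
  proof (subst matrix_left_invertible_injective[symmetric], subst matrix_left_invertible_ker, intro allI impI)
    fix h assume "(mat 1 + s *\<^sub>R A) *v h = 0"
    then have "h = - (s *\<^sub>R (A *v h))"
      by (simp add: matrix_vector_mult_add_rdistrib eq_neg_iff_add_eq_0 scaleR_matrix_vector_assoc)
    then have "norm h = s * norm (A *v h)" using s by (metis abs_of_nonneg norm_minus_cancel norm_scaleR)
    also have "\<dots> \<le> 1 * (norm h / 2)" using s A by (intro mult_mono) auto
    finally show "h = 0" by simp
  qed
  then have "det (mat 1 + s *\<^sub>R A) \<noteq> 0"
    by (metis invertible_det_nz invertible_left_inverse matrix_left_invertible_injective)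
  with s show False by simp
qed

text \<open>\<open>V\<close> is Lipschitz with constant 1/2, so the map from x to z - V x is a
  contraction, and its fixed point is the preimage of z.\<close>

lemma perturbed_identity_bij:
  fixes V :: "real^'n \<Rightarrow> real^'n"
  assumes der: "\<And>x. (V has_derivative (\<lambda>h. G x *v h)) (at x)"
    and G: "\<And>x h. norm (G x *v h) \<le> norm h / 2"
  shows "\<exists>!x. x + V x = z"
proof -
  have on: "onorm ((*v) (G x)) \<le> 1/2" for x
    by (rule onorm_bound) (use G in auto)
  have lip: "norm (V x - V y) \<le> 1/2 * norm (x - y)" for x y
    by (rule differentiable_bound[of UNIV V "\<lambda>x h. G x *v h"])
       (use der on in \<open>auto simp: has_derivative_at_withinI\<close>)
  have "\<exists>!x. z - V x = x"
    by (rule banach_fix_type[of "1/2"]) (use lip in \<open>auto simp: dist_norm norm_minus_commute\<close>)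
  then show ?thesis by (metis add.commute diff_add_cancel add_diff_cancel)
qed

text \<open>The map id + V is a bijection that commutes with integer translations, so it carries one
  fundamental domain to another and the image of the cube still has measure 1. Change of variables
  turns this into the mean of the determinant, which is positive and so its own absolute
  value.\<close>

lemma has_integral_det_wellorder:
  fixes V :: "real^'m::{finite,wellorder} \<Rightarrow> real^'m::_"
  assumes V: "torus_fun V"
    and der: "\<And>x. (V has_derivative (\<lambda>h. G x *v h)) (at x)"
    and G: "\<And>x h. norm (G x *v h) \<le> norm h / 2"
  shows "((\<lambda>x. det (mat 1 + G x)) has_integral 1) unit_cube"
proof -
  define Y where "Y = (\<lambda>x. x + V x)"
  let ?S = "half_open_cube :: (real^'m::{finite,wellorder}) set"
  have derY: "(Y has_derivative (\<lambda>h. (mat 1 + G x) *v h)) (at x within A)" for x A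
    unfolding Y_def matrix_vector_mult_add_rdistrib matrix_vector_mul_lid
    by (rule has_derivative_at_withinI, rule has_derivative_add[OF has_derivative_ident der])
  have bij: "\<exists>!x. Y x = z" for z
    unfolding Y_def by (rule perturbed_identity_bij[OF der G])
  have Yk: "Y (x - int_vec k) = Y x - int_vec k" for x k
    using torus_fun_int_vec[OF V, of x "-k"] by (simp add: Y_def int_vec_simps)
  have inj: "inj_on Y ?S" using bij by (metis inj_onI)
  have meas: "Y ` ?S \<in> sets lebesgue"
    by (rule differentiable_image_in_sets_lebesgue[OF half_open_cube_lebesgue])
       (use derY in \<open>auto simp: differentiable_on_def differentiable_def\<close>)
  have "\<exists>!k. z - int_vec k \<in> Y ` ?S" for z
  proof -
    obtain x where x: "Y x = z" using bij[of z] by blast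
    have "z - int_vec k \<in> Y ` ?S \<longleftrightarrow> x - int_vec k \<in> ?S" for k
    proof -
      have "y = x - int_vec k" if "z - int_vec k = Y y" for y
        using that x Yk[of x k] bij[of "Y y"] by metis
      moreover have "z - int_vec k = Y (x - int_vec k)" using x Yk[of x k] by simp
      ultimately show ?thesis by (metis image_iff)
    qed
    then show ?thesis using half_open_cube_fundamental[of x] by simp
  qed
  then have em: "emeasure lebesgue (Y ` ?S) = 1"
    using emeasure_fundamental_domain[OF meas _ half_open_cube_lebesgue half_open_cube_fundamental]
      emeasure_half_open_cube by metis
  then have "Y ` ?S \<in> lmeasurable \<and> measure lebesgue (Y ` ?S) = 1"
    using meas by (auto simp: fmeasurable_def measure_def)
  then have "((\<lambda>x. \<bar>det (matrix (\<lambda>h. (mat 1 + G x) *v h))\<bar>) has_integral 1) ?S"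
    using has_measure_differentiable_image[OF half_open_cube_lebesgue derY inj] by blast
  moreover have "\<bar>det (matrix (\<lambda>h. (mat 1 + G x) *v h))\<bar> = det (mat 1 + G x)" for x
    using det_add_nonneg[OF G[of x]] by (simp add: matrix_of_matrix_vector_mul)
  ultimately show ?thesis by (simp add: has_integral_half_open_cube)
qed


text \<open>
  The change of variables formula of the library is restricted to well-ordered index types.  Every
  finite type is in bijection with the following one.
\<close>

typedef (overloaded) 'n wo = "{..<CARD('n::finite)}"
  by (rule exI[of _ 0]) simp

instantiation wo :: (finite) wellorder
begin

definition less_eq_wo :: "'a wo \<Rightarrow> 'a wo \<Rightarrow> bool" where "less_eq_wo x y \<longleftrightarrow> Rep_wo x \<le> Rep_wo y"
definition less_wo :: "'a wo \<Rightarrow> 'a wo \<Rightarrow> bool" where "less_wo x y \<longleftrightarrow> Rep_wo x < Rep_wo y"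

instance
proof
  fix P :: "'a wo \<Rightarrow> bool" and a :: "'a wo"
  assume *: "\<And>x. (\<And>y. y < x \<Longrightarrow> P y) \<Longrightarrow> P x"
  show "P a"
    by (induction "Rep_wo a" arbitrary: a rule: less_induct) (use * in \<open>auto simp: less_wo_def\<close>)
qed (auto simp: less_eq_wo_def less_wo_def Rep_wo_inject)

end

lemma wo_UNIV: "(UNIV :: 'n::finite wo set) = Abs_wo ` {..<CARD('n)}"
  by (metis type_definition.Abs_image type_definition_wo)

instance wo :: (finite) finite
  by standard (simp add: wo_UNIV)

lemma CARD_wo: "CARD('n wo) = CARD('n::finite)"
  by (subst wo_UNIV, subst card_image) (auto intro!: inj_onI simp: Abs_wo_inject)

lemma sign_conj:
  fixes \<pi> :: "'m::finite \<Rightarrow> 'n::finite"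
  assumes "bij \<pi>" "p permutes UNIV"
  shows "sign (\<pi> \<circ> p \<circ> inv \<pi>) = sign p"
  using assms(2) finite[of UNIV]
proof (induction rule: permutes_induct)
  case id
  then show ?case using assms(1) by (simp add: bij_is_surj surj_iff[THEN iffD1])
next
  case (swap a b p)
  have inj: "inj \<pi>" and surj: "surj \<pi>" using assms(1) by (auto simp: bij_def)
  have "\<pi> \<circ> (Transposition.transpose a b \<circ> p) \<circ> inv \<pi>
      = Transposition.transpose (\<pi> a) (\<pi> b) \<circ> (\<pi> \<circ> p \<circ> inv \<pi>)"
    using inj by (auto simp: fun_eq_iff Transposition.transpose_def inj_eq)
  moreover have "bij (\<pi> \<circ> p \<circ> inv \<pi>)"
    using assms(1) swap.hyps(4) by (intro bij_comp bij_imp_bij_inv) (auto simp: permutes_bij)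
  then have "permutation (\<pi> \<circ> p \<circ> inv \<pi>)"
    by (simp add: permutation)
  moreover have "permutation p" using swap.hyps(4) by (simp add: permutation permutes_bij)
  moreover have "\<pi> a \<noteq> \<pi> b" using inj swap.hyps(3) by (simp add: inj_eq)
  ultimately show ?case
    using swap.hyps(3) swap.IH
    by (simp only: sign_compose sign_swap_id permutation_swap_id if_False)
qed

text \<open>The permutations of the two index types correspond by conjugation with \<pi>, which
  preserves signs.\<close>

lemma det_reindex:
  fixes \<pi> :: "'m::finite \<Rightarrow> 'n::finite" and A :: "real^'n^'n"
  assumes \<pi>: "bij \<pi>"
  shows "det (\<chi> i j. A $ \<pi> i $ \<pi> j) = det A"
proof -
  have inv: "inv \<pi> (\<pi> x) = x" "\<pi> (inv \<pi> y) = y" for x y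
    using \<pi> by (simp_all add: bij_is_inj bij_is_surj surj_f_inv_f)
  have "det A = (\<Sum>p\<in>{p. p permutes (UNIV :: 'n set)}. of_int (sign p) * (\<Prod>i\<in>UNIV. A $ i $ p i))"
    by (simp add: det_def)
  also have "\<dots> = (\<Sum>p\<in>{p. p permutes (UNIV :: 'm set)}.
      of_int (sign (\<pi> \<circ> p \<circ> inv \<pi>)) * (\<Prod>i\<in>UNIV. A $ i $ (\<pi> \<circ> p \<circ> inv \<pi>) i))"
  proof (rule sum.reindex_bij_witness[of _ "\<lambda>p. \<pi> \<circ> p \<circ> inv \<pi>" "\<lambda>p. inv \<pi> \<circ> p \<circ> \<pi>"])
    fix p assume "p \<in> {p. p permutes (UNIV :: 'n set)}"
    then show "\<pi> \<circ> (inv \<pi> \<circ> p \<circ> \<pi>) \<circ> inv \<pi> = p" "inv \<pi> \<circ> p \<circ> \<pi> \<in> {p. p permutes UNIV}"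
      using \<pi> by (auto simp: fun_eq_iff inv permutes_bij intro!: bij_imp_permutes bij_comp bij_imp_bij_inv)
  next
    fix p assume "p \<in> {p. p permutes (UNIV :: 'm set)}"
    then show "inv \<pi> \<circ> (\<pi> \<circ> p \<circ> inv \<pi>) \<circ> \<pi> = p" "\<pi> \<circ> p \<circ> inv \<pi> \<in> {p. p permutes UNIV}"
      using \<pi> by (auto simp: fun_eq_iff inv permutes_bij intro!: bij_imp_permutes bij_comp bij_imp_bij_inv)
  qed (simp add: fun_eq_iff inv comp_def)
  also have "\<dots> = (\<Sum>p\<in>{p. p permutes (UNIV :: 'm set)}.
      of_int (sign p) * (\<Prod>i\<in>UNIV. A $ \<pi> i $ \<pi> (p i)))"
  proof (rule sum.cong)
    fix p assume "p \<in> {p. p permutes (UNIV :: 'm set)}"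
    moreover have "(\<Prod>i\<in>UNIV. A $ i $ (\<pi> \<circ> p \<circ> inv \<pi>) i) = (\<Prod>i\<in>UNIV. A $ \<pi> i $ \<pi> (p i))"
      by (rule prod.reindex_bij_witness[of _ \<pi> "inv \<pi>"]) (auto simp: inv)
    ultimately show "of_int (sign (\<pi> \<circ> p \<circ> inv \<pi>)) * (\<Prod>i\<in>UNIV. A $ i $ (\<pi> \<circ> p \<circ> inv \<pi>) i)
        = of_int (sign p) * (\<Prod>i\<in>UNIV. A $ \<pi> i $ \<pi> (p i))"
      using sign_conj[OF \<pi>] by simp
  qed simp
  also have "\<dots> = det (\<chi> i j. A $ \<pi> i $ \<pi> j)" by (simp add: det_def)
  finally show ?thesis ..
qed

definition reindex :: "('m \<Rightarrow> 'n) \<Rightarrow> 'a^'n \<Rightarrow> 'a^'m" where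
  "reindex \<pi> x = (\<chi> i. x $ \<pi> i)"

lemma reindex_nth [simp]: "reindex \<pi> x $ i = x $ \<pi> i"
  by (simp add: reindex_def)

lemma bounded_linear_reindex: "bounded_linear (reindex \<pi> :: real^'n \<Rightarrow> real^'m)"
  by (rule linear_conv_bounded_linear[THEN iffD1], rule linearI) (simp_all add: vec_eq_iff)

lemma reindex_inv:
  assumes "bij \<pi>"
  shows "reindex \<pi> (reindex (inv \<pi>) x) = x" "reindex (inv \<pi>) (reindex \<pi> y) = y"
  using assms by (simp_all add: vec_eq_iff bij_is_inj bij_is_surj surj_f_inv_f)

lemma norm_reindex:
  assumes "bij \<pi>"
  shows "norm (reindex \<pi> x :: real^'m) = norm x"
  unfolding norm_vec_def L2_set_def
  using sum.reindex_bij_betw[OF assms, of "\<lambda>i. (norm (x $ i))\<^sup>2"] by simp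

text \<open>A bijective renaming of coordinates maps boxes to boxes of the same content.\<close>

lemma has_integral_reindex:
  fixes \<pi> :: "'m::finite \<Rightarrow> 'n::finite" and f :: "real^'m \<Rightarrow> real"
  assumes \<pi>: "bij \<pi>" and f: "(f has_integral I) unit_cube"
  shows "((\<lambda>x. f (reindex \<pi> x)) has_integral I) unit_cube"
proof -
  have surj: "surj \<pi>" "surj (inv \<pi>)" using \<pi> by (auto simp: bij_is_surj bij_imp_bij_inv)
  have le: "(\<forall>i. P (\<pi> i)) \<longleftrightarrow> (\<forall>i. P i)" "(\<forall>i. Q (inv \<pi> i)) \<longleftrightarrow> (\<forall>i. Q i)" for P Q
    using surj by (metis surjD)+
  have im1: "reindex \<pi> ` cbox u v = cbox (reindex \<pi> u) (reindex \<pi> v)" for u v :: "real^'n"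
  proof (intro equalityI subsetI)
    fix y assume "y \<in> cbox (reindex \<pi> u) (reindex \<pi> v)"
    then have "reindex (inv \<pi>) y \<in> cbox u v"
      using \<pi> by (auto simp: mem_box_cart bij_is_surj surj_f_inv_f) (metis bij_inv_eq_iff)+
    then show "y \<in> reindex \<pi> ` cbox u v"
      using reindex_inv[OF \<pi>] by (metis imageI)
  qed (auto simp: mem_box_cart)
  have im2: "reindex (inv \<pi>) ` cbox u v = cbox (reindex (inv \<pi>) u) (reindex (inv \<pi>) v)" for u v :: "real^'m"
  proof (intro equalityI subsetI)
    fix y assume "y \<in> cbox (reindex (inv \<pi>) u) (reindex (inv \<pi>) v)"
    then have "reindex \<pi> y \<in> cbox u v"
      using \<pi> by (auto simp: mem_box_cart bij_is_inj) (metis bij_inv_eq_iff)+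
    then show "y \<in> reindex (inv \<pi>) ` cbox u v"
      using reindex_inv[OF \<pi>] by (metis imageI)
  qed (auto simp: mem_box_cart)
  have "((\<lambda>x. f (reindex \<pi> x)) has_integral (1 / 1) *\<^sub>R I) (reindex (inv \<pi>) ` cbox 0 (\<chi> i. 1))"
  proof (rule has_integral_twiddle)
    show "isCont (reindex \<pi>) x" for x :: "real^'n"
      by (rule linear_continuous_at[OF bounded_linear_reindex])
    show "\<exists>w z. reindex \<pi> ` cbox u v = cbox w z" for u v :: "real^'n" using im1 by blast
    show "\<exists>w z. reindex (inv \<pi>) ` cbox u v = cbox w z" for u v :: "real^'m" using im2 by blast
    show "Henstock_Kurzweil_Integration.content (reindex \<pi> ` cbox u v)
        = 1 * Henstock_Kurzweil_Integration.content (cbox u v)" for u v :: "real^'n"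
    proof -
      have "cbox (reindex \<pi> u) (reindex \<pi> v) = {} \<longleftrightarrow> cbox u v = {}"
        unfolding im1[symmetric] by simp
      moreover have "(\<Prod>i\<in>UNIV. v $ \<pi> i - u $ \<pi> i) = (\<Prod>i\<in>UNIV. v $ i - u $ i)"
        using prod.reindex_bij_betw[OF \<pi>, of "\<lambda>i. v $ i - u $ i"] by simp
      ultimately show ?thesis by (simp add: im1 content_cbox_if_cart)
    qed
  qed (use reindex_inv[OF \<pi>] f in \<open>auto simp: unit_cube_def\<close>)
  moreover have "reindex (inv \<pi>) ` cbox 0 (\<chi> i. 1) = unit_cube"
    by (simp add: im2 unit_cube_def) (simp add: reindex_def zero_vec_def)
  ultimately show ?thesis by simp
qed

text \<open>Conjugation with the renaming of coordinates carries the field to the well-ordered index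
  type; determinants, norms and integrals over the cube are unchanged.\<close>

lemma has_integral_det:
  fixes V :: "real^'n \<Rightarrow> real^'n"
  assumes V: "torus_fun V"
    and der: "\<And>x. (V has_derivative (\<lambda>h. G x *v h)) (at x)"
    and G: "\<And>x h. norm (G x *v h) \<le> norm h / 2"
  shows "((\<lambda>x. det (mat 1 + G x)) has_integral 1) unit_cube"
proof -
  obtain \<pi> :: "'n wo \<Rightarrow> 'n" where \<pi>: "bij \<pi>"
    using finite_same_card_bij[of "UNIV :: 'n wo set" "UNIV :: 'n set"] by (auto simp: CARD_wo)
  let ?P = "reindex \<pi> :: real^'n \<Rightarrow> real^'n wo" and ?Q = "reindex (inv \<pi>) :: real^'n wo \<Rightarrow> real^'n"
  have \<pi>': "bij (inv \<pi>)" "inv (inv \<pi>) = \<pi>" using \<pi> by (simp_all add: bij_imp_bij_inv inv_inv_eq)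
  define V' where "V' = ?P \<circ> V \<circ> ?Q"
  define G' where "G' = (\<lambda>y. (\<chi> i j. G (?Q y) $ \<pi> i $ \<pi> j) :: real^'n wo^'n wo)"
  have mv: "G' y *v h = ?P (G (?Q y) *v ?Q h)" for y h
  proof -
    have "(\<Sum>j\<in>UNIV. G (?Q y) $ \<pi> i $ \<pi> j * h $ j) = (\<Sum>j\<in>UNIV. G (?Q y) $ \<pi> i $ j * h $ inv \<pi> j)" for i
      using sum.reindex_bij_betw[OF \<pi>, of "\<lambda>j. G (?Q y) $ \<pi> i $ j * h $ inv \<pi> j"] \<pi>
      by (simp add: bij_is_inj)
    then show ?thesis by (simp add: vec_eq_iff matrix_vector_mult_def G'_def)
  qed
  have "((\<lambda>y. det (mat 1 + G' y)) has_integral 1) unit_cube"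
  proof (rule has_integral_det_wellorder)
    have "?Q (x + axis i 1) = ?Q x + axis (\<pi> i) 1" for x i
      using \<pi> by (auto simp: vec_eq_iff axis_def) (metis bij_inv_eq_iff)+
    then show "torus_fun V'"
      using V by (simp add: torus_fun_def V'_def)
    show "(V' has_derivative (\<lambda>h. G' y *v h)) (at y)" for y
      unfolding V'_def comp_def mv
      by (rule bounded_linear.has_derivative[OF bounded_linear_reindex]
          has_derivative_compose[OF bounded_linear_imp_has_derivative[OF bounded_linear_reindex] der])+
    show "norm (G' y *v h) \<le> norm h / 2" for y h
      using G[of "?Q y" "?Q h"] by (simp add: mv norm_reindex[OF \<pi>] norm_reindex[OF \<pi>'(1)])
  qed
  moreover have "det (mat 1 + G' y) = det (mat 1 + G (?Q y))" for y
  proof -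
    have "mat 1 + G' y = (\<chi> i j. (mat 1 + G (?Q y)) $ \<pi> i $ \<pi> j)"
      using \<pi> by (auto simp: vec_eq_iff G'_def mat_def bij_is_inj inj_eq)
    then show ?thesis using det_reindex[OF \<pi>] by metis
  qed
  ultimately show ?thesis
    using has_integral_reindex[OF \<pi>, of "\<lambda>y. det (mat 1 + G (?Q y))" 1] by (simp add: reindex_inv[OF \<pi>])
qed

section \<open>Expansion of the determinant near the identity and the weak Piola identity\<close>

lemma prod_one_plus_expansion:
  fixes c :: real
  assumes "finite F" "c \<ge> 0"
  obtains K where "K \<ge> 0"
    "\<And>e a. \<bar>e\<bar> \<le> 1 \<Longrightarrow> (\<And>i. i \<in> F \<Longrightarrow> \<bar>a i\<bar> \<le> c) \<Longrightarrow> \<bar>(\<Prod>i\<in>F. 1 + e * a i) - 1 - e * (\<Sum>i\<in>F. a i)\<bar> \<le> K * e\<^sup>2"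
proof -
  have "\<exists>K\<ge>0. \<forall>e a. \<bar>e\<bar> \<le> 1 \<longrightarrow> (\<forall>i\<in>F. \<bar>a i\<bar> \<le> c) \<longrightarrow> \<bar>(\<Prod>i\<in>F. 1 + e * a i) - 1 - e * (\<Sum>i\<in>F. a i)\<bar> \<le> K * e\<^sup>2"
    using assms(1)
  proof (induction F rule: finite_induct)
    case empty
    show ?case by (intro exI[of _ 0]) simp
  next
    case (insert j F)
    then obtain K where K: "K \<ge> 0" "\<And>e a. \<bar>e\<bar> \<le> 1 \<Longrightarrow> \<forall>i\<in>F. \<bar>a i\<bar> \<le> c \<Longrightarrow> \<bar>(\<Prod>i\<in>F. 1 + e * a i) - 1 - e * (\<Sum>i\<in>F. a i)\<bar> \<le> K * e\<^sup>2"
      by blast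
    show ?case
    \<comment> \<open>Multiplying out one more factor: the cross term of \<open>a j\<close> with the
      sum is bounded by \<open>c * (card F * c)\<close>, and the old remainder times the new factor,
      which is at most 1 + c, by \<open>(1 + c) * K\<close>.\<close>
    proof (intro exI[of _ "c * (card F * c) + (1 + c) * K"] conjI allI impI)
      show "0 \<le> c * (card F * c) + (1 + c) * K" using K(1) assms(2) by simp
      fix e :: real and a :: "'a \<Rightarrow> real"
      assume e: "\<bar>e\<bar> \<le> 1" and a: "\<forall>i\<in>insert j F. \<bar>a i\<bar> \<le> c"
      let ?S = "\<Sum>i\<in>F. a i" and ?r = "(\<Prod>i\<in>F. 1 + e * a i) - 1 - e * (\<Sum>i\<in>F. a i)"
      have "\<bar>?S\<bar> \<le> (\<Sum>i\<in>F. c)" using a by (intro order_trans[OF sum_abs] sum_mono) auto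
      then have "\<bar>a j\<bar> * \<bar>?S\<bar> \<le> c * (card F * c)" using a assms(2) by (intro mult_mono) auto
      moreover have "\<bar>e * a j\<bar> \<le> 1 * c" unfolding abs_mult using a e by (intro mult_mono) auto
      then have "\<bar>1 + e * a j\<bar> * \<bar>?r\<bar> \<le> (1 + c) * (K * e\<^sup>2)"
        using K(2)[OF e, of a] a assms(2) by (intro mult_mono) auto
      moreover have "(\<Prod>i\<in>insert j F. 1 + e * a i) - 1 - e * (\<Sum>i\<in>insert j F. a i)
          = e\<^sup>2 * (a j * ?S) + (1 + e * a j) * ?r"
        using insert.hyps by (simp add: algebra_simps power2_eq_square)
      moreover have "\<bar>e\<^sup>2 * (a j * ?S)\<bar> = e\<^sup>2 * (\<bar>a j\<bar> * \<bar>?S\<bar>)" by (simp add: abs_mult)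
      moreover have "e\<^sup>2 * (\<bar>a j\<bar> * \<bar>?S\<bar>) \<le> e\<^sup>2 * (c * (card F * c))"
        using calculation(1) by (rule mult_left_mono) simp
      moreover have "\<bar>(1 + e * a j) * ?r\<bar> = \<bar>1 + e * a j\<bar> * \<bar>?r\<bar>" by (rule abs_mult)
      moreover have "(c * (card F * c) + (1 + c) * K) * e\<^sup>2 = e\<^sup>2 * (c * (card F * c)) + (1 + c) * (K * e\<^sup>2)"
        by (simp add: algebra_simps)
      ultimately show "\<bar>(\<Prod>i\<in>insert j F. 1 + e * a i) - 1 - e * (\<Sum>i\<in>insert j F. a i)\<bar>
          \<le> (c * (card F * c) + (1 + c) * K) * e\<^sup>2"
        by linarith
    qed
  qed
  then show ?thesis using that by blast
qed

text \<open>In the Leibniz sum the identity permutation gives the diagonal product, hence 1 + e tr A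
  up to e^2. Any other permutation moves at least two indices, so its term has two off-diagonal
  factors of size e. The constant is uniform over matrices with entries bounded by \<open>c\<close>,
  as needed both under the integral sign and for the derivative of the determinant.\<close>

lemma det_expansion:
  fixes c :: real
  assumes c: "c \<ge> 0"
  obtains C where "C \<ge> 0"
    "\<And>e (A :: real^'n^'n). \<bar>e\<bar> \<le> 1 \<Longrightarrow> (\<And>i j. \<bar>A $ i $ j\<bar> \<le> c) \<Longrightarrow>
       \<bar>det (mat 1 + e *\<^sub>R A) - 1 - e * trace A\<bar> \<le> C * e\<^sup>2"
proof -
  obtain K where K: "K \<ge> 0"
    "\<And>e a. \<bar>e\<bar> \<le> 1 \<Longrightarrow> (\<And>i. i \<in> (UNIV :: 'n set) \<Longrightarrow> \<bar>a i\<bar> \<le> c) \<Longrightarrow> \<bar>(\<Prod>i\<in>UNIV. 1 + e * a i) - 1 - e * (\<Sum>i\<in>UNIV. a i)\<bar> \<le> K * e\<^sup>2"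
    by (rule prod_one_plus_expansion[of "UNIV :: 'n set", OF _ c]) auto
  let ?Q = "{p. p permutes (UNIV :: 'n set)} - {id}"
  let ?L = "c * c * (1 + c) ^ (CARD('n) - 2)"
  show ?thesis
  proof (rule that[of "K + card ?Q * ?L"])
    show "0 \<le> K + card ?Q * ?L" using K c by simp
    fix e :: real and A :: "real^'n^'n"
    assume e: "\<bar>e\<bar> \<le> 1" and A: "\<And>i j. \<bar>A $ i $ j\<bar> \<le> c"
    let ?f = "\<lambda>p. of_int (sign p) * (\<Prod>i\<in>UNIV. (mat 1 + e *\<^sub>R A) $ i $ p i)"
    have f: "\<bar>(mat 1 + e *\<^sub>R A) $ i $ j\<bar> \<le> 1 + c" for i j
    proof -
      have "\<bar>e * A $ i $ j\<bar> \<le> 1 * c" unfolding abs_mult using A e by (intro mult_mono) auto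
      then show ?thesis using c by (auto simp: mat_def)
    qed
    have od: "\<bar>(mat 1 + e *\<^sub>R A) $ i $ j\<bar> \<le> \<bar>e\<bar> * c" if "i \<noteq> j" for i j
      using that A by (auto simp: mat_def abs_mult intro!: mult_left_mono)
    have small: "\<bar>?f p\<bar> \<le> ?L * e\<^sup>2" if p: "p \<in> ?Q" for p
    proof -
      have inj: "inj p" using p by (auto simp: permutes_inj)
      obtain i where i: "p i \<noteq> i" using p by (auto simp: fun_eq_iff)
      define j where "j = p i"
      have j: "p j \<noteq> j" "j \<noteq> i" using i inj by (auto simp: j_def inj_eq)
      let ?g = "\<lambda>i. \<bar>(mat 1 + e *\<^sub>R A) $ i $ p i\<bar>"
      have "\<bar>?f p\<bar> = (\<Prod>i\<in>UNIV. ?g i)"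
        by (simp add: abs_mult abs_prod sign_def)
      also have "\<dots> = ?g i * (?g j * (\<Prod>i\<in>UNIV - {i} - {j}. ?g i))"
        using j by (subst prod.remove[of _ i], simp, simp, subst prod.remove[of _ j]) auto
      also have "\<dots> \<le> (\<bar>e\<bar> * c) * ((\<bar>e\<bar> * c) * (\<Prod>i\<in>UNIV - {i} - {j}. 1 + c))"
        using od i j f c by (intro mult_mono prod_mono mult_nonneg_nonneg prod_nonneg) (auto simp del: vector_add_component)
      also have "(\<Prod>i\<in>UNIV - {i} - {j}. 1 + c) = (1 + c) ^ (CARD('n) - 2)"
        using j by (simp add: card_Diff_subset numeral_2_eq_2)
      also have "(\<bar>e\<bar> * c) * ((\<bar>e\<bar> * c) * (1 + c) ^ (CARD('n) - 2)) = ?L * e\<^sup>2"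
        by (simp add: power2_eq_square algebra_simps)
      finally show ?thesis .
    qed
    have "det (mat 1 + e *\<^sub>R A) = ?f id + (\<Sum>p\<in>?Q. ?f p)"
      unfolding det_def by (rule sum.remove) (auto simp: permutes_id)
    moreover have "?f id = (\<Prod>i\<in>UNIV. 1 + e * A $ i $ i)" by (simp add: mat_def sign_id)
    moreover have "\<bar>(\<Prod>i\<in>UNIV. 1 + e * A $ i $ i) - 1 - e * trace A\<bar> \<le> K * e\<^sup>2"
      unfolding trace_def using K(2)[OF e, of "\<lambda>i. A $ i $ i"] A by simp
    moreover have "\<bar>\<Sum>p\<in>?Q. ?f p\<bar> \<le> (\<Sum>p\<in>?Q. ?L * e\<^sup>2)"
      by (rule order_trans[OF sum_abs sum_mono[OF small]])
    ultimately show "\<bar>det (mat 1 + e *\<^sub>R A) - 1 - e * trace A\<bar> \<le> (K + card ?Q * ?L) * e\<^sup>2"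
      by (simp add: algebra_simps)
  qed
qed

lemma torus_fun_bounded:
  fixes f :: "real^'n \<Rightarrow> 'b::real_normed_vector"
  assumes "torus_fun f" "continuous_on UNIV f"
  obtains M where "M > 0" "\<And>x. norm (f x) \<le> M"
proof -
  have "compact (f ` unit_cube)"
    unfolding unit_cube_def by (intro compact_continuous_image continuous_on_subset[OF assms(2)]) auto
  then obtain M where M: "M > 0" "\<And>x. x \<in> unit_cube \<Longrightarrow> norm (f x) \<le> M"
    by (metis bounded_pos compact_imp_bounded imageI)
  show ?thesis
    by (rule that[OF M(1)]) (metis torus_fun_reduce[OF assms(1)] M(2))
qed

lemma torus_fun_derivative:
  fixes f :: "real^'n \<Rightarrow> 'b::real_normed_vector"
  assumes f: "torus_fun f" and der: "\<And>x. (f has_derivative D x) (at x)"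
  shows "torus_fun D"
  unfolding torus_fun_def
proof (intro allI)
  fix x :: "real^'n" and i
  have "((\<lambda>y. y + axis i 1) has_derivative (\<lambda>h. h)) (at x)"
    by (auto intro!: derivative_eq_intros)
  from has_derivative_compose[OF this der]
  have "((\<lambda>y. f (y + axis i 1)) has_derivative D (x + axis i 1)) (at x)" .
  then have "(f has_derivative D (x + axis i 1)) (at x)"
    using f by (simp add: torus_fun_def)
  then show "D (x + axis i 1) = D x" using der by (rule has_derivative_unique)
qed

lemma abs_entry_le_norm: "\<bar>A $ i $ j\<bar> \<le> norm (A :: real^'n^'m)"
  by (rule order_trans[OF component_le_norm_cart Finite_Cartesian_Product.norm_nth_le])

lemma norm_matrix_vector_le:
  fixes A :: "real^'n^'n"
  shows "norm (A *v h) \<le> (\<Sum>i\<in>UNIV. \<Sum>j\<in>UNIV. \<bar>A $ i $ j\<bar>) * norm h"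
proof -
  have "norm (A *v h) \<le> (\<Sum>i\<in>UNIV. \<bar>(A *v h) $ i\<bar>)" by (rule norm_le_l1_cart)
  also have "\<dots> \<le> (\<Sum>i\<in>UNIV. \<Sum>j\<in>UNIV. \<bar>A $ i $ j\<bar> * norm h)"
    unfolding matrix_vector_mult_def
    by (intro sum_mono) (auto intro!: order_trans[OF sum_abs] sum_mono mult_left_mono component_le_norm_cart simp: abs_mult)
  finally show ?thesis by (simp add: sum_distrib_right)
qed

text \<open>
  Weak form of the Piola identity: \<open>B\<close> is the cofactor matrix of the volume preserving map
  \<open>id + V\<close>, and the mean Jacobian determinant of \<open>id + V + e W\<close> is 1 for every small \<open>e\<close>.
\<close>

lemma has_integral_trace_piola:
  fixes V W :: "real^'n \<Rightarrow> real^'n" and G B D :: "real^'n \<Rightarrow> real^'n^'n"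
  assumes V: "torus_fun V" "\<And>x. (V has_derivative (\<lambda>h. G x *v h)) (at x)"
    and G: "\<And>x h. norm (G x *v h) \<le> norm h / 4" and det: "\<And>x. det (mat 1 + G x) = 1"
    and B: "\<And>x. B x ** (mat 1 + G x) = mat 1" "continuous_on UNIV B" "torus_fun B"
    and W: "torus_fun W" "\<And>x. (W has_derivative (\<lambda>h. D x *v h)) (at x)" "continuous_on UNIV D"
  shows "((\<lambda>x. trace (B x ** D x)) has_integral 0) unit_cube"
proof -
  have perD: "torus_fun D"
    using torus_fun_derivative[OF W(1,2)] unfolding torus_fun_def by (metis matrix_of_matrix_vector_mul)
  obtain M where M: "M > 0" "\<And>x. norm (D x) \<le> M" using torus_fun_bounded[OF perD W(3)] by blast
  have contBD: "continuous_on UNIV (\<lambda>x. B x ** D x)"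
    unfolding matrix_matrix_mult_def
    by (intro continuous_intros continuous_on_vec_lambda) (use B(2) W(3) in auto)
  obtain c where c: "c > 0" "\<And>x. norm (B x ** D x) \<le> c"
    using torus_fun_bounded[OF _ contBD] perD B(3) by (auto simp: torus_fun_def)
  have c': "\<bar>(B x ** D x) $ i $ j\<bar> \<le> c" for x i j
    by (rule order_trans[OF abs_entry_le_norm c(2)])
  obtain C where C: "C \<ge> 0"
    "\<And>e (A :: real^'n^'n). \<bar>e\<bar> \<le> 1 \<Longrightarrow> (\<And>i j. \<bar>A $ i $ j\<bar> \<le> c) \<Longrightarrow>
       \<bar>det (mat 1 + e *\<^sub>R A) - 1 - e * trace A\<bar> \<le> C * e\<^sup>2"
    using det_expansion[of c] c(1) by (metis less_imp_le)
  have cont: "continuous_on unit_cube (\<lambda>x. trace (B x ** D x))"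
    unfolding trace_def by (intro continuous_intros continuous_on_subset[OF contBD]) auto
  then have int: "(\<lambda>x. trace (B x ** D x)) integrable_on unit_cube"
    unfolding unit_cube_def by (rule integrable_continuous)
  define J where "J = integral unit_cube (\<lambda>x. trace (B x ** D x))"
  have J: "((\<lambda>x. trace (B x ** D x)) has_integral J) unit_cube"
    using int by (simp add: J_def has_integral_integral)
  have mD: "norm (D x *v h) \<le> CARD('n) * CARD('n) * M * norm h" for x h
  proof -
    have "(\<Sum>i\<in>UNIV. \<Sum>j\<in>UNIV. \<bar>D x $ i $ j\<bar>) \<le> (\<Sum>i\<in>(UNIV::'n set). \<Sum>j\<in>(UNIV::'n set). M)"
      by (intro sum_mono order_trans[OF abs_entry_le_norm M(2)])
    then show ?thesis
      by (intro order_trans[OF norm_matrix_vector_le mult_right_mono]) (auto simp: mult.assoc)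
  qed
  \<comment> \<open>\<open>L\<close> bounds the operator norm of every \<open>D x\<close>; with |e|
    L at most 1/4 the perturbed gradient G + e D still meets the bound 1/2 required by
    \<open>has_integral_det\<close>.\<close>
  define L where "L = CARD('n) * CARD('n) * M"
  have L: "L > 0" using M(1) by (simp add: L_def)
  have bound: "\<bar>e\<bar> * \<bar>J\<bar> \<le> C * e\<^sup>2" if e: "\<bar>e\<bar> \<le> 1" "\<bar>e\<bar> * L \<le> 1/4" for e :: real
  proof -
    have "((\<lambda>x. det (mat 1 + (G x + e *\<^sub>R D x))) has_integral 1) unit_cube"
    proof (rule has_integral_det)
      show "torus_fun (\<lambda>x. V x + e *\<^sub>R W x)" using V W by (simp add: torus_fun_def)
      show "((\<lambda>x. V x + e *\<^sub>R W x) has_derivative (\<lambda>h. (G x + e *\<^sub>R D x) *v h)) (at x)" for x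
        unfolding matrix_vector_mult_add_rdistrib scaleR_matrix_vector_assoc[symmetric]
        by (intro has_derivative_add has_derivative_scaleR_right V W)
      show "norm ((G x + e *\<^sub>R D x) *v h) \<le> norm h / 2" for x h
      proof -
        have "norm ((G x + e *\<^sub>R D x) *v h) \<le> norm (G x *v h) + \<bar>e\<bar> * norm (D x *v h)"
          unfolding matrix_vector_mult_add_rdistrib scaleR_matrix_vector_assoc[symmetric]
          by (metis norm_triangle_ineq norm_scaleR)
        also have "\<bar>e\<bar> * norm (D x *v h) \<le> \<bar>e\<bar> * (L * norm h)"
          using mD[of x h] by (intro mult_left_mono) (auto simp: L_def)
        also have "\<bar>e\<bar> * (L * norm h) \<le> 1/4 * norm h"
          using mult_right_mono[OF e(2), of "norm h"] by (simp add: mult.assoc)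
        finally show ?thesis using G[of x h] by simp
      qed
    qed
    \<comment> \<open>Factoring out I + G, of determinant 1, leaves I + e B D, and the expansion
      applies with linear term e tr(B D).\<close>
    moreover have "det (mat 1 + (G x + e *\<^sub>R D x)) = det (mat 1 + e *\<^sub>R (B x ** D x))" for x
    proof -
      have "(mat 1 + G x) ** B x = mat 1" using B(1) by (metis matrix_left_right_inverse)
      then have "(mat 1 + G x) ** (e *\<^sub>R (B x ** D x)) = e *\<^sub>R D x"
        by (simp only: matrix_scalar_ac matrix_mul_assoc scalar_matrix_assoc[symmetric] matrix_mul_lid)
      then have "mat 1 + (G x + e *\<^sub>R D x) = (mat 1 + G x) ** (mat 1 + e *\<^sub>R (B x ** D x))"
        by (simp add: matrix_add_ldistrib)
      then show ?thesis by (simp add: det_mul det)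
    qed
    ultimately have "((\<lambda>x. det (mat 1 + e *\<^sub>R (B x ** D x)) - 1 - e * trace (B x ** D x)) has_integral (1 - 1 - e * J)) unit_cube"
      using has_integral_const[of "1::real" 0 "(\<chi> i. 1) :: real^'n"] J
      by (intro has_integral_diff has_integral_mult_right) (auto simp: unit_cube_def content_cbox_if_cart interval_eq_empty_cart)
    then have "norm (1 - 1 - e * J) \<le> C * e\<^sup>2 * Henstock_Kurzweil_Integration.content (cbox 0 ((\<chi> i. 1) :: real^'n))"
      unfolding unit_cube_def using C c' e(1) by (intro has_integral_bound) auto
    then show ?thesis by (simp add: abs_mult content_cbox_if_cart interval_eq_empty_cart)
  qed
  have "J = 0"
  proof (rule ccontr)
    assume "J \<noteq> 0"
    \<comment> \<open>Taking means in the expansion gives |e J| \<le> C e^2 for all small e. The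
      last bound on this e makes C e smaller than |J|, a contradiction.\<close>
    define e where "e = min (min 1 (1 / (4 * L))) (\<bar>J\<bar> / (2 * (C + 1)))"
    have e: "e > 0" "e \<le> 1" "e * L \<le> 1/4" "e * (C + 1) \<le> \<bar>J\<bar> / 2"
    proof -
      show "e > 0" "e \<le> 1" using \<open>J \<noteq> 0\<close> L C by (auto simp: e_def)
      have "e \<le> 1 / (4 * L)" "e \<le> \<bar>J\<bar> / (2 * (C + 1))" by (auto simp: e_def)
      then show "e * L \<le> 1/4" "e * (C + 1) \<le> \<bar>J\<bar> / 2" using L C by (auto simp: field_simps)
    qed
    have "e * \<bar>J\<bar> \<le> e * (C * e)" using bound[of e] e by (simp add: power2_eq_square mult.left_commute)
    then have "\<bar>J\<bar> \<le> C * e" using e(1) by simp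
    moreover have "C * e \<le> e * (C + 1)" using e(1) by (simp add: algebra_simps)
    ultimately show False using e(4) \<open>J \<noteq> 0\<close> by linarith
  qed
  with J show ?thesis by simp
qed

section \<open>Fourier series and the Wiener algebra\<close>

no_notation Infinite_Set_Sum.abs_summable_on (infix \<open>abs'_summable'_on\<close> 50)

text \<open>The case V = 0 of the weak Piola identity, with W equal to \<phi> times the i-th unit
  vector: the trace is then the i-th partial derivative of \<phi>.\<close>

lemma has_integral_partial_zero:
  fixes \<phi> :: "real^'n \<Rightarrow> real" and g :: "real^'n \<Rightarrow> real^'n"
  assumes "torus_fun \<phi>" "\<And>x. (\<phi> has_derivative (\<lambda>h. g x \<bullet> h)) (at x)" "continuous_on UNIV g"
  shows "((\<lambda>x. g x $ i) has_integral 0) unit_cube"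
proof -
  define D :: "real^'n \<Rightarrow> real^'n^'n" where "D = (\<lambda>x. \<chi> a b. if a = i then g x $ b else 0)"
  have "((\<lambda>x. trace (mat 1 ** D x)) has_integral 0) unit_cube"
  proof (rule has_integral_trace_piola[where V = "\<lambda>_. 0" and G = "\<lambda>_. 0"])
    show "torus_fun (\<lambda>x. \<phi> x *\<^sub>R axis i (1::real))" using assms(1) by (simp add: torus_fun_def)
    have "(g x \<bullet> h) *\<^sub>R axis i 1 = D x *v h" for x h
      by (auto simp: vec_eq_iff D_def matrix_vector_mult_def axis_def inner_vec_def)
    then have "(\<lambda>h. D x *v h) = (\<lambda>h. (g x \<bullet> h) *\<^sub>R axis i 1)" for x by (simp add: fun_eq_iff)
    then show "((\<lambda>x. \<phi> x *\<^sub>R axis i (1::real)) has_derivative (\<lambda>h. D x *v h)) (at x)" for x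
      using has_derivative_scaleR_left[OF assms(2)[of x], of "axis i 1"] by metis
    show "continuous_on UNIV D"
      unfolding D_def
    proof (intro continuous_on_vec_lambda)
      show "continuous_on UNIV (\<lambda>x. if a = i then g x $ b else 0)" for a b
        by (cases "a = i") (auto intro!: continuous_intros assms(3))
    qed
  qed (auto simp: torus_fun_def)
  moreover have "trace (mat 1 ** D x) = g x $ i" for x
    by (simp add: trace_def D_def matrix_mul_lid)
  ultimately show ?thesis by simp
qed

section \<open>Characters of the torus and absolutely convergent Fourier series\<close>

definition chr :: "int^'n \<Rightarrow> real^'n \<Rightarrow> complex" where
  "chr k x = cis (2 * pi * (int_vec k \<bullet> x))"

lemma chr_simps [simp]: "chr 0 x = 1" "norm (chr k x) = 1" "chr k 0 = 1"
  and chr_add: "chr (k + l) x = chr k x * chr l x"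
  and chr_minus: "chr (- k) x = cnj (chr k x)"
  and chr_add_right: "chr k (x + y) = chr k x * chr k y"
  by (simp_all add: chr_def int_vec_simps cis_mult cis_cnj inner_add_left inner_add_right algebra_simps)

lemma torus_fun_chr: "torus_fun (chr k)"
proof -
  have "chr k (axis i 1) = 1" for i
    using cis_multiple_2pi[of "of_int (k $ i)"] by (simp add: chr_def inner_axis mult.commute)
  then show ?thesis by (simp add: torus_fun_def chr_add_right)
qed

lemma continuous_on_chr [continuous_intros]: "continuous_on S (chr k)"
  unfolding chr_def by (intro continuous_intros)

lemma has_derivative_trig:
  "((\<lambda>x. sin (2 * pi * (a \<bullet> x))) has_derivative (\<lambda>h. (2 * pi * cos (2 * pi * (a \<bullet> x))) *\<^sub>R a \<bullet> h)) (at x)"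
  "((\<lambda>x. cos (2 * pi * (a \<bullet> x))) has_derivative (\<lambda>h. (- 2 * pi * sin (2 * pi * (a \<bullet> x))) *\<^sub>R a \<bullet> h)) (at x)"
  by (auto intro!: derivative_eq_intros simp: fun_eq_iff algebra_simps)

lemma has_integral_chr: "(chr k has_integral (if k = 0 then 1 else 0)) unit_cube"
proof (cases "k = 0")
  case True
  have "((\<lambda>x. 1::complex) has_integral 1) (cbox 0 ((\<chi> i. 1) :: real^'n))"
    using has_integral_const[of "1::complex" 0 "(\<chi> i. 1) :: real^'n"]
    by (simp add: content_cbox_if_cart interval_eq_empty_cart)
  then show ?thesis using True by (simp add: unit_cube_def chr_simps(1)[abs_def])
next
  case False
  \<comment> \<open>Along a coordinate with \<open>k $ i\<close> nonzero, cosine and sine are, up to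
    a nonzero factor, partial derivatives of the periodic functions sine and cosine, so their
    integrals vanish.\<close>
  then obtain i where i: "k $ i \<noteq> 0" by (auto simp: vec_eq_iff)
  have re: "Re (chr k x) = cos (2 * pi * (int_vec k \<bullet> x))" "Im (chr k x) = sin (2 * pi * (int_vec k \<bullet> x))" for x
    by (simp_all add: chr_def)
  have "torus_fun (\<lambda>x. Im (chr k x))" "torus_fun (\<lambda>x. Re (chr k x))"
    using torus_fun_chr[of k] by (simp_all add: torus_fun_def)
  then have tor: "torus_fun (\<lambda>x. sin (2 * pi * (int_vec k \<bullet> x)))" "torus_fun (\<lambda>x. cos (2 * pi * (int_vec k \<bullet> x)))"
    by (simp_all add: re)
  have cont: "continuous_on UNIV (\<lambda>x. (2 * pi * cos (2 * pi * (int_vec k \<bullet> x))) *\<^sub>R int_vec k)"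
    "continuous_on UNIV (\<lambda>x. (- 2 * pi * sin (2 * pi * (int_vec k \<bullet> x))) *\<^sub>R int_vec k)"
    by (intro continuous_intros)+
  have c: "((\<lambda>x. 2 * pi * cos (2 * pi * (int_vec k \<bullet> x)) * of_int (k $ i)) has_integral 0) unit_cube"
    using has_integral_partial_zero[OF tor(1) has_derivative_trig(1) cont(1), of i] by simp
  have s: "((\<lambda>x. - 2 * pi * sin (2 * pi * (int_vec k \<bullet> x)) * of_int (k $ i)) has_integral 0) unit_cube"
    using has_integral_partial_zero[OF tor(2) has_derivative_trig(2) cont(2), of i] by simp
  have "((\<lambda>x. Re (chr k x)) has_integral 0) unit_cube"
    using has_integral_mult_right[OF c, of "1 / (2 * pi * of_int (k $ i))"] i by (simp add: re)
  moreover have "((\<lambda>x. Im (chr k x)) has_integral 0) unit_cube"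
    using has_integral_mult_right[OF s, of "1 / (- 2 * pi * of_int (k $ i))"] i by (simp add: re)
  ultimately have "((\<lambda>x. of_real (Re (chr k x)) + \<i> * of_real (Im (chr k x))) has_integral (of_real 0 + \<i> * of_real 0)) unit_cube"
    by (intro has_integral_add has_integral_mult_right has_integral_of_real)
  then show ?thesis using False by (simp add: complex_eq[symmetric])
qed

definition fseries :: "(int^'n \<Rightarrow> complex) \<Rightarrow> real^'n \<Rightarrow> complex" where
  "fseries c x = (\<Sum>\<^sub>\<infinity>k. c k * chr k x)"

lemma abs_summable_chr:
  assumes "c abs_summable_on UNIV"
  shows "(\<lambda>k. c k * chr k x) abs_summable_on UNIV"
  using assms by (simp add: norm_mult)

lemma uniform_limit_fseries:
  assumes "c abs_summable_on UNIV"
  shows "uniform_limit S (\<lambda>F x. \<Sum>k\<in>F. c k * chr k x) (fseries c) (finite_subsets_at_top UNIV)"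
  unfolding fseries_def
  by (rule Weierstrass_m_test_general[OF _ assms]) (simp add: norm_mult)

lemma continuous_on_fseries:
  assumes "c abs_summable_on UNIV"
  shows "continuous_on S (fseries c)"
  by (rule uniform_limit_theorem[OF _ uniform_limit_fseries[OF assms]])
     (auto intro!: always_eventually continuous_intros)

lemma torus_fun_fseries: "torus_fun (fseries c)"
  unfolding torus_fun_def fseries_def
  by (intro allI infsum_cong) (use torus_fun_chr in \<open>auto simp: torus_fun_def\<close>)

text \<open>Multiplication by a character shifts the coefficients, so only the mean of a series is
  needed. Uniform convergence permits termwise integration, and the constant term alone
  survives.\<close>

lemma has_integral_fseries:
  assumes "c abs_summable_on UNIV"
  shows "((\<lambda>x. fseries c x * chr (- m) x) has_integral c m) unit_cube"
proof -
  have eq: "fseries c x * chr (- m) x = fseries (\<lambda>k. c (k + m)) x" for x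
  proof -
    have "fseries (\<lambda>k. c (k + m)) x = (\<Sum>\<^sub>\<infinity>k. c (k + m) * chr (k + m) x * chr (- m) x)"
      unfolding fseries_def by (intro infsum_cong) (simp add: mult.assoc chr_add[symmetric])
    also have "\<dots> = (\<Sum>\<^sub>\<infinity>k. c k * chr k x * chr (- m) x)"
      by (rule infsum_reindex_bij_betw) (rule bij_betwI[of _ _ _ "\<lambda>k. k - m"], auto)
    also have "\<dots> = fseries c x * chr (- m) x"
      unfolding fseries_def by (rule infsum_cmult_left') 
    finally show ?thesis ..
  qed
  have summ: "(\<lambda>k. c (k + m)) abs_summable_on UNIV"
    using summable_on_reindex_bij_betw[of "\<lambda>k. k + m" UNIV UNIV "\<lambda>k. norm (c k)"] assms
    by (simp add: bij_betwI[of _ _ _ "\<lambda>k. k - m"])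
  let ?d = "\<lambda>k. c (k + m)"
  have "uniform_limit (cbox 0 (\<chi> i. 1)) (\<lambda>F x. \<Sum>k\<in>F. ?d k * chr k x) (fseries ?d) (finite_subsets_at_top UNIV)"
    by (rule uniform_limit_fseries[OF summ])
  then obtain I J where IJ: "\<And>F. ((\<lambda>x. \<Sum>k\<in>F. ?d k * chr k x) has_integral I F) (cbox 0 (\<chi> i. 1))"
    "(fseries ?d has_integral J) (cbox 0 (\<chi> i. 1))" "(I \<longlongrightarrow> J) (finite_subsets_at_top UNIV)"
    by (rule uniform_limit_integral_cbox) (auto intro!: continuous_intros)
  have "I F = ?d 0" if "finite F" "{0} \<subseteq> F" for F
  proof -
    have h: "((\<lambda>x. \<Sum>k\<in>F. ?d k * chr k x) has_integral (\<Sum>k\<in>F. ?d k * (if k = 0 then 1 else 0))) unit_cube"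
      using that by (intro has_integral_sum has_integral_mult_right has_integral_chr) auto
    have "(\<Sum>k\<in>F. ?d k * (if k = 0 then 1 else 0)) = ?d 0"
      using that by (simp add: if_distrib[of "(*) _"] sum.delta cong: if_cong)
    then show ?thesis using has_integral_unique[OF IJ(1)[of F, folded unit_cube_def] h] by simp
  qed
  then have "eventually (\<lambda>F. I F = c m) (finite_subsets_at_top UNIV)"
    unfolding eventually_finite_subsets_at_top by (intro exI[of _ "{0}"]) auto
  then have "(I \<longlongrightarrow> c m) (finite_subsets_at_top UNIV)" by (rule tendsto_eventually)
  then have "J = c m" using IJ(3) by (metis tendsto_unique finite_subsets_at_top_neq_bot)
  then show ?thesis using IJ(2) by (simp add: eq unit_cube_def)
qed

lemma fseries_inject:
  assumes "c abs_summable_on UNIV" "d abs_summable_on UNIV" "\<And>x. fseries c x = fseries d x"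
  shows "c = d"
proof
  show "c m = d m" for m
    using has_integral_fseries[OF assms(1), of m] has_integral_fseries[OF assms(2), of m] assms(3)
    by (simp add: has_integral_unique)
qed

section \<open>Convolution of summable families\<close>

definition conv :: "('k::ab_group_add \<Rightarrow> 'a) \<Rightarrow> ('k \<Rightarrow> 'a) \<Rightarrow> 'k \<Rightarrow> 'a::{real_normed_field,banach}" where
  "conv c d k = (\<Sum>\<^sub>\<infinity>p. c p * d (k - p))"

context
  fixes c d :: "'k::ab_group_add \<Rightarrow> 'a::{real_normed_field,banach}"
  assumes c: "c abs_summable_on UNIV" and d: "d abs_summable_on UNIV"
begin

lemma abs_summable_prod: "(\<lambda>(p, q). c p * d q) abs_summable_on UNIV \<times> UNIV"
proof (rule Infinite_Sum.abs_summable_on_Sigma_iff[THEN iffD2], intro conjI ballI)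
  show "(\<lambda>q. case (p, q) of (p, q) \<Rightarrow> c p * d q) abs_summable_on UNIV" for p
    using d by (auto simp: norm_mult intro: summable_on_cmult_right)
  have "infsum (\<lambda>q. norm (case (p, q) of (p, q) \<Rightarrow> c p * d q)) UNIV = norm (c p) * (\<Sum>\<^sub>\<infinity>q. norm (d q))" for p
    by (simp add: norm_mult infsum_cmult_right')
  then show "(\<lambda>p. \<Sum>\<^sub>\<infinity>q. norm (case (p, q) of (p, q) \<Rightarrow> c p * d q)) abs_summable_on UNIV"
    using c by (auto simp: abs_mult intro: summable_on_cmult_left)
qed

text \<open>The family indexed by (k, p) is the product family reindexed by q = k - p: its row sums
  form the convolution, and its total is the product of the two sums.\<close>

lemma conv_pairs:
  "((\<lambda>(k, p). c p * d (k - p)) has_sum (infsum c UNIV * infsum d UNIV)) (UNIV \<times> UNIV)"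
  "(\<lambda>(k, p). c p * d (k - p)) abs_summable_on UNIV \<times> UNIV"
proof -
  have b: "bij_betw (\<lambda>(k, p). (p, k - p)) (UNIV \<times> UNIV) (UNIV \<times> (UNIV :: 'k set))"
    by (rule bij_betwI[of _ _ _ "\<lambda>(p, q). (p + q, p)"]) auto
  have "((\<lambda>(p, q). c p * d q) has_sum (infsum c UNIV * infsum d UNIV)) (UNIV \<times> UNIV)"
  proof (rule has_sum_SigmaI)
    show "((\<lambda>q. case (p, q) of (p, q) \<Rightarrow> c p * d q) has_sum c p * infsum d UNIV) UNIV" for p
      using abs_summable_summable[OF d] by (auto intro: has_sum_cmult_right)
    show "((\<lambda>p. c p * infsum d UNIV) has_sum infsum c UNIV * infsum d UNIV) UNIV"
      using abs_summable_summable[OF c] by (auto intro: has_sum_cmult_left)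
  qed (rule abs_summable_summable[OF abs_summable_prod])
  then show "((\<lambda>(k, p). c p * d (k - p)) has_sum (infsum c UNIV * infsum d UNIV)) (UNIV \<times> UNIV)"
    by (subst (asm) has_sum_reindex_bij_betw[OF b, symmetric]) (simp add: case_prod_unfold)
  show "(\<lambda>(k, p). c p * d (k - p)) abs_summable_on UNIV \<times> UNIV"
    using abs_summable_prod
    by (subst (asm) summable_on_reindex_bij_betw[OF b, symmetric]) (simp add: case_prod_unfold)
qed

lemma conv_summand: "(\<lambda>p. c p * d (k - p)) abs_summable_on UNIV"
  using Infinite_Sum.abs_summable_on_Sigma_iff[THEN iffD1, OF conv_pairs(2)] by auto

lemma infsum_conv: "infsum (conv c d) UNIV = infsum c UNIV * infsum d UNIV"
  using infsum_Sigma_banach[OF abs_summable_summable[OF conv_pairs(2)]] infsumI[OF conv_pairs(1)]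
  by (simp add: conv_def[abs_def])

end

text \<open>Young's inequality in l1, in the form shared by all product estimates: the weighted
  coefficients of a product are majorized by a convolution of two nonnegative summable
  families.\<close>

lemma conv_nonneg_summable:
  fixes a b :: "'k::ab_group_add \<Rightarrow> real"
  assumes "a summable_on UNIV" "b summable_on UNIV" "\<And>k. a k \<ge> 0" "\<And>k. b k \<ge> 0"
    and t: "\<And>k. norm (t k) \<le> conv a b k"
  shows "t abs_summable_on UNIV" "(\<Sum>\<^sub>\<infinity>k. norm (t k)) \<le> infsum a UNIV * infsum b UNIV"
proof -
  have ab: "a abs_summable_on UNIV" "b abs_summable_on UNIV" using assms by simp_all
  have "(\<lambda>k. \<Sum>\<^sub>\<infinity>p. norm (a p * b (k - p))) abs_summable_on UNIV"
    using Infinite_Sum.abs_summable_on_Sigma_iff[THEN iffD1, OF conv_pairs(2)[OF ab]] by simp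
  then have cs: "conv a b summable_on UNIV"
    using assms(3,4) by (simp add: conv_def[abs_def] abs_mult infsum_nonneg)
  then show 1: "t abs_summable_on UNIV"
    by (rule summable_on_comparison_test) (use t in auto)
  have "(\<Sum>\<^sub>\<infinity>k. norm (t k)) \<le> infsum (conv a b) UNIV"
    by (rule infsum_mono[OF 1 cs]) (use t in auto)
  then show "(\<Sum>\<^sub>\<infinity>k. norm (t k)) \<le> infsum a UNIV * infsum b UNIV"
    by (simp add: infsum_conv[OF ab])
qed

lemma norm_conv_le:
  fixes c d :: "'k::ab_group_add \<Rightarrow> 'a::{real_normed_field,banach}"
  assumes "c abs_summable_on UNIV" "d abs_summable_on UNIV"
  shows "norm (conv c d k) \<le> conv (\<lambda>p. norm (c p)) (\<lambda>p. norm (d p)) k"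
  unfolding conv_def using norm_infsum_bound[OF conv_summand[OF assms, of k]] by (simp add: norm_mult)

lemma conv_abs_summable:
  fixes c d :: "'k::ab_group_add \<Rightarrow> 'a::{real_normed_field,banach}"
  assumes "c abs_summable_on UNIV" "d abs_summable_on UNIV"
  shows "conv c d abs_summable_on UNIV"
    "(\<Sum>\<^sub>\<infinity>k. norm (conv c d k)) \<le> (\<Sum>\<^sub>\<infinity>k. norm (c k)) * (\<Sum>\<^sub>\<infinity>k. norm (d k))"
  using conv_nonneg_summable[OF assms _ _ norm_conv_le[OF assms]] by simp_all

lemma fseries_conv:
  assumes "c abs_summable_on UNIV" "d abs_summable_on UNIV"
  shows "fseries (conv c d) x = fseries c x * fseries d x"
proof -
  have "fseries (conv c d) x = infsum (conv (\<lambda>k. c k * chr k x) (\<lambda>k. d k * chr k x)) UNIV"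
    unfolding fseries_def
  proof (rule infsum_cong)
    fix k
    have *: "c p * chr p x * (d (k - p) * chr (k - p) x) = c p * d (k - p) * chr k x" for p
      using chr_add[of p "k - p" x] by simp
    then show "conv c d k * chr k x = conv (\<lambda>k. c k * chr k x) (\<lambda>k. d k * chr k x) k"
      by (simp only: conv_def * infsum_cmult_left')
  qed
  then show ?thesis
    using infsum_conv[OF abs_summable_chr[OF assms(1)] abs_summable_chr[OF assms(2)]] by (simp add: fseries_def)
qed

section \<open>The Wiener algebra of real functions on the torus\<close>

text \<open>Functions are encoded by their coefficients, so that completeness and multipliers are
  handled on families indexed by frequencies. The symmetry between k and -k selects the real-valued
  functions and makes this an algebra over the reals.\<close>

typedef (overloaded) 'n wiener =
  "{c :: int^'n::finite \<Rightarrow> complex. c abs_summable_on UNIV \<and> (\<forall>k. c (- k) = cnj (c k))}"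
  morphisms coef Wiener
  by (rule exI[of _ "\<lambda>_. 0"]) simp

lemma coef_summable: "coef f abs_summable_on UNIV"
  and coef_minus: "coef f (- k) = cnj (coef f k)"
  using coef[of f] by auto

lemma coef_Wiener:
  assumes "c abs_summable_on UNIV" "\<And>k. c (- k) = cnj (c k)"
  shows "coef (Wiener c) = c"
  using assms by (simp add: Wiener_inverse)

lemma wiener_eqI: "(\<And>k. coef f k = coef g k) \<Longrightarrow> f = g"
  by (simp add: coef_inject[symmetric] fun_eq_iff)

lemma infsum_minus_index: "(\<Sum>\<^sub>\<infinity>k. f (- k)) = (\<Sum>\<^sub>\<infinity>k::'k::ab_group_add. f k)"
  by (rule infsum_reindex_bij_witness[of _ uminus uminus]) auto

lemma abs_summable_single: "(\<lambda>k. if k = a then x else 0) abs_summable_on UNIV"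
  by (rule finite_nonzero_values_imp_summable_on) (auto intro: finite_subset[of _ "{a}"])

lemma infsum_single: "(\<Sum>\<^sub>\<infinity>k. if k = a then f k else 0) = (f a :: 'a::{comm_monoid_add,t2_space})"
  using infsum_cong_neutral[of UNIV "{a}" "\<lambda>k. if k = a then f k else 0" f] by simp

lemma abs_summable_add:
  assumes "f abs_summable_on A" "g abs_summable_on A"
  shows "(\<lambda>x. f x + g x) abs_summable_on A"
  by (rule summable_on_comparison_test[OF summable_on_add[OF assms]]) (auto intro: norm_triangle_ineq)

instantiation wiener :: (finite) real_normed_vector
begin

definition zero_wiener :: "'a wiener" where "0 = Wiener (\<lambda>_. 0)"
definition plus_wiener :: "'a wiener \<Rightarrow> 'a wiener \<Rightarrow> 'a wiener" where
  "f + g = Wiener (\<lambda>k. coef f k + coef g k)"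
definition uminus_wiener :: "'a wiener \<Rightarrow> 'a wiener" where "- f = Wiener (\<lambda>k. - coef f k)"
definition minus_wiener :: "'a wiener \<Rightarrow> 'a wiener \<Rightarrow> 'a wiener" where "f - g = f + - (g :: 'a wiener)"
definition scaleR_wiener :: "real \<Rightarrow> 'a wiener \<Rightarrow> 'a wiener" where
  "r *\<^sub>R f = Wiener (\<lambda>k. r *\<^sub>R coef f k)"
definition norm_wiener :: "'a wiener \<Rightarrow> real" where "norm f = (\<Sum>\<^sub>\<infinity>k. norm (coef f k))"
definition dist_wiener :: "'a wiener \<Rightarrow> 'a wiener \<Rightarrow> real" where
  "dist (f :: 'a wiener) (g :: 'a wiener) = norm (f - g)"
definition sgn_wiener :: "'a wiener \<Rightarrow> 'a wiener" where "sgn (f :: 'a wiener) = inverse (norm f) *\<^sub>R f"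
definition uniformity_wiener :: "('a wiener \<times> 'a wiener) filter" where
  "uniformity_wiener = (INF e\<in>{0 <..}. principal {(x, y). dist x y < e})"
definition open_wiener :: "'a wiener set \<Rightarrow> bool" where
  "open_wiener U \<longleftrightarrow> (\<forall>x\<in>U. eventually (\<lambda>(x', y). x' = x \<longrightarrow> y \<in> U) uniformity)"

lemma coef_zero [simp]: "coef 0 k = 0"
  unfolding zero_wiener_def by (subst coef_Wiener) auto

lemma coef_add [simp]: "coef (f + g) k = coef f k + coef g k"
  unfolding plus_wiener_def by (subst coef_Wiener) (auto simp: abs_summable_add coef_summable coef_minus)

lemma coef_uminus [simp]: "coef (- f) k = - coef f k"
  unfolding uminus_wiener_def by (subst coef_Wiener) (auto simp: coef_summable coef_minus)

lemma coef_diff [simp]: "coef (f - g) k = coef f k - coef g k"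
  by (simp add: minus_wiener_def)

lemma coef_scaleR [simp]: "coef (r *\<^sub>R f) k = r *\<^sub>R coef f k"
  unfolding scaleR_wiener_def
  by (subst coef_Wiener) (auto simp: coef_summable coef_minus intro: summable_on_cmult_right)

instance
proof
  fix f g h :: "'a wiener" and r s :: real
  show "f + g + h = f + (g + h)" "f + g = g + f" "0 + f = f" "- f + f = 0" "f - g = f + - g"
    "r *\<^sub>R (f + g) = r *\<^sub>R f + r *\<^sub>R g" "(r + s) *\<^sub>R f = r *\<^sub>R f + s *\<^sub>R f" "r *\<^sub>R s *\<^sub>R f = (r * s) *\<^sub>R f"
    "1 *\<^sub>R f = f"
    by (auto intro!: wiener_eqI simp: algebra_simps)
  show "dist f g = norm (f - g)" by (rule dist_wiener_def)
  show "sgn f = inverse (norm f) *\<^sub>R f" by (rule sgn_wiener_def)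
  show "(uniformity :: ('a wiener \<times> 'a wiener) filter) = (INF e\<in>{0 <..}. principal {(x, y). dist x y < e})"
    by (rule uniformity_wiener_def)
  show "open U \<longleftrightarrow> (\<forall>x\<in>U. \<forall>\<^sub>F (x', y) in uniformity. x' = x \<longrightarrow> y \<in> U)" for U :: "'a wiener set"
    by (rule open_wiener_def)
  show "norm f = 0 \<longleftrightarrow> f = 0"
  proof
    assume "norm f = 0"
    then have "norm (coef f k) = 0" for k
      using nonneg_infsum_le_0D[of "\<lambda>k. norm (coef f k)" UNIV k] coef_summable[of f] by (simp add: norm_wiener_def)
    then show "f = 0" by (auto intro!: wiener_eqI)
  qed (simp add: norm_wiener_def)
  show "norm (f + g) \<le> norm f + norm g"
    unfolding norm_wiener_def infsum_add[OF coef_summable coef_summable, symmetric]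
    by (rule infsum_mono[OF coef_summable summable_on_add[OF coef_summable coef_summable]])
       (simp add: norm_triangle_ineq)
  show "norm (r *\<^sub>R f) = \<bar>r\<bar> * norm f"
    by (simp add: norm_wiener_def infsum_cmult_right')
qed

end

instantiation wiener :: (finite) "{times, one}"
begin

definition one_wiener :: "'a wiener" where "1 = Wiener (\<lambda>k. if k = 0 then 1 else 0)"
definition times_wiener :: "'a wiener \<Rightarrow> 'a wiener \<Rightarrow> 'a wiener" where
  "f * g = Wiener (conv (coef f) (coef g))"

instance ..

end

lemma coef_one: "coef 1 k = (if k = 0 then 1 else 0)"
  unfolding one_wiener_def by (subst coef_Wiener) (auto simp: abs_summable_single)

lemma coef_mult: "coef (f * g) = conv (coef f) (coef g)"
proof -
  have "conv (coef f) (coef g) (- k) = cnj (conv (coef f) (coef g) k)" for k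
  proof -
    have "cnj (conv (coef f) (coef g) k) = (\<Sum>\<^sub>\<infinity>p. coef f (- p) * coef g (- k - - p))"
      unfolding conv_def infsum_cnj[symmetric] by (intro infsum_cong) (simp add: coef_minus[symmetric])
    also have "\<dots> = conv (coef f) (coef g) (- k)"
      unfolding conv_def by (rule infsum_minus_index)
    finally show ?thesis ..
  qed
  then show ?thesis
    unfolding times_wiener_def by (intro coef_Wiener conv_abs_summable coef_summable)
qed

definition evc :: "'n::finite wiener \<Rightarrow> real^'n \<Rightarrow> complex" where
  "evc f = fseries (coef f)"

definition ev :: "'n::finite wiener \<Rightarrow> real^'n \<Rightarrow> real" where
  "ev f x = Re (evc f x)"

lemma evc_inject:
  assumes "\<And>x. evc f x = evc g x"
  shows "f = g"
proof -
  have "coef f = coef g"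
    by (rule fseries_inject[OF coef_summable coef_summable]) (use assms in \<open>simp add: evc_def\<close>)
  then show ?thesis by (simp only: coef_inject)
qed

lemma evc_mult: "evc (f * g) x = evc f x * evc g x"
  by (simp add: evc_def coef_mult fseries_conv coef_summable)

lemma coef_chr_summable: "(\<lambda>k. coef f k * chr k x) summable_on UNIV"
  by (rule abs_summable_summable[OF abs_summable_chr[OF coef_summable]])

lemma evc_add: "evc (f + g) x = evc f x + evc g x"
  by (simp add: evc_def fseries_def distrib_right infsum_add coef_chr_summable)

lemma evc_scaleR: "evc (r *\<^sub>R f) x = r *\<^sub>R evc f x"
  by (simp add: evc_def fseries_def infsum_scaleR_right)

lemma evc_one: "evc 1 x = 1"
proof -
  have "coef 1 k * chr k x = (if k = 0 then 1 else 0)" for k by (simp add: coef_one)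
  then show ?thesis using infsum_single[of 0 "\<lambda>_. 1 :: complex"] by (simp add: evc_def fseries_def)
qed

text \<open>The ring laws for convolution are pulled back from pointwise multiplication, since an
  element is determined by its values.\<close>

instance wiener :: (finite) "{comm_ring_1, real_normed_algebra_1}"
proof
  fix f g h :: "'a wiener" and r :: real
  show "f * g * h = f * (g * h)" "f * g = g * f" "1 * f = f" "(f + g) * h = f * h + g * h"
    "f * (g + h) = f * g + f * h" "f * 1 = f"
    "r *\<^sub>R f * g = r *\<^sub>R (f * g)" "f * r *\<^sub>R g = r *\<^sub>R (f * g)"
    by (rule evc_inject, simp add: evc_mult evc_add evc_scaleR evc_one algebra_simps)+
  have "coef 0 0 \<noteq> coef (1 :: 'a wiener) 0" by (simp add: coef_one)
  then show "(0 :: 'a wiener) \<noteq> 1" by metis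
  show "norm (f * g) \<le> norm f * norm g"
    unfolding norm_wiener_def coef_mult by (rule conv_abs_summable(2)[OF coef_summable coef_summable])
  have "norm (coef (1 :: 'a wiener) k) = (if k = 0 then 1 else 0)" for k by (simp add: coef_one)
  then show "norm (1 :: 'a wiener) = 1" 
    using infsum_single[of 0 "\<lambda>_. 1 :: real"] by (simp add: norm_wiener_def)
qed

lemma norm_coef_le: "norm (coef f k) \<le> norm f"
  using finite_sum_le_infsum[OF coef_summable, of "{k}" f] by (simp add: norm_wiener_def)

lemma sum_norm_coef_le: "finite F \<Longrightarrow> (\<Sum>k\<in>F. norm (coef f k)) \<le> norm f"
  using finite_sum_le_infsum[OF coef_summable, of F f] by (simp add: norm_wiener_def)

text \<open>The coefficients of a Cauchy sequence converge one by one; the Cauchy estimate over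
  finite sets of frequencies passes to the limit and gives convergence in norm.\<close>

instance wiener :: (finite) banach
proof
  fix X :: "nat \<Rightarrow> 'a wiener"
  assume X: "Cauchy X"
  have "Cauchy (\<lambda>n. coef (X n) k)" for k
  proof (rule metric_CauchyI)
    fix e :: real assume "e > 0"
    then obtain M where M: "\<And>m n. m \<ge> M \<Longrightarrow> n \<ge> M \<Longrightarrow> norm (X m - X n) < e"
      using metric_CauchyD[OF X] by (metis dist_norm)
    have "dist (coef (X m) k) (coef (X n) k) < e" if "m \<ge> M" "n \<ge> M" for m n
      using norm_coef_le[of "X m - X n" k] M[OF that] by (simp add: dist_norm)
    then show "\<exists>M. \<forall>m\<ge>M. \<forall>n\<ge>M. dist (coef (X m) k) (coef (X n) k) < e" by blast
  qed
  then have "\<forall>k. \<exists>l. (\<lambda>n. coef (X n) k) \<longlonglongrightarrow> l"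
    by (simp add: Cauchy_convergent_iff convergent_def)
  then obtain c where c: "\<And>k. (\<lambda>n. coef (X n) k) \<longlonglongrightarrow> c k"
    unfolding choice_iff by blast
  have bound: "\<exists>M. \<forall>n\<ge>M. \<forall>F. finite F \<longrightarrow> (\<Sum>k\<in>F. norm (coef (X n) k - c k)) \<le> e" if e: "e > 0" for e
  proof -
    obtain M where M: "\<And>m n. m \<ge> M \<Longrightarrow> n \<ge> M \<Longrightarrow> norm (X m - X n) < e"
      using metric_CauchyD[OF X e] by (auto simp: dist_norm)
    have "(\<Sum>k\<in>F. norm (coef (X n) k - c k)) \<le> e" if "n \<ge> M" "finite F" for n F
    proof (rule LIMSEQ_le_const2)
      show "(\<lambda>m. \<Sum>k\<in>F. norm (coef (X n) k - coef (X m) k)) \<longlonglongrightarrow> (\<Sum>k\<in>F. norm (coef (X n) k - c k))"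
        by (intro tendsto_intros c)
      have "(\<Sum>k\<in>F. norm (coef (X n) k - coef (X m) k)) \<le> e" if "m \<ge> M" for m
        using sum_norm_coef_le[OF \<open>finite F\<close>, of "X n - X m"] M[OF \<open>n \<ge> M\<close> that] by simp
      then show "\<exists>N. \<forall>m\<ge>N. (\<Sum>k\<in>F. norm (coef (X n) k - coef (X m) k)) \<le> e" by blast
    qed
    then show ?thesis by blast
  qed
  obtain M where M: "\<And>F. finite F \<Longrightarrow> (\<Sum>k\<in>F. norm (coef (X M) k - c k)) \<le> 1"
    using bound[of 1] by auto
  have summ: "c abs_summable_on UNIV"
    unfolding abs_summable_iff_bdd_above
  proof (rule bdd_aboveI)
    fix y assume "y \<in> sum (\<lambda>x. norm (c x)) ` {F. F \<subseteq> UNIV \<and> finite F}"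
    then obtain F where F: "finite F" "y = (\<Sum>k\<in>F. norm (c k))" by auto
    have "y \<le> (\<Sum>k\<in>F. norm (coef (X M) k) + norm (coef (X M) k - c k))"
      unfolding F(2) by (intro sum_mono) (metis norm_triangle_sub add.commute norm_minus_commute)
    also have "\<dots> \<le> norm (X M) + 1"
      using M[OF F(1)] sum_norm_coef_le[OF F(1), of "X M"] by (simp add: sum.distrib)
    finally show "y \<le> norm (X M) + 1" .
  qed
  have "c (- k) = cnj (c k)" for k
    using c[of "-k"] tendsto_cnj[OF c[of k]] by (simp add: coef_minus LIMSEQ_unique)
  then have coefc: "coef (Wiener c) = c" by (rule coef_Wiener[OF summ])
  have "X \<longlonglongrightarrow> Wiener c"
  proof (rule metric_LIMSEQ_I)
    fix e :: real assume "e > 0"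
    then obtain M where M: "\<And>n F. n \<ge> M \<Longrightarrow> finite F \<Longrightarrow> (\<Sum>k\<in>F. norm (coef (X n) k - c k)) \<le> e / 2"
      using bound[of "e/2"] by auto
    have "norm (X n - Wiener c) \<le> e / 2" if "n \<ge> M" for n
      unfolding norm_wiener_def
      by (rule infsum_le_finite_sums[OF coef_summable]) (use M[OF that] in \<open>simp add: coefc\<close>)
    then show "\<exists>no. \<forall>n\<ge>no. dist (X n) (Wiener c) < e" using \<open>e > 0\<close>
      by (intro exI[of _ M]) (force simp: dist_norm)
  qed
  then show "convergent X" by (auto simp: convergent_def)
qed

lemma evc_real: "evc f x = of_real (ev f x)"
proof -
  have "cnj (evc f x) = (\<Sum>\<^sub>\<infinity>k. coef f (- k) * chr (- k) x)"
    unfolding evc_def fseries_def infsum_cnj[symmetric]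
    by (intro infsum_cong) (simp add: coef_minus chr_minus)
  also have "\<dots> = evc f x"
    unfolding evc_def fseries_def by (rule infsum_minus_index)
  finally show ?thesis by (simp add: ev_def complex_eq_iff)
qed

lemma ev_mult [simp]: "ev (f * g) x = ev f x * ev g x"
  using evc_mult[of f g x] by (simp add: evc_real flip: of_real_mult)

lemma ev_add [simp]: "ev (f + g) x = ev f x + ev g x"
  and ev_scaleR [simp]: "ev (r *\<^sub>R f) x = r * ev f x"
  and ev_one [simp]: "ev 1 x = 1"
  by (simp_all add: ev_def evc_add evc_scaleR evc_one)

lemma abs_ev_le: "\<bar>ev f x\<bar> \<le> norm f"
proof -
  have "\<bar>ev f x\<bar> \<le> norm (evc f x)" by (simp add: ev_def abs_Re_le_cmod)
  also have "\<dots> \<le> norm f"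
    unfolding evc_def fseries_def norm_wiener_def
    using norm_infsum_bound[OF abs_summable_chr[OF coef_summable], of f x] by (simp add: norm_mult)
  finally show ?thesis .
qed

lemma bounded_linear_ev: "bounded_linear (\<lambda>f. ev f x)"
  by (rule bounded_linear_intro[of _ 1]) (auto simp: abs_ev_le)

lemmas ev_zero [simp] = linear_0[OF bounded_linear.linear[OF bounded_linear_ev]]
  and ev_diff [simp] = linear_diff[OF bounded_linear.linear[OF bounded_linear_ev]]
  and ev_uminus [simp] = linear_neg[OF bounded_linear.linear[OF bounded_linear_ev]]
  and ev_sum = linear_sum[OF bounded_linear.linear[OF bounded_linear_ev]]

lemma ev_power [simp]: "ev (f ^ n) x = ev f x ^ n"
  by (induction n) auto

lemma continuous_on_ev [continuous_intros]: "continuous_on S (ev f)"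
  unfolding ev_def evc_def by (intro continuous_on_Re continuous_on_fseries coef_summable)

lemma torus_fun_ev: "torus_fun (ev f)"
  using torus_fun_fseries[of "coef f"] by (simp add: torus_fun_def ev_def evc_def)

lemma has_integral_ev: "(ev f has_integral Re (coef f 0)) unit_cube"
proof -
  have "(evc f has_integral coef f 0) unit_cube"
    using has_integral_fseries[OF coef_summable, of f 0] by (simp add: evc_def)
  then show ?thesis
    unfolding ev_def using has_integral_linear[OF _ bounded_linear_Re] by (force simp: comp_def)
qed

text \<open>The coefficient at 0 is the mean. Through this, pointwise inequalities become
  inequalities between L2 norms.\<close>

lemma ev_nonneg_imp_mean_nonneg: "(\<And>x. ev f x \<ge> 0) \<Longrightarrow> Re (coef f 0) \<ge> 0"
  using has_integral_nonneg[OF has_integral_ev] by blast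

section \<open>The subalgebra with one derivative\<close>

definition freq_norm :: "int^'n \<Rightarrow> real" where
  "freq_norm k = (\<Sum>i\<in>UNIV. \<bar>of_int (k $ i)\<bar>)"

abbreviation wt :: "int^'n \<Rightarrow> real" where
  "wt k \<equiv> 1 + freq_norm k"

lemma freq_norm_nonneg [simp]: "freq_norm k \<ge> 0"
  by (simp add: freq_norm_def sum_nonneg)

lemma wt_pos [simp]: "wt k > 0" "wt k \<ge> 0" "wt k \<noteq> 0"
  using freq_norm_nonneg[of k] by linarith+

lemma freq_norm_add: "freq_norm (k + l) \<le> freq_norm k + freq_norm l"
  by (simp add: freq_norm_def sum.distrib[symmetric] sum_mono abs_triangle_ineq flip: of_int_add)

lemma abs_nth_le_freq_norm: "\<bar>of_int (k $ i)\<bar> \<le> freq_norm k"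
  unfolding freq_norm_def by (rule member_le_sum) auto

lemma freq_norm_simps [simp]: "freq_norm 0 = 0" "freq_norm (- k) = freq_norm k"
  by (simp_all add: freq_norm_def)

text \<open>Submultiplicativity of the weight is what makes \<open>A1\<close> closed under
  products.\<close>

lemma wt_add_le: "wt (p + q) \<le> wt p * wt q"
proof -
  have "wt p * wt q = 1 + freq_norm p + freq_norm q + freq_norm p * freq_norm q" by (simp add: algebra_simps)
  then show ?thesis using freq_norm_add[of p q] mult_nonneg_nonneg[OF freq_norm_nonneg[of p] freq_norm_nonneg[of q]] by linarith
qed

lemma finite_freq_norm_le: "finite {k :: int^'n. freq_norm k \<le> N}"
proof -
  have "{k :: int^'n. freq_norm k \<le> N} \<subseteq> vec_lambda ` (PiE UNIV (\<lambda>_. {-\<lceil>N\<rceil>..\<lceil>N\<rceil>}))"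
  proof
    fix k :: "int^'n" assume "k \<in> {k. freq_norm k \<le> N}"
    then have "\<bar>of_int (k $ i)\<bar> \<le> N" for i using abs_nth_le_freq_norm[of k i] by simp
    then have "k $ i \<in> {-\<lceil>N\<rceil>..\<lceil>N\<rceil>}" for i by (simp add: abs_le_iff) (smt (verit) le_of_int_ceiling of_int_le_iff of_int_minus)
    then show "k \<in> vec_lambda ` (PiE UNIV (\<lambda>_. {-\<lceil>N\<rceil>..\<lceil>N\<rceil>}))"
      by (intro image_eqI[of _ _ "vec_nth k"]) auto
  qed
  then show ?thesis by (rule finite_subset) (auto intro!: finite_PiE)
qed

definition A1 :: "'n::finite wiener set" where
  "A1 = {f. (\<lambda>k. wt k * norm (coef f k)) summable_on UNIV}"

definition norm1 :: "'n::finite wiener \<Rightarrow> real" where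
  "norm1 f = (\<Sum>\<^sub>\<infinity>k. wt k * norm (coef f k))"

lemma A1_summable: "f \<in> A1 \<Longrightarrow> (\<lambda>k. wt k * norm (coef f k)) summable_on UNIV"
  by (simp add: A1_def)

lemma norm1_nonneg [simp]: "norm1 f \<ge> 0"
  by (simp add: norm1_def infsum_nonneg)

lemma A1_comparison:
  assumes "g summable_on UNIV" "\<And>k. wt k * norm (coef f k) \<le> g k"
  shows "f \<in> A1" "norm1 f \<le> infsum g UNIV"
proof -
  show "f \<in> A1" unfolding A1_def mem_Collect_eq
    by (rule summable_on_comparison_test[OF assms(1)]) (use assms(2) in auto)
  then show "norm1 f \<le> infsum g UNIV" unfolding norm1_def A1_def
    by (intro infsum_mono assms) auto
qed

lemma norm_le_norm1:
  assumes "f \<in> A1"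
  shows "norm f \<le> norm1 f"
  unfolding norm_wiener_def norm1_def
proof (rule infsum_mono[OF coef_summable A1_summable[OF assms]])
  show "norm (coef f k) \<le> wt k * norm (coef f k)" for k
    using mult_right_mono[of 1 "wt k" "norm (coef f k)"] by simp
qed

lemma A1_zero [simp]: "0 \<in> A1" "norm1 0 = 0"
  by (simp_all add: A1_def norm1_def)

lemma A1_add:
  assumes "f \<in> A1" "g \<in> A1"
  shows "f + g \<in> A1" "norm1 (f + g) \<le> norm1 f + norm1 g"
proof -
  have *: "wt k * norm (coef (f + g) k) \<le> wt k * norm (coef f k) + wt k * norm (coef g k)" for k
    using mult_left_mono[OF norm_triangle_ineq wt_pos(2)[of k], of "coef f k" "coef g k"] by (simp add: distrib_left)
  show "f + g \<in> A1" "norm1 (f + g) \<le> norm1 f + norm1 g"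
    using A1_comparison[OF summable_on_add[OF assms[THEN A1_summable]] *]
    by (simp_all add: infsum_add[OF assms[THEN A1_summable]] norm1_def)
qed

lemma A1_scaleR:
  assumes "f \<in> A1"
  shows "r *\<^sub>R f \<in> A1" "norm1 (r *\<^sub>R f) = \<bar>r\<bar> * norm1 f"
proof -
  have *: "wt k * norm (coef (r *\<^sub>R f) k) = \<bar>r\<bar> * (wt k * norm (coef f k))" for k by simp
  show "r *\<^sub>R f \<in> A1" "norm1 (r *\<^sub>R f) = \<bar>r\<bar> * norm1 f"
    unfolding A1_def norm1_def mem_Collect_eq *
    by (rule summable_on_cmult_right[OF A1_summable[OF assms]], rule infsum_cmult_right')
qed

lemma A1_uminus: "f \<in> A1 \<Longrightarrow> - f \<in> A1" "norm1 (- f) = norm1 f"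
  by (simp_all add: A1_def norm1_def)

lemma A1_diff:
  assumes "f \<in> A1" "g \<in> A1"
  shows "f - g \<in> A1" "norm1 (f - g) \<le> norm1 f + norm1 g"
  using A1_add[OF assms(1) A1_uminus(1)[OF assms(2)]] by (simp_all add: A1_uminus)

lemma A1_sum:
  assumes "\<And>i. i \<in> I \<Longrightarrow> f i \<in> A1"
  shows "(\<Sum>i\<in>I. f i) \<in> A1" "norm1 (\<Sum>i\<in>I. f i) \<le> (\<Sum>i\<in>I. norm1 (f i))"
proof -
  have "(\<Sum>i\<in>I. f i) \<in> A1 \<and> norm1 (\<Sum>i\<in>I. f i) \<le> (\<Sum>i\<in>I. norm1 (f i))"
    using assms
  proof (induction I rule: infinite_finite_induct)
    case (insert i I)
    then have fi: "f i \<in> A1" and fI: "sum f I \<in> A1" "norm1 (sum f I) \<le> (\<Sum>i\<in>I. norm1 (f i))" by auto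
    then show ?case using insert.hyps A1_add[OF fi fI(1)] by simp
  qed auto
  then show "(\<Sum>i\<in>I. f i) \<in> A1" "norm1 (\<Sum>i\<in>I. f i) \<le> (\<Sum>i\<in>I. norm1 (f i))" by auto
qed

lemma A1_mult:
  assumes f: "f \<in> A1" and g: "g \<in> A1"
  shows "f * g \<in> A1" "norm1 (f * g) \<le> norm1 f * norm1 g"
proof -
  let ?a = "\<lambda>k. wt k * norm (coef f k)" and ?b = "\<lambda>k. wt k * norm (coef g k)"
  have ab: "?a abs_summable_on UNIV" "?b abs_summable_on UNIV"
    using f[THEN A1_summable] g[THEN A1_summable] by (simp_all add: abs_mult)
  have "norm (wt k *\<^sub>R coef (f * g) k) \<le> conv ?a ?b k" for k
  proof -
    have s: "(\<lambda>p. norm (coef f p) * norm (coef g (k - p))) summable_on UNIV"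
      using conv_summand[OF coef_summable coef_summable, of f g k] by (simp add: norm_mult)
    have "norm (wt k *\<^sub>R coef (f * g) k) \<le> wt k * conv (\<lambda>p. norm (coef f p)) (\<lambda>p. norm (coef g p)) k"
      using norm_conv_le[OF coef_summable coef_summable, of f g k] by (simp add: coef_mult mult_left_mono)
    also have "\<dots> = (\<Sum>\<^sub>\<infinity>p. wt k * (norm (coef f p) * norm (coef g (k - p))))"
      unfolding conv_def by (rule infsum_cmult_right'[symmetric])
    also have "\<dots> \<le> conv ?a ?b k"
      unfolding conv_def
    proof (rule infsum_mono)
      show "(\<lambda>p. wt k * (norm (coef f p) * norm (coef g (k - p)))) summable_on UNIV"
        by (rule summable_on_cmult_right[OF s])
      show "(\<lambda>p. ?a p * ?b (k - p)) summable_on UNIV"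
        by (rule abs_summable_summable[OF conv_summand[OF ab]])
      fix p
      have "wt k \<le> wt p * wt (k - p)" using wt_add_le[of p "k - p"] by simp
      then have "wt k * (norm (coef f p) * norm (coef g (k - p))) \<le> (wt p * wt (k - p)) * (norm (coef f p) * norm (coef g (k - p)))"
        by (rule mult_right_mono) simp
      then show "wt k * (norm (coef f p) * norm (coef g (k - p))) \<le> ?a p * ?b (k - p)"
        by (simp add: mult_ac)
    qed
    finally show ?thesis .
  qed
  note * = conv_nonneg_summable[OF f[THEN A1_summable] g[THEN A1_summable] _ _ this]
  show "f * g \<in> A1" using *(1) by (simp add: A1_def)
  show "norm1 (f * g) \<le> norm1 f * norm1 g" using *(2) by (simp add: norm1_def)
qed

lemma A1_one: "(1 :: 'n::finite wiener) \<in> A1" "norm1 (1 :: 'n wiener) = 1"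
proof -
  have "wt k * norm (coef 1 k) = (if k = 0 then 1 else 0)" for k :: "int^'n" by (simp add: coef_one)
  then show "(1 :: 'n wiener) \<in> A1" "norm1 (1 :: 'n wiener) = 1"
    using abs_summable_single[of "0 :: int^'n" "1 :: real"] infsum_single[of "0 :: int^'n" "\<lambda>_. 1 :: real"]
    by (simp_all add: A1_def norm1_def if_distrib[of abs] cong: if_cong)
qed

lemma A1_power: "f \<in> A1 \<Longrightarrow> f ^ n \<in> A1"
  by (induction n) (auto simp: A1_one A1_mult)

section \<open>Fourier multipliers, derivatives and truncations\<close>

text \<open>Total in both arguments; the coefficients are the products in the body when the
  multiplier is Hermitian and the products are summable, so results about it carry such
  hypotheses.\<close>

definition fmul :: "(int^'n::finite \<Rightarrow> complex) \<Rightarrow> 'n wiener \<Rightarrow> 'n wiener" where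
  "fmul m f = Wiener (\<lambda>k. m k * coef f k)"

definition hermitian :: "(int^'n \<Rightarrow> complex) \<Rightarrow> bool" where
  "hermitian m \<longleftrightarrow> (\<forall>k. m (- k) = cnj (m k))"

lemma coef_fmul_summable:
  assumes "hermitian m" "(\<lambda>k. m k * coef f k) abs_summable_on UNIV"
  shows "coef (fmul m f) k = m k * coef f k"
  unfolding fmul_def by (subst coef_Wiener) (use assms in \<open>auto simp: hermitian_def coef_minus\<close>)

definition bounded_multiplier :: "(int^'n \<Rightarrow> complex) \<Rightarrow> real \<Rightarrow> bool" where
  "bounded_multiplier m C \<longleftrightarrow> hermitian m \<and> (\<forall>k. norm (m k) \<le> C)"

lemma coef_fmul:
  assumes "bounded_multiplier m C"
  shows "coef (fmul m f) k = m k * coef f k"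
proof (rule coef_fmul_summable)
  show "hermitian m" using assms by (simp add: bounded_multiplier_def)
  have "(\<lambda>k. C * norm (coef f k)) summable_on UNIV"
    by (rule summable_on_cmult_right[OF coef_summable])
  then show "(\<lambda>k. m k * coef f k) abs_summable_on UNIV"
    by (rule summable_on_comparison_test) (use assms in \<open>auto simp: norm_mult bounded_multiplier_def mult_right_mono\<close>)
qed

lemma norm_fmul_le:
  assumes "bounded_multiplier m C"
  shows "norm (fmul m f) \<le> C * norm f"
  unfolding norm_wiener_def infsum_cmult_right'[symmetric]
  by (rule infsum_mono[OF coef_summable summable_on_cmult_right[OF coef_summable]])
     (use assms in \<open>auto simp: coef_fmul[OF assms] norm_mult bounded_multiplier_def mult_right_mono\<close>)

lemma A1_fmul:
  assumes "bounded_multiplier m C" "f \<in> A1"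
  shows "fmul m f \<in> A1" "norm1 (fmul m f) \<le> C * norm1 f"
proof -
  have "wt k * norm (coef (fmul m f) k) \<le> C * (wt k * norm (coef f k))" for k
    using assms(1) mult_right_mono[of "norm (m k)" C "wt k * norm (coef f k)"]
    by (simp add: coef_fmul[OF assms(1)] norm_mult bounded_multiplier_def mult_ac)
  note A1_comparison[OF summable_on_cmult_right[OF A1_summable[OF assms(2)]] this]
  then show "fmul m f \<in> A1" "norm1 (fmul m f) \<le> C * norm1 f"
    by (simp_all add: norm1_def infsum_cmult_right')
qed

lemma bounded_linear_fmul:
  assumes "bounded_multiplier m C"
  shows "bounded_linear (fmul m)"
proof (rule bounded_linear_intro)
  show "norm (fmul m f) \<le> norm f * C" for f using norm_fmul_le[OF assms, of f] by (simp add: mult.commute)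
qed (auto intro!: wiener_eqI simp: coef_fmul[OF assms] algebra_simps)

text \<open>The multiplier is unbounded, so the rules for this operator assume \<open>A1\<close>,
  which it maps into the Wiener algebra.\<close>

definition der :: "'n \<Rightarrow> 'n::finite wiener \<Rightarrow> 'n wiener" where
  "der j = fmul (\<lambda>k. 2 * pi * \<i> * of_int (k $ j))"

lemma coef_der:
  assumes "f \<in> A1"
  shows "coef (der j f) k = 2 * pi * \<i> * of_int (k $ j) * coef f k"
  unfolding der_def
proof (rule coef_fmul_summable)
  show "(\<lambda>k. 2 * pi * \<i> * of_int (k $ j) * coef f k) abs_summable_on UNIV"
  proof (rule summable_on_comparison_test[OF summable_on_cmult_right[OF A1_summable[OF assms]]])
    have "\<bar>of_int (k $ j)\<bar> \<le> wt k" for k using abs_nth_le_freq_norm[of k j] by simp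
    then show "norm (2 * pi * \<i> * of_int (k $ j) * coef f k) \<le> (2 * pi) * (wt k * norm (coef f k))" for k
      by (auto simp: norm_mult mult.assoc intro!: mult_left_mono mult_right_mono)
  qed simp
qed (simp add: hermitian_def)

lemma norm_der_le:
  assumes "f \<in> A1"
  shows "norm (der j f) \<le> 2 * pi * norm1 f"
  unfolding norm_wiener_def norm1_def infsum_cmult_right'[symmetric]
proof (rule infsum_mono[OF coef_summable summable_on_cmult_right[OF A1_summable[OF assms]]])
  have "\<bar>of_int (k $ j)\<bar> \<le> wt k" for k using abs_nth_le_freq_norm[of k j] by simp
  then show "norm (coef (der j f) k) \<le> (2 * pi) * (wt k * norm (coef f k))" for k
    by (auto simp: norm_mult mult.assoc coef_der[OF assms] intro!: mult_left_mono mult_right_mono)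
qed

lemma der_add: "f \<in> A1 \<Longrightarrow> g \<in> A1 \<Longrightarrow> der j (f + g) = der j f + der j g"
  and der_diff: "f \<in> A1 \<Longrightarrow> g \<in> A1 \<Longrightarrow> der j (f - g) = der j f - der j g"
  and der_scaleR: "f \<in> A1 \<Longrightarrow> der j (r *\<^sub>R f) = r *\<^sub>R der j f"
  by (rule wiener_eqI, simp add: coef_der A1_add A1_diff A1_scaleR algebra_simps)+

lemma der_zero [simp]: "der j 0 = 0"
  by (rule wiener_eqI) (simp add: coef_der)

lemma der_mult:
  assumes f: "f \<in> A1" and g: "g \<in> A1"
  shows "der j (f * g) = der j f * g + f * der j g"
proof (rule wiener_eqI)
  fix k
  have "coef (der j f * g + f * der j g) k
      = (\<Sum>\<^sub>\<infinity>p. coef (der j f) p * coef g (k - p) + coef f p * coef (der j g) (k - p))"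
    unfolding coef_add coef_mult conv_def
    by (intro infsum_add[symmetric] abs_summable_summable[OF conv_summand] coef_summable)
  also have "\<dots> = (\<Sum>\<^sub>\<infinity>p. 2 * pi * \<i> * of_int (k $ j) * (coef f p * coef g (k - p)))"
    by (intro infsum_cong) (simp add: coef_der[OF f] coef_der[OF g] algebra_simps)
  also have "\<dots> = coef (der j (f * g)) k"
    by (simp add: coef_der[OF A1_mult(1)[OF f g]] infsum_cmult_right' coef_mult conv_def)
  finally show "coef (der j (f * g)) k = coef (der j f * g + f * der j g) k" ..
qed

definition trunc :: "nat \<Rightarrow> 'n::finite wiener \<Rightarrow> 'n wiener" where
  "trunc N = fmul (\<lambda>k. if freq_norm k \<le> N then 1 else 0)"

lemma bounded_multiplier_trunc: "bounded_multiplier (\<lambda>k. if freq_norm k \<le> N then 1 else 0) 1"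
  by (simp add: bounded_multiplier_def hermitian_def)

lemma coef_trunc: "coef (trunc N f) k = (if freq_norm k \<le> N then coef f k else 0)"
  by (simp add: trunc_def coef_fmul[OF bounded_multiplier_trunc])

lemma A1_trunc: "f \<in> A1 \<Longrightarrow> trunc N f \<in> A1"
  unfolding trunc_def by (rule A1_fmul(1)[OF bounded_multiplier_trunc])

lemma trunc_approx:
  assumes f: "f \<in> A1" and e: "e > 0"
  shows "\<exists>N0. \<forall>N\<ge>N0. norm1 (f - trunc N f) \<le> e"
proof -
  let ?w = "\<lambda>k. wt k * norm (coef f k)"
  have "\<forall>\<^sub>F F in finite_subsets_at_top UNIV. dist (sum ?w F) (norm1 f) < e"
    using infsum_tendsto[OF A1_summable[OF f]] e unfolding norm1_def by (rule tendstoD)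
  then obtain F where F: "finite F" "dist (sum ?w F) (norm1 f) < e"
    unfolding eventually_finite_subsets_at_top by blast
  define N0 where "N0 = nat \<lceil>\<Sum>k\<in>F. freq_norm k\<rceil>"
  have N0: "freq_norm k \<le> N0" if "k \<in> F" for k
    unfolding N0_def by (rule order_trans[OF member_le_sum[OF that _ F(1)] real_nat_ceiling_ge]) auto
  have "norm1 (f - trunc N f) \<le> e" if N: "N \<ge> N0" for N
    unfolding norm1_def
  proof (rule infsum_le_finite_sums[OF A1_summable[OF A1_diff(1)[OF f A1_trunc[OF f]]]])
    fix G :: "(int^'a) set" assume G: "finite G"
    have "(\<Sum>k\<in>G. wt k * norm (coef (f - trunc N f) k)) \<le> (\<Sum>k\<in>G - F. ?w k)"
    proof -
      have "wt k * norm (coef (f - trunc N f) k) \<le> (if k \<in> G - F then ?w k else 0)" if "k \<in> G" for k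
        using that N N0[of k] by (auto simp: coef_trunc)
      then have "(\<Sum>k\<in>G. wt k * norm (coef (f - trunc N f) k)) \<le> (\<Sum>k\<in>G. if k \<in> G - F then ?w k else 0)"
        by (intro sum_mono) auto
      then show ?thesis using G by (simp add: sum.inter_filter[symmetric] set_diff_eq)
    qed
    also have "\<dots> = sum ?w (G \<union> F) - sum ?w F"
      using sum_diff[of "G \<union> F" F ?w] G F(1) by (simp add: Un_Diff)
    also have "\<dots> \<le> norm1 f - sum ?w F"
      unfolding norm1_def using finite_sum_le_infsum[OF A1_summable[OF f], of "G \<union> F"] G F(1) by simp
    also have "\<dots> \<le> e" using F(2) by (simp add: dist_real_def)
    finally show "(\<Sum>k\<in>G. wt k * norm (coef (f - trunc N f) k)) \<le> e" .
  qed
  then show ?thesis by blast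
qed

lemma ev_finite_support:
  assumes "finite F" "\<And>k. k \<notin> F \<Longrightarrow> coef f k = 0"
  shows "ev f x = (\<Sum>k\<in>F. Re (coef f k * chr k x))"
proof -
  have "evc f x = (\<Sum>\<^sub>\<infinity>k\<in>F. coef f k * chr k x)"
    unfolding evc_def fseries_def by (rule infsum_cong_neutral) (use assms in auto)
  then show ?thesis using assms(1) by (simp add: ev_def)
qed

lemma has_derivative_Re_chr:
  "((\<lambda>x. Re (c * chr k x)) has_derivative (\<lambda>h. \<Sum>j\<in>UNIV. Re (2 * pi * \<i> * of_int (k $ j) * c * chr k x) * h $ j)) (at x)"
proof -
  have eq: "(\<lambda>x. Re (c * chr k x)) = (\<lambda>x. Re c * cos (2 * pi * (int_vec k \<bullet> x)) - Im c * sin (2 * pi * (int_vec k \<bullet> x)))"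
    by (simp add: chr_def fun_eq_iff)
  show ?thesis
    unfolding eq
    by (rule has_derivative_eq_rhs[OF has_derivative_diff[OF has_derivative_mult_right[OF has_derivative_trig(2)]
            has_derivative_mult_right[OF has_derivative_trig(1)]]])
       (simp add: fun_eq_iff chr_def inner_vec_def algebra_simps sum_distrib_left sum_subtractf[symmetric] sum_negf[symmetric] sum.distrib[symmetric],
        intro allI sum.cong refl, simp)
qed

text \<open>Truncations are trigonometric polynomials, for which the formula is termwise
  differentiation. They converge in \<open>norm1\<close>, so their gradients converge uniformly, and
  the limit may be differentiated.\<close>

lemma has_derivative_ev:
  assumes f: "f \<in> A1"
  shows "(ev f has_derivative (\<lambda>h. \<Sum>j\<in>UNIV. ev (der j f) x * h $ j)) (at x)"
proof -
  let ?g = "\<lambda>f x (h :: real^'a). \<Sum>j\<in>UNIV. ev (der j f) x * h $ j"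
  have fin: "(ev (trunc n f) has_derivative ?g (trunc n f) x) (at x within UNIV)" for n x
  proof -
    let ?F = "{k :: int^'a. freq_norm k \<le> n}"
    have F: "finite ?F" by (rule finite_freq_norm_le)
    have A: "ev (trunc n f) = (\<lambda>x. \<Sum>k\<in>?F. Re (coef (trunc n f) k * chr k x))"
      by (rule ext, rule ev_finite_support[OF F]) (simp add: coef_trunc)
    have B: "ev (der j (trunc n f)) x = (\<Sum>k\<in>?F. Re (2 * pi * \<i> * of_int (k $ j) * coef (trunc n f) k * chr k x))" for j
      by (subst ev_finite_support[OF F]) (simp_all add: coef_der A1_trunc f coef_trunc)
    show ?thesis unfolding A
      by (rule has_derivative_eq_rhs[OF has_derivative_sum[OF has_derivative_Re_chr]])
         (simp add: B fun_eq_iff sum_distrib_right sum.swap[of _ ?F UNIV])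
  qed
  have bound: "\<forall>\<^sub>F n in sequentially. \<forall>x\<in>UNIV. \<forall>h. norm (?g (trunc n f) x h - ?g f x h) \<le> e * norm h"
    if e: "e > 0" for e
  proof -
    \<comment> \<open>Each of the d partial derivatives of the truncation is off by at most 2 \<pi>
      times the error in \<open>norm1\<close>; the sum over them has to stay below e.\<close>
    define e' where "e' = e / (CARD('a) * (2 * pi))"
    have "e' > 0" using e by (simp add: e'_def)
    then obtain N where N: "\<And>n. n \<ge> N \<Longrightarrow> norm1 (f - trunc n f) \<le> e'" using trunc_approx[OF f] by blast
    have "norm (?g (trunc n f) x h - ?g f x h) \<le> e * norm h" if n: "n \<ge> N" for n x h
    proof -
      have d: "\<bar>ev (der j (trunc n f)) x - ev (der j f) x\<bar> \<le> 2 * pi * e'" for j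
      proof -
        have "\<bar>ev (der j (f - trunc n f)) x\<bar> \<le> 2 * pi * norm1 (f - trunc n f)"
          using abs_ev_le norm_der_le[OF A1_diff(1)[OF f A1_trunc[OF f]]] order_trans by blast
        also have "\<dots> \<le> 2 * pi * e'" using N[OF n] by simp
        finally show ?thesis by (simp add: der_diff f A1_trunc)
      qed
      have "norm (?g (trunc n f) x h - ?g f x h) = \<bar>\<Sum>j\<in>UNIV. (ev (der j (trunc n f)) x - ev (der j f) x) * h $ j\<bar>"
        by (simp add: sum_subtractf[symmetric] left_diff_distrib)
      also have "\<dots> \<le> (\<Sum>j\<in>(UNIV :: 'a set). (2 * pi * e') * norm h)"
        by (rule order_trans[OF sum_abs sum_mono])
           (auto simp: abs_mult intro!: mult_mono d component_le_norm_cart order_trans[OF abs_ge_zero d])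
      also have "\<dots> = e * norm h" by (simp add: e'_def)
      finally show ?thesis .
    qed
    then show ?thesis by (auto simp: eventually_sequentially)
  qed
  have lim: "(\<lambda>n. ev (trunc n f) x) \<longlonglongrightarrow> ev f x" for x
  proof (rule LIMSEQ_I)
    fix e :: real assume "e > 0"
    then obtain N where N: "\<And>n. n \<ge> N \<Longrightarrow> norm1 (f - trunc n f) \<le> e / 2" using trunc_approx[OF f, of "e/2"] by auto
    have "norm (ev (trunc n f) x - ev f x) < e" if "n \<ge> N" for n
    proof -
      have "\<bar>ev (f - trunc n f) x\<bar> \<le> norm1 (f - trunc n f)"
        using abs_ev_le norm_le_norm1[OF A1_diff(1)[OF f A1_trunc[OF f]]] order_trans by blast
      then show ?thesis using N[OF that] \<open>e > 0\<close> by simp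
    qed
    then show "\<exists>no. \<forall>n\<ge>no. norm (ev (trunc n f) x - ev f x) < e" by blast
  qed
  obtain g where g: "\<And>x. (\<lambda>n. ev (trunc n f) x) \<longlonglongrightarrow> g x" "\<And>x. (g has_derivative ?g f x) (at x within UNIV)"
    using has_derivative_sequence[OF convex_UNIV fin bound UNIV_I lim[of 0]] by blast
  have "g = ev f" using LIMSEQ_unique[OF g(1) lim] by (simp add: fun_eq_iff)
  then show ?thesis using g(2)[of x] by simp
qed

section \<open>The Leray projection\<close>

lemma infsum_finite_sum:
  fixes f :: "'i \<Rightarrow> 'k \<Rightarrow> 'a::{topological_comm_monoid_add,t2_space}"
  assumes "\<And>i. i \<in> I \<Longrightarrow> f i summable_on A"
  shows "(\<Sum>\<^sub>\<infinity>k\<in>A. \<Sum>i\<in>I. f i k) = (\<Sum>i\<in>I. infsum (f i) A)" "(\<lambda>k. \<Sum>i\<in>I. f i k) summable_on A"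
proof -
  have "(\<lambda>k. \<Sum>i\<in>I. f i k) summable_on A \<and> (\<Sum>\<^sub>\<infinity>k\<in>A. \<Sum>i\<in>I. f i k) = (\<Sum>i\<in>I. infsum (f i) A)"
    using assms by (induction I rule: infinite_finite_induct) (auto simp: infsum_add summable_on_add)
  then show "(\<Sum>\<^sub>\<infinity>k\<in>A. \<Sum>i\<in>I. f i k) = (\<Sum>i\<in>I. infsum (f i) A)" "(\<lambda>k. \<Sum>i\<in>I. f i k) summable_on A"
    by auto
qed

definition freq_sq :: "int^'n \<Rightarrow> real" where
  "freq_sq k = (\<Sum>i\<in>UNIV. (of_int (k $ i))\<^sup>2)"

lemma freq_sq_nonneg [simp]: "freq_sq k \<ge> 0"
  by (simp add: freq_sq_def sum_nonneg)

lemma freq_sq_minus [simp]: "freq_sq (- k) = freq_sq k"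
  by (simp add: freq_sq_def)

lemma freq_sq_eq_0_iff: "freq_sq k = 0 \<longleftrightarrow> k = 0"
  by (simp add: freq_sq_def sum_nonneg_eq_0_iff vec_eq_iff)

lemma sq_nth_le_freq_sq: "(of_int (k $ i))\<^sup>2 \<le> freq_sq k"
  unfolding freq_sq_def by (rule member_le_sum) auto

text \<open>Integers satisfy |m| \<le> m^2. This gap around frequency 0 lets the inverse Laplacian
  absorb the inhomogeneous weight 1 + |k|.\<close>

lemma abs_nth_le_freq_sq: "\<bar>of_int (k $ i)\<bar> \<le> freq_sq k"
proof -
  have "\<bar>k $ i\<bar> \<le> (k $ i)\<^sup>2"
    using self_le_power[of "\<bar>k $ i\<bar>" 2] by (cases "k $ i = 0") auto
  then have "\<bar>real_of_int (k $ i)\<bar> \<le> (of_int (k $ i))\<^sup>2" by (metis of_int_abs of_int_le_iff of_int_power)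
  then show ?thesis using sq_nth_le_freq_sq by (rule order_trans)
qed

lemma abs_mult_nth_le_freq_sq: "\<bar>of_int (k $ i)\<bar> * \<bar>of_int (k $ j)\<bar> \<le> freq_sq k"
proof -
  have "0 \<le> (\<bar>real_of_int (k $ i)\<bar> - \<bar>real_of_int (k $ j)\<bar>)\<^sup>2" by simp
  then show ?thesis using sq_nth_le_freq_sq[of k i] sq_nth_le_freq_sq[of k j] by (simp add: power2_diff)
qed

text \<open>
  The operator \<open>\<partial>\<^sub>j \<Delta>\<^sup>-\<^sup>1\<close> and the entries of the Leray projection.  At frequency 0, division by zero
  makes the first one vanish and the second one the identity, so that constants count as divergence free.
\<close>

definition sol_mult :: "'n \<Rightarrow> int^'n \<Rightarrow> complex" where
  "sol_mult j k = of_real (- of_int (k $ j) / (2 * pi * freq_sq k)) * \<i>"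

definition leray_mult :: "'n \<Rightarrow> 'n \<Rightarrow> int^'n \<Rightarrow> real" where
  "leray_mult j l k = (if j = l then 1 else 0) - of_int (k $ j) * of_int (k $ l) / freq_sq k"

definition sol :: "'n \<Rightarrow> 'n::finite wiener \<Rightarrow> 'n wiener" where
  "sol j = fmul (sol_mult j)"

definition leray_entry :: "'n \<Rightarrow> 'n \<Rightarrow> 'n::finite wiener \<Rightarrow> 'n wiener" where
  "leray_entry j l = fmul (\<lambda>k. of_real (leray_mult j l k))"

definition leray :: "('n \<Rightarrow> 'n::finite wiener) \<Rightarrow> 'n \<Rightarrow> 'n wiener" where
  "leray Q j = (\<Sum>l\<in>UNIV. leray_entry j l (Q l))"

text \<open>The operator regains the derivative that \<open>der\<close> loses: (1 + |k|) |k_j| is at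
  most (d + 1) |k|^2, and the factor 1/(2 \<pi>) is estimated by 1.\<close>

lemma wt_sol_mult_le: "wt k * norm (sol_mult j k) \<le> CARD('n) + 1" for k :: "int^'n"
proof (cases "freq_sq k = 0")
  case False
  then have pos: "freq_sq k > 0" using freq_sq_nonneg[of k] by linarith
  have "wt k * \<bar>of_int (k $ j)\<bar> = \<bar>of_int (k $ j)\<bar> + (\<Sum>i\<in>UNIV. \<bar>of_int (k $ i)\<bar> * \<bar>of_int (k $ j)\<bar>)"
    by (simp add: freq_norm_def distrib_right sum_distrib_right)
  also have "\<dots> \<le> freq_sq k + (\<Sum>i\<in>(UNIV :: 'n set). freq_sq k)"
    by (intro add_mono abs_nth_le_freq_sq sum_mono abs_mult_nth_le_freq_sq)
  also have "\<dots> = (CARD('n) + 1) * freq_sq k" by (simp add: algebra_simps)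
  finally have *: "wt k * \<bar>of_int (k $ j)\<bar> \<le> (CARD('n) + 1) * freq_sq k" .
  have "wt k * norm (sol_mult j k) = wt k * \<bar>of_int (k $ j)\<bar> / freq_sq k / (2 * pi)"
    using pos unfolding sol_mult_def norm_mult norm_of_real norm_ii by (simp add: field_simps)
  also have "\<dots> \<le> wt k * \<bar>of_int (k $ j)\<bar> / freq_sq k / 1"
    using pos pi_gt3 by (intro divide_left_mono divide_nonneg_nonneg) auto
  also have "\<dots> \<le> CARD('n) + 1" using * pos by (simp add: divide_le_eq)
  finally show ?thesis .
qed (simp add: sol_mult_def)

lemma bounded_multiplier_sol: "bounded_multiplier (sol_mult j) (CARD('n) + 1)" for j :: "'n::finite"
proof -
  have "norm (sol_mult j k) \<le> CARD('n) + 1" for k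
    using wt_sol_mult_le[of k j] mult_right_mono[of 1 "wt k" "norm (sol_mult j k)"] by simp
  then show ?thesis by (simp add: bounded_multiplier_def hermitian_def sol_mult_def)
qed

lemma abs_leray_mult_le: "\<bar>leray_mult j l k\<bar> \<le> 1"
proof (cases "freq_sq k = 0")
  case False
  then have pos: "freq_sq k > 0" using freq_sq_nonneg[of k] by linarith
  have "\<bar>of_int (k $ j) * of_int (k $ l) / freq_sq k\<bar> \<le> 1"
    using pos abs_mult_nth_le_freq_sq[of k j l] by (simp add: abs_mult)
  moreover have "of_int (k $ l) * of_int (k $ l) / freq_sq k \<ge> 0" using pos by simp
  ultimately show ?thesis by (auto simp: leray_mult_def)
qed (simp add: leray_mult_def)

lemma bounded_multiplier_leray: "bounded_multiplier (\<lambda>k. of_real (leray_mult j l k)) 1"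
  unfolding bounded_multiplier_def hermitian_def norm_of_real
  by (intro conjI allI abs_leray_mult_le) (simp add: leray_mult_def)

lemma coef_sol: "coef (sol j f) k = sol_mult j k * coef f k"
  unfolding sol_def by (rule coef_fmul[OF bounded_multiplier_sol])

lemma coef_leray_entry: "coef (leray_entry j l f) k = of_real (leray_mult j l k) * coef f k"
  unfolding leray_entry_def by (rule coef_fmul[OF bounded_multiplier_leray])

lemma coef_sum: "coef (\<Sum>i\<in>I. f i) k = (\<Sum>i\<in>I. coef (f i) k)"
  by (induction I rule: infinite_finite_induct) auto

lemma coef_leray: "coef (leray Q j) k = (\<Sum>l\<in>UNIV. of_real (leray_mult j l k) * coef (Q l) k)"
  by (simp add: leray_def coef_sum coef_leray_entry)

lemma coef_leray': "coef (leray Q j) k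
    = coef (Q j) k - of_real (of_int (k $ j) / freq_sq k) * (\<Sum>l\<in>UNIV. of_int (k $ l) * coef (Q l) k)"
proof -
  have "of_real (leray_mult j l k) * coef (Q l) k
      = (if j = l then coef (Q l) k else 0) - of_real (of_int (k $ j) / freq_sq k) * (of_int (k $ l) * coef (Q l) k)" for l
    by (simp add: leray_mult_def algebra_simps)
  then show ?thesis
    by (simp add: coef_leray sum_subtractf sum_distrib_left)
qed

lemma A1_sol: "sol j f \<in> A1" "norm1 (sol j f) \<le> (CARD('n) + 1) * norm f" for f :: "'n::finite wiener"
proof -
  have "wt k * norm (coef (sol j f) k) \<le> (CARD('n) + 1) * norm (coef f k)" for k
    using mult_right_mono[OF wt_sol_mult_le[of k j], of "norm (coef f k)"] by (simp add: coef_sol norm_mult mult.assoc)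
  note A1_comparison[OF summable_on_cmult_right[OF coef_summable] this]
  then show "sol j f \<in> A1" "norm1 (sol j f) \<le> (CARD('n) + 1) * norm f"
    by (simp_all add: norm_wiener_def infsum_cmult_right')
qed

lemma A1_leray:
  assumes "\<And>l. Q l \<in> A1"
  shows "leray Q j \<in> A1" "norm1 (leray Q j) \<le> (\<Sum>l\<in>UNIV. norm1 (Q l))"
proof -
  have "leray_entry j l (Q l) \<in> A1" "norm1 (leray_entry j l (Q l)) \<le> norm1 (Q l)" for l
    using A1_fmul[OF bounded_multiplier_leray assms] by (simp_all add: leray_entry_def)
  then show "leray Q j \<in> A1" "norm1 (leray Q j) \<le> (\<Sum>l\<in>UNIV. norm1 (Q l))"
    unfolding leray_def by (auto intro: A1_sum order_trans[OF A1_sum(2)] sum_mono)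
qed

lemma norm_leray_le: "norm (leray Q j) \<le> (\<Sum>l\<in>UNIV. norm (Q l))"
  unfolding leray_def leray_entry_def
  by (rule order_trans[OF norm_sum sum_mono]) (use norm_fmul_le[OF bounded_multiplier_leray] in simp)

lemma bounded_linear_leray_entry: "bounded_linear (leray_entry j l)"
  unfolding leray_entry_def by (rule bounded_linear_fmul[OF bounded_multiplier_leray])

lemma freq_sq_sum: "(\<Sum>l\<in>UNIV. of_int (k $ l) * of_int (k $ l)) = complex_of_real (freq_sq k)"
  by (simp add: freq_sq_def power2_eq_square)

lemma leray_leray: "leray (leray Q) = leray Q"
proof (rule ext, rule wiener_eqI)
  fix j k
  have "(\<Sum>l\<in>UNIV. of_int (k $ l) * coef (leray Q l) k) = 0"
  proof -
    let ?a = "\<Sum>l\<in>UNIV. of_int (k $ l) * coef (Q l) k"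
    have "(\<Sum>l\<in>UNIV. of_int (k $ l) * coef (leray Q l) k)
        = (\<Sum>l\<in>UNIV. of_int (k $ l) * coef (Q l) k - of_int (k $ l) * of_int (k $ l) * (?a / of_real (freq_sq k)))"
      by (rule sum.cong) (simp_all add: coef_leray' right_diff_distrib)
    also have "\<dots> = ?a - (\<Sum>l\<in>UNIV. of_int (k $ l) * of_int (k $ l)) * (?a / of_real (freq_sq k))"
      by (simp only: sum_subtractf sum_distrib_right)
    also have "\<dots> = 0" by (cases "k = 0") (simp_all add: freq_sq_sum freq_sq_eq_0_iff)
    finally show ?thesis .
  qed
  then show "coef (leray (leray Q) j) k = coef (leray Q j) k"
    by (subst coef_leray') simp
qed

lemma leray_add: "leray (\<lambda>l. P l + Q l) j = leray P j + leray Q j"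
  and leray_diff: "leray (\<lambda>l. P l - Q l) j = leray P j - leray Q j"
  and leray_uminus: "leray (\<lambda>l. - P l) j = - leray P j"
  by (rule wiener_eqI, simp add: coef_leray algebra_simps sum.distrib sum_subtractf sum_negf)+

lemma leray_sol: "leray (\<lambda>l. sol l f) j = 0"
proof (rule wiener_eqI)
  fix k
  have "(\<Sum>l\<in>UNIV. of_int (k $ l) * coef (sol l f) k)
      = (\<Sum>l\<in>UNIV. of_int (k $ l) * of_int (k $ l)) * (of_real (- 1 / (2 * pi * freq_sq k)) * \<i> * coef f k)"
    unfolding sum_distrib_right by (rule sum.cong) (simp_all add: coef_sol sol_mult_def)
  then show "coef (leray (\<lambda>l. sol l f) j) k = coef 0 k"
    by (cases "k = 0") (simp_all add: coef_leray' freq_sq_sum freq_sq_eq_0_iff coef_sol sol_mult_def)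
qed


text \<open>A divergence always vanishes at frequency 0, so the prescribed function is recovered at
  the other frequencies only. The exception reappears in \<open>div_curl_system\<close> and is
  repaired in \<open>ex_euler_flow\<close>.\<close>

lemma coef_div_sol: "coef (\<Sum>j\<in>UNIV. der j (sol j f)) k = (if k = 0 then 0 else coef f k)"
proof -
  have "coef (\<Sum>j\<in>UNIV. der j (sol j f)) k
      = (\<Sum>l\<in>UNIV. of_int (k $ l) * of_int (k $ l)) * (coef f k / of_real (freq_sq k))"
    unfolding coef_sum sum_distrib_right
    by (rule sum.cong) (simp_all add: coef_der A1_sol coef_sol sol_mult_def mult_ac)
  then show ?thesis by (simp add: freq_sq_sum freq_sq_eq_0_iff)
qed

lemma div_leray:
  assumes "\<And>l. Q l \<in> A1" "leray Q = Q"
  shows "(\<Sum>j\<in>UNIV. der j (Q j)) = 0"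
proof (rule wiener_eqI)
  fix k
  let ?a = "\<Sum>l\<in>UNIV. of_int (k $ l) * coef (Q l) k"
  have "?a = 0"
  proof (cases "k = 0")
    case False
    have "coef (Q l) k = coef (Q l) k - of_real (of_int (k $ l) / freq_sq k) * ?a" for l
      using coef_leray'[of Q l k] assms(2) by simp
    then have "of_int (k $ l) * ?a = 0" for l using False by (auto simp: freq_sq_eq_0_iff)
    moreover obtain l where "k $ l \<noteq> 0" using False by (auto simp: vec_eq_iff)
    ultimately show ?thesis by (metis mult_eq_0_iff of_int_eq_0_iff)
  qed simp
  then have "2 * pi * \<i> * ?a = 0" by simp
  then show "coef (\<Sum>j\<in>UNIV. der j (Q j)) k = coef 0 k"
    by (simp add: coef_sum coef_der assms(1) sum_distrib_left mult.assoc)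
qed

text \<open>The gradient part in the Helmholtz decomposition depends on the divergence alone. For g
  Q with Q solenoidal that divergence contains no derivative of Q, which is the source of the
  smoothing estimate \<open>norm1_T_diff_le\<close>.\<close>

lemma diff_leray:
  assumes "\<And>l. Q l \<in> A1"
  shows "Q j - leray Q j = sol j (\<Sum>l\<in>UNIV. der l (Q l))"
  by (rule wiener_eqI)
     (simp add: coef_leray' coef_sol coef_sum coef_der assms sol_mult_def sum_distrib_left mult_ac)

text \<open>Vanishing projection forces each coefficient vector to be parallel to its frequency, and
  to be zero at frequency 0. The factor of proportionality gives the potential, which lies in
  \<open>A1\<close> since \<open>sol\<close> gains a derivative.\<close>

lemma leray_zero_imp_gradient:
  assumes "leray Z = (\<lambda>_. 0)"
  shows "Z j = der j (\<Sum>l\<in>UNIV. sol l (Z l))"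
proof (rule wiener_eqI)
  fix k
  have "coef (Z j) k = of_real (of_int (k $ j) / freq_sq k) * (\<Sum>l\<in>UNIV. of_int (k $ l) * coef (Z l) k)"
    using coef_leray'[of Z j k] assms by simp
  then show "coef (Z j) k = coef (der j (\<Sum>l\<in>UNIV. sol l (Z l))) k"
    by (simp add: coef_der A1_sum A1_sol coef_sum coef_sol sol_mult_def sum_distrib_left mult_ac)
qed

lemma leray_mult_self: "(\<Sum>l\<in>UNIV. leray_mult j l k * of_int (k $ l)) = 0"
proof -
  have "(\<Sum>l\<in>UNIV. leray_mult j l k * of_int (k $ l))
      = (\<Sum>l\<in>UNIV. (if j = l then of_int (k $ l) else 0) - of_int (k $ j) / freq_sq k * (of_int (k $ l))\<^sup>2)"
    by (rule sum.cong) (simp_all add: leray_mult_def left_diff_distrib power2_eq_square)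
  also have "\<dots> = of_int (k $ j) - of_int (k $ j) / freq_sq k * freq_sq k"
    unfolding sum_subtractf sum_distrib_left[symmetric] freq_sq_def[symmetric] by simp
  finally show ?thesis by (cases "k = 0") (auto simp: freq_sq_eq_0_iff)
qed

text \<open>
  For \<open>k = p + q\<close>, the projected vectors \<open>P\<^sub>k p\<close> and \<open>P\<^sub>k q\<close> are opposite since \<open>P\<^sub>k k = 0\<close>; this is
  what makes the projection of \<open>R \<nabla>f\<close> as regular as \<open>f\<close> and \<open>R\<close> themselves.
\<close>

lemma leray_mult_bound:
  "wt (p + q) * \<bar>\<Sum>l\<in>UNIV. leray_mult j l (p + q) * of_int (p $ l)\<bar> \<le> 2 * (wt p * wt q)"
proof -
  let ?k = "p + q"
  let ?P = "\<lambda>v. \<Sum>l\<in>UNIV. leray_mult j l ?k * of_int (v $ l)"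
  have bd: "\<bar>?P v\<bar> \<le> freq_norm v" for v
  proof -
    have "\<bar>?P v\<bar> \<le> (\<Sum>l\<in>UNIV. 1 * \<bar>of_int (v $ l)\<bar>)"
      by (rule order_trans[OF sum_abs sum_mono]) (auto simp: abs_mult intro!: mult_left_le_one_le abs_leray_mult_le)
    then show ?thesis by (simp add: freq_norm_def)
  qed
  have "?P ?k = 0" by (rule leray_mult_self)
  then have eq: "?P p = - ?P q"
    by (simp add: sum.distrib distrib_left)
  have "freq_norm ?k * \<bar>?P p\<bar> \<le> (freq_norm p + freq_norm q) * \<bar>?P p\<bar>"
    by (rule mult_right_mono[OF freq_norm_add]) simp
  also have "\<dots> = freq_norm p * \<bar>?P q\<bar> + freq_norm q * \<bar>?P p\<bar>" by (simp add: eq distrib_right)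
  also have "\<dots> \<le> freq_norm p * freq_norm q + freq_norm q * freq_norm p"
    by (intro add_mono mult_left_mono bd) auto
  finally have "wt ?k * \<bar>?P p\<bar> \<le> freq_norm p + 2 * (freq_norm p * freq_norm q)"
    using bd[of p] by (simp add: distrib_right)
  also have "\<dots> \<le> 2 * (wt p * wt q)" by (simp add: algebra_simps)
  finally show ?thesis .
qed

text \<open>The product with a gradient is a priori one derivative short of \<open>A1\<close>. Its
  projection has coefficients built from P_k p, f_p and g_(k-p), and the cancellation in
  \<open>leray_mult_bound\<close> distributes the weight of k over p and k - p. This closes the
  recursion for \<open>curl_rhs\<close> in \<open>A1\<close>.\<close>

lemma A1_leray_gradient_mult:
  fixes f g :: "'n::finite wiener"
  assumes f: "f \<in> A1" and g: "g \<in> A1"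
  shows "leray (\<lambda>l. der l f * g) j \<in> A1"
    "norm1 (leray (\<lambda>l. der l f * g) j) \<le> 4 * pi * (norm1 f * norm1 g)"
proof -
  let ?a = "\<lambda>k. wt k * norm (coef f k)" and ?b = "\<lambda>k. wt k * norm (coef g k)"
  \<comment> \<open>The factor 4 \<pi> collects 2 \<pi> from the derivative and 2 from
    \<open>leray_mult_bound\<close>.\<close>
  let ?t = "\<lambda>k. (wt k / (4 * pi)) *\<^sub>R coef (leray (\<lambda>l. der l f * g) j) k"
  have ab: "?a abs_summable_on UNIV" "?b abs_summable_on UNIV"
    using f[THEN A1_summable] g[THEN A1_summable] by (simp_all add: abs_mult)
  have t: "norm (?t k) \<le> conv ?a ?b k" for k
  proof -
    let ?s = "\<lambda>p. (\<Sum>l\<in>UNIV. leray_mult j l k * of_int (p $ l))"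
    have summ: "(\<lambda>p. coef (der l f) p * coef g (k - p)) summable_on UNIV" for l
      by (rule abs_summable_summable[OF conv_summand]) (rule coef_summable)+
    have "coef (leray (\<lambda>l. der l f * g) j) k
        = (\<Sum>\<^sub>\<infinity>p. \<Sum>l\<in>UNIV. of_real (leray_mult j l k) * (coef (der l f) p * coef g (k - p)))"
      unfolding coef_leray coef_mult conv_def
      by (subst infsum_finite_sum) (auto intro: summable_on_cmult_right[OF summ] simp: infsum_cmult_right')
    also have "\<dots> = (\<Sum>\<^sub>\<infinity>p. (2 * pi * \<i>) * (of_real (?s p) * coef f p * coef g (k - p)))"
      by (intro infsum_cong) (simp add: coef_der[OF f] sum_distrib_left sum_distrib_right mult_ac)
    also have "\<dots> = (2 * pi * \<i>) * (\<Sum>\<^sub>\<infinity>p. of_real (?s p) * coef f p * coef g (k - p))"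
      by (rule infsum_cmult_right')
    finally have eq: "?t k = (wt k / 2) *\<^sub>R (\<i> * (\<Sum>\<^sub>\<infinity>p. of_real (?s p) * coef f p * coef g (k - p)))"
      by (simp add: scaleR_conv_of_real)
    have le: "wt k / 2 * norm (of_real (?s p) * coef f p * coef g (k - p)) \<le> ?a p * ?b (k - p)" for p
    proof -
      have "wt k * \<bar>?s p\<bar> \<le> 2 * (wt p * wt (k - p))" using leray_mult_bound[of p "k - p" j] by simp
      from mult_right_mono[OF this, of "norm (coef f p) * norm (coef g (k - p)) / 2"]
      show ?thesis unfolding norm_mult norm_of_real by (simp only: mult_ac times_divide_eq_left times_divide_eq_right) simp
    qed
    have sR: "(\<lambda>p. ?a p * ?b (k - p)) summable_on UNIV"
      by (rule abs_summable_summable[OF conv_summand[OF ab]])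
    have sL: "(\<lambda>p. wt k / 2 * norm (of_real (?s p) * coef f p * coef g (k - p))) summable_on UNIV"
      by (rule summable_on_comparison_test[OF sR le]) auto
    have sL': "(\<lambda>p. of_real (?s p) * coef f p * coef g (k - p)) abs_summable_on UNIV"
    proof -
      have "2 / wt k * (wt k / 2 * y) = y" for y by simp
      then show ?thesis using summable_on_cmult_right[OF sL, of "2 / wt k"] by (simp only:)
    qed
    have "norm (?t k) \<le> wt k / 2 * (\<Sum>\<^sub>\<infinity>p. norm (of_real (?s p) * coef f p * coef g (k - p)))"
      unfolding eq norm_scaleR norm_mult[of \<i>] using norm_infsum_bound[OF sL'] by (simp add: mult_left_mono)
    also have "\<dots> = (\<Sum>\<^sub>\<infinity>p. wt k / 2 * norm (of_real (?s p) * coef f p * coef g (k - p)))"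
      by (rule infsum_cmult_right'[symmetric])
    also have "\<dots> \<le> conv ?a ?b k"
      unfolding conv_def by (rule infsum_mono[OF sL sR le])
    finally show ?thesis .
  qed
  note * = conv_nonneg_summable[OF f[THEN A1_summable] g[THEN A1_summable] _ _ t]
  let ?w = "\<lambda>k. wt k * norm (coef (leray (\<lambda>l. der l f * g) j) k)"
  have w: "?w k = 4 * pi * norm (?t k)" for k by simp
  have "?w summable_on UNIV" unfolding w by (rule summable_on_cmult_right[OF *(1)]) auto
  then show "leray (\<lambda>l. der l f * g) j \<in> A1" by (simp add: A1_def)
  have "norm1 (leray (\<lambda>l. der l f * g) j) = 4 * pi * (\<Sum>\<^sub>\<infinity>k. norm (?t k))"
    unfolding norm1_def w by (rule infsum_cmult_right')
  also have "\<dots> \<le> 4 * pi * (norm1 f * norm1 g)"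
    using *(2) by (intro mult_left_mono) (auto simp: norm1_def)
  finally show "norm1 (leray (\<lambda>l. der l f * g) j) \<le> 4 * pi * (norm1 f * norm1 g)" .
qed

section \<open>The div-curl system with variable density\<close>

text \<open>The squared L2 norm, written as the mean of f^2 so that pointwise bounds apply to it;
  Parseval's identity is the next lemma.\<close>

definition norm2_sq :: "'n::finite wiener \<Rightarrow> real" where
  "norm2_sq f = Re (coef (f * f) 0)"

lemma norm2_sq: "(\<lambda>k. (norm (coef f k))\<^sup>2) summable_on UNIV" "norm2_sq f = (\<Sum>\<^sub>\<infinity>k. (norm (coef f k))\<^sup>2)"
proof -
  have eq: "coef f p * coef f (0 - p) = of_real ((norm (coef f p))\<^sup>2)" for p
    by (simp add: coef_minus complex_mult_cnj cmod_power2)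
  have "(\<lambda>p. norm (coef f p * coef f (0 - p))) summable_on UNIV"
    by (rule conv_summand) (rule coef_summable)+
  then show s: "(\<lambda>k. (norm (coef f k))\<^sup>2) summable_on UNIV" unfolding eq norm_of_real by simp
  have "coef (f * f) 0 = (\<Sum>\<^sub>\<infinity>p. of_real ((norm (coef f p))\<^sup>2))"
    unfolding coef_mult conv_def eq ..
  then show "norm2_sq f = (\<Sum>\<^sub>\<infinity>k. (norm (coef f k))\<^sup>2)"
    unfolding norm2_sq_def infsumI[OF has_sum_of_real[OF has_sum_infsum[OF s]]] by simp
qed

lemma norm2_sq_nonneg [simp]: "norm2_sq f \<ge> 0"
  unfolding norm2_sq(2) by (rule infsum_nonneg) simp

lemma norm_coef_le_norm2: "norm (coef f k) \<le> sqrt (norm2_sq f)"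
proof (rule real_le_rsqrt)
  show "(norm (coef f k))\<^sup>2 \<le> norm2_sq f"
    unfolding norm2_sq(2) using finite_sum_le_infsum[OF norm2_sq(1), of "{k}" f] by simp
qed

lemma norm2_le_norm: "sqrt (norm2_sq f) \<le> norm f"
proof (rule real_le_lsqrt)
  have "norm2_sq f \<le> norm (coef (f * f) 0)" unfolding norm2_sq_def by (rule complex_Re_le_cmod)
  also have "\<dots> \<le> norm f * norm f" using norm_coef_le norm_mult_ineq order_trans by blast
  finally show "norm2_sq f \<le> (norm f)\<^sup>2" by (simp add: power2_eq_square)
qed auto

text \<open>The function r^2 f^2 - (g f)^2 is nonnegative at every point, hence so is its
  mean.\<close>

lemma norm2_sq_mult_le:
  assumes "\<And>x. \<bar>ev g x\<bar> \<le> r"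
  shows "norm2_sq (g * f) \<le> r\<^sup>2 * norm2_sq f"
proof -
  have "ev (r\<^sup>2 *\<^sub>R (f * f) - (g * f) * (g * f)) x \<ge> 0" for x
  proof -
    have "(ev g x)\<^sup>2 \<le> r\<^sup>2" using assms[of x] by (rule sqrt_le_D[unfolded real_sqrt_abs, OF order_trans, rotated]) simp
    then have "(ev g x)\<^sup>2 * (ev f x)\<^sup>2 \<le> r\<^sup>2 * (ev f x)\<^sup>2" by (rule mult_right_mono) simp
    then show ?thesis by (simp add: power2_eq_square mult_ac)
  qed
  then have "Re (coef (r\<^sup>2 *\<^sub>R (f * f) - (g * f) * (g * f)) 0) \<ge> 0" by (rule ev_nonneg_imp_mean_nonneg)
  then show ?thesis by (simp add: norm2_sq_def)
qed

text \<open>Interpolation in place of a compactness argument: the finitely many frequencies up to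
  \<open>M\<close> are controlled by L2, the others by the weight, with a factor that is small for
  large \<open>M\<close>.\<close>

lemma norm_le_low_high:
  fixes f :: "'n::finite wiener"
  assumes f: "f \<in> A1"
  shows "norm f \<le> card {k :: int^'n. freq_norm k \<le> real M} * sqrt (norm2_sq f) + norm1 f / (1 + real M)"
  unfolding norm_wiener_def
proof (rule infsum_le_finite_sums[OF coef_summable])
  fix F :: "(int^'n) set" assume F: "finite F"
  let ?L = "{k :: int^'n. freq_norm k \<le> real M}"
  have "(\<Sum>k\<in>F. norm (coef f k)) \<le> (\<Sum>k\<in>F. (if k \<in> ?L then sqrt (norm2_sq f) else 0) + wt k * norm (coef f k) / (1 + real M))"
  proof (rule sum_mono)
    fix k
    have "norm (coef f k) \<le> wt k * norm (coef f k) / (1 + real M)" if "k \<notin> ?L"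
    proof -
      have "(1 + real M) * norm (coef f k) \<le> wt k * norm (coef f k)" using that by (intro mult_right_mono) auto
      then show ?thesis by (simp add: field_simps)
    qed
    then show "norm (coef f k) \<le> (if k \<in> ?L then sqrt (norm2_sq f) else 0) + wt k * norm (coef f k) / (1 + real M)"
      using norm_coef_le_norm2[of f k] by (auto intro: add_increasing2)
  qed
  also have "\<dots> = card (F \<inter> ?L) * sqrt (norm2_sq f) + (\<Sum>k\<in>F. wt k * norm (coef f k)) / (1 + real M)"
    using F by (simp add: sum.distrib sum_divide_distrib sum.If_cases)
  also have "\<dots> \<le> card ?L * sqrt (norm2_sq f) + norm1 f / (1 + real M)"
    unfolding norm1_def using finite_sum_le_infsum[OF A1_summable[OF f] F] finite_freq_norm_le[of M]
    by (intro add_mono mult_right_mono divide_right_mono) (auto intro!: card_mono)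
  finally show "(\<Sum>k\<in>F. norm (coef f k)) \<le> card ?L * sqrt (norm2_sq f) + norm1 f / (1 + real M)" .
qed

text \<open>Trigonometric polynomials of degree at most \<open>M\<close>.\<close>

definition band :: "nat \<Rightarrow> 'n::finite wiener set" where
  "band M = {f. \<forall>k. freq_norm k > M \<longrightarrow> coef f k = 0}"

lemma band_mult:
  fixes f g :: "'n::finite wiener"
  shows "f \<in> band M \<Longrightarrow> g \<in> band N \<Longrightarrow> f * g \<in> band (M + N)"
  unfolding band_def mem_Collect_eq coef_mult conv_def
proof (intro allI impI)
  fix k :: "int^'n"
  assume f: "\<forall>k. freq_norm k > M \<longrightarrow> coef f k = 0" and g: "\<forall>k. freq_norm k > N \<longrightarrow> coef g k = 0"
    and k: "freq_norm k > real (M + N)"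
  have "coef f p * coef g (k - p) = 0" for p
    using freq_norm_add[of p "k - p"] f g k by (cases "freq_norm p > M") auto
  then show "(\<Sum>\<^sub>\<infinity>p. coef f p * coef g (k - p)) = 0" by (rule infsum_0)
qed

lemma band_power: "f \<in> band N \<Longrightarrow> f ^ j \<in> band (j * N)"
  by (induction j) (auto simp: band_mult, simp add: band_def coef_one)

lemma card_freq_norm_le: "card {k :: int^'n. freq_norm k \<le> real M} \<le> (2 * M + 1) ^ CARD('n)"
proof -
  have "{k :: int^'n. freq_norm k \<le> real M} \<subseteq> vec_lambda ` (PiE UNIV (\<lambda>_. {- int M..int M}))"
  proof
    fix k :: "int^'n" assume "k \<in> {k. freq_norm k \<le> real M}"
    then have "\<bar>real_of_int (k $ i)\<bar> \<le> real M" for i using abs_nth_le_freq_norm[of k i] by simp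
    then have "\<bar>k $ i\<bar> \<le> int M" for i by (metis of_int_abs of_int_le_iff of_int_of_nat_eq)
    then have "k $ i \<in> {- int M..int M}" for i by (simp add: abs_le_iff minus_le_iff)
    then show "k \<in> vec_lambda ` (PiE UNIV (\<lambda>_. {- int M..int M}))"
      by (intro image_eqI[of _ _ "vec_nth k"]) auto
  qed
  moreover have fin: "finite (PiE (UNIV :: 'n set) (\<lambda>_. {- int M..int M}))" by (intro finite_PiE) auto
  ultimately have "card {k :: int^'n. freq_norm k \<le> real M} \<le> card (PiE (UNIV :: 'n set) (\<lambda>_. {- int M..int M}))"
    by (meson card_image_le card_mono finite_imageI le_trans)
  also have "\<dots> = (2 * M + 1) ^ CARD('n)" by (simp add: card_PiE nat_add_distrib nat_mult_distrib)
  finally show ?thesis .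
qed

lemma norm1_band_le:
  fixes f :: "'n::finite wiener"
  assumes "f \<in> band M" "f \<in> A1"
  shows "norm1 f \<le> (1 + real M) * (2 * real M + 1) ^ CARD('n) * sqrt (norm2_sq f)"
  unfolding norm1_def
proof (rule infsum_le_finite_sums[OF A1_summable[OF assms(2)]])
  fix F :: "(int^'n) set" assume F: "finite F"
  let ?L = "{k :: int^'n. freq_norm k \<le> real M}"
  have "(\<Sum>k\<in>F. wt k * norm (coef f k)) \<le> (\<Sum>k\<in>F. if k \<in> ?L then (1 + real M) * sqrt (norm2_sq f) else 0)"
    using assms(1) norm_coef_le_norm2[of f]
    by (intro sum_mono) (auto simp: band_def intro!: mult_mono)
  also have "\<dots> = card (F \<inter> ?L) * ((1 + real M) * sqrt (norm2_sq f))"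
    using F by (simp add: sum.If_cases)
  also have "\<dots> \<le> ((2 * real M + 1) ^ CARD('n)) * ((1 + real M) * sqrt (norm2_sq f))"
  proof (rule mult_right_mono)
    have "card (F \<inter> ?L) \<le> card ?L" by (rule card_mono) (auto simp: finite_freq_norm_le)
    also have "\<dots> \<le> (2 * M + 1) ^ CARD('n)" by (rule card_freq_norm_le)
    finally have "real (card (F \<inter> ?L)) \<le> real ((2 * M + 1) ^ CARD('n))" by (simp only: of_nat_le_iff)
    then show "real (card (F \<inter> ?L)) \<le> (2 * real M + 1) ^ CARD('n)" by (simp add: add.commute)
  qed auto
  finally show "(\<Sum>k\<in>F. wt k * norm (coef f k)) \<le> (1 + real M) * (2 * real M + 1) ^ CARD('n) * sqrt (norm2_sq f)"
    by (simp add: mult_ac)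
qed

text \<open>With t the m-th root of s, the expression is the m-th power of (n + 1) t^n, which tends
  to 0.\<close>

lemma poly_times_power_small:
  fixes s :: real
  assumes "0 < s" "s < 1" "e > 0" "m > 0"
  shows "\<exists>n>0. (real n + 1) ^ m * s ^ n \<le> e"
proof -
  define t where "t = root m s"
  have t: "0 < t" "t < 1" "t ^ m = s" using assms by (auto simp: t_def)
  have "(\<lambda>n. real n * t ^ n + t ^ n) \<longlonglongrightarrow> 0 + 0"
    using t by (intro tendsto_add powser_times_n_limit_0 LIMSEQ_power_zero) auto
  from tendsto_power[OF this, of m] have "(\<lambda>n. (real n * t ^ n + t ^ n) ^ m) \<longlonglongrightarrow> 0"
    by (simp only: add_0 zero_power[OF assms(4)])
  moreover have "(real n * t ^ n + t ^ n) ^ m = (real n + 1) ^ m * s ^ n" for n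
  proof -
    have "real n * t ^ n + t ^ n = (real n + 1) * t ^ n" by (simp add: algebra_simps)
    moreover have "(t ^ n) ^ m = s ^ n" unfolding t(3)[symmetric] by (simp add: power_mult[symmetric] mult.commute)
    ultimately show ?thesis by (simp add: power_mult_distrib)
  qed
  ultimately have "(\<lambda>n. (real n + 1) ^ m * s ^ n) \<longlonglongrightarrow> 0" by simp
  then have "\<forall>\<^sub>F n in sequentially. (real n + 1) ^ m * s ^ n < e" using assms(3) by (rule order_tendstoD)
  then obtain N where "\<And>n. n \<ge> N \<Longrightarrow> (real n + 1) ^ m * s ^ n < e" by (auto simp: eventually_sequentially)
  then show ?thesis by (intro exI[of _ "Suc N"]) (auto intro!: less_imp_le simp del: power_Suc of_nat_Suc)
qed

lemma norm1_power_le: "f \<in> A1 \<Longrightarrow> norm1 (f ^ n) \<le> norm1 f ^ n"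
proof (induction n)
  case (Suc n)
  have "norm1 (f ^ Suc n) \<le> norm1 f * norm1 (f ^ n)"
    using Suc.prems by (simp add: A1_mult A1_power)
  also have "\<dots> \<le> norm1 f * norm1 f ^ n" using Suc by (intro mult_left_mono) auto
  finally show ?case by simp
qed (simp add: A1_one)

text \<open>
  The spectral radius of \<open>g\<close> in the algebra \<open>A1\<close> is its maximum modulus: after truncation to a
  trigonometric polynomial, the powers have polynomially many frequencies, so that the norm of \<open>A1\<close>
  exceeds the norm of \<open>L\<^sup>2\<close> by a polynomial factor only.
\<close>

lemma power_norm1_small:
  fixes g :: "'n::finite wiener"
  assumes g: "g \<in> A1" and r: "\<And>x. \<bar>ev g x\<bar> \<le> r" "r < 1" and d: "d > 0"
  shows "\<exists>n>0. norm1 (g ^ n) \<le> d"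
proof -
  have r0: "r \<ge> 0" using r(1)[of 0] by linarith
  \<comment> \<open>With this e the truncation is bounded by r + e and the remainder by e; the base
    r + 2e of the binomial sum below is (1 + r)/2, less than 1.\<close>
  define e where "e = (1 - r) / 4"
  have e: "e > 0" "r + 2 * e < 1" "r + 2 * e > 0" using r r0 by (auto simp: e_def field_simps)
  obtain N where N: "norm1 (g - trunc N g) \<le> e" using trunc_approx[OF g e(1)] by blast
  let ?P = "trunc N g"
  let ?R = "g - ?P"
  have P: "?P \<in> A1" and R: "?R \<in> A1" using g by (simp_all add: A1_trunc A1_diff)
  have evP: "\<bar>ev ?P x\<bar> \<le> r + e" for x
  proof -
    have "\<bar>ev ?R x\<bar> \<le> e" using abs_ev_le[of ?R x] norm_le_norm1[OF R] N by linarith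
    then show ?thesis using r(1)[of x] by auto
  qed
  have bandP: "?P \<in> band N" by (simp add: band_def coef_trunc)
  let ?c = "CARD('n) + 1"
  \<comment> \<open>A polynomial in n of degree d + 1 that dominates the constant of
    \<open>norm1_band_le\<close> at the degree j N of the j-th power, for all j up to n.\<close>
  let ?B = "\<lambda>n. ((2 * real N + 1) * (real n + 1)) ^ ?c"
  have normP: "norm1 (?P ^ j) \<le> ?B n * (r + e) ^ j" if "j \<le> n" for j n
  proof -
    have "norm2_sq (?P ^ j * 1) \<le> ((r + e) ^ j)\<^sup>2 * norm2_sq (1 :: 'n wiener)"
    proof (rule norm2_sq_mult_le)
      show "\<bar>ev (?P ^ j) x\<bar> \<le> (r + e) ^ j" for x using evP[of x] by (simp add: power_abs power_mono)
    qed
    moreover have "norm2_sq (1 :: 'n wiener) = 1" by (simp add: norm2_sq_def coef_one)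
    ultimately have "sqrt (norm2_sq (?P ^ j)) \<le> (r + e) ^ j"
      using r0 e by (simp add: real_le_lsqrt)
    then have "norm1 (?P ^ j) \<le> (1 + real (j * N)) * (2 * real (j * N) + 1) ^ CARD('n) * (r + e) ^ j"
      by (intro order_trans[OF norm1_band_le[OF band_power[OF bandP] A1_power[OF P]]])
         (auto intro!: mult_left_mono simp del: of_nat_mult)
    also have "\<dots> \<le> ?B n * (r + e) ^ j"
    proof (rule mult_right_mono)
      have jN: "real (j * N) \<le> real n * real N" using that by (simp add: mult_right_mono)
      have a: "1 + real (j * N) \<le> (2 * real N + 1) * (real n + 1)" "2 * real (j * N) + 1 \<le> (2 * real N + 1) * (real n + 1)"
      proof -
        have "(2 * real N + 1) * (real n + 1) = 2 * (real n * real N) + 2 * real N + real n + 1"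
          by (simp add: algebra_simps)
        moreover have "0 \<le> real n * real N" by simp
        ultimately show "1 + real (j * N) \<le> (2 * real N + 1) * (real n + 1)"
          "2 * real (j * N) + 1 \<le> (2 * real N + 1) * (real n + 1)"
          using jN by linarith+
      qed
      have "(1 + real (j * N)) * (2 * real (j * N) + 1) ^ CARD('n)
         \<le> ((2 * real N + 1) * (real n + 1)) * ((2 * real N + 1) * (real n + 1)) ^ CARD('n)"
        by (intro mult_mono a power_mono) auto
      then show "(1 + real (j * N)) * (2 * real (j * N) + 1) ^ CARD('n) \<le> ?B n" by simp
    qed (use r0 e in auto)
    finally show ?thesis .
  qed
  have main: "norm1 (g ^ n) \<le> ?B n * (r + 2 * e) ^ n" for n
  proof -
    have "g ^ n = (\<Sum>j\<le>n. of_nat (n choose j) * ?P ^ j * ?R ^ (n - j))"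
      using binomial_ring[of ?P ?R n] by simp
    also have "\<dots> = (\<Sum>j\<le>n. real (n choose j) *\<^sub>R (?P ^ j * ?R ^ (n - j)))"
      by (intro sum.cong refl) (simp add: scaleR_conv_of_real mult.assoc)
    finally have "norm1 (g ^ n) = norm1 (\<Sum>j\<le>n. real (n choose j) *\<^sub>R (?P ^ j * ?R ^ (n - j)))" by simp
    also have "\<dots> \<le> (\<Sum>j\<le>n. norm1 (real (n choose j) *\<^sub>R (?P ^ j * ?R ^ (n - j))))"
      by (intro A1_sum A1_scaleR A1_mult A1_power P R)
    also have "\<dots> \<le> (\<Sum>j\<le>n. ?B n * (real (n choose j) * (r + e) ^ j * e ^ (n - j)))"
    proof (rule sum_mono)
      fix j assume j: "j \<in> {..n}"
      have "norm1 (?P ^ j * ?R ^ (n - j)) \<le> (?B n * (r + e) ^ j) * e ^ (n - j)"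
        by (rule order_trans[OF A1_mult(2)[OF A1_power[OF P] A1_power[OF R]]], intro mult_mono)
           (use normP[of j n] j N r0 e in \<open>auto intro!: order_trans[OF norm1_power_le[OF R]] power_mono\<close>)
      then have "real (n choose j) * norm1 (?P ^ j * ?R ^ (n - j)) \<le> real (n choose j) * ((?B n * (r + e) ^ j) * e ^ (n - j))"
        by (rule mult_left_mono) simp
      then show "norm1 (real (n choose j) *\<^sub>R (?P ^ j * ?R ^ (n - j))) \<le> ?B n * (real (n choose j) * (r + e) ^ j * e ^ (n - j))"
        by (simp add: A1_scaleR A1_mult A1_power P R mult_ac)
    qed
    also have "\<dots> = ?B n * ((r + e) + e) ^ n" unfolding binomial_ring by (simp add: sum_distrib_left)
    finally show ?thesis by (simp add: add.assoc)
  qed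
  have "d / (2 * real N + 1) ^ ?c > 0" using d by simp
  then obtain n where n: "n > 0" "(real n + 1) ^ ?c * (r + 2 * e) ^ n \<le> d / (2 * real N + 1) ^ ?c"
    using poly_times_power_small[OF e(3,2), of _ ?c] by auto
  have "?B n * (r + 2 * e) ^ n = (2 * real N + 1) ^ ?c * ((real n + 1) ^ ?c * (r + 2 * e) ^ n)"
    by (simp add: power_mult_distrib mult_ac)
  also have "\<dots> \<le> (2 * real N + 1) ^ ?c * (d / (2 * real N + 1) ^ ?c)"
    by (rule mult_left_mono[OF n(2)]) simp
  also have "\<dots> = d"
  proof -
    have "2 * real N + 1 \<noteq> 0" by (metis add_pos_nonneg le_add_same_cancel2 of_nat_0_le_iff add.commute less_numeral_extra(1) mult_nonneg_nonneg order_less_irrefl zero_le_numeral)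
    then show ?thesis by simp
  qed
  finally show ?thesis using main[of n] n(1) by (intro exI[of _ n]) linarith
qed

lemma bounded_linear_coef: "bounded_linear (\<lambda>f. coef f k)"
  by (rule bounded_linear_intro[of _ 1]) (auto simp: norm_coef_le)

text \<open>\<open>A1\<close> carries no norm structure of its own, so the sum is taken in the
  Wiener norm, and the bound in \<open>norm1\<close> is passed on to it through finite sets of
  frequencies.\<close>

lemma A1_suminf:
  fixes f :: "nat \<Rightarrow> 'n::finite wiener"
  assumes f: "\<And>i. f i \<in> A1" and s: "summable (\<lambda>i. norm1 (f i))"
  shows "summable (\<lambda>i. norm (f i))" "(\<Sum>i. f i) \<in> A1" "norm1 (\<Sum>i. f i) \<le> (\<Sum>i. norm1 (f i))"
proof -
  show sn: "summable (\<lambda>i. norm (f i))"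
    by (rule summable_comparison_test'[OF s]) (use f in \<open>auto intro: norm_le_norm1\<close>)
  then have sf: "summable f" by (rule summable_norm_cancel)
  have bound: "(\<Sum>k\<in>F. wt k * norm (coef (\<Sum>i. f i) k)) \<le> (\<Sum>i. norm1 (f i))" if F: "finite F" for F
  proof -
    have sk: "summable (\<lambda>i. norm (coef (f i) k))" for k
      by (rule summable_comparison_test'[OF sn]) (simp add: norm_coef_le)
    have "(\<Sum>k\<in>F. wt k * norm (coef (\<Sum>i. f i) k)) \<le> (\<Sum>k\<in>F. wt k * (\<Sum>i. norm (coef (f i) k)))"
      using summable_norm[OF sk]
      by (intro sum_mono mult_left_mono) (auto simp: bounded_linear.suminf[OF bounded_linear_coef sf, symmetric])
    also have "\<dots> = (\<Sum>i. \<Sum>k\<in>F. wt k * norm (coef (f i) k))"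
      using sk by (simp add: suminf_mult[symmetric] suminf_sum summable_mult)
    also have "\<dots> \<le> (\<Sum>i. norm1 (f i))"
    proof (rule suminf_le)
      show "(\<Sum>k\<in>F. wt k * norm (coef (f i) k)) \<le> norm1 (f i)" for i
        unfolding norm1_def by (rule finite_sum_le_infsum[OF A1_summable[OF f] F]) auto
      show "summable (\<lambda>i. \<Sum>k\<in>F. wt k * norm (coef (f i) k))"
        using sk by (intro summable_sum summable_mult)
    qed (rule s)
    finally show ?thesis .
  qed
  have "(\<lambda>k. wt k * norm (coef (\<Sum>i. f i) k)) summable_on UNIV"
    by (rule nonneg_bdd_above_summable_on) (use bound in \<open>auto intro!: bdd_aboveI\<close>)
  then show "(\<Sum>i. f i) \<in> A1" by (simp add: A1_def)
  then show "norm1 (\<Sum>i. f i) \<le> (\<Sum>i. norm1 (f i))"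
    unfolding norm1_def[of "\<Sum>i. f i"] by (intro infsum_le_finite_sums A1_summable bound)
qed

lemma der_suminf:
  fixes f :: "nat \<Rightarrow> 'n::finite wiener"
  assumes f: "\<And>i. f i \<in> A1" and s: "summable (\<lambda>i. norm1 (f i))"
  shows "summable (\<lambda>i. norm (der j (f i)))" "der j (\<Sum>i. f i) = (\<Sum>i. der j (f i))"
proof -
  show sn: "summable (\<lambda>i. norm (der j (f i)))"
    by (rule summable_comparison_test'[OF summable_mult[OF s, of "2 * pi"]]) (use f norm_der_le in auto)
  have sf: "summable f" by (rule summable_norm_cancel[OF A1_suminf(1)[OF f s]])
  show "der j (\<Sum>i. f i) = (\<Sum>i. der j (f i))"
  proof (rule wiener_eqI)
    fix k
    have "summable (\<lambda>i. coef (f i) k)" by (rule bounded_linear.summable[OF bounded_linear_coef sf])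
    then show "coef (der j (\<Sum>i. f i)) k = coef (\<Sum>i. der j (f i)) k"
      by (simp add: coef_der A1_suminf[OF f s] f suminf_mult
          bounded_linear.suminf[OF bounded_linear_coef sf]
          bounded_linear.suminf[OF bounded_linear_coef summable_norm_cancel[OF sn]])
  qed
qed

section \<open>Vector fields and the Neumann series\<close>

definition vnorm :: "('n \<Rightarrow> 'n::finite wiener) \<Rightarrow> real" where
  "vnorm Q = (\<Sum>j\<in>UNIV. norm (Q j))"

definition vnorm1 :: "('n \<Rightarrow> 'n::finite wiener) \<Rightarrow> real" where
  "vnorm1 Q = (\<Sum>j\<in>UNIV. norm1 (Q j))"

text \<open>The components are combined by a Euclidean sum, unlike in the other two norms: then the
  Leray projection has norm at most 1 and does not spoil the contraction factor r.\<close>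

definition vnorm2 :: "('n \<Rightarrow> 'n::finite wiener) \<Rightarrow> real" where
  "vnorm2 Q = sqrt (\<Sum>j\<in>UNIV. norm2_sq (Q j))"

lemma vnorm_nonneg [simp]: "vnorm Q \<ge> 0" "vnorm1 Q \<ge> 0" "vnorm2 Q \<ge> 0"
  by (auto simp: vnorm_def vnorm1_def vnorm2_def intro!: sum_nonneg)

lemma norm_le_vnorm: "norm (Q j) \<le> vnorm Q" "norm1 (Q j) \<le> vnorm1 Q"
  unfolding vnorm_def vnorm1_def by (rule member_le_sum, auto)+

lemma vnorm_le_vnorm1: "(\<And>j. Q j \<in> A1) \<Longrightarrow> vnorm Q \<le> vnorm1 Q"
  unfolding vnorm_def vnorm1_def by (intro sum_mono norm_le_norm1)

lemma vnorm2_le_vnorm: "vnorm2 Q \<le> vnorm Q"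
proof -
  have "vnorm2 Q = L2_set (\<lambda>j. sqrt (norm2_sq (Q j))) UNIV" by (simp add: vnorm2_def L2_set_def)
  also have "\<dots> \<le> (\<Sum>j\<in>UNIV. sqrt (norm2_sq (Q j)))" by (rule L2_set_le_sum) simp
  also have "\<dots> \<le> vnorm Q" unfolding vnorm_def by (intro sum_mono norm2_le_norm)
  finally show ?thesis .
qed

lemma norm2_le_vnorm2: "sqrt (norm2_sq (Q j)) \<le> vnorm2 Q"
  unfolding vnorm2_def by (intro real_sqrt_le_mono member_le_sum) auto

text \<open>Removing the component along a vector a does not increase the length; for a = 0 division
  by zero leaves x unchanged, in accordance with the convention at frequency 0.\<close>

lemma real_projection_le:
  fixes a x :: "'n::finite \<Rightarrow> real"
  shows "(\<Sum>j\<in>UNIV. (x j - a j / (\<Sum>i\<in>UNIV. (a i)\<^sup>2) * (\<Sum>l\<in>UNIV. a l * x l))\<^sup>2) \<le> (\<Sum>j\<in>UNIV. (x j)\<^sup>2)"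
proof -
  let ?s = "\<Sum>i\<in>UNIV. (a i)\<^sup>2" and ?b = "\<Sum>l\<in>UNIV. a l * x l"
  have "(x j - a j / ?s * ?b)\<^sup>2 = (x j)\<^sup>2 - 2 * (?b / ?s) * (a j * x j) + (?b / ?s)\<^sup>2 * (a j)\<^sup>2" for j
    by (simp add: power2_eq_square algebra_simps add_divide_distrib)
  then have "(\<Sum>j\<in>UNIV. (x j - a j / ?s * ?b)\<^sup>2) = (\<Sum>j\<in>UNIV. (x j)\<^sup>2) - 2 * (?b / ?s) * ?b + (?b / ?s)\<^sup>2 * ?s"
    by (simp only: sum.distrib sum_subtractf sum_distrib_left)
  also have "\<dots> = (\<Sum>j\<in>UNIV. (x j)\<^sup>2) - ?b\<^sup>2 / ?s"
    by (cases "?s = 0") (auto simp: power2_eq_square field_simps)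
  also have "\<dots> \<le> (\<Sum>j\<in>UNIV. (x j)\<^sup>2)" by (simp add: sum_nonneg)
  finally show ?thesis .
qed

lemma vnorm2_leray_le: "vnorm2 (leray Q) \<le> vnorm2 Q"
proof -
  have "(\<Sum>j\<in>UNIV. norm2_sq (leray Q j)) = (\<Sum>\<^sub>\<infinity>k. \<Sum>j\<in>UNIV. (norm (coef (leray Q j) k))\<^sup>2)"
    unfolding norm2_sq(2) by (rule infsum_finite_sum(1)[symmetric]) (rule norm2_sq(1))
  also have "\<dots> \<le> (\<Sum>\<^sub>\<infinity>k. \<Sum>j\<in>UNIV. (norm (coef (Q j) k))\<^sup>2)"
  proof (rule infsum_mono; (intro infsum_finite_sum(2) norm2_sq(1))?)
    fix k
    let ?R = "\<lambda>j. Re (coef (Q j) k)" and ?I = "\<lambda>j. Im (coef (Q j) k)"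
    let ?p = "\<lambda>x j. x j - of_int (k $ j) / freq_sq k * (\<Sum>l\<in>UNIV. of_int (k $ l) * x l)"
    have "(norm (coef (leray Q j) k))\<^sup>2 = (?p ?R j)\<^sup>2 + (?p ?I j)\<^sup>2" for j
    proof -
      define c where "c = of_int (k $ j) / freq_sq k"
      have "coef (leray Q j) k = coef (Q j) k - of_real c * (\<Sum>l\<in>UNIV. of_int (k $ l) * coef (Q l) k)"
        by (simp only: coef_leray' c_def)
      then show ?thesis unfolding c_def[symmetric] by (simp add: cmod_power2)
    qed
    then have "(\<Sum>j\<in>UNIV. (norm (coef (leray Q j) k))\<^sup>2) = (\<Sum>j\<in>UNIV. (?p ?R j)\<^sup>2) + (\<Sum>j\<in>UNIV. (?p ?I j)\<^sup>2)"
      by (simp add: sum.distrib)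
    also have "\<dots> \<le> (\<Sum>j\<in>UNIV. (?R j)\<^sup>2) + (\<Sum>j\<in>UNIV. (?I j)\<^sup>2)"
      unfolding freq_sq_def by (intro add_mono real_projection_le)
    also have "\<dots> = (\<Sum>j\<in>UNIV. (norm (coef (Q j) k))\<^sup>2)" by (simp add: cmod_power2 sum.distrib)
    finally show "(\<Sum>j\<in>UNIV. (norm (coef (leray Q j) k))\<^sup>2) \<le> (\<Sum>j\<in>UNIV. (norm (coef (Q j) k))\<^sup>2)" .
  qed
  also have "\<dots> = (\<Sum>j\<in>UNIV. norm2_sq (Q j))"
    unfolding norm2_sq(2) by (rule infsum_finite_sum(1)) (rule norm2_sq(1))
  finally show ?thesis by (simp add: vnorm2_def)
qed

text \<open>The initial density will be a constant times 1 - g. Finding a solenoidal field Q for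
  which (1 - g) Q has a prescribed projection means inverting I - T, with T the operator defined
  next.\<close>

locale leray_contraction =
  fixes g :: "'n::finite wiener" and r :: real
  assumes g: "g \<in> A1" and r: "\<And>x. \<bar>ev g x\<bar> \<le> r" "r < 1"
begin

definition T :: "('n \<Rightarrow> 'n wiener) \<Rightarrow> 'n \<Rightarrow> 'n wiener" where
  "T Q = leray (\<lambda>l. g * Q l)"

definition solenoidal :: "('n \<Rightarrow> 'n wiener) set" where
  "solenoidal = {Q. (\<forall>j. Q j \<in> A1) \<and> leray Q = Q}"

lemma r_nonneg: "r \<ge> 0"
  using r(1)[of 0] by linarith

lemma T_solenoidal: "Q \<in> solenoidal \<Longrightarrow> T Q \<in> solenoidal"
  by (auto simp: solenoidal_def T_def leray_leray intro!: A1_leray A1_mult g)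

lemma funpow_T_solenoidal: "Q \<in> solenoidal \<Longrightarrow> (T ^^ i) Q \<in> solenoidal"
  by (induction i) (auto intro: T_solenoidal)

lemma vnorm_T_le: "vnorm (T Q) \<le> (CARD('n) * norm g) * vnorm Q"
proof -
  have "norm (T Q j) \<le> norm g * vnorm Q" for j
    unfolding T_def vnorm_def sum_distrib_left
    by (rule order_trans[OF norm_leray_le sum_mono[OF norm_mult_ineq]])
  then have "vnorm (T Q) \<le> (\<Sum>j\<in>(UNIV :: 'n set). norm g * vnorm Q)" unfolding vnorm_def[of "T Q"] by (rule sum_mono)
  then show ?thesis by (simp add: mult.assoc)
qed

lemma vnorm1_T_le:
  assumes "Q \<in> solenoidal"
  shows "vnorm1 (T Q) \<le> (CARD('n) * norm1 g) * vnorm1 Q"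
proof -
  have Q: "Q j \<in> A1" for j using assms by (simp add: solenoidal_def)
  have "norm1 (T Q j) \<le> norm1 g * vnorm1 Q" for j
    unfolding T_def vnorm1_def sum_distrib_left
    by (rule order_trans[OF A1_leray(2) sum_mono[OF A1_mult(2)]]) (auto intro: A1_mult g Q)
  then have "vnorm1 (T Q) \<le> (\<Sum>j\<in>(UNIV :: 'n set). norm1 g * vnorm1 Q)" unfolding vnorm1_def[of "T Q"] by (rule sum_mono)
  then show ?thesis by (simp add: mult.assoc)
qed

lemma vnorm2_T_le: "vnorm2 (T Q) \<le> r * vnorm2 Q"
proof -
  have "vnorm2 (T Q) \<le> vnorm2 (\<lambda>l. g * Q l)" unfolding T_def by (rule vnorm2_leray_le)
  also have "\<dots> \<le> sqrt (\<Sum>j\<in>UNIV. r\<^sup>2 * norm2_sq (Q j))"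
    unfolding vnorm2_def by (intro real_sqrt_le_mono sum_mono norm2_sq_mult_le r)
  also have "\<dots> = r * vnorm2 Q"
    using r_nonneg by (simp add: vnorm2_def sum_distrib_left[symmetric] real_sqrt_mult)
  finally show ?thesis .
qed

lemma vnorm2_funpow_T_le: "vnorm2 ((T ^^ i) Q) \<le> r ^ i * vnorm2 Q"
proof (induction i)
  case (Suc i)
  have "vnorm2 ((T ^^ Suc i) Q) \<le> r * vnorm2 ((T ^^ i) Q)" by (simp add: vnorm2_T_le)
  also have "\<dots> \<le> r * (r ^ i * vnorm2 Q)" using Suc r_nonneg by (rule mult_left_mono)
  finally show ?case by (simp add: mult.assoc)
qed simp

text \<open>On solenoidal fields, \<open>T\<close> is the multiplication by \<open>g\<close> up to an operator that gains a derivative.\<close>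

lemma norm1_T_diff_le:
  assumes "Q \<in> solenoidal"
  shows "norm1 (g * Q j - T Q j) \<le> ((CARD('n) + 1) * (2 * pi * norm1 g)) * vnorm Q"
proof -
  have Q: "Q j \<in> A1" for j using assms by (simp add: solenoidal_def)
  have "(\<Sum>l\<in>UNIV. der l (g * Q l)) = (\<Sum>l\<in>UNIV. der l g * Q l) + g * (\<Sum>l\<in>UNIV. der l (Q l))"
    by (simp add: der_mult g Q sum.distrib sum_distrib_left)
  also have "\<dots> = (\<Sum>l\<in>UNIV. der l g * Q l)"
    using div_leray[of Q] assms by (simp add: solenoidal_def)
  finally have "g * Q j - T Q j = sol j (\<Sum>l\<in>UNIV. der l g * Q l)"
    unfolding T_def by (subst diff_leray) (auto intro: A1_mult g Q)
  then have "norm1 (g * Q j - T Q j) \<le> (CARD('n) + 1) * norm (\<Sum>l\<in>UNIV. der l g * Q l)"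
    by (metis A1_sol(2))
  also have "norm (\<Sum>l\<in>UNIV. der l g * Q l) \<le> (\<Sum>l\<in>UNIV. (2 * pi * norm1 g) * norm (Q l))"
    by (rule order_trans[OF norm_sum sum_mono])
       (rule order_trans[OF norm_mult_ineq mult_right_mono[OF norm_der_le[OF g]]], simp)
  finally show ?thesis by (simp add: vnorm_def sum_distrib_left mult.assoc mult_left_mono)
qed

lemma vnorm_funpow_T_le: "vnorm ((T ^^ n) Q) \<le> (CARD('n) * norm g) ^ n * vnorm Q"
proof (induction n)
  case (Suc n)
  have "vnorm ((T ^^ Suc n) Q) \<le> (CARD('n) * norm g) * vnorm ((T ^^ n) Q)" using vnorm_T_le by simp
  also have "\<dots> \<le> (CARD('n) * norm g) * ((CARD('n) * norm g) ^ n * vnorm Q)" using Suc by (rule mult_left_mono) simp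
  finally show ?case by (simp add: mult.assoc)
qed simp

text \<open>Induction on the identity that T^(n+1) - g^(n+1) equals g (T^n - g^n) minus (g - T) T^n
  on solenoidal fields, where \<open>norm1_T_diff_le\<close> handles the last term.\<close>

lemma funpow_T_smoothing:
  "\<exists>C\<ge>0. \<forall>Q\<in>solenoidal. \<forall>j. norm1 ((T ^^ n) Q j - g ^ n * Q j) \<le> C * vnorm Q"
proof (induction n)
  case 0
  show ?case by (intro exI[of _ 0]) simp
next
  case (Suc n)
  then obtain C where C: "C \<ge> 0" "\<And>Q j. Q \<in> solenoidal \<Longrightarrow> norm1 ((T ^^ n) Q j - g ^ n * Q j) \<le> C * vnorm Q" by blast
  let ?D = "(CARD('n) + 1) * (2 * pi * norm1 g)" and ?E = "(CARD('n) * norm g) ^ n"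
  show ?case
  proof (intro exI[of _ "norm1 g * C + ?D * ?E"] conjI ballI allI)
    show "0 \<le> norm1 g * C + ?D * ?E" using C(1) by simp
    fix Q j assume Q: "Q \<in> solenoidal"
    let ?M = "(T ^^ n) Q"
    have M: "?M \<in> solenoidal" by (rule funpow_T_solenoidal[OF Q])
    have A: "?M j \<in> A1" "Q j \<in> A1" "T ?M j \<in> A1" using M Q T_solenoidal[OF M] by (simp_all add: solenoidal_def)
    have gn: "g ^ n * Q j \<in> A1" by (intro A1_mult A1_power g A)
    have eq: "(T ^^ Suc n) Q j - g ^ Suc n * Q j = g * (?M j - g ^ n * Q j) - (g * ?M j - T ?M j)"
      by (simp add: algebra_simps)
    have "norm1 ((T ^^ Suc n) Q j - g ^ Suc n * Q j) \<le> norm1 (g * (?M j - g ^ n * Q j)) + norm1 (g * ?M j - T ?M j)"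
      unfolding eq by (rule A1_diff(2)) (intro A1_diff A1_mult g A gn)+
    also have "\<dots> \<le> norm1 g * (C * vnorm Q) + ?D * (?E * vnorm Q)"
    proof (rule add_mono)
      show "norm1 (g * (?M j - g ^ n * Q j)) \<le> norm1 g * (C * vnorm Q)"
        by (rule order_trans[OF A1_mult(2) mult_left_mono[OF C(2)[OF Q]]]) (auto intro: g A1_diff A gn)
      show "norm1 (g * ?M j - T ?M j) \<le> ?D * (?E * vnorm Q)"
        by (rule order_trans[OF norm1_T_diff_le[OF M] mult_left_mono[OF vnorm_funpow_T_le]]) simp
    qed
    finally show "norm1 ((T ^^ Suc n) Q j - g ^ Suc n * Q j) \<le> (norm1 g * C + ?D * ?E) * vnorm Q"
      by (simp add: algebra_simps)
  qed
qed

lemma vnorm_le_low_high: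
  assumes "e > 0"
  shows "\<exists>C\<ge>0. \<forall>Q. (\<forall>j. Q j \<in> A1) \<longrightarrow> vnorm (Q :: 'n \<Rightarrow> 'n wiener) \<le> e * vnorm1 Q + C * vnorm2 Q"
proof -
  obtain M :: nat where M: "1 / e < real M" using reals_Archimedean2 by blast
  let ?c = "real (card {k :: int^'n. freq_norm k \<le> real M})"
  have e: "1 / (1 + real M) \<le> e" using M assms by (simp add: field_simps)
  have "vnorm Q \<le> e * vnorm1 Q + (CARD('n) * ?c) * vnorm2 Q" if Q: "\<forall>j. Q j \<in> A1" for Q :: "'n \<Rightarrow> 'n wiener"
  proof -
    have "norm (Q j) \<le> ?c * vnorm2 Q + e * norm1 (Q j)" for j
    proof -
      have "norm (Q j) \<le> ?c * sqrt (norm2_sq (Q j)) + 1 / (1 + real M) * norm1 (Q j)"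
        using norm_le_low_high[of "Q j" M] Q by simp
      also have "\<dots> \<le> ?c * vnorm2 Q + e * norm1 (Q j)"
        by (intro add_mono mult_left_mono mult_right_mono norm2_le_vnorm2 e) auto
      finally show ?thesis .
    qed
    then have "vnorm Q \<le> (\<Sum>j\<in>UNIV. ?c * vnorm2 Q + e * norm1 (Q j))" unfolding vnorm_def by (rule sum_mono)
    also have "\<dots> = e * vnorm1 Q + (CARD('n) * ?c) * vnorm2 Q"
      by (simp add: sum.distrib vnorm1_def sum_distrib_left algebra_simps)
    finally show ?thesis .
  qed
  then show ?thesis by (intro exI[of _ "CARD('n) * ?c"]) auto
qed

text \<open>Choose n with g^n small in \<open>A1\<close>. The smoothing error costs the Wiener norm,
  which interpolates between a small multiple of \<open>vnorm1\<close> and L2. The result is an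
  inequality of Lasota-Yorke type: contraction in the strong norm, up to a weak norm that decays on
  its own.\<close>

lemma funpow_T_lasota_yorke:
  "\<exists>n>0. \<exists>C\<ge>0. \<forall>Q\<in>solenoidal. vnorm1 ((T ^^ n) Q) \<le> vnorm1 Q / 2 + C * vnorm2 Q"
proof -
  obtain n where n: "n > 0" "norm1 (g ^ n) \<le> 1/4" using power_norm1_small[OF g r, of "1/4"] by auto
  obtain C where C: "C \<ge> 0" "\<And>Q j. Q \<in> solenoidal \<Longrightarrow> norm1 ((T ^^ n) Q j - g ^ n * Q j) \<le> C * vnorm Q"
    using funpow_T_smoothing[of n] by blast
  \<comment> \<open>With this e the part of the smoothing error measured in \<open>vnorm1\<close> is
    at most 1/4, and g^n contributes another 1/4.\<close>
  define e where "e = 1 / (4 * (CARD('n) * C + 1))"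
  have e: "e > 0" "CARD('n) * C * e \<le> 1/4"
  proof -
    have c: "0 \<le> real CARD('n) * C" using C(1) by simp
    then show "e > 0" by (auto simp: e_def intro!: divide_pos_pos)
    then have "CARD('n) * C * e \<le> (CARD('n) * C + 1) * e" by (intro mult_right_mono) auto
    also have "\<dots> = 1/4" using c by (simp add: e_def)
    finally show "CARD('n) * C * e \<le> 1/4" .
  qed
  obtain C' where C': "C' \<ge> 0" "\<And>Q. (\<forall>j. Q j \<in> A1) \<Longrightarrow> vnorm (Q :: 'n \<Rightarrow> 'n wiener) \<le> e * vnorm1 Q + C' * vnorm2 Q"
    using vnorm_le_low_high[OF e(1)] by blast
  have "vnorm1 ((T ^^ n) Q) \<le> vnorm1 Q / 2 + (CARD('n) * C * C') * vnorm2 Q" if Q: "Q \<in> solenoidal" for Q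
  proof -
    have A: "Q j \<in> A1" "(T ^^ n) Q j \<in> A1" for j
      using Q funpow_T_solenoidal[OF Q, of n] by (simp_all add: solenoidal_def)
    have "norm1 ((T ^^ n) Q j) \<le> C * vnorm Q + 1/4 * norm1 (Q j)" for j
    proof -
      have "norm1 ((T ^^ n) Q j) \<le> norm1 ((T ^^ n) Q j - g ^ n * Q j) + norm1 (g ^ n * Q j)"
        using A1_add(2)[of "(T ^^ n) Q j - g ^ n * Q j" "g ^ n * Q j"] by (simp add: A A1_diff A1_mult A1_power g)
      moreover have "norm1 (g ^ n * Q j) \<le> 1/4 * norm1 (Q j)"
        by (rule order_trans[OF A1_mult(2)[OF A1_power[OF g] A(1)] mult_right_mono[OF n(2)]]) simp
      ultimately show ?thesis using C(2)[OF Q, of j] by linarith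
    qed
    then have "vnorm1 ((T ^^ n) Q) \<le> (\<Sum>j\<in>UNIV. C * vnorm Q + 1/4 * norm1 (Q j))" unfolding vnorm1_def by (rule sum_mono)
    also have "\<dots> = (CARD('n) * C) * vnorm Q + 1/4 * vnorm1 Q"
      by (simp add: sum.distrib vnorm1_def sum_distrib_left)
    also have "(CARD('n) * C) * vnorm Q \<le> (CARD('n) * C) * (e * vnorm1 Q + C' * vnorm2 Q)"
      using C(1) C'(2)[of Q] A by (intro mult_left_mono) auto
    also have "(CARD('n) * C) * (e * vnorm1 Q + C' * vnorm2 Q) = CARD('n) * C * e * vnorm1 Q + (CARD('n) * C * C') * vnorm2 Q"
      by (simp add: algebra_simps)
    also have "CARD('n) * C * e * vnorm1 Q \<le> 1/4 * vnorm1 Q" by (rule mult_right_mono[OF e(2)]) simp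
    finally show ?thesis by simp
  qed
  then show ?thesis using n(1) C(1) C'(1) by (intro exI[of _ n] conjI exI[of _ "CARD('n) * C * C'"]) auto
qed

text \<open>When the previous inequality is summed along the orbit, half of the sum reappears on the
  right and is absorbed. The first n terms are bounded one by one, and the L2 part is geometric with
  ratio r.\<close>

lemma sum_funpow_T_bound:
  "\<exists>K\<ge>0. \<forall>Q\<in>solenoidal. \<forall>m. (\<Sum>i<m. vnorm1 ((T ^^ i) Q)) \<le> K * vnorm1 Q"
proof -
  obtain n C where n: "n > 0" and C: "C \<ge> 0"
    "\<And>Q. Q \<in> solenoidal \<Longrightarrow> vnorm1 ((T ^^ n) Q) \<le> vnorm1 Q / 2 + C * vnorm2 Q"
    using funpow_T_lasota_yorke by blast
  let ?L = "CARD('n) * norm1 g"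
  let ?K = "2 * ((\<Sum>i<n. ?L ^ i) + C / (1 - r))"
  have "(\<Sum>i<m. vnorm1 ((T ^^ i) Q)) \<le> ?K * vnorm1 Q" if Q: "Q \<in> solenoidal" for Q m
  proof -
    let ?x = "\<lambda>i. vnorm1 ((T ^^ i) Q)"
    have sol: "(T ^^ i) Q \<in> solenoidal" for i by (rule funpow_T_solenoidal[OF Q])
    have x: "?x i \<le> ?L ^ i * vnorm1 Q" for i
    proof (induction i)
      case (Suc i)
      have "?x (Suc i) \<le> ?L * ?x i" using vnorm1_T_le[OF sol[of i]] by simp
      also have "\<dots> \<le> ?L * (?L ^ i * vnorm1 Q)" using Suc by (rule mult_left_mono) simp
      finally show ?case by (simp add: mult.assoc)
    qed simp
    have y: "vnorm2 ((T ^^ i) Q) \<le> r ^ i * vnorm1 Q" for i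
    proof -
      have "vnorm2 Q \<le> vnorm1 Q"
        using vnorm2_le_vnorm vnorm_le_vnorm1 Q unfolding solenoidal_def by (metis (no_types, lifting) mem_Collect_eq order_trans)
      then show ?thesis
        using vnorm2_funpow_T_le[of i Q] mult_left_mono[of "vnorm2 Q" "vnorm1 Q" "r ^ i"] r_nonneg by auto
    qed
    have step: "?x (i + n) \<le> ?x i / 2 + C * (r ^ i * vnorm1 Q)" for i
      using C(2)[OF sol[of i]] mult_left_mono[OF y[of i] C(1)]
      by (simp add: funpow_add[symmetric] add.commute flip: comp_apply[of "T ^^ n" "T ^^ i"])
    have geo: "(\<Sum>i<m. r ^ i) \<le> 1 / (1 - r)"
      using sum_gp_strict[of r m] r(2) r_nonneg by (simp add: divide_right_mono)
    have "(\<Sum>i<m. ?x i) \<le> (\<Sum>i<m + n. ?x i)" by (rule sum_mono2) auto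
    also have "\<dots> = (\<Sum>i<n. ?x i) + (\<Sum>i<m. ?x (i + n))"
      using sum.atLeastLessThan_concat[of 0 n "m + n" ?x] sum.shift_bounds_nat_ivl[of ?x 0 n m]
      by (simp add: lessThan_atLeast0)
    also have "(\<Sum>i<n. ?x i) \<le> (\<Sum>i<n. ?L ^ i * vnorm1 Q)" by (rule sum_mono[OF x])
    also have "(\<Sum>i<m. ?x (i + n)) \<le> (\<Sum>i<m. ?x i / 2 + C * (r ^ i * vnorm1 Q))" by (rule sum_mono[OF step])
    also have "\<dots> = (\<Sum>i<m. ?x i) / 2 + (C * vnorm1 Q) * (\<Sum>i<m. r ^ i)"
      by (simp add: sum.distrib sum_divide_distrib sum_distrib_left mult_ac)
    also have "(C * vnorm1 Q) * (\<Sum>i<m. r ^ i) \<le> (C * vnorm1 Q) * (1 / (1 - r))"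
      using C(1) by (intro mult_left_mono geo) simp
    finally have "(\<Sum>i<m. ?x i) / 2 \<le> (\<Sum>i<n. ?L ^ i * vnorm1 Q) + (C * vnorm1 Q) * (1 / (1 - r))" by linarith
    also have "\<dots> = ((\<Sum>i<n. ?L ^ i) + C / (1 - r)) * vnorm1 Q"
      by (simp add: sum_distrib_right distrib_right)
    finally show ?thesis unfolding mult.assoc by linarith
  qed
  moreover have "?K \<ge> 0" using C(1) r(2) by (intro mult_nonneg_nonneg add_nonneg_nonneg sum_nonneg) auto
  ultimately show ?thesis by blast
qed

text \<open>The Neumann series, summed in each component; it converges absolutely in
  \<open>norm1\<close> by \<open>sum_funpow_T_bound\<close>, although \<open>norm1 g\<close> may
  exceed 1.\<close>

lemma resolvent:
  "\<exists>K\<ge>0. \<forall>h\<in>solenoidal. \<exists>Q\<in>solenoidal. (\<forall>j. Q j = h j + T Q j) \<and> vnorm1 Q \<le> K * vnorm1 h"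
proof -
  obtain K where K: "K \<ge> 0" "\<And>Q m. Q \<in> solenoidal \<Longrightarrow> (\<Sum>i<m. vnorm1 ((T ^^ i) Q)) \<le> K * vnorm1 Q"
    using sum_funpow_T_bound by blast
  have "\<exists>Q\<in>solenoidal. (\<forall>j. Q j = h j + T Q j) \<and> vnorm1 Q \<le> (CARD('n) * K) * vnorm1 h" if h: "h \<in> solenoidal" for h
  proof -
    let ?f = "\<lambda>j i. (T ^^ i) h j"
    have A: "?f j i \<in> A1" for i j using funpow_T_solenoidal[OF h, of i] by (simp add: solenoidal_def)
    have part: "(\<Sum>i<m. norm1 (?f j i)) \<le> K * vnorm1 h" for j m
      by (rule order_trans[OF sum_mono K(2)[OF h]]) (rule norm_le_vnorm(2))
    have s: "summable (\<lambda>i. norm1 (?f j i))" for j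
      by (rule summableI_nonneg_bounded[OF _ part]) simp
    note sum = A1_suminf[OF A s]
    have sf: "summable (?f j)" for j by (rule summable_norm_cancel[OF sum(1)])
    define Q where "Q = (\<lambda>j. \<Sum>i. ?f j i)"
    have lin: "bounded_linear (\<lambda>f. leray_entry j l (g * f))" for j l
      by (rule bounded_linear_compose[OF bounded_linear_leray_entry bounded_linear_mult_right])
    have T_eq: "T X j = (\<Sum>l\<in>UNIV. leray_entry j l (g * X l))" for X j
      by (simp add: T_def leray_def)
    have TQ: "T Q j = (\<Sum>i. T (\<lambda>l. ?f l i) j)" for j
      by (simp only: T_eq Q_def bounded_linear.suminf[OF lin sf])
         (rule suminf_sum[symmetric], rule bounded_linear.summable[OF lin sf])
    have Q: "Q j = h j + T Q j" for j
    proof -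
      have "T Q j = (\<Sum>i. ?f j (Suc i))" by (simp add: TQ)
      moreover have "(\<Sum>i. ?f j (Suc i)) = Q j - h j"
        using suminf_split_head[OF sf[of j]] by (simp add: Q_def)
      ultimately show ?thesis by simp
    qed
    have leray: "leray Q = Q"
    proof
      fix j
      have "leray Q j = (\<Sum>i. leray (\<lambda>l. ?f l i) j)"
        unfolding leray_def Q_def bounded_linear.suminf[OF bounded_linear_leray_entry sf]
        by (rule suminf_sum[symmetric]) (rule bounded_linear.summable[OF bounded_linear_leray_entry sf])
      also have "\<dots> = Q j"
        using funpow_T_solenoidal[OF h] by (simp add: solenoidal_def Q_def)
      finally show "leray Q j = Q j" .
    qed
    have "norm1 (Q j) \<le> K * vnorm1 h" for j
      unfolding Q_def by (rule order_trans[OF sum(3) suminf_le_const[OF s part]])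
    then have "vnorm1 Q \<le> (\<Sum>j\<in>(UNIV :: 'n set). K * vnorm1 h)" unfolding vnorm1_def[of Q] by (rule sum_mono)
    then have "vnorm1 Q \<le> (CARD('n) * K) * vnorm1 h" by (simp add: mult.assoc)
    moreover have "Q \<in> solenoidal" using sum(2) leray by (simp add: solenoidal_def Q_def)
    ultimately show ?thesis using Q by blast
  qed
  then show ?thesis using K(1) by (intro exI[of _ "CARD('n) * K"]) auto
qed

text \<open>Solution of a system that prescribes the divergence of \<open>Q\<close> and the curl of \<open>(1 - g) Q\<close>.\<close>

lemma div_curl_system:
  "\<exists>K\<ge>0. \<forall>f \<tau>. (\<forall>j. \<tau> j \<in> A1) \<longrightarrow> leray \<tau> = \<tau> \<longrightarrow>
     (\<exists>Q. (\<forall>j. Q j \<in> A1) \<and> (\<forall>k. k \<noteq> 0 \<longrightarrow> coef (\<Sum>j\<in>UNIV. der j (Q j)) k = coef f k)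
        \<and> leray (\<lambda>j. (1 - g) * Q j) = \<tau> \<and> vnorm1 Q \<le> K * (norm f + vnorm1 \<tau>))"
proof -
  obtain K where K: "K \<ge> 0"
    "\<And>h. h \<in> solenoidal \<Longrightarrow> \<exists>Q\<in>solenoidal. (\<forall>j. Q j = h j + T Q j) \<and> vnorm1 Q \<le> K * vnorm1 h"
    using resolvent by blast
  let ?d = "real CARD('n) * (real CARD('n) + 1)"
  let ?K = "?d + K * (CARD('n) * (norm1 g * ?d)) + K"
  have "\<exists>Q. (\<forall>j. Q j \<in> A1) \<and> (\<forall>k. k \<noteq> 0 \<longrightarrow> coef (\<Sum>j\<in>UNIV. der j (Q j)) k = coef f k)
        \<and> leray (\<lambda>j. (1 - g) * Q j) = \<tau> \<and> vnorm1 Q \<le> ?K * (norm f + vnorm1 \<tau>)"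
    if \<tau>: "\<And>j. \<tau> j \<in> A1" "leray \<tau> = \<tau>" for f \<tau>
  proof -
    let ?S = "\<lambda>j. sol j f"
    have SA: "?S j \<in> A1" for j by (rule A1_sol)
    \<comment> \<open>Ansatz Q = S + P, where the gradient field S carries the divergence and P is
      solenoidal. As the projection kills S, the condition on (1 - g) Q becomes P = T S + \<tau> + T
      P.\<close>
    define h where "h = (\<lambda>j. T ?S j + \<tau> j)"
    have TA: "T ?S j \<in> A1" for j unfolding T_def by (intro A1_leray A1_mult g SA)
    have hsol: "h \<in> solenoidal"
    proof -
      have "leray h j = h j" for j
        unfolding h_def leray_add using \<tau>(2) by (simp add: T_def leray_leray fun_eq_iff)
      then show ?thesis using \<tau>(1) TA by (auto simp: solenoidal_def h_def A1_add)
    qed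
    obtain P where P: "P \<in> solenoidal" "\<And>j. P j = h j + T P j" "vnorm1 P \<le> K * vnorm1 h"
      using K(2)[OF hsol] by blast
    have PA: "P j \<in> A1" "leray P = P" for j using P(1) by (simp_all add: solenoidal_def)
    define Q where "Q = (\<lambda>j. ?S j + P j)"
    have QA: "Q j \<in> A1" for j by (simp add: Q_def A1_add SA PA)
    have div: "coef (\<Sum>j\<in>UNIV. der j (Q j)) k = coef f k" if "k \<noteq> 0" for k
      using that div_leray[OF PA(1) PA(2)] coef_div_sol[of f k]
      by (simp add: Q_def der_add SA PA sum.distrib)
    have "leray (\<lambda>j. (1 - g) * Q j) j = \<tau> j" for j
    proof -
      have "leray (\<lambda>j. (1 - g) * Q j) j = leray Q j - T Q j"
        unfolding T_def leray_diff[symmetric] by (simp add: left_diff_distrib)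
      also have "leray Q j = P j" unfolding Q_def leray_add leray_sol PA(2) by simp
      also have "T Q j = T ?S j + T P j" unfolding T_def Q_def leray_add[symmetric] by (simp add: distrib_left)
      finally show ?thesis using P(2)[of j] by (simp add: h_def)
    qed
    then have eq: "leray (\<lambda>j. (1 - g) * Q j) = \<tau>" by (rule ext)
    have S1: "vnorm1 ?S \<le> ?d * norm f"
    proof -
      have "vnorm1 ?S \<le> (\<Sum>j\<in>(UNIV :: 'n set). (CARD('n) + 1) * norm f)"
        unfolding vnorm1_def by (intro sum_mono A1_sol)
      then show ?thesis by (simp add: algebra_simps)
    qed
    have T1: "norm1 (T ?S j) \<le> norm1 g * vnorm1 ?S" for j
      unfolding T_def vnorm1_def sum_distrib_left
      by (rule order_trans[OF A1_leray(2) sum_mono[OF A1_mult(2)]]) (auto intro: A1_mult g SA)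
    have "vnorm1 h \<le> (\<Sum>j\<in>UNIV. norm1 g * (?d * norm f) + norm1 (\<tau> j))"
      unfolding vnorm1_def[of h]
    proof (rule sum_mono)
      show "norm1 (h j) \<le> norm1 g * (?d * norm f) + norm1 (\<tau> j)" for j
        unfolding h_def
        using A1_add(2)[OF TA \<tau>(1), of j j] T1[of j] mult_left_mono[OF S1, of "norm1 g"] by simp
    qed
    also have "\<dots> = (CARD('n) * (norm1 g * ?d)) * norm f + vnorm1 \<tau>"
      by (simp add: sum.distrib vnorm1_def)
    finally have h1: "vnorm1 h \<le> (CARD('n) * (norm1 g * ?d)) * norm f + vnorm1 \<tau>" .
    have "vnorm1 Q \<le> vnorm1 ?S + vnorm1 P"
      unfolding vnorm1_def Q_def sum.distrib[symmetric] by (intro sum_mono A1_add SA PA)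
    also have "\<dots> \<le> ?d * norm f + K * ((CARD('n) * (norm1 g * ?d)) * norm f + vnorm1 \<tau>)"
      using S1 order_trans[OF P(3) mult_left_mono[OF h1 K(1)]] by (rule add_mono)
    also have "\<dots> \<le> ?K * (norm f + vnorm1 \<tau>)"
      using K(1) mult_nonneg_nonneg[OF K(1), of "norm f"]
        mult_nonneg_nonneg[of "?d + K * (CARD('n) * (norm1 g * ?d))" "vnorm1 \<tau>"]
      by (simp add: algebra_simps)
    finally show ?thesis using QA div eq by (intro exI[of _ Q]) auto
  qed
  moreover have "?K \<ge> 0" using K(1) by simp
  ultimately show ?thesis by blast
qed

end

section \<open>Power series of the Lagrangian flow\<close>

text \<open>Besides the usual product bound, the index sets \<open>I n\<close> record the range of
  both factors. Leaving out m = 0 or m = n shortens one of the partial sums, and this is what lets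
  the induction in \<open>series_bounds\<close> close.\<close>

lemma cauchy_partial_sum_le:
  fixes a b :: "nat \<Rightarrow> real"
  assumes "R \<ge> 0" "\<And>n. a n \<ge> 0" "\<And>n. b n \<ge> 0"
    and I: "\<And>n m. n < N \<Longrightarrow> m \<in> I n \<Longrightarrow> m \<le> n \<and> m < M1 \<and> n - m < M2"
  shows "(\<Sum>n<N. R ^ n * (\<Sum>m\<in>I n. a m * b (n - m))) \<le> (\<Sum>n<M1. R ^ n * a n) * (\<Sum>n<M2. R ^ n * b n)"
proof -
  let ?f = "\<lambda>(m, k). (R ^ m * a m) * (R ^ k * b k)"
  have fin: "finite (I n)" if "n < N" for n
    using I[OF that] by (auto intro: finite_subset[of _ "{..n}"])
  have "(\<Sum>n<N. R ^ n * (\<Sum>m\<in>I n. a m * b (n - m))) = (\<Sum>n<N. \<Sum>m\<in>I n. ?f (m, n - m))"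
  proof (intro sum.cong refl)
    fix n assume n: "n \<in> {..<N}"
    have "R ^ n * (a m * b (n - m)) = ?f (m, n - m)" if "m \<in> I n" for m
    proof -
      have "R ^ n = R ^ m * R ^ (n - m)" using I[of n m] n that by (simp add: power_add[symmetric])
      then show ?thesis by (simp add: mult_ac)
    qed
    then show "R ^ n * (\<Sum>m\<in>I n. a m * b (n - m)) = (\<Sum>m\<in>I n. ?f (m, n - m))"
      unfolding sum_distrib_left by (intro sum.cong) auto
  qed
  also have "\<dots> = (\<Sum>(n, m)\<in>Sigma {..<N} I. ?f (m, n - m))"
    by (rule sum.Sigma) (use fin in auto)
  also have "\<dots> = sum ?f ((\<lambda>(n, m). (m, n - m)) ` Sigma {..<N} I)"
  proof (subst sum.reindex)
    show "inj_on (\<lambda>(n, m). (m, n - m)) (Sigma {..<N} I)"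
    proof (rule inj_onI, clarify)
      fix n m n' m' assume "n < N" "m \<in> I n" "n' < N" "m \<in> I n'" "n - m = n' - m"
      then show "n = n' \<and> m = m" using I[of n m] I[of n' m] by auto
    qed
  qed (simp add: comp_def case_prod_unfold)
  also have "\<dots> \<le> sum ?f ({..<M1} \<times> {..<M2})"
    by (rule sum_mono2) (use I assms(1-3) in \<open>auto intro!: mult_nonneg_nonneg\<close>)
  also have "\<dots> = (\<Sum>n<M1. R ^ n * a n) * (\<Sum>n<M2. R ^ n * b n)"
    by (simp add: sum_product sum.cartesian_product)
  finally show ?thesis .
qed

definition mnorm :: "('i::finite \<Rightarrow> 'j::finite \<Rightarrow> 'a::real_normed_vector) \<Rightarrow> real" where
  "mnorm A = (\<Sum>i\<in>UNIV. \<Sum>j\<in>UNIV. norm (A i j))"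

lemma mnorm_nonneg [simp]: "mnorm A \<ge> 0"
  by (simp add: mnorm_def sum_nonneg)

lemma norm_le_mnorm: "norm (A i j) \<le> mnorm A"
proof -
  have "norm (A i j) \<le> (\<Sum>j\<in>UNIV. norm (A i j))" by (rule member_le_sum) auto
  also have "\<dots> \<le> mnorm A" unfolding mnorm_def
    by (rule member_le_sum[of i UNIV "\<lambda>i. \<Sum>j\<in>UNIV. norm (A i j)"]) (auto intro: sum_nonneg)
  finally show ?thesis .
qed

lemma mnorm_sum: "mnorm (\<lambda>i j. \<Sum>m\<in>I. A m i j) \<le> (\<Sum>m\<in>I. mnorm (A m))"
proof -
  have "mnorm (\<lambda>i j. \<Sum>m\<in>I. A m i j) \<le> (\<Sum>i\<in>UNIV. \<Sum>j\<in>UNIV. \<Sum>m\<in>I. norm (A m i j))"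
    unfolding mnorm_def by (intro sum_mono norm_sum)
  also have "\<dots> = (\<Sum>m\<in>I. mnorm (A m))"
    unfolding mnorm_def by (simp add: sum.swap[of _ I])
  finally show ?thesis .
qed

lemma mnorm_uminus [simp]: "mnorm (\<lambda>i j. - A i j) = mnorm A"
  by (simp add: mnorm_def)

lemma mnorm_mult:
  fixes A :: "'i::finite \<Rightarrow> 'l::finite \<Rightarrow> 'a::real_normed_algebra" and B :: "'l \<Rightarrow> 'j::finite \<Rightarrow> 'a"
  shows "mnorm (\<lambda>i j. \<Sum>l\<in>UNIV. A i l * B l j) \<le> mnorm A * mnorm B"
proof -
  let ?a = "\<lambda>l. \<Sum>i\<in>UNIV. norm (A i l)" and ?b = "\<lambda>l. \<Sum>j\<in>UNIV. norm (B l j)"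
  have a: "?a l \<ge> 0" and b: "?b l \<ge> 0" for l by (simp_all add: sum_nonneg)
  have "mnorm (\<lambda>i j. \<Sum>l\<in>UNIV. A i l * B l j) \<le> (\<Sum>i\<in>UNIV. \<Sum>j\<in>UNIV. \<Sum>l\<in>UNIV. norm (A i l) * norm (B l j))"
    unfolding mnorm_def by (intro sum_mono order_trans[OF norm_sum] norm_mult_ineq)
  also have "\<dots> = (\<Sum>i\<in>UNIV. \<Sum>l\<in>UNIV. \<Sum>j\<in>UNIV. norm (A i l) * norm (B l j))"
    by (intro sum.cong refl sum.swap)
  also have "\<dots> = (\<Sum>l\<in>UNIV. ?a l * ?b l)"
    by (subst sum.swap) (simp add: sum_product)
  also have "\<dots> \<le> (\<Sum>l\<in>UNIV. ?a l * (\<Sum>l\<in>UNIV. ?b l))"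
    by (intro sum_mono mult_left_mono member_le_sum a) (auto intro: b)
  also have "\<dots> = (\<Sum>l\<in>UNIV. ?a l) * mnorm B" by (simp add: sum_distrib_right mnorm_def)
  also have "(\<Sum>l\<in>UNIV. ?a l) = mnorm A" unfolding mnorm_def by (rule sum.swap)
  finally show ?thesis .
qed

lemma norm_trace_mult_le:
  fixes A :: "'i::finite \<Rightarrow> 'j::finite \<Rightarrow> 'a::real_normed_algebra"
  shows "norm (\<Sum>i\<in>UNIV. \<Sum>j\<in>UNIV. A i j * B j i) \<le> mnorm A * mnorm B"
proof -
  have "norm (\<Sum>i\<in>UNIV. \<Sum>j\<in>UNIV. A i j * B j i) \<le> (\<Sum>i\<in>UNIV. \<Sum>j\<in>UNIV. norm (A i j) * mnorm B)"
    by (intro order_trans[OF norm_sum] sum_mono order_trans[OF norm_mult_ineq] mult_left_mono norm_le_mnorm) auto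
  then show ?thesis by (simp add: mnorm_def[of A] sum_distrib_right)
qed

lemma mnorm_der_le:
  fixes X :: "'n::finite \<Rightarrow> 'n wiener"
  assumes "\<And>i. X i \<in> A1"
  shows "mnorm (\<lambda>i j. der j (X i)) \<le> 2 * pi * CARD('n) * vnorm1 X"
proof -
  have "mnorm (\<lambda>i j. der j (X i)) \<le> (\<Sum>i\<in>UNIV. \<Sum>j\<in>(UNIV :: 'n set). 2 * pi * norm1 (X i))"
    unfolding mnorm_def by (intro sum_mono norm_der_le assms)
  then show ?thesis by (simp add: vnorm1_def sum_distrib_left mult_ac)
qed

text \<open>The power series of the inverse of \<open>1 + \<Sum>\<^sub>n t\<^sup>n G\<^sub>n\<close>, for a matrix series with \<open>G\<^sub>0 = 0\<close>.\<close>

fun inv_series :: "(nat \<Rightarrow> 'i \<Rightarrow> 'i \<Rightarrow> 'a::ring_1) \<Rightarrow> nat \<Rightarrow> 'i::finite \<Rightarrow> 'i \<Rightarrow> 'a" where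
  "inv_series G n = (if n = 0 then (\<lambda>i j. if i = j then 1 else 0)
     else (\<lambda>i j. - (\<Sum>m<n. \<Sum>l\<in>UNIV. inv_series G m i l * G (n - m) l j)))"

declare inv_series.simps [simp del]

lemma inv_series_0: "inv_series G 0 i j = (if i = j then 1 else 0)"
  by (simp add: inv_series.simps)

lemma inv_series_pos: "n > 0 \<Longrightarrow> inv_series G n i j = - (\<Sum>m<n. \<Sum>l\<in>UNIV. inv_series G m i l * G (n - m) l j)"
  by (subst inv_series.simps) simp

lemma inv_series_cong: "(\<And>m. m \<le> n \<Longrightarrow> G m = G' m) \<Longrightarrow> inv_series G n = inv_series G' n"
proof (induction n rule: less_induct)
  case (less n)
  then have "inv_series G m = inv_series G' m" if "m < n" for m using that by auto
  with less.prems show ?case by (subst (1 2) inv_series.simps) auto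
qed

section \<open>Taylor coefficients of the Lagrangian flow\<close>

locale lagrangian_series = leray_contraction g r for g :: "'n::finite wiener" and r :: real +
  fixes U :: "'n \<Rightarrow> 'n wiener"
  assumes U: "\<And>j. U j \<in> A1"
begin

context
  fixes Q :: "nat \<Rightarrow> 'n \<Rightarrow> 'n wiener"
begin

text \<open>\<open>Q n\<close> stands for the n-th Taylor coefficient of the acceleration. Velocity
  and displacement arise from it by one and two integrations in time, with initial values
  \<open>U\<close> and 0.\<close>

definition vel :: "nat \<Rightarrow> 'n \<Rightarrow> 'n wiener" where
  "vel n j = (if n = 0 then U j else (1 / real n) *\<^sub>R Q (n - 1) j)"

definition disp :: "nat \<Rightarrow> 'n \<Rightarrow> 'n wiener" where
  "disp n j = (if n = 0 then 0 else (1 / real n) *\<^sub>R vel (n - 1) j)"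

definition disp_grad :: "nat \<Rightarrow> 'n \<Rightarrow> 'n \<Rightarrow> 'n wiener" where
  "disp_grad n i j = der j (disp n i)"

definition vel_grad :: "nat \<Rightarrow> 'n \<Rightarrow> 'n \<Rightarrow> 'n wiener" where
  "vel_grad n i j = der j (vel n i)"

definition inv_jac :: "nat \<Rightarrow> 'n \<Rightarrow> 'n \<Rightarrow> 'n wiener" where
  "inv_jac = inv_series disp_grad"

text \<open>Coefficients of B H, with B the inverse Jacobian and H the gradient of the Lagrangian
  velocity. This matrix is conjugate to the Eulerian velocity gradient H B, so the traces of powers
  agree.\<close>

definition euler_grad :: "nat \<Rightarrow> 'n \<Rightarrow> 'n \<Rightarrow> 'n wiener" where
  "euler_grad n i j = (\<Sum>m\<le>n. \<Sum>l\<in>UNIV. inv_jac m i l * vel_grad (n - m) l j)"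

text \<open>Since the time derivative of B is -B H B, differentiating tr(B H) = 0 gives tr(B DQ) =
  tr((B H)^2). At order n the term with \<open>inv_jac 0\<close>, the identity, is the divergence of
  \<open>Q n\<close>; all the others stand here.\<close>

definition div_rhs :: "nat \<Rightarrow> 'n wiener" where
  "div_rhs n = (\<Sum>m\<le>n. \<Sum>i\<in>UNIV. \<Sum>j\<in>UNIV. euler_grad m i j * euler_grad (n - m) j i)
     - (\<Sum>m\<in>{1..n}. \<Sum>i\<in>UNIV. \<Sum>j\<in>UNIV. inv_jac m i j * der i (Q (n - m) j))"

text \<open>The Euler equation says that the projection of (I + D\<xi>)^T (1 - g) Q vanishes. At
  order n the identity contributes the projection of (1 - g) \<open>Q n\<close>; the terms with a
  displacement coefficient, which start at m = 1, stand here.\<close>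

definition curl_rhs :: "nat \<Rightarrow> 'n \<Rightarrow> 'n wiener" where
  "curl_rhs n j = - (\<Sum>m\<in>{1..n}. \<Sum>i\<in>UNIV. leray (\<lambda>l. der l (disp m i) * ((1 - g) * Q (n - m) i)) j)"

end

text \<open>The right-hand sides at order n involve \<open>Q m\<close> for m < n only, as the
  recursive choice in \<open>ex_series\<close> requires; the congruences up to
  \<open>curl_rhs_cong\<close> establish this.\<close>

lemma vel_cong: "(\<And>m. m < n \<Longrightarrow> Q m = Q' m) \<Longrightarrow> k \<le> n \<Longrightarrow> vel Q k = vel Q' k"
  by (auto simp: vel_def fun_eq_iff)

lemma disp_cong: "(\<And>m. m < n \<Longrightarrow> Q m = Q' m) \<Longrightarrow> k \<le> n \<Longrightarrow> disp Q k = disp Q' k"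
  using vel_cong[of n Q Q' "k - 1"] by (auto simp: disp_def fun_eq_iff)

lemma inv_jac_cong: "(\<And>m. m < n \<Longrightarrow> Q m = Q' m) \<Longrightarrow> k \<le> n \<Longrightarrow> inv_jac Q k = inv_jac Q' k"
  unfolding inv_jac_def
  by (rule inv_series_cong) (use disp_cong[of n Q Q'] in \<open>simp add: disp_grad_def[abs_def]\<close>)

lemma euler_grad_cong:
  assumes "\<And>m. m < n \<Longrightarrow> Q m = Q' m" "k \<le> n"
  shows "euler_grad Q k = euler_grad Q' k"
proof -
  have "inv_jac Q m i l * vel_grad Q (k - m) l j = inv_jac Q' m i l * vel_grad Q' (k - m) l j" if "m \<le> k" for m i l j
    using inv_jac_cong[of n Q Q' m] vel_cong[of n Q Q' "k - m"] assms that by (simp add: vel_grad_def)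
  then show ?thesis by (auto simp: euler_grad_def fun_eq_iff intro!: sum.cong)
qed

lemma div_rhs_cong:
  assumes "\<And>m. m < n \<Longrightarrow> Q m = Q' m"
  shows "div_rhs Q n = div_rhs Q' n"
proof -
  have "euler_grad Q m i j * euler_grad Q (n - m) j i = euler_grad Q' m i j * euler_grad Q' (n - m) j i" if "m \<le> n" for m i j
    using euler_grad_cong[of n Q Q'] assms that by simp
  moreover have "inv_jac Q m i j * der i (Q (n - m) j) = inv_jac Q' m i j * der i (Q' (n - m) j)" if "m \<in> {1..n}" for m i j
    using inv_jac_cong[of n Q Q' m] assms that by simp
  ultimately show ?thesis unfolding div_rhs_def by (intro arg_cong2[where f = "(-)"] sum.cong refl) auto
qed

lemma curl_rhs_cong:
  assumes "\<And>m. m < n \<Longrightarrow> Q m = Q' m"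
  shows "curl_rhs Q n = curl_rhs Q' n"
proof -
  have "disp Q m i = disp Q' m i" "Q (n - m) i = Q' (n - m) i" if "m \<in> {1..n}" for m i
    using disp_cong[of n Q Q' m] assms that by auto
  then show ?thesis by (auto simp: curl_rhs_def fun_eq_iff intro!: sum.cong)
qed

definition step :: "real \<Rightarrow> (nat \<Rightarrow> 'n \<Rightarrow> 'n wiener) \<Rightarrow> nat \<Rightarrow> ('n \<Rightarrow> 'n wiener) \<Rightarrow> bool" where
  "step K Q n q \<longleftrightarrow> (\<forall>j. q j \<in> A1)
     \<and> (\<forall>k. k \<noteq> 0 \<longrightarrow> coef (\<Sum>j\<in>UNIV. der j (q j)) k = coef (div_rhs Q n) k)
     \<and> leray (\<lambda>j. (1 - g) * q j) = curl_rhs Q n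
     \<and> vnorm1 q \<le> K * (norm (div_rhs Q n) + vnorm1 (curl_rhs Q n))"

lemma A1_vel: "(\<And>m j. m < n \<Longrightarrow> Q m j \<in> A1) \<Longrightarrow> vel Q n j \<in> A1"
  by (auto simp: vel_def U A1_scaleR)

lemma A1_disp: "(\<And>m j. m < n \<Longrightarrow> Q m j \<in> A1) \<Longrightarrow> disp Q n j \<in> A1"
  by (auto simp: disp_def intro!: A1_scaleR A1_vel)

text \<open>These are the two conditions that \<open>div_curl_system\<close> puts on its curl datum;
  membership in \<open>A1\<close> is where \<open>A1_leray_gradient_mult\<close> enters.\<close>

lemma curl_rhs_props:
  assumes "\<And>m j. m < n \<Longrightarrow> Q m j \<in> A1"
  shows "curl_rhs Q n j \<in> A1" "leray (curl_rhs Q n) = curl_rhs Q n"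
proof -
  have A: "leray (\<lambda>l. der l (disp Q m i) * ((1 - g) * Q (n - m) i)) j \<in> A1" if "m \<in> {1..n}" for m i j
    using that assms by (intro A1_leray_gradient_mult A1_disp A1_mult A1_diff A1_one g) auto
  then show "curl_rhs Q n j \<in> A1" unfolding curl_rhs_def by (intro A1_uminus A1_sum)
  have lsum: "leray (\<lambda>l. \<Sum>i\<in>I. P i l) = (\<lambda>j. \<Sum>i\<in>I. leray (P i) j)" for I and P :: "'b \<Rightarrow> 'n \<Rightarrow> 'n wiener"
    by (rule ext, rule wiener_eqI) (simp add: coef_leray coef_sum sum_distrib_left sum.swap[of _ I])
  show "leray (curl_rhs Q n) = curl_rhs Q n"
    unfolding curl_rhs_def by (rule ext) (simp add: leray_uminus lsum leray_leray)
qed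

text \<open>The div-curl system supplies some solution at each order, with a constant
  \<open>K\<close> common to all orders, so the coefficients are picked by dependent choice along
  the naturals.\<close>

lemma ex_series: "\<exists>K\<ge>0. \<exists>Q. \<forall>n. step K Q n (Q n)"
proof -
  obtain K where K: "K \<ge> 0" "\<And>f \<tau>. (\<forall>j. \<tau> j \<in> A1) \<Longrightarrow> leray \<tau> = \<tau> \<Longrightarrow>
     (\<exists>Q. (\<forall>j. Q j \<in> A1) \<and> (\<forall>k. k \<noteq> 0 \<longrightarrow> coef (\<Sum>j\<in>UNIV. der j (Q j)) k = coef f k)
        \<and> leray (\<lambda>j. (1 - g) * Q j) = \<tau> \<and> vnorm1 Q \<le> K * (norm f + vnorm1 \<tau>))"
    using div_curl_system by blast
  have "\<exists>Q. \<forall>n. step K Q n (Q n)"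
  proof (rule dependent_wf_choice[OF wf_less])
    fix Q Q' :: "nat \<Rightarrow> 'n \<Rightarrow> 'n wiener" and n q
    assume "\<And>z. (z, n) \<in> {(x, y). x < y} \<Longrightarrow> Q z = Q' z"
    then have "\<And>m. m < n \<Longrightarrow> Q m = Q' m" by simp
    then show "step K Q n q = step K Q' n q"
      using div_rhs_cong[of n Q Q'] curl_rhs_cong[of n Q Q'] by (simp add: step_def)
  next
    fix n and Q :: "nat \<Rightarrow> 'n \<Rightarrow> 'n wiener"
    assume "\<And>y. (y, n) \<in> {(x, y). x < y} \<Longrightarrow> step K Q y (Q y)"
    then have "\<And>m j. m < n \<Longrightarrow> Q m j \<in> A1" by (simp add: step_def)
    then show "\<exists>q. step K Q n q" unfolding step_def by (intro K(2) allI curl_rhs_props)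
  qed
  with K(1) show ?thesis by blast
qed

lemma norm_div_rhs_le:
  assumes "\<And>m j. Q m j \<in> A1"
  shows "norm (div_rhs Q n) \<le> (\<Sum>m\<le>n. mnorm (euler_grad Q m) * mnorm (euler_grad Q (n - m)))
     + (\<Sum>m\<in>{1..n}. mnorm (inv_jac Q m) * (2 * pi * CARD('n) * vnorm1 (Q (n - m))))"
proof -
  have "norm (\<Sum>m\<in>{1..n}. \<Sum>i\<in>UNIV. \<Sum>j\<in>UNIV. inv_jac Q m i j * der i (Q (n - m) j))
      \<le> (\<Sum>m\<in>{1..n}. mnorm (inv_jac Q m) * (2 * pi * CARD('n) * vnorm1 (Q (n - m))))"
    by (rule order_trans[OF norm_sum sum_mono],
        rule order_trans[OF norm_trace_mult_le mult_left_mono[OF mnorm_der_le[OF assms]]]) simp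
  moreover have "norm (\<Sum>m\<le>n. \<Sum>i\<in>UNIV. \<Sum>j\<in>UNIV. euler_grad Q m i j * euler_grad Q (n - m) j i)
      \<le> (\<Sum>m\<le>n. mnorm (euler_grad Q m) * mnorm (euler_grad Q (n - m)))"
    by (rule order_trans[OF norm_sum sum_mono[OF norm_trace_mult_le]])
  ultimately show ?thesis
    unfolding div_rhs_def by (intro order_trans[OF norm_triangle_ineq4] add_mono)
qed

lemma vnorm1_curl_rhs_le:
  assumes "\<And>m j. Q m j \<in> A1"
  shows "vnorm1 (curl_rhs Q n) \<le> (\<Sum>m\<in>{1..n}. vnorm1 (disp Q m) * (4 * pi * CARD('n) * norm1 (1 - g) * vnorm1 (Q (n - m))))"
proof -
  let ?c = "4 * pi * norm1 (1 - g)"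
  have D: "disp Q m i \<in> A1" for m i by (rule A1_disp[OF assms])
  have g': "1 - g \<in> A1" by (intro A1_diff A1_one g)
  have le: "norm1 (leray (\<lambda>l. der l (disp Q m i) * ((1 - g) * Q (n - m) i)) j)
      \<le> norm1 (disp Q m i) * (?c * vnorm1 (Q (n - m)))" for m i j
  proof -
    have "norm1 (leray (\<lambda>l. der l (disp Q m i) * ((1 - g) * Q (n - m) i)) j)
        \<le> 4 * pi * (norm1 (disp Q m i) * norm1 ((1 - g) * Q (n - m) i))"
      by (intro A1_leray_gradient_mult D A1_mult g' assms)
    also have "\<dots> \<le> 4 * pi * (norm1 (disp Q m i) * (norm1 (1 - g) * vnorm1 (Q (n - m))))"
      by (intro mult_left_mono order_trans[OF A1_mult(2)[OF g' assms]] norm_le_vnorm) auto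
    finally show ?thesis by (simp add: mult_ac)
  qed
  have "norm1 (curl_rhs Q n j) \<le> (\<Sum>m\<in>{1..n}. vnorm1 (disp Q m) * (?c * vnorm1 (Q (n - m))))" for j
  proof -
    have A: "leray (\<lambda>l. der l (disp Q m i) * ((1 - g) * Q (n - m) i)) j \<in> A1" for m i
      by (intro A1_leray_gradient_mult D A1_mult g' assms)
    have "norm1 (curl_rhs Q n j) \<le> (\<Sum>m\<in>{1..n}. \<Sum>i\<in>UNIV. norm1 (disp Q m i) * (?c * vnorm1 (Q (n - m))))"
      unfolding curl_rhs_def A1_uminus(2)
      by (intro order_trans[OF A1_sum(2)] sum_mono le A1_sum A)
    then show ?thesis by (simp add: vnorm1_def[of "disp Q _"] sum_distrib_right)
  qed
  then have "vnorm1 (curl_rhs Q n) \<le> (\<Sum>j\<in>(UNIV :: 'n set). \<Sum>m\<in>{1..n}. vnorm1 (disp Q m) * (?c * vnorm1 (Q (n - m))))"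
    unfolding vnorm1_def[of "curl_rhs Q n"] by (rule sum_mono)
  also have "\<dots> = (\<Sum>m\<in>{1..n}. vnorm1 (disp Q m) * (4 * pi * CARD('n) * norm1 (1 - g) * vnorm1 (Q (n - m))))"
    by (simp add: sum_distrib_left mult_ac)
  finally show ?thesis .
qed

lemma mnorm_inv_jac_0: "mnorm (inv_jac Q 0) = CARD('n)"
proof -
  have "norm (inv_jac Q 0 i j) = (if i = j then 1 else 0)" for i j by (simp add: inv_jac_def inv_series_0)
  then show ?thesis by (simp add: mnorm_def)
qed

lemma mnorm_inv_jac_le:
  assumes "n > 0"
  shows "mnorm (inv_jac Q n) \<le> (\<Sum>m<n. mnorm (inv_jac Q m) * mnorm (disp_grad Q (n - m)))"
proof -
  have "mnorm (inv_jac Q n) = mnorm (\<lambda>i j. \<Sum>m<n. \<Sum>l\<in>UNIV. inv_jac Q m i l * disp_grad Q (n - m) l j)"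
    unfolding inv_jac_def inv_series_pos[OF assms, abs_def] by (rule mnorm_uminus)
  also have "\<dots> \<le> (\<Sum>m<n. mnorm (inv_jac Q m) * mnorm (disp_grad Q (n - m)))"
    by (rule order_trans[OF mnorm_sum sum_mono[OF mnorm_mult]])
  finally show ?thesis .
qed

text \<open>The shift of index produced by an integration in time is worth one factor
  \<open>R\<close>.\<close>

lemma sum_lessThan_Suc_mult_power:
  "(\<Sum>n<Suc N. R ^ n * a n) = a 0 + R * (\<Sum>n<N. R ^ n * (a (Suc n) :: real))"
  by (simp add: sum.lessThan_Suc_shift sum_distrib_left mult_ac del: sum.lessThan_Suc)

text \<open>
  Every term of the recursion beyond the data contains a time integral, hence a factor \<open>R\<close>; so the
  partial sums stay below a bound that does not depend on their length once \<open>R\<close> is small.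
\<close>

lemma series_bounds:
  "\<exists>Q R. R > 0 \<and> (\<forall>n j. Q n j \<in> A1) \<and> (\<exists>K. \<forall>n. step K Q n (Q n))
     \<and> (\<exists>C. \<forall>N. (\<Sum>n<N. R ^ n * vnorm1 (Q n)) \<le> C)
     \<and> (\<forall>N. (\<Sum>n<N. R ^ n * mnorm (disp_grad Q n)) \<le> 1/4)
     \<and> (\<exists>C. \<forall>N. (\<Sum>n<N. R ^ n * mnorm (inv_jac Q n)) \<le> C)"
proof -
  obtain K Q where K: "K \<ge> 0" and Q: "\<And>n. step K Q n (Q n)" using ex_series by blast
  have A: "Q n j \<in> A1" for n j using Q[of n] by (simp add: step_def)
  let ?d = "real CARD('n)"
  have d: "?d \<ge> 1" by (simp add: Suc_le_eq)
  \<comment> \<open>Bounds for the majorant sums, with d the dimension: \<open>v\<close> for the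
    velocity, where the extra 1 absorbs R q; \<open>\<kappa>\<close> for B H, as 2d for the inverse
    Jacobian times 2 \<pi> d v for the velocity gradient; \<open>q\<close> for the acceleration. The
    two conditions in \<open>R\<close> give R q \<le> 1 and a displacement gradient of at most
    1/4.\<close>
  define v where "v = vnorm1 U + 1"
  define \<kappa> where "\<kappa> = (2 * ?d) * (2 * pi * ?d * v)"
  define q where "q = K * (\<kappa>\<^sup>2 + (2 * ?d) * (2 * pi * ?d * v) * (2 * pi * ?d) + v * (4 * pi * ?d * norm1 (1 - g)))"
  define R where "R = min (1 / (q + 1)) (1 / (8 * pi * ?d * v))"
  have v: "v \<ge> 1" by (simp add: v_def)
  have \<kappa>: "\<kappa> \<ge> 0" using v by (simp add: \<kappa>_def)
  have q: "q \<ge> 0" unfolding q_def using K v \<kappa> by (intro mult_nonneg_nonneg add_nonneg_nonneg) auto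
  have R: "R > 0" using q v d by (auto simp: R_def)
  have Rq: "R * q \<le> 1"
  proof -
    have "R * q \<le> 1 / (q + 1) * q" using q by (intro mult_right_mono) (auto simp: R_def)
    also have "\<dots> \<le> 1" using q by (simp add: divide_le_eq)
    finally show ?thesis .
  qed
  have Rv: "2 * pi * ?d * (R * v) \<le> 1/4"
  proof -
    have pos: "8 * pi * ?d * v > 0" using v d by auto
    have "R * (8 * pi * ?d * v) \<le> 1 / (8 * pi * ?d * v) * (8 * pi * ?d * v)"
      using pos by (intro mult_right_mono) (auto simp: R_def)
    also have "\<dots> = 1" using v d by auto
    finally show ?thesis by (simp add: mult_ac)
  qed
  let ?S = "\<lambda>a N. \<Sum>n<N. R ^ n * a n"
  have mono: "?S a M \<le> ?S a N" if "M \<le> N" "\<And>n. a n \<ge> 0" for a M N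
    by (rule sum_mono2) (use that R in auto)
  have nn: "?S a N \<ge> 0" if "\<And>n. a n \<ge> 0" for a N by (rule sum_nonneg) (use that R in auto)
  \<comment> \<open>\<open>?\<beta>'\<close> drops the identity from the inverse Jacobian. What is
    left is of order R, which compensates the factor q of the acceleration in the divergence
    equation.\<close>
  let ?q = "\<lambda>n. vnorm1 (Q n)" and ?v = "\<lambda>n. vnorm1 (vel Q n)" and ?x = "\<lambda>n. vnorm1 (disp Q n)"
    and ?\<gamma> = "\<lambda>n. mnorm (disp_grad Q n)" and ?\<eta> = "\<lambda>n. mnorm (vel_grad Q n)"
    and ?\<beta> = "\<lambda>n. mnorm (inv_jac Q n)" and ?\<beta>' = "\<lambda>n. if n = 0 then 0 else mnorm (inv_jac Q n)"
    and ?k = "\<lambda>n. mnorm (euler_grad Q n)"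
  have scale: "vnorm1 (\<lambda>j. (1 / real (Suc n)) *\<^sub>R P j) \<le> vnorm1 P" if "\<And>j. P j \<in> A1" for n and P :: "'n \<Rightarrow> 'n wiener"
    unfolding vnorm1_def
  proof (rule sum_mono)
    fix j
    have "1 / real (Suc n) * norm1 (P j) \<le> 1 * norm1 (P j)" by (rule mult_right_mono) auto
    then show "norm1 ((1 / real (Suc n)) *\<^sub>R P j) \<le> norm1 (P j)" using that by (simp add: A1_scaleR)
  qed
  have vs: "?v (Suc n) \<le> ?q n" for n
    using scale[of "Q n" n] A by (simp add: vel_def[abs_def])
  have xs: "?x (Suc n) \<le> ?v n" for n
    using scale[of "vel Q n" n] A1_vel[OF A] by (simp add: disp_def[abs_def])
  have x0: "?x 0 = 0" by (simp add: disp_def[abs_def] vnorm1_def)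
  \<comment> \<open>Bounds on the acceleration below order N control all other series through order
    N, and the recursion returns the bound on the acceleration through order N with the same
    constant.\<close>
  have main: "?S ?q N \<le> q \<longrightarrow> ?S ?\<gamma> (Suc N) \<le> 1/4 \<and> ?S ?\<beta> (Suc N) \<le> 2 * ?d \<and> ?S ?q (Suc N) \<le> q" for N
  proof
    assume IH: "?S ?q N \<le> q"
    have sv: "?S ?v (Suc N) \<le> v"
    proof -
      have "?S ?v (Suc N) = vnorm1 (vel Q 0) + R * (\<Sum>n<N. R ^ n * ?v (Suc n))" by (rule sum_lessThan_Suc_mult_power)
      also have "vnorm1 (vel Q 0) = vnorm1 U" by (simp add: vel_def[abs_def])
      also have "(\<Sum>n<N. R ^ n * ?v (Suc n)) \<le> q"
        by (rule order_trans[OF sum_mono[OF mult_left_mono[OF vs]] IH]) (use R in auto)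
      finally show ?thesis using Rq R by (simp add: v_def mult_left_mono)
    qed
    have sx: "?S ?x (Suc N) \<le> R * v"
    proof -
      have "?S ?x (Suc N) = R * (\<Sum>n<N. R ^ n * ?x (Suc n))" unfolding sum_lessThan_Suc_mult_power x0 by simp
      also have "(\<Sum>n<N. R ^ n * ?x (Suc n)) \<le> ?S ?v N"
        by (rule sum_mono[OF mult_left_mono[OF xs]]) (use R in auto)
      also have "\<dots> \<le> ?S ?v (Suc N)" by (rule mono) auto
      also note sv
      finally show ?thesis using R by (simp add: mult_left_mono)
    qed
    have sg: "?S ?\<gamma> (Suc N) \<le> 2 * pi * ?d * (R * v)"
    proof -
      have "?\<gamma> n \<le> 2 * pi * ?d * ?x n" for n
        unfolding disp_grad_def[abs_def] by (rule mnorm_der_le[OF A1_disp[OF A]])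
      then have "?S ?\<gamma> (Suc N) \<le> (\<Sum>n<Suc N. R ^ n * (2 * pi * ?d * ?x n))"
        using R by (intro sum_mono mult_left_mono) auto
      also have "\<dots> = 2 * pi * ?d * ?S ?x (Suc N)" unfolding sum_distrib_left by (intro sum.cong) (auto simp: mult_ac)
      also have "\<dots> \<le> 2 * pi * ?d * (R * v)" by (rule mult_left_mono[OF sx]) simp
      finally show ?thesis .
    qed
    have sg4: "?S ?\<gamma> (Suc N) \<le> 1/4" using sg Rv by linarith
    have sh: "?S ?\<eta> (Suc N) \<le> 2 * pi * ?d * v"
    proof -
      have "?\<eta> n \<le> 2 * pi * ?d * ?v n" for n
        unfolding vel_grad_def[abs_def] by (rule mnorm_der_le[OF A1_vel[OF A]])
      then have "?S ?\<eta> (Suc N) \<le> (\<Sum>n<Suc N. R ^ n * (2 * pi * ?d * ?v n))"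
        using R by (intro sum_mono mult_left_mono) auto
      also have "\<dots> = 2 * pi * ?d * ?S ?v (Suc N)" unfolding sum_distrib_left by (intro sum.cong) (auto simp: mult_ac)
      also have "\<dots> \<le> 2 * pi * ?d * v" by (rule mult_left_mono[OF sv]) simp
      finally show ?thesis .
    qed
    have b': "(\<Sum>n<M. R ^ n * ?\<beta>' n) \<le> ?S ?\<beta> (M - 1) * ?S ?\<gamma> M" for M
    proof -
      have "(\<Sum>n<M. R ^ n * ?\<beta>' n) \<le> (\<Sum>n<M. R ^ n * (\<Sum>m<n. ?\<beta> m * ?\<gamma> (n - m)))"
        using R mnorm_inv_jac_le by (intro sum_mono mult_left_mono) auto
      also have "\<dots> \<le> ?S ?\<beta> (M - 1) * ?S ?\<gamma> M"
        by (rule cauchy_partial_sum_le) (use R in auto)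
      finally show ?thesis .
    qed
    have bsplit: "?S ?\<beta> (Suc M) = ?d + (\<Sum>n<Suc M. R ^ n * ?\<beta>' n)" for M
      unfolding sum_lessThan_Suc_mult_power by (simp add: mnorm_inv_jac_0)
    \<comment> \<open>The recursion for the inverse gives d plus 1/4 of the previous bound 2d, again
      at most 2d.\<close>
    have sb: "?S ?\<beta> M \<le> 2 * ?d" if "M \<le> Suc N" for M
      using that
    proof (induction M)
      case (Suc M)
      have "?S ?\<gamma> (Suc M) \<le> 1/4" using mono[of "Suc M" "Suc N" ?\<gamma>] Suc.prems sg4 by simp
      then have "?S ?\<beta> M * ?S ?\<gamma> (Suc M) \<le> (2 * ?d) * (1/4)"
        using Suc by (intro mult_mono nn) auto
      then show ?case unfolding bsplit using b'[of "Suc M"] d by simp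
    qed simp
    have sb': "(\<Sum>n<Suc N. R ^ n * ?\<beta>' n) \<le> (2 * ?d) * (2 * pi * ?d * (R * v))"
      by (rule order_trans[OF b' mult_mono]) (use sb[of N] sg nn[of ?\<gamma> "Suc N"] in \<open>auto simp del: sum.lessThan_Suc\<close>)
    have sk: "?S ?k (Suc N) \<le> \<kappa>"
    proof -
      have "?S ?k (Suc N) \<le> (\<Sum>n<Suc N. R ^ n * (\<Sum>m\<in>{..n}. ?\<beta> m * ?\<eta> (n - m)))"
        unfolding euler_grad_def[abs_def] using R
        by (intro sum_mono mult_left_mono order_trans[OF mnorm_sum] mnorm_mult) auto
      also have "\<dots> \<le> ?S ?\<beta> (Suc N) * ?S ?\<eta> (Suc N)"
        by (rule cauchy_partial_sum_le) (use R in auto)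
      also have "\<dots> \<le> \<kappa>" unfolding \<kappa>_def by (intro mult_mono sb sh nn) auto
      finally show ?thesis .
    qed
    have sf: "(\<Sum>n<Suc N. R ^ n * norm (div_rhs Q n)) \<le> \<kappa>\<^sup>2 + (2 * ?d) * (2 * pi * ?d * v) * (2 * pi * ?d)"
    proof -
      have "(\<Sum>n<Suc N. R ^ n * norm (div_rhs Q n))
          \<le> (\<Sum>n<Suc N. R ^ n * ((\<Sum>m\<in>{..n}. ?k m * ?k (n - m)) + (\<Sum>m\<in>{1..n}. ?\<beta>' m * (2 * pi * ?d * ?q (n - m)))))"
        using R by (intro sum_mono mult_left_mono order_trans[OF norm_div_rhs_le[OF A]] add_mono) auto
      also have "\<dots> = (\<Sum>n<Suc N. R ^ n * (\<Sum>m\<in>{..n}. ?k m * ?k (n - m)))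
          + (\<Sum>n<Suc N. R ^ n * (\<Sum>m\<in>{1..n}. ?\<beta>' m * (2 * pi * ?d * ?q (n - m))))"
        by (simp only: distrib_left sum.distrib)
      also have "\<dots> \<le> ?S ?k (Suc N) * ?S ?k (Suc N) + (\<Sum>n<Suc N. R ^ n * ?\<beta>' n) * (\<Sum>n<N. R ^ n * (2 * pi * ?d * ?q n))"
        by (intro add_mono cauchy_partial_sum_le) (use R in auto)
      also have "(\<Sum>n<N. R ^ n * (2 * pi * ?d * ?q n)) = 2 * pi * ?d * ?S ?q N"
        unfolding sum_distrib_left by (intro sum.cong) (auto simp: mult_ac)
      also have "?S ?k (Suc N) * ?S ?k (Suc N) + (\<Sum>n<Suc N. R ^ n * ?\<beta>' n) * (2 * pi * ?d * ?S ?q N)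
          \<le> \<kappa> * \<kappa> + ((2 * ?d) * (2 * pi * ?d * (R * v))) * (2 * pi * ?d * q)"
        by (intro add_mono mult_mono sk sb' mult_left_mono IH nn \<kappa> mult_nonneg_nonneg) (use R v in auto)
      also have "((2 * ?d) * (2 * pi * ?d * (R * v))) * (2 * pi * ?d * q) = ((2 * ?d) * (2 * pi * ?d * v) * (2 * pi * ?d)) * (R * q)"
        by (simp add: mult_ac)
      also have "\<dots> \<le> ((2 * ?d) * (2 * pi * ?d * v) * (2 * pi * ?d)) * 1"
        using v by (intro mult_left_mono Rq) auto
      finally show ?thesis by (simp add: power2_eq_square)
    qed
    have st: "(\<Sum>n<Suc N. R ^ n * vnorm1 (curl_rhs Q n)) \<le> v * (4 * pi * ?d * norm1 (1 - g))"
    proof -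
      let ?c = "4 * pi * ?d * norm1 (1 - g)"
      have "(\<Sum>n<Suc N. R ^ n * vnorm1 (curl_rhs Q n)) \<le> (\<Sum>n<Suc N. R ^ n * (\<Sum>m\<in>{1..n}. ?x m * (?c * ?q (n - m))))"
        using R by (intro sum_mono mult_left_mono vnorm1_curl_rhs_le A) auto
      also have "\<dots> \<le> ?S ?x (Suc N) * (\<Sum>n<N. R ^ n * (?c * ?q n))"
        by (rule cauchy_partial_sum_le) (use R in auto)
      also have "(\<Sum>n<N. R ^ n * (?c * ?q n)) = ?c * ?S ?q N"
        unfolding sum_distrib_left by (intro sum.cong) (auto simp: mult_ac)
      also have "?S ?x (Suc N) * (?c * ?S ?q N) \<le> (R * v) * (?c * q)"
        by (intro mult_mono sx mult_left_mono IH mult_nonneg_nonneg nn) (use R v in auto)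
      also have "\<dots> = (v * ?c) * (R * q)" by (simp add: mult_ac)
      also have "\<dots> \<le> (v * ?c) * 1" using v by (intro mult_left_mono Rq) auto
      finally show ?thesis by simp
    qed
    have "?S ?q (Suc N) \<le> (\<Sum>n<Suc N. R ^ n * (K * (norm (div_rhs Q n) + vnorm1 (curl_rhs Q n))))"
      using Q R by (intro sum_mono mult_left_mono) (auto simp: step_def)
    also have "\<dots> = K * ((\<Sum>n<Suc N. R ^ n * norm (div_rhs Q n)) + (\<Sum>n<Suc N. R ^ n * vnorm1 (curl_rhs Q n)))"
      unfolding sum_distrib_left sum.distrib[symmetric] by (intro sum.cong) (auto simp: algebra_simps)
    also have "\<dots> \<le> q" unfolding q_def by (intro mult_left_mono add_mono sf st K)
    finally show "?S ?\<gamma> (Suc N) \<le> 1/4 \<and> ?S ?\<beta> (Suc N) \<le> 2 * ?d \<and> ?S ?q (Suc N) \<le> q"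
      using sg4 sb[of "Suc N"] by (simp del: sum.lessThan_Suc)
  qed
  have qN: "?S ?q N \<le> q" for N
  proof (induction N)
    case (Suc N)
    then show ?case using main[of N] by (simp del: sum.lessThan_Suc)
  qed (use q in simp)
  have "?S ?\<gamma> N \<le> 1/4" for N
    using main[of N] qN[of N] mono[of N "Suc N" ?\<gamma>] by (simp del: sum.lessThan_Suc)
  moreover have "?S ?\<beta> N \<le> 2 * ?d" for N
    using main[of N] qN[of N] mono[of N "Suc N" ?\<beta>] by (simp del: sum.lessThan_Suc)
  ultimately show ?thesis using R A Q qN by blast
qed

end

section \<open>Power series in time with coefficients in a Banach space\<close>

definition tsum :: "(nat \<Rightarrow> 'a::real_normed_vector) \<Rightarrow> real \<Rightarrow> 'a" where
  "tsum a t = (\<Sum>n. t ^ n *\<^sub>R a n)"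

text \<open>Absolute summability at the endpoint, so that sums are available on the closed interval
  |t| \<le> R; differentiation in time is restricted to the interior.\<close>

definition tsummable :: "real \<Rightarrow> (nat \<Rightarrow> 'a::real_normed_vector) \<Rightarrow> bool" where
  "tsummable R a \<longleftrightarrow> summable (\<lambda>n. R ^ n * norm (a n))"

lemma tsummable_bounded_sums:
  assumes "R \<ge> 0" "\<And>n. norm (a n) \<le> b n" "\<And>N. (\<Sum>n<N. R ^ n * b n) \<le> C"
  shows "tsummable R a"
  unfolding tsummable_def
proof (rule summableI_nonneg_bounded)
  show "(\<Sum>n<N. R ^ n * norm (a n)) \<le> C" for N
    by (rule order_trans[OF sum_mono[OF mult_left_mono] assms(3)]) (use assms in auto)
qed (use assms(1) in simp)

lemma tsummable_norm:
  assumes "tsummable R a" "\<bar>t\<bar> \<le> R"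
  shows "summable (\<lambda>n. norm (t ^ n *\<^sub>R a n))"
proof (rule summable_comparison_test'[OF assms(1)[unfolded tsummable_def]])
  show "norm (norm (t ^ n *\<^sub>R a n)) \<le> R ^ n * norm (a n)" for n
    using power_mono[OF assms(2), of n] by (auto simp: power_abs intro!: mult_right_mono)
qed

lemma tsummable_summable:
  fixes a :: "nat \<Rightarrow> 'a::banach"
  assumes "tsummable R a" "\<bar>t\<bar> \<le> R"
  shows "summable (\<lambda>n. t ^ n *\<^sub>R a n)"
  by (rule summable_norm_cancel[OF tsummable_norm[OF assms]])

lemma tsummable_comparison:
  assumes "tsummable R a" "R \<ge> 0" "\<And>n. norm (b n) \<le> C * norm (a n)"
  shows "tsummable R b"
  unfolding tsummable_def
proof (rule summable_comparison_test'[OF summable_mult[OF assms(1)[unfolded tsummable_def], of C]])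
  show "norm (R ^ n * norm (b n)) \<le> C * (R ^ n * norm (a n))" for n
    using mult_left_mono[OF assms(3)[of n], of "R ^ n"] assms(2) by (simp add: mult_ac)
qed

lemma tsummable_add:
  assumes "tsummable R a" "tsummable R b" "R \<ge> 0"
  shows "tsummable R (\<lambda>n. a n + b n)"
  unfolding tsummable_def
proof (rule summable_comparison_test'[OF summable_add[OF assms(1,2)[unfolded tsummable_def]]])
  show "norm (R ^ n * norm (a n + b n)) \<le> R ^ n * norm (a n) + R ^ n * norm (b n)" for n
    using mult_left_mono[OF norm_triangle_ineq, of "R ^ n" "a n" "b n"] assms(3) by (simp add: distrib_left)
qed

lemma tsummable_sum:
  assumes "\<And>i. i \<in> I \<Longrightarrow> tsummable R (a i)" "R \<ge> 0"
  shows "tsummable R (\<lambda>n. \<Sum>i\<in>I. a i n)"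
  using assms(1)
proof (induction I rule: infinite_finite_induct)
  case (insert i I)
  then show ?case using tsummable_add[of R "a i" "\<lambda>n. \<Sum>i\<in>I. a i n"] assms(2) by simp
qed (simp_all add: tsummable_def)

lemma tsum_0 [simp]: "tsum a 0 = a 0"
  using suminf_finite[of "{0}" "\<lambda>n. 0 ^ n *\<^sub>R a n"] by (simp add: tsum_def)

lemma tsum_add:
  fixes a b :: "nat \<Rightarrow> 'a::banach"
  assumes "tsummable R a" "tsummable R b" "\<bar>t\<bar> \<le> R"
  shows "tsum (\<lambda>n. a n + b n) t = tsum a t + tsum b t"
  unfolding tsum_def scaleR_add_right
  by (rule suminf_add[symmetric]) (use assms tsummable_summable in auto)

lemma tsum_sum:
  fixes a :: "'i \<Rightarrow> nat \<Rightarrow> 'a::banach"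
  assumes "\<And>i. i \<in> I \<Longrightarrow> tsummable R (a i)" "\<bar>t\<bar> \<le> R"
  shows "tsum (\<lambda>n. \<Sum>i\<in>I. a i n) t = (\<Sum>i\<in>I. tsum (a i) t)"
  unfolding tsum_def scaleR_sum_right
  by (rule suminf_sum) (use assms tsummable_summable in auto)

lemma tsum_linear:
  fixes a :: "nat \<Rightarrow> 'a::banach"
  assumes "bounded_linear L" "tsummable R a" "\<bar>t\<bar> \<le> R"
  shows "tsum (\<lambda>n. L (a n)) t = L (tsum a t)"
  unfolding tsum_def
  by (simp add: bounded_linear.suminf[OF assms(1) tsummable_summable[OF assms(2,3)]]
      linear_scale[OF bounded_linear.linear[OF assms(1)]])

lemma tsummable_linear:
  assumes "bounded_linear L" "tsummable R a" "R \<ge> 0"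
  shows "tsummable R (\<lambda>n. L (a n))"
proof -
  obtain K where "\<And>x. norm (L x) \<le> norm x * K" using bounded_linear.bounded[OF assms(1)] by blast
  then show ?thesis by (intro tsummable_comparison[OF assms(2,3), of _ K]) (simp add: mult.commute)
qed

lemma tsum_mult:
  fixes a b :: "nat \<Rightarrow> 'a::{real_normed_algebra,banach}"
  assumes "tsummable R a" "tsummable R b" "\<bar>t\<bar> \<le> R"
  shows "tsum (\<lambda>n. \<Sum>m\<le>n. a m * b (n - m)) t = tsum a t * tsum b t"
proof -
  have "t ^ n *\<^sub>R (\<Sum>m\<le>n. a m * b (n - m)) = (\<Sum>m\<le>n. (t ^ m *\<^sub>R a m) * (t ^ (n - m) *\<^sub>R b (n - m)))" for n
    unfolding scaleR_sum_right by (intro sum.cong refl) (simp add: power_add[symmetric])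
  then show ?thesis
    unfolding tsum_def
    by (simp add: Cauchy_product[OF tsummable_norm[OF assms(1,3)] tsummable_norm[OF assms(2,3)]])
qed

lemma tsummable_mult:
  fixes a b :: "nat \<Rightarrow> 'a::{real_normed_algebra,banach}"
  assumes "tsummable R a" "tsummable R b" "R \<ge> 0"
  shows "tsummable R (\<lambda>n. \<Sum>m\<le>n. a m * b (n - m))"
proof (rule tsummable_bounded_sums[OF assms(3)])
  let ?S = "\<lambda>a :: nat \<Rightarrow> 'a. \<Sum>n. R ^ n * norm (a n)"
  show "norm (\<Sum>m\<le>n. a m * b (n - m)) \<le> (\<Sum>m\<in>{..n}. norm (a m) * norm (b (n - m)))" for n
    by (rule order_trans[OF norm_sum sum_mono[OF norm_mult_ineq]])
  have le: "(\<Sum>n<N. R ^ n * norm (c n)) \<le> ?S c" if "tsummable R c" for c :: "nat \<Rightarrow> 'a" and N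
    using that assms(3) unfolding tsummable_def by (intro sum_le_suminf) auto
  show "(\<Sum>n<N. R ^ n * (\<Sum>m\<in>{..n}. norm (a m) * norm (b (n - m)))) \<le> ?S a * ?S b" for N
    by (rule order_trans[OF cauchy_partial_sum_le[where ?M1.0 = N and ?M2.0 = N] mult_mono])
       (use assms le in \<open>auto intro!: sum_nonneg suminf_nonneg simp: tsummable_def\<close>)
qed

lemma continuous_on_tsum_ev:
  fixes a :: "nat \<Rightarrow> 'n::finite wiener"
  assumes "tsummable R a"
  shows "continuous_on ({-R..R} \<times> UNIV) (\<lambda>(t, x). ev (tsum a t) x)"
proof -
  have "uniform_limit ({-R..R} \<times> UNIV) (\<lambda>N p. \<Sum>n<N. (fst p) ^ n * ev (a n) (snd p))
      (\<lambda>p. \<Sum>n. (fst p) ^ n * ev (a n) (snd p)) sequentially"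
  proof (rule Weierstrass_m_test)
    show "norm ((fst p) ^ n * ev (a n) (snd p)) \<le> R ^ n * norm (a n)" if "p \<in> {-R..R} \<times> UNIV" for n p
      using that by (auto simp: abs_mult power_abs intro!: mult_mono power_mono abs_ev_le)
    show "summable (\<lambda>n. R ^ n * norm (a n))" using assms by (simp add: tsummable_def)
  qed
  then have "continuous_on ({-R..R} \<times> UNIV) (\<lambda>p. \<Sum>n. (fst p) ^ n * ev (a n) (snd p))"
  proof (rule uniform_limit_theorem[rotated])
    have "continuous_on ({-R..R} \<times> UNIV) (\<lambda>p. (fst p) ^ n * ev (a n) (snd p))" for n
      by (intro continuous_intros continuous_on_compose2[OF continuous_on_ev]) auto
    then show "\<forall>\<^sub>F N in sequentially. continuous_on ({-R..R} \<times> UNIV) (\<lambda>p. \<Sum>n<N. (fst p) ^ n * ev (a n) (snd p))"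
      by (intro always_eventually allI continuous_on_sum)
  qed simp
  moreover have "(\<Sum>n. t ^ n * ev (a n) x) = ev (tsum a t) x" if "t \<in> {-R..R}" for t x
  proof -
    have "\<bar>t\<bar> \<le> R" using that by auto
    then show ?thesis using tsum_linear[OF bounded_linear_ev assms, of t x] by (simp add: tsum_def)
  qed
  ultimately show ?thesis by (subst continuous_on_cong) (auto simp: case_prod_unfold)
qed

lemma ev_tsum_eq:
  assumes "tsummable R a" "\<bar>t\<bar> \<le> R"
  shows "ev (tsum a t) x = (\<Sum>n. ev (a n) x * t ^ n)"
  using tsum_linear[OF bounded_linear_ev assms, of x] by (simp add: tsum_def mult.commute)

lemma summable_ev:
  assumes "tsummable R a" "R \<ge> 0"
  shows "summable (\<lambda>n. ev (a n) x * R ^ n)"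
  unfolding mult.commute[of "ev _ _"]
  by (rule summable_comparison_test'[OF assms(1)[unfolded tsummable_def]])
     (use assms(2) in \<open>auto simp: abs_mult intro!: mult_left_mono abs_ev_le\<close>)

text \<open>For a fixed point x the evaluation is a scalar power series, so termwise differentiation
  applies; \<open>a'\<close> lists the coefficients of the derived series.\<close>

lemma has_derivative_tsum_time:
  fixes a a' :: "nat \<Rightarrow> 'n::finite wiener"
  assumes a: "tsummable R a" "tsummable R a'" and a': "\<And>n. a' n = real (Suc n) *\<^sub>R a (Suc n)" and t: "\<bar>t\<bar> < R"
  shows "((\<lambda>t. ev (tsum a t) x) has_real_derivative ev (tsum a' t) x) (at t)"
proof -
  let ?c = "\<lambda>n. ev (a n) x"
  have "DERIV (\<lambda>t. \<Sum>n. ?c n * t ^ n) t :> (\<Sum>n. diffs ?c n * t ^ n)"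
    by (rule termdiffs_strong[OF summable_ev[OF a(1)]]) (use t in auto)
  moreover have "diffs ?c n = ev (a' n) x" for n by (simp add: diffs_def a')
  ultimately have "((\<lambda>t. \<Sum>n. ?c n * t ^ n) has_real_derivative ev (tsum a' t) x) (at t)"
    using ev_tsum_eq[OF a(2), of t x] t by simp
  then show ?thesis
    by (rule has_field_derivative_transform_within_open[of _ _ _ "{-R<..<R}"])
       (use t ev_tsum_eq[OF a(1)] in auto)
qed

lemma tsum_A1:
  fixes a :: "nat \<Rightarrow> 'n::finite wiener"
  assumes A: "\<And>n. a n \<in> A1" and s: "\<And>N. (\<Sum>n<N. R ^ n * norm1 (a n)) \<le> C" and t: "\<bar>t\<bar> \<le> R"
  shows "tsum a t \<in> A1" "der j (tsum a t) = tsum (\<lambda>n. der j (a n)) t" "norm1 (tsum a t) \<le> C"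
    "tsummable R a" "tsummable R (\<lambda>n. der j (a n))"
proof -
  have R: "R \<ge> 0" using t by linarith
  have sm: "summable (\<lambda>n. R ^ n * norm1 (a n))"
    by (rule summableI_nonneg_bounded[OF _ s]) (use R in simp)
  have sc: "(\<lambda>n. norm1 (t ^ n *\<^sub>R a n)) = (\<lambda>n. \<bar>t\<bar> ^ n * norm1 (a n))"
    by (simp add: A1_scaleR A power_abs)
  have sm': "summable (\<lambda>n. norm1 (t ^ n *\<^sub>R a n))"
    unfolding sc by (rule summable_comparison_test'[OF sm]) (use t in \<open>auto intro!: mult_right_mono power_mono\<close>)
  note * = A1_suminf[OF A1_scaleR(1)[OF A] sm'] and ** = der_suminf[OF A1_scaleR(1)[OF A] sm']
  show "tsum a t \<in> A1" unfolding tsum_def by (rule *(2))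
  show "der j (tsum a t) = tsum (\<lambda>n. der j (a n)) t" unfolding tsum_def **(2) by (simp add: der_scaleR A)
  have "norm1 (tsum a t) \<le> (\<Sum>n. norm1 (t ^ n *\<^sub>R a n))" unfolding tsum_def by (rule *(3))
  also have "\<dots> \<le> (\<Sum>n. R ^ n * norm1 (a n))"
    by (rule suminf_le[OF _ sm' sm]) (use t in \<open>auto simp: A1_scaleR A power_abs intro!: mult_right_mono power_mono\<close>)
  also have "\<dots> \<le> C" by (rule suminf_le_const[OF sm s])
  finally show "norm1 (tsum a t) \<le> C" .
  show "tsummable R a" by (rule tsummable_bounded_sums[OF R norm_le_norm1[OF A] s])
  have "norm (der j (a n)) \<le> 2 * pi * norm1 (a n)" for n by (rule norm_der_le[OF A])
  moreover have "(\<Sum>n<N. R ^ n * (2 * pi * norm1 (a n))) \<le> 2 * pi * C" for N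
    using mult_left_mono[OF s[of N], of "2 * pi"] by (simp add: sum_distrib_left mult_ac)
  ultimately show "tsummable R (\<lambda>n. der j (a n))" by (rule tsummable_bounded_sums[OF R])
qed

text \<open>
  A real power series is analytic in the interior of its interval of convergence; the expansions at
  the other points come from the holomorphic extension to the disc.
\<close>

lemma real_analytic_on_tsum:
  fixes f :: "real \<Rightarrow> real^'n" and a :: "'n \<Rightarrow> nat \<Rightarrow> real"
  assumes a: "\<And>i. summable (\<lambda>n. a i n * R ^ n)" and f: "\<And>t i. \<bar>t\<bar> < R \<Longrightarrow> f t $ i = (\<Sum>n. a i n * t ^ n)"
  shows "real_analytic_on f {-R<..<R}"
  unfolding real_analytic_on_def
proof
  fix t0 assume t0: "t0 \<in> {-R<..<R}"
  define e where "e = R - \<bar>t0\<bar>"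
  have e: "e > 0" using t0 by (auto simp: e_def)
  define F where "F = (\<lambda>i z. \<Sum>n. complex_of_real (a i n) * z ^ n)"
  have sR: "summable (\<lambda>n. complex_of_real (a i n) * (of_real R) ^ n)" for i
    using summable_of_real[OF a[of i], where 'a = complex] by simp
  have F: "F i holomorphic_on ball (of_real t0) e" for i
  proof -
    have "\<exists>d. (F i has_field_derivative d) (at z)" if "z \<in> ball (of_real t0) e" for z
    proof -
      have "norm z \<le> norm (complex_of_real t0) + dist (complex_of_real t0) z"
        by (metis dist_commute dist_norm norm_triangle_sub)
      then have "norm z < norm (complex_of_real R)" using that t0 by (auto simp: e_def)
      from termdiffs_strong[OF sR this] show ?thesis unfolding F_def by blast
    qed
    then show ?thesis unfolding holomorphic_on_def field_differentiable_def
      using has_field_derivative_at_within by blast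
  qed
  define c where "c = (\<lambda>n. \<chi> i. Re ((deriv ^^ n) (F i) (of_real t0) / fact n))"
  have "(\<lambda>n. (t - t0) ^ n *\<^sub>R c n) sums f t" if t: "\<bar>t - t0\<bar> < e" for t
    unfolding sums_def
  proof (rule vec_tendstoI)
    fix i
    have "(\<lambda>n. (deriv ^^ n) (F i) (of_real t0) / fact n * (of_real t - of_real t0) ^ n) sums F i (of_real t)"
      by (rule holomorphic_power_series[OF F]) (use t in \<open>simp add: dist_norm norm_minus_commute flip: of_real_diff\<close>)
    then have "(\<lambda>n. Re ((deriv ^^ n) (F i) (of_real t0) / fact n * (of_real t - of_real t0) ^ n)) sums Re (F i (of_real t))"
      by (rule sums_Re)
    moreover have re: "Re (z * (of_real t - of_real t0) ^ n) = (t - t0) ^ n * Re z" for z n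
      by (simp flip: of_real_diff of_real_power)
    moreover have "Re (F i (of_real t)) = f t $ i"
    proof -
      have tR: "\<bar>t\<bar> < R" using t by (auto simp: e_def)
      then have "summable (\<lambda>n. a i n * t ^ n)" by (intro powser_inside[OF a]) auto
      then have "F i (of_real t) = of_real (\<Sum>n. a i n * t ^ n)"
        unfolding F_def by (simp add: suminf_of_real)
      then show ?thesis using f[OF tR] by simp
    qed
    moreover have "(\<lambda>n. Re ((deriv ^^ n) (F i) (of_real t0) / fact n * (of_real t - of_real t0) ^ n))
        = (\<lambda>n. ((t - t0) ^ n *\<^sub>R c n) $ i)"
      by (rule ext) (simp only: re c_def vec_lambda_beta vector_scaleR_component real_scaleR_def)
    ultimately have "(\<lambda>n. ((t - t0) ^ n *\<^sub>R c n) $ i) sums f t $ i" by simp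
    then show "(\<lambda>N. (\<Sum>n<N. (t - t0) ^ n *\<^sub>R c n) $ i) \<longlonglongrightarrow> f t $ i"
      by (simp add: sums_def)
  qed
  then show "\<exists>c. \<exists>\<epsilon>>0. \<forall>t. \<bar>t - t0\<bar> < \<epsilon> \<longrightarrow> (\<lambda>n. (t - t0) ^ n *\<^sub>R c n) sums f t"
    using e by blast
qed

section \<open>Derivative of the determinant\<close>

text \<open>\<open>det_expansion\<close> is applied with s - t as small parameter and the difference
  quotient of \<open>C\<close> as matrix. The entries of the quotient are bounded near t, so the
  remainder is quadratic in s - t.\<close>

lemma has_real_derivative_det_at_identity:
  fixes C :: "real \<Rightarrow> real^'n^'n" and C' :: "real^'n^'n"
  assumes der: "\<And>i j. ((\<lambda>s. C s $ i $ j) has_real_derivative C' $ i $ j) (at t)" and C: "C t = mat 1"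
  shows "((\<lambda>s. det (C s)) has_real_derivative trace C') (at t)"
proof -
  have "\<forall>\<^sub>F s in at t. \<bar>(C s - mat 1) $ i $ j / (s - t)\<bar> \<le> \<bar>C' $ i $ j\<bar> + 1" for i j
  proof -
    have "((\<lambda>s. (C s $ i $ j - C t $ i $ j) / (s - t)) \<longlongrightarrow> C' $ i $ j) (at t)"
      using der[of i j] by (simp add: has_field_derivative_iff)
    then have d: "\<forall>\<^sub>F s in at t. dist ((C s $ i $ j - C t $ i $ j) / (s - t)) (C' $ i $ j) < 1"
      by (rule tendstoD) simp
    have "\<bar>y\<bar> \<le> \<bar>c\<bar> + 1" if "dist y c < 1" for y c :: real
      using that by (simp add: dist_real_def)
    then show ?thesis
      using d by (elim eventually_mono) (simp only: C vector_minus_component)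
  qed
  then have ev1: "\<forall>\<^sub>F s in at t. \<forall>i j. \<bar>(C s - mat 1) $ i $ j / (s - t)\<bar> \<le> \<bar>C' $ i $ j\<bar> + 1"
    by (simp add: eventually_all_finite)
  define c where "c = norm C' + 1"
  have c: "c \<ge> 0" "\<bar>C' $ i $ j\<bar> + 1 \<le> c" for i j using abs_entry_le_norm[of C' i j] by (auto simp: c_def)
  obtain K where K: "K \<ge> 0"
    "\<And>e (A :: real^'n^'n). \<bar>e\<bar> \<le> 1 \<Longrightarrow> (\<And>i j. \<bar>A $ i $ j\<bar> \<le> c) \<Longrightarrow>
       \<bar>det (mat 1 + e *\<^sub>R A) - 1 - e * trace A\<bar> \<le> K * e\<^sup>2"
    using det_expansion[OF c(1)] by blast
  have "\<forall>\<^sub>F s in at t. \<bar>s - t\<bar> < 1"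
    by (auto simp: eventually_at intro!: exI[of _ 1] simp: dist_real_def)
  with ev1 have ev2: "\<forall>\<^sub>F s in at t. \<bar>det (C s) - 1 - trace (C s - mat 1)\<bar> \<le> K * (s - t)\<^sup>2"
    using eventually_neq_at_within[of t]
  proof eventually_elim
    case (elim s)
    let ?N = "(1 / (s - t)) *\<^sub>R (C s - mat 1)"
    have "\<bar>?N $ i $ j\<bar> \<le> c" for i j using elim(1) c(2)[of i j] order_trans by fastforce
    then have "\<bar>det (mat 1 + (s - t) *\<^sub>R ?N) - 1 - (s - t) * trace ?N\<bar> \<le> K * (s - t)\<^sup>2"
      using elim(2) by (intro K(2)) auto
    moreover have "(s - t) *\<^sub>R ?N = C s - mat 1" using elim(3) by simp
    moreover have "(s - t) * trace ?N = trace (C s - mat 1)"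
      using elim(3) by (simp add: trace_def sum_distrib_left)
    ultimately show ?case by simp
  qed
  have tr: "((\<lambda>s. trace (C s)) has_real_derivative trace C') (at t)"
    unfolding trace_def by (intro DERIV_sum der)
  have "((\<lambda>s. det (C s) - trace (C s)) has_real_derivative 0) (at t)"
    unfolding has_field_derivative_iff
  proof (rule Lim_null_comparison)
    show "\<forall>\<^sub>F s in at t. norm ((det (C s) - trace (C s) - (det (C t) - trace (C t))) / (s - t)) \<le> K * \<bar>s - t\<bar>"
      using ev2 eventually_neq_at_within[of t]
    proof eventually_elim
      case (elim s)
      have h1: "det (C s) - trace (C s) - (det (C t) - trace (C t)) = det (C s) - 1 - trace (C s - mat 1)"
        by (simp add: C trace_sub)
      have h2: "K * (s - t)\<^sup>2 = K * \<bar>s - t\<bar> * \<bar>s - t\<bar>"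
        by (simp add: power2_eq_square abs_mult_self_eq mult.assoc)
      have "\<bar>s - t\<bar> > 0" using elim(2) by simp
      then show ?case
        using elim(1) unfolding real_norm_def abs_divide h1 h2 by (subst pos_divide_le_eq)
    qed
    show "((\<lambda>s. K * \<bar>s - t\<bar>) \<longlongrightarrow> 0) (at t)"
      by (rule tendsto_eq_intros refl | simp)+
  qed
  from DERIV_add[OF this tr] show ?thesis by simp
qed

text \<open>Jacobi's formula, reduced to the identity matrix by left multiplication with the
  constant inverse \<open>B\<close> of \<open>A t\<close>.\<close>

lemma has_real_derivative_det:
  fixes A :: "real \<Rightarrow> real^'n^'n" and A' B :: "real^'n^'n"
  assumes der: "\<And>i j. ((\<lambda>s. A s $ i $ j) has_real_derivative A' $ i $ j) (at t)" and B: "B ** A t = mat 1"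
  shows "((\<lambda>s. det (A s)) has_real_derivative det (A t) * trace (B ** A')) (at t)"
proof -
  have B': "A t ** B = mat 1" using B by (simp add: matrix_left_right_inverse)
  have "((\<lambda>s. det (B ** A s)) has_real_derivative trace (B ** A')) (at t)"
  proof (rule has_real_derivative_det_at_identity[where C = "\<lambda>s. B ** A s"])
    show "B ** A t = mat 1" by (rule B)
    show "((\<lambda>s. (B ** A s) $ i $ j) has_real_derivative (B ** A') $ i $ j) (at t)" for i j
      unfolding matrix_matrix_mult_def vec_lambda_beta by (intro DERIV_sum DERIV_cmult der)
  qed
  then have "((\<lambda>s. det (A t) * det (B ** A s)) has_real_derivative det (A t) * trace (B ** A')) (at t)"
    by (rule DERIV_cmult)
  moreover have "det (A t) * det (B ** A s) = det (A s)" for s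
    using arg_cong[OF B', of det] by (simp add: det_mul)
  ultimately show ?thesis by simp
qed

lemma has_real_derivative_zero_const:
  fixes f :: "real \<Rightarrow> real"
  assumes "\<And>t. \<bar>t\<bar> < R \<Longrightarrow> (f has_real_derivative 0) (at t)" "\<bar>t\<bar> < R"
  shows "f t = f 0"
  by (rule DERIV_isconst3[of "-R" R]) (use assms in auto)

lemma minus_matrix_mult: "(- A) ** C = - (A ** C)" for A :: "'a::ring_1^'n^'m"
  by (simp add: matrix_matrix_mult_def vec_eq_iff sum_negf)

text \<open>
  A volume preserving flow \<open>id + \<xi>\<close> of the torus, with velocity \<open>V\<close> and acceleration \<open>W\<close> in
  Lagrangian coordinates, for which \<open>\<sigma> W\<close> is a gradient in Eulerian coordinates; \<open>G\<close>, \<open>H\<close> are the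
  spatial derivatives of \<open>\<xi>\<close>, \<open>V\<close>, and \<open>B\<close> is the inverse Jacobian matrix.
\<close>

locale euler_flow =
  fixes R :: real and \<xi> V W :: "real \<Rightarrow> real^'n \<Rightarrow> real^'n" and G H B :: "real \<Rightarrow> real^'n \<Rightarrow> real^'n^'n"
    and \<phi> :: "real \<Rightarrow> real^'n \<Rightarrow> real" and \<sigma> :: "real^'n \<Rightarrow> real"
  assumes R: "R > 0"
    and torus: "\<And>t. \<bar>t\<bar> < R \<Longrightarrow> torus_fun (\<xi> t)" "\<And>t. \<bar>t\<bar> < R \<Longrightarrow> torus_fun (V t)"
      "\<And>t. \<bar>t\<bar> < R \<Longrightarrow> torus_fun (B t)" "\<And>t. \<bar>t\<bar> < R \<Longrightarrow> torus_fun (\<phi> t)"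
    and \<xi>_0: "\<And>x. \<xi> 0 x = 0"
    and d_\<xi>: "\<And>t x. \<bar>t\<bar> < R \<Longrightarrow> ((\<lambda>t. \<xi> t x) has_vector_derivative V t x) (at t)"
    and d_V: "\<And>t x. \<bar>t\<bar> < R \<Longrightarrow> ((\<lambda>t. V t x) has_vector_derivative W t x) (at t)"
    and D_\<xi>: "\<And>t x. \<bar>t\<bar> < R \<Longrightarrow> (\<xi> t has_derivative (\<lambda>h. G t x *v h)) (at x)"
    and D_V: "\<And>t x. \<bar>t\<bar> < R \<Longrightarrow> (V t has_derivative (\<lambda>h. H t x *v h)) (at x)"
    and D_\<phi>: "\<And>t x. \<bar>t\<bar> < R \<Longrightarrow> (\<phi> t has_derivative (\<lambda>h. ((\<sigma> x *\<^sub>R W t x) v* (mat 1 + G t x)) \<bullet> h)) (at x)"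
    and cont: "continuous_on ({-R<..<R} \<times> UNIV) (\<lambda>(t, x). \<xi> t x)"
      "continuous_on ({-R<..<R} \<times> UNIV) (\<lambda>(t, x). V t x)"
      "continuous_on ({-R<..<R} \<times> UNIV) (\<lambda>(t, x). W t x)"
      "continuous_on ({-R<..<R} \<times> UNIV) (\<lambda>(t, x). G t x)"
      "continuous_on ({-R<..<R} \<times> UNIV) (\<lambda>(t, x). H t x)"
      "continuous_on ({-R<..<R} \<times> UNIV) (\<lambda>(t, x). B t x)"
    and cont_\<sigma>: "continuous_on UNIV \<sigma>"
    and G: "\<And>t x h. \<bar>t\<bar> < R \<Longrightarrow> norm (G t x *v h) \<le> norm h / 4"
    and det: "\<And>t x. \<bar>t\<bar> < R \<Longrightarrow> det (mat 1 + G t x) = 1"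
    and B: "\<And>t x. \<bar>t\<bar> < R \<Longrightarrow> B t x ** (mat 1 + G t x) = mat 1"
    and trace_BH: "\<And>t x. \<bar>t\<bar> < R \<Longrightarrow> trace (B t x ** H t x) = 0"
    and analytic: "\<And>x. real_analytic_on (\<lambda>t. \<xi> t x) {-R<..<R}"

lemma tsum_single:
  fixes c :: "'a::banach"
  shows "tsum (\<lambda>n. if n = 0 then c else 0) t = c" "tsummable R (\<lambda>n. if n = 0 then c else 0)"
proof -
  have "(\<lambda>n. t ^ n *\<^sub>R (if n = 0 then c else 0)) = (\<lambda>n. if n = 0 then c else 0)" by auto
  then show "tsum (\<lambda>n. if n = 0 then c else 0) t = c"
    unfolding tsum_def using suminf_finite[of "{0}" "\<lambda>n. if n = 0 then c else 0"] by simp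
  show "tsummable R (\<lambda>n. if n = 0 then c else 0)"
    unfolding tsummable_def by (rule summable_finite[of "{0}"]) auto
qed

lemma ev_constant:
  assumes "\<And>k. k \<noteq> 0 \<Longrightarrow> coef f k = 0"
  shows "ev f x = Re (coef f 0)"
  using ev_finite_support[of "{0}" f x] assms by simp

lemma has_derivative_vecI:
  fixes f :: "'a::real_normed_vector \<Rightarrow> real^'n"
  assumes "\<And>i. ((\<lambda>x. f x $ i) has_derivative (\<lambda>h. f' h $ i)) (at x within S)"
  shows "(f has_derivative f') (at x within S)"
  by (subst has_derivative_componentwise_within) (use assms in \<open>auto simp: Basis_vec_def inner_axis\<close>)

lemma has_vector_derivative_vecI:
  fixes f :: "real \<Rightarrow> real^'n"
  assumes "\<And>i. ((\<lambda>x. f x $ i) has_real_derivative f' $ i) (at x within S)"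
  shows "(f has_vector_derivative f') (at x within S)"
  unfolding has_vector_derivative_def
  by (rule has_derivative_vecI) (use assms in \<open>simp add: has_field_derivative_def mult_commute_abs\<close>)

lemma has_derivative_vec_ev:
  fixes X :: "'n \<Rightarrow> 'n::finite wiener"
  assumes "\<And>i. X i \<in> A1"
  shows "((\<lambda>x. \<chi> i. ev (X i) x) has_derivative (\<lambda>h. (\<chi> i j. ev (der j (X i)) x) *v h)) (at x)"
  by (rule has_derivative_vecI)
     (use has_derivative_ev[OF assms] in \<open>simp add: matrix_vector_mult_def\<close>)

lemma norm_tsum_le:
  fixes a :: "nat \<Rightarrow> 'a::banach"
  assumes "tsummable R a" "\<bar>t\<bar> \<le> R"
  shows "norm (tsum a t) \<le> (\<Sum>n. R ^ n * norm (a n))"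
  unfolding tsum_def
  by (rule order_trans[OF summable_norm[OF tsummable_norm[OF assms]] suminf_le[OF _ tsummable_norm[OF assms]]])
     (use assms in \<open>auto simp: power_abs tsummable_def intro!: mult_right_mono power_mono\<close>)

lemma tsum_uminus:
  fixes a :: "nat \<Rightarrow> 'a::banach"
  assumes "tsummable R a" "\<bar>t\<bar> \<le> R"
  shows "tsum (\<lambda>n. - a n) t = - tsum a t"
  by (rule tsum_linear[OF bounded_linear_minus[OF bounded_linear_ident] assms])

lemma ev_tsum_differentiable:
  assumes "tsummable R a" "\<bar>t\<bar> < R"
  obtains d where "((\<lambda>t. ev (tsum a t) x) has_real_derivative d) (at t)"
proof -
  let ?c = "\<lambda>n. ev (a n) x"
  have "DERIV (\<lambda>t. \<Sum>n. ?c n * t ^ n) t :> (\<Sum>n. diffs ?c n * t ^ n)"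
    by (rule termdiffs_strong[OF summable_ev[OF assms(1)]]) (use assms(2) in auto)
  then have "((\<lambda>t. ev (tsum a t) x) has_real_derivative (\<Sum>n. diffs ?c n * t ^ n)) (at t)"
    by (rule has_field_derivative_transform_within_open[of _ _ _ "{-R<..<R}"])
       (use assms(2) ev_tsum_eq[OF assms(1)] in auto)
  then show ?thesis by (rule that)
qed

lemma continuous_on_tsum_vec:
  fixes a :: "'i::finite \<Rightarrow> nat \<Rightarrow> 'n::finite wiener"
  assumes "\<And>i. tsummable R (a i)"
  shows "continuous_on ({-R<..<R} \<times> UNIV) (\<lambda>(t, x). \<chi> i. ev (tsum (a i) t) x)"
  unfolding case_prod_unfold
  by (intro continuous_on_vec_lambda continuous_on_subset[OF continuous_on_tsum_ev[OF assms, unfolded case_prod_unfold]]) auto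

lemma continuous_on_tsum_mat:
  fixes a :: "'i::finite \<Rightarrow> 'j::finite \<Rightarrow> nat \<Rightarrow> 'n::finite wiener"
  assumes "\<And>i j. tsummable R (a i j)"
  shows "continuous_on ({-R<..<R} \<times> UNIV) (\<lambda>(t, x). \<chi> i j. ev (tsum (a i j) t) x)"
  unfolding case_prod_unfold
  by (intro continuous_on_vec_lambda continuous_on_subset[OF continuous_on_tsum_ev[OF assms, unfolded case_prod_unfold]]) auto

lemma shifted_bounds:
  fixes a b :: "nat \<Rightarrow> 'n::finite wiener"
  assumes R: "R \<ge> 0" and b: "\<And>n. b n \<in> A1" "\<And>N. (\<Sum>n<N. R ^ n * norm1 (b n)) \<le> C"
    and a: "\<And>n. a (Suc n) = (1 / real (Suc n)) *\<^sub>R b n"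
  shows "(\<Sum>n<N. R ^ n * norm1 (a n)) \<le> norm1 (a 0) + R * C"
proof -
  have le: "norm1 (a (Suc n)) \<le> norm1 (b n)" for n
  proof -
    have "1 / real (Suc n) * norm1 (b n) \<le> 1 * norm1 (b n)" by (rule mult_right_mono) auto
    then show ?thesis by (simp add: a A1_scaleR b)
  qed
  have "(\<Sum>n<N. R ^ n * norm1 (a n)) \<le> (\<Sum>n<Suc N. R ^ n * norm1 (a n))" using R by simp
  also have "\<dots> = norm1 (a 0) + R * (\<Sum>n<N. R ^ n * norm1 (a (Suc n)))"
    by (simp add: sum.lessThan_Suc_shift sum_distrib_left mult_ac del: sum.lessThan_Suc)
  also have "(\<Sum>n<N. R ^ n * norm1 (a (Suc n))) \<le> C"
    by (rule order_trans[OF sum_mono b(2)]) (use R le in \<open>auto intro!: mult_left_mono\<close>)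
  finally show ?thesis using R by (simp add: mult_left_mono)
qed

section \<open>Existence of an analytic volume preserving flow\<close>

context lagrangian_series
begin

text \<open>Summing over all orders turns the recursion into identities between functions. The
  gradient condition follows at once, but incompressibility only up to a function of time, which is
  then fixed by the volume of the torus.\<close>

theorem ex_euler_flow:
  assumes divU: "(\<Sum>j\<in>UNIV. der j (U j)) = 0"
  shows "\<exists>R \<xi> V W G H B \<phi>. euler_flow R \<xi> V W G H B \<phi> (\<lambda>x. 1 - ev g x) \<and> (\<forall>x. V 0 x = (\<chi> j. ev (U j) x))"
proof -
  obtain Q R K C CB where R: "R > 0" and A: "\<And>n j. Q n j \<in> A1" and step: "\<And>n. step K Q n (Q n)"
    and C: "\<And>N. (\<Sum>n<N. R ^ n * vnorm1 (Q n)) \<le> C"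
    and GB: "\<And>N. (\<Sum>n<N. R ^ n * mnorm (disp_grad Q n)) \<le> 1/4"
    and CB: "\<And>N. (\<Sum>n<N. R ^ n * mnorm (inv_jac Q n)) \<le> CB"
    using series_bounds by (elim exE conjE) (rule that; blast)
  have R0: "R \<ge> 0" "\<bar>0\<bar> \<le> R" using R by auto
  have Av: "vel Q n j \<in> A1" and Ax: "disp Q n j \<in> A1" for n j
    using A1_vel[OF A] A1_disp[OF A] by auto
  have bq: "(\<Sum>n<N. R ^ n * norm1 (Q n j)) \<le> C" for j N
    by (rule order_trans[OF sum_mono C]) (use R in \<open>auto intro!: mult_left_mono norm_le_vnorm\<close>)
  have bv: "(\<Sum>n<N. R ^ n * norm1 (vel Q n j)) \<le> norm1 (vel Q 0 j) + R * C" for j N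
    by (rule shifted_bounds[OF R0(1) A bq]) (simp add: vel_def)
  have bx: "(\<Sum>n<N. R ^ n * norm1 (disp Q n j)) \<le> norm1 (disp Q 0 j) + R * (norm1 (vel Q 0 j) + R * C)" for j N
    by (rule shifted_bounds[OF R0(1) Av bv]) (simp add: disp_def)
  define q where "q = (\<lambda>t j. tsum (\<lambda>n. Q n j) t)"
  define v where "v = (\<lambda>t j. tsum (\<lambda>n. vel Q n j) t)"
  define X where "X = (\<lambda>t j. tsum (\<lambda>n. disp Q n j) t)"
  define fG where "fG = (\<lambda>t i j. tsum (\<lambda>n. disp_grad Q n i j) t)"
  define fH where "fH = (\<lambda>t i j. tsum (\<lambda>n. vel_grad Q n i j) t)"
  define fB where "fB = (\<lambda>t i j. tsum (\<lambda>n. inv_jac Q n i j) t)"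
  define fK where "fK = (\<lambda>t i j. tsum (\<lambda>n. euler_grad Q n i j) t)"
  define fD where "fD = (\<lambda>t i j. tsum (\<lambda>n. der j (Q n i)) t)"
  note tq = tsum_A1[OF A bq] and tv = tsum_A1[OF Av bv] and tx = tsum_A1[OF Ax bx]
  have sq: "tsummable R (\<lambda>n. Q n j)" "tsummable R (\<lambda>n. der i (Q n j))" for i j using tq(4,5)[OF R0(2)] .
  have sv: "tsummable R (\<lambda>n. vel Q n j)" "tsummable R (\<lambda>n. vel_grad Q n j i)" for i j
    using tv(4,5)[OF R0(2)] by (auto simp: vel_grad_def)
  have sx: "tsummable R (\<lambda>n. disp Q n j)" "tsummable R (\<lambda>n. disp_grad Q n j i)" for i j
    using tx(4,5)[OF R0(2)] by (auto simp: disp_grad_def)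
  have sB: "tsummable R (\<lambda>n. inv_jac Q n i j)" for i j
    by (rule tsummable_bounded_sums[OF R0(1) norm_le_mnorm CB])
  have sK: "tsummable R (\<lambda>n. euler_grad Q n i j)" for i j
    unfolding euler_grad_def sum.swap[of _ UNIV]
    by (intro tsummable_sum tsummable_mult sB sv R0)
  have derX: "der j (X t i) = fG t i j" and derv: "der j (v t i) = fH t i j" and derq: "der j (q t i) = fD t i j"
    and AX: "X t i \<in> A1" "v t i \<in> A1" "q t i \<in> A1" if "\<bar>t\<bar> \<le> R" for t i j
    unfolding X_def v_def q_def fG_def fH_def fD_def disp_grad_def vel_grad_def
    using tx(1,2)[OF that] tv(1,2)[OF that] tq(1,2)[OF that] by auto
  have fK: "fK t i j = (\<Sum>l\<in>UNIV. fB t i l * fH t l j)" if t: "\<bar>t\<bar> \<le> R" for t i j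
  proof -
    have "fK t i j = tsum (\<lambda>n. \<Sum>l\<in>UNIV. \<Sum>m\<le>n. inv_jac Q m i l * vel_grad Q (n - m) l j) t"
      unfolding fK_def euler_grad_def sum.swap[of _ UNIV] ..
    also have "\<dots> = (\<Sum>l\<in>UNIV. fB t i l * fH t l j)"
      by (simp add: tsum_sum[OF tsummable_mult[OF sB sv(2) R0(1)] t] tsum_mult[OF sB sv(2) t] fB_def fH_def)
    finally show ?thesis .
  qed
  have inv: "(\<Sum>l\<in>UNIV. fB t i l * fG t l j) + fB t i j = (if i = j then 1 else 0)" if t: "\<bar>t\<bar> \<le> R" for t i j
  proof -
    have eq: "(\<Sum>l\<in>UNIV. \<Sum>m\<le>n. inv_jac Q m i l * disp_grad Q (n - m) l j) + inv_jac Q n i j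
        = (if n = 0 then (if i = j then 1 else 0) else 0)" for n
    proof (cases "n = 0")
      case True
      then show ?thesis by (simp add: disp_grad_def disp_def inv_jac_def inv_series_0)
    next
      case False
      have "(\<Sum>l\<in>UNIV. \<Sum>m\<le>n. inv_jac Q m i l * disp_grad Q (n - m) l j)
          = (\<Sum>m<n. \<Sum>l\<in>UNIV. inv_jac Q m i l * disp_grad Q (n - m) l j)"
        by (subst sum.swap) (simp add: lessThan_Suc_atMost[symmetric] disp_grad_def disp_def)
      then show ?thesis using False inv_series_pos[of n "disp_grad Q" i j] by (simp add: inv_jac_def)
    qed
    have "tsum (\<lambda>n. (\<Sum>l\<in>UNIV. \<Sum>m\<le>n. inv_jac Q m i l * disp_grad Q (n - m) l j) + inv_jac Q n i j) t
        = (\<Sum>l\<in>UNIV. fB t i l * fG t l j) + fB t i j"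
      by (subst tsum_add[OF tsummable_sum sB t])
         (auto simp: tsum_sum[OF tsummable_mult[OF sB sx(2) R0(1)] t] tsum_mult[OF sB sx(2) t] fB_def fG_def
            intro: tsummable_mult sB sx R0)
    then show ?thesis unfolding eq tsum_single by simp
  qed
  \<comment> \<open>The divergence equations of all orders, summed: tr(B DQ) - tr((B H)^2) has no
    nonzero frequency, hence is a function of time only.\<close>
  have divconst: "coef ((\<Sum>i\<in>UNIV. \<Sum>j\<in>UNIV. fB t i j * fD t j i) - (\<Sum>i\<in>UNIV. \<Sum>j\<in>UNIV. fK t i j * fK t j i)) k = 0"
    if t: "\<bar>t\<bar> \<le> R" and k: "k \<noteq> 0" for t k
  proof -
    define e where "e = (\<lambda>n. (\<Sum>i\<in>UNIV. \<Sum>j\<in>UNIV. \<Sum>m\<le>n. inv_jac Q m i j * der i (Q (n - m) j))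
        + - (\<Sum>i\<in>UNIV. \<Sum>j\<in>UNIV. \<Sum>m\<le>n. euler_grad Q m i j * euler_grad Q (n - m) j i))"
    have s1: "tsummable R (\<lambda>n. \<Sum>m\<le>n. inv_jac Q m i j * der i (Q (n - m) j))"
      and s2: "tsummable R (\<lambda>n. \<Sum>m\<le>n. euler_grad Q m i j * euler_grad Q (n - m) j i)" for i j
      by (intro tsummable_mult sB sq sK R0)+
    have s2': "tsummable R (\<lambda>n. - (\<Sum>i\<in>UNIV. \<Sum>j\<in>UNIV. \<Sum>m\<le>n. euler_grad Q m i j * euler_grad Q (n - m) j i))"
      by (intro tsummable_linear[OF bounded_linear_minus[OF bounded_linear_ident]] tsummable_sum s2 R0)
    have se: "tsummable R e" unfolding e_def by (intro tsummable_add tsummable_sum s1 s2' R0)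
    have te: "tsum e t = (\<Sum>i\<in>UNIV. \<Sum>j\<in>UNIV. fB t i j * fD t j i) - (\<Sum>i\<in>UNIV. \<Sum>j\<in>UNIV. fK t i j * fK t j i)"
      unfolding e_def
      by (subst tsum_add[OF _ s2' t], intro tsummable_sum s1 R0,
          subst tsum_uminus[OF _ t], intro tsummable_sum s2 R0)
         (simp add: tsum_sum[OF tsummable_sum[OF s1 R0(1)] t] tsum_sum[OF s1 t] tsum_mult[OF sB sq(2) t]
            tsum_sum[OF tsummable_sum[OF s2 R0(1)] t] tsum_sum[OF s2 t] tsum_mult[OF sK sK t] fB_def fD_def fK_def)
    have e0: "coef (e n) k = 0" for n
    proof -
      have sw: "(\<Sum>i\<in>UNIV. \<Sum>j\<in>UNIV. \<Sum>m\<le>n. F m i j) = (\<Sum>m\<le>n. \<Sum>i\<in>UNIV. \<Sum>j\<in>UNIV. F m i j)"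
        for F :: "nat \<Rightarrow> 'n \<Rightarrow> 'n \<Rightarrow> 'n wiener"
        by (simp only: sum.swap[of _ UNIV "{..n}"])
      have "{..n} = insert 0 {1..n}" by auto
      then have "(\<Sum>m\<le>n. \<Sum>i\<in>UNIV. \<Sum>j\<in>UNIV. inv_jac Q m i j * der i (Q (n - m) j))
          = (\<Sum>j\<in>UNIV. der j (Q n j)) + (\<Sum>m\<in>{1..n}. \<Sum>i\<in>UNIV. \<Sum>j\<in>UNIV. inv_jac Q m i j * der i (Q (n - m) j))"
        by (simp add: inv_jac_def inv_series_0 if_distrib[of "\<lambda>x. x * _"] cong: if_cong)
      then have "e n = (\<Sum>j\<in>UNIV. der j (Q n j)) - div_rhs Q n"
        unfolding e_def div_rhs_def sw by simp
      then show ?thesis using step[of n] k by (simp add: step_def)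
    qed
    have "coef (tsum e t) k = 0"
      using tsum_linear[OF bounded_linear_coef se t, of k] e0 by (simp add: tsum_def)
    then show ?thesis unfolding te .
  qed
  \<comment> \<open>The projection of (I + D\<xi>)^T (1 - g) Q vanishes at every order, so this
    field is a gradient, with the potential of \<open>leray_zero_imp_gradient\<close>.\<close>
  have gradient: "(1 - g) * q t j + (\<Sum>i\<in>UNIV. fG t i j * ((1 - g) * q t i))
      = der j (\<Sum>l\<in>UNIV. sol l ((1 - g) * q t l + (\<Sum>i\<in>UNIV. fG t i l * ((1 - g) * q t i))))"
    if t: "\<bar>t\<bar> \<le> R" for t j
  proof (rule leray_zero_imp_gradient, rule ext)
    fix j
    define z where "z = (\<lambda>j n. (1 - g) * Q n j + (\<Sum>i\<in>UNIV. \<Sum>m\<le>n. disp_grad Q m i j * ((1 - g) * Q (n - m) i)))"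
    have sg: "tsummable R (\<lambda>n. (1 - g) * Q n i)" for i
      by (rule tsummable_linear[OF bounded_linear_mult_right sq(1) R0(1)])
    have sm: "tsummable R (\<lambda>n. \<Sum>m\<le>n. disp_grad Q m i j * ((1 - g) * Q (n - m) i))" for i j
      by (rule tsummable_mult[OF sx(2) sg R0(1)])
    have sz: "tsummable R (z j)" for j unfolding z_def by (intro tsummable_add tsummable_sum sg sm R0)
    have tg: "tsum (\<lambda>n. (1 - g) * Q n i) t = (1 - g) * q t i" for i
      unfolding q_def by (rule tsum_linear[OF bounded_linear_mult_right sq(1) t])
    have tz: "tsum (z j) t = (1 - g) * q t j + (\<Sum>i\<in>UNIV. fG t i j * ((1 - g) * q t i))" for j
      unfolding z_def
      by (subst tsum_add[OF sg _ t], intro tsummable_sum sm R0)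
         (simp add: tsum_sum[OF sm t] tsum_mult[OF sx(2) sg t] tg fG_def)
    have z0: "leray (\<lambda>j. z j n) j = 0" for n
    proof -
      have lsum: "leray (\<lambda>l. \<Sum>i\<in>I. P i l) j = (\<Sum>i\<in>I. leray (P i) j)" for I and P :: "'b \<Rightarrow> 'n \<Rightarrow> 'n wiener"
        by (rule wiener_eqI) (simp add: coef_leray coef_sum sum_distrib_left sum.swap[of _ I])
      have "leray (\<lambda>j. z j n) j = leray (\<lambda>j. (1 - g) * Q n j) j
          + (\<Sum>m\<le>n. \<Sum>i\<in>UNIV. leray (\<lambda>l. disp_grad Q m i l * ((1 - g) * Q (n - m) i)) j)"
        unfolding z_def leray_add lsum by (subst sum.swap) simp
      also have "{..n} = insert 0 {1..n}" by auto
      also have "(\<Sum>m\<in>insert 0 {1..n}. \<Sum>i\<in>UNIV. leray (\<lambda>l. disp_grad Q m i l * ((1 - g) * Q (n - m) i)) j)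
          = (\<Sum>m\<in>{1..n}. \<Sum>i\<in>UNIV. leray (\<lambda>l. disp_grad Q m i l * ((1 - g) * Q (n - m) i)) j)"
        by (simp add: disp_grad_def disp_def leray_def leray_entry_def linear_0[OF bounded_linear.linear[OF bounded_linear_fmul[OF bounded_multiplier_leray]]])
      also have "leray (\<lambda>j. (1 - g) * Q n j) j + \<dots> = 0"
        using step[of n] by (simp add: step_def curl_rhs_def disp_grad_def)
      finally show ?thesis .
    qed
    have "leray (\<lambda>j. tsum (z j) t) j = tsum (\<lambda>n. leray (\<lambda>j. z j n) j) t"
      unfolding leray_def
      by (subst tsum_sum[OF tsummable_linear[OF bounded_linear_leray_entry sz R0(1)] t])
         (simp add: tsum_linear[OF bounded_linear_leray_entry sz t])
    also have "\<dots> = 0" unfolding z0 by (simp add: tsum_def)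
    finally show "leray (\<lambda>j. (1 - g) * q t j + (\<Sum>i\<in>UNIV. fG t i j * ((1 - g) * q t i))) j = 0"
      unfolding tz .
  qed
  define \<xi> where "\<xi> = (\<lambda>t x. \<chi> i. ev (X t i) x)"
  define V' where "V' = (\<lambda>t x. \<chi> i. ev (v t i) x)"
  define W' where "W' = (\<lambda>t x. \<chi> i. ev (q t i) x)"
  define G' where "G' = (\<lambda>t x. \<chi> i j. ev (fG t i j) x)"
  define H' where "H' = (\<lambda>t x. \<chi> i j. ev (fH t i j) x)"
  define B' where "B' = (\<lambda>t x. \<chi> i j. ev (fB t i j) x)"
  define D' where "D' = (\<lambda>t x. \<chi> i j. ev (fD t i j) x)"
  define p where "p = (\<lambda>t. \<Sum>l\<in>UNIV. sol l ((1 - g) * q t l + (\<Sum>i\<in>UNIV. fG t i l * ((1 - g) * q t i))))"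
  have ent: "G' t x $ i $ j = ev (fG t i j) x" "H' t x $ i $ j = ev (fH t i j) x"
    "B' t x $ i $ j = ev (fB t i j) x" "D' t x $ i $ j = ev (fD t i j) x" for t x i j
    by (simp_all add: G'_def H'_def B'_def D'_def)
  have BG: "B' t x ** (mat 1 + G' t x) = mat 1" if t: "\<bar>t\<bar> < R" for t x
  proof -
    have "(\<Sum>l\<in>UNIV. ev (fB t i l) x * ((if l = j then 1 else 0) + ev (fG t l j) x)) = (if i = j then 1 else 0)" for i j
    proof -
      have "(\<Sum>l\<in>UNIV. ev (fB t i l) x * ((if l = j then 1 else 0) + ev (fG t l j) x))
          = ev ((\<Sum>l\<in>UNIV. fB t i l * fG t l j) + fB t i j) x"
        by (simp add: ev_sum distrib_left sum.distrib if_distrib[of "\<lambda>y. _ * y"] cong: if_cong)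
      also have "\<dots> = (if i = j then 1 else 0)" using inv[of t i j] t by simp
      finally show ?thesis .
    qed
    then show ?thesis by (simp add: vec_eq_iff matrix_matrix_mult_def mat_def ent)
  qed
  have GB': "(mat 1 + G' t x) ** B' t x = mat 1" if "\<bar>t\<bar> < R" for t x
    using BG[OF that] by (simp add: matrix_left_right_inverse)
  have Gle: "norm (G' t x *v h) \<le> norm h / 4" if t: "\<bar>t\<bar> < R" for t x h
  proof -
    have sG: "summable (\<lambda>n. R ^ n * norm (disp_grad Q n i j))" for i j using sx(2) by (simp add: tsummable_def)
    have "\<bar>ev (fG t i j) x\<bar> \<le> (\<Sum>n. R ^ n * norm (disp_grad Q n i j))" for i j
      unfolding fG_def by (rule order_trans[OF abs_ev_le norm_tsum_le[OF sx(2)]]) (use t in simp)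
    then have "(\<Sum>i\<in>UNIV. \<Sum>j\<in>UNIV. \<bar>G' t x $ i $ j\<bar>) \<le> (\<Sum>i\<in>UNIV. \<Sum>j\<in>UNIV. \<Sum>n. R ^ n * norm (disp_grad Q n i j))"
      unfolding ent by (intro sum_mono)
    also have "\<dots> = (\<Sum>n. R ^ n * mnorm (disp_grad Q n))"
      using sG by (simp add: mnorm_def sum_distrib_left suminf_sum summable_sum)
    also have "\<dots> \<le> 1/4"
      by (rule suminf_le_const[OF summableI_nonneg_bounded[OF _ GB] GB]) (use R in simp)
    finally show ?thesis
      by (intro order_trans[OF norm_matrix_vector_le]) (use mult_right_mono[of _ "1/4" "norm h"] in force)
  qed
  have tR: "\<bar>t\<bar> \<le> R" if "\<bar>t\<bar> < R" for t using that by simp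
  have d_fG: "((\<lambda>t. ev (fG t i j) x) has_real_derivative ev (fH t i j) x) (at t)" if "\<bar>t\<bar> < R" for t x i j
    unfolding fG_def fH_def
    by (rule has_derivative_tsum_time[OF sx(2) sv(2) _ that])
       (simp add: disp_grad_def vel_grad_def disp_def[of Q "Suc _"] der_scaleR Av)
  have d_fH: "((\<lambda>t. ev (fH t i j) x) has_real_derivative ev (fD t i j) x) (at t)" if "\<bar>t\<bar> < R" for t x i j
    unfolding fH_def fD_def
    by (rule has_derivative_tsum_time[OF sv(2) sq(2) _ that])
       (simp add: vel_grad_def vel_def[of Q "Suc _"] der_scaleR A)
  define c where "c = (\<lambda>t. Re (coef ((\<Sum>i\<in>UNIV. \<Sum>j\<in>UNIV. fB t i j * fD t j i) - (\<Sum>i\<in>UNIV. \<Sum>j\<in>UNIV. fK t i j * fK t j i)) 0))"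
  have c: "trace (B' t x ** D' t x) - trace ((B' t x ** H' t x) ** (B' t x ** H' t x)) = c t" if t: "\<bar>t\<bar> < R" for t x
  proof -
    have "(B' t x ** H' t x) $ i $ j = ev (fK t i j) x" for i j
      by (simp add: matrix_matrix_mult_def ent fK[OF tR[OF t]] ev_sum)
    then show ?thesis
      using ev_constant[OF divconst[OF tR[OF t]], of x]
      by (simp add: trace_def matrix_matrix_mult_def[of "B' t x" "D' t x"] matrix_matrix_mult_def[of "B' t x ** H' t x"] ent c_def ev_sum)
  qed
  \<comment> \<open>The entries of B are power series, hence differentiable; the value -B H B of the
    derivative comes from differentiating B (I + G) = I. So the time derivative of tr(B H) is
    \<open>c t\<close>, the same at all points.\<close>
  have d_tr: "((\<lambda>t. trace (B' t x ** H' t x)) has_real_derivative c t) (at t)" if t: "\<bar>t\<bar> < R" for t x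
  proof -
    have "\<forall>i j. \<exists>d. ((\<lambda>t. B' t x $ i $ j) has_real_derivative d) (at t)"
      unfolding ent fB_def using ev_tsum_differentiable[OF sB t] by metis
    then obtain bd where bd: "\<And>i j. ((\<lambda>t. B' t x $ i $ j) has_real_derivative bd i j) (at t)" by metis
    define Bd where "Bd = (\<chi> i j. bd i j)"
    have "(Bd ** (mat 1 + G' t x) + B' t x ** H' t x) $ i $ j = 0" for i j
    proof -
      have "((\<lambda>t. (B' t x ** (mat 1 + G' t x)) $ i $ j) has_real_derivative (Bd ** (mat 1 + G' t x) + B' t x ** H' t x) $ i $ j) (at t)"
        unfolding matrix_matrix_mult_def vec_lambda_beta vector_add_component sum.distrib[symmetric]
      proof (rule DERIV_sum)
        fix l
        have "((\<lambda>t. (mat 1 + G' t x) $ l $ j) has_real_derivative H' t x $ l $ j) (at t)"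
          unfolding vector_add_component ent using DERIV_add[OF DERIV_const d_fG[OF t]] by simp
        from DERIV_mult'[OF bd[of i l] this]
        show "((\<lambda>t. B' t x $ i $ l * (mat 1 $ l $ j + G' t x $ l $ j)) has_real_derivative
            Bd $ i $ l * (mat 1 $ l $ j + G' t x $ l $ j) + B' t x $ i $ l * H' t x $ l $ j) (at t)"
          by (simp add: Bd_def add.commute)
      qed
      moreover have "((\<lambda>t. (B' t x ** (mat 1 + G' t x)) $ i $ j) has_real_derivative 0) (at t)"
        by (rule has_field_derivative_transform_within_open[OF DERIV_const, of "{-R<..<R}" _ "mat 1 $ i $ j"])
           (use t BG in auto)
      ultimately show ?thesis by (rule DERIV_unique)
    qed
    then have "Bd ** (mat 1 + G' t x) = - (B' t x ** H' t x)"
      by (simp add: vec_eq_iff eq_neg_iff_add_eq_0)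
    then have "(Bd ** (mat 1 + G' t x)) ** B' t x = - (B' t x ** H' t x) ** B' t x" by simp
    then have Bd: "Bd = - (B' t x ** H' t x) ** B' t x"
      using GB'[OF t, of x] by (simp add: matrix_mul_assoc[symmetric] minus_matrix_mult)
    have "((\<lambda>t. trace (B' t x ** H' t x)) has_real_derivative trace (Bd ** H' t x) + trace (B' t x ** D' t x)) (at t)"
      unfolding trace_def matrix_matrix_mult_def vec_lambda_beta sum.distrib[symmetric]
    proof (intro DERIV_sum)
      fix i j
      have "((\<lambda>t. H' t x $ j $ i) has_real_derivative D' t x $ j $ i) (at t)" unfolding ent by (rule d_fH[OF t])
      from DERIV_mult'[OF bd[of i j] this]
      show "((\<lambda>t. B' t x $ i $ j * H' t x $ j $ i) has_real_derivative
          Bd $ i $ j * H' t x $ j $ i + B' t x $ i $ j * D' t x $ j $ i) (at t)"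
        by (simp add: Bd_def add.commute)
    qed
    moreover have "trace (Bd ** H' t x) = - trace ((B' t x ** H' t x) ** (B' t x ** H' t x))"
    proof -
      have "Bd ** H' t x = - ((B' t x ** H' t x) ** (B' t x ** H' t x))"
        unfolding Bd by (simp only: matrix_mul_assoc minus_matrix_mult)
      then show ?thesis by (simp add: trace_def sum_negf)
    qed
    ultimately show ?thesis using c[OF t, of x] by simp
  qed
  have tr0: "trace (B' 0 x ** H' 0 x) = 0" for x
  proof -
    have "trace (B' 0 x ** H' 0 x) = (\<Sum>i\<in>UNIV. H' 0 x $ i $ i)"
    proof -
      have "B' 0 x = mat 1"
        by (simp add: vec_eq_iff ent fB_def inv_jac_def inv_series_0 mat_def)
      then show ?thesis by (simp add: trace_def)
    qed
    also have "\<dots> = ev (\<Sum>i\<in>UNIV. der i (U i)) x" by (simp add: ent fH_def vel_grad_def vel_def[abs_def] ev_sum)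
    finally show ?thesis using divU by simp
  qed
  \<comment> \<open>Initially the trace is the divergence of \<open>U\<close>, that is 0, at all
    points, and afterwards its time derivatives at different points agree.\<close>
  have tr_const: "trace (B' t x ** H' t x) = trace (B' t 0 ** H' t 0)" if t: "\<bar>t\<bar> < R" for t x
    using has_real_derivative_zero_const[of R "\<lambda>t. trace (B' t x ** H' t x) - trace (B' t 0 ** H' t 0)" t]
      DERIV_diff[OF d_tr d_tr] t tr0 by simp
  have d_det: "((\<lambda>t. det (mat 1 + G' t x)) has_real_derivative det (mat 1 + G' t x) * trace (B' t x ** H' t x)) (at t)"
    if t: "\<bar>t\<bar> < R" for t x
    by (rule has_real_derivative_det[where A = "\<lambda>t. mat 1 + G' t x", OF _ BG[OF t]])
       (use DERIV_add[OF DERIV_const d_fG[OF t]] in \<open>simp add: ent\<close>)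
  have Gle2: "norm (G' t x *v h) \<le> norm h / 2" if "\<bar>t\<bar> < R" for t x h
    using Gle[OF that, of x h] norm_ge_zero[of h] by linarith
  have det_pos: "det (mat 1 + G' t x) > 0" if "\<bar>t\<bar> < R" for t x
    by (rule det_add_nonneg[OF Gle2[OF that]])
  have G0: "G' 0 x = 0" for x
    by (simp add: vec_eq_iff ent fG_def disp_grad_def disp_def)
  \<comment> \<open>By Jacobi's formula the logarithmic time derivative of the determinant is tr(B
    H), the same at all points; so the quotient of the determinants at two points keeps its initial
    value 1.\<close>
  have det_const: "det (mat 1 + G' t x) = det (mat 1 + G' t 0)" if t: "\<bar>t\<bar> < R" for t x
  proof -
    have "det (mat 1 + G' t x) / det (mat 1 + G' t 0) = det (mat 1 + G' 0 x) / det (mat 1 + G' 0 0)"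
    proof (rule has_real_derivative_zero_const[OF _ t])
      fix s assume s: "\<bar>s\<bar> < R"
      show "((\<lambda>t. det (mat 1 + G' t x) / det (mat 1 + G' t 0)) has_real_derivative 0) (at s)"
        using DERIV_divide[OF d_det[OF s, of x] d_det[OF s, of 0]] det_pos[OF s, of 0] tr_const[OF s, of x]
        by (simp add: mult_ac)
    qed
    then show ?thesis using det_pos[OF t, of 0] by (simp add: G0)
  qed
  have D_\<xi>: "(\<xi> t has_derivative (\<lambda>h. G' t x *v h)) (at x)" and D_V: "(V' t has_derivative (\<lambda>h. H' t x *v h)) (at x)"
    if t: "\<bar>t\<bar> < R" for t x
    unfolding \<xi>_def V'_def G'_def H'_def derX[OF tR[OF t], symmetric] derv[OF tR[OF t], symmetric]
    by (rule has_derivative_vec_ev[OF AX(1)[OF tR[OF t]]], rule has_derivative_vec_ev[OF AX(2)[OF tR[OF t]]])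
  have tor: "torus_fun (\<lambda>x. \<chi> i. ev (F i) x)" "torus_fun (\<lambda>x. \<chi> i j. ev (F' i j) x)"
    for F :: "'n \<Rightarrow> 'n wiener" and F' :: "'n \<Rightarrow> 'n \<Rightarrow> 'n wiener"
    using torus_fun_ev by (auto simp: torus_fun_def vec_eq_iff)
  \<comment> \<open>A determinant that is constant in space equals its mean, which is 1 since id +
    \<xi> is a small periodic perturbation of the identity.\<close>
  have det1: "det (mat 1 + G' t x) = 1" if t: "\<bar>t\<bar> < R" for t x
  proof -
    have "((\<lambda>x. det (mat 1 + G' t x)) has_integral 1) unit_cube"
      by (rule has_integral_det[OF _ D_\<xi>[OF t] Gle2[OF t]]) (simp add: \<xi>_def tor)
    then have "((\<lambda>x. det (mat 1 + G' t 0)) has_integral 1) (unit_cube :: (real^'n) set)"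
      using det_const[OF t] by (metis (no_types, lifting) has_integral_eq)
    moreover have "((\<lambda>x. det (mat 1 + G' t 0)) has_integral det (mat 1 + G' t 0)) (unit_cube :: (real^'n) set)"
      using has_integral_const[of "det (mat 1 + G' t 0)" 0 "(\<chi> i. 1) :: real^'n"]
      by (simp add: unit_cube_def content_cbox_if_cart interval_eq_empty_cart)
    ultimately have "det (mat 1 + G' t 0) = 1" by (metis has_integral_unique)
    then show ?thesis using det_const[OF t, of x] by simp
  qed
  \<comment> \<open>Only now does the trace itself vanish: the determinant is constant in time as
    well.\<close>
  have tr_zero: "trace (B' t x ** H' t x) = 0" if t: "\<bar>t\<bar> < R" for t x
  proof -
    have "((\<lambda>t. det (mat 1 + G' t x)) has_real_derivative 0) (at t)"
      by (rule has_field_derivative_transform_within_open[OF DERIV_const, of "{-R<..<R}" _ 1])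
         (use t det1 in auto)
    from DERIV_unique[OF d_det[OF t] this] show ?thesis by (simp add: det1[OF t])
  qed
  have "euler_flow R \<xi> V' W' G' H' B' (\<lambda>t. ev (p t)) (\<lambda>x. 1 - ev g x)"
  proof
    show "R > 0" by (rule R)
    show "torus_fun (\<xi> t)" "torus_fun (V' t)" "torus_fun (B' t)" "torus_fun (ev (p t))" for t
      by (simp_all add: \<xi>_def V'_def B'_def tor torus_fun_ev)
    show "\<xi> 0 x = 0" for x by (simp add: \<xi>_def X_def disp_def vec_eq_iff)
    show "((\<lambda>t. \<xi> t x) has_vector_derivative V' t x) (at t)" if t: "\<bar>t\<bar> < R" for t x
    proof (rule has_vector_derivative_vecI)
      show "((\<lambda>t. \<xi> t x $ i) has_real_derivative V' t x $ i) (at t)" for i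
        unfolding \<xi>_def V'_def X_def v_def vec_lambda_beta
        by (rule has_derivative_tsum_time[OF sx(1) sv(1) _ t]) (simp add: disp_def)
    qed
    show "((\<lambda>t. V' t x) has_vector_derivative W' t x) (at t)" if t: "\<bar>t\<bar> < R" for t x
    proof (rule has_vector_derivative_vecI)
      show "((\<lambda>t. V' t x $ i) has_real_derivative W' t x $ i) (at t)" for i
        unfolding V'_def W'_def v_def q_def vec_lambda_beta
        by (rule has_derivative_tsum_time[OF sv(1) sq(1) _ t]) (simp add: vel_def)
    qed
    show "(\<xi> t has_derivative (\<lambda>h. G' t x *v h)) (at x)" "(V' t has_derivative (\<lambda>h. H' t x *v h)) (at x)"
      if "\<bar>t\<bar> < R" for t x using D_\<xi>[OF that] D_V[OF that] by auto
    show "(ev (p t) has_derivative (\<lambda>h. (((1 - ev g x) *\<^sub>R W' t x) v* (mat 1 + G' t x)) \<bullet> h)) (at x)"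
      if t: "\<bar>t\<bar> < R" for t x
    proof -
      have pA: "p t \<in> A1" unfolding p_def by (intro A1_sum A1_sol)
      have "(((1 - ev g x) *\<^sub>R W' t x) v* (mat 1 + G' t x)) $ j = ev (der j (p t)) x" for j
      proof -
        have "ev (der j (p t)) x = (1 - ev g x) * ev (q t j) x + (\<Sum>i\<in>UNIV. ev (fG t i j) x * ((1 - ev g x) * ev (q t i) x))"
          unfolding p_def gradient[OF tR[OF t], symmetric] by (simp add: ev_sum)
        then show ?thesis
          by (simp add: vector_matrix_mult_def W'_def ent mat_def distrib_left sum.distrib if_distrib[of "\<lambda>y. _ * y"] mult_ac cong: if_cong)
      qed
      then show ?thesis using has_derivative_ev[OF pA] by (simp add: inner_vec_def)
    qed
    show "continuous_on ({-R<..<R} \<times> UNIV) (\<lambda>(t, x). \<xi> t x)" "continuous_on ({-R<..<R} \<times> UNIV) (\<lambda>(t, x). V' t x)"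
      "continuous_on ({-R<..<R} \<times> UNIV) (\<lambda>(t, x). W' t x)"
      unfolding \<xi>_def V'_def W'_def X_def v_def q_def
      by (rule continuous_on_tsum_vec[OF sx(1)], rule continuous_on_tsum_vec[OF sv(1)], rule continuous_on_tsum_vec[OF sq(1)])
    show "continuous_on ({-R<..<R} \<times> UNIV) (\<lambda>(t, x). G' t x)" "continuous_on ({-R<..<R} \<times> UNIV) (\<lambda>(t, x). H' t x)"
      "continuous_on ({-R<..<R} \<times> UNIV) (\<lambda>(t, x). B' t x)"
      unfolding G'_def H'_def B'_def fG_def fH_def fB_def
      by (rule continuous_on_tsum_mat[OF sx(2)], rule continuous_on_tsum_mat[OF sv(2)], rule continuous_on_tsum_mat[OF sB])
    show "continuous_on UNIV (\<lambda>x. 1 - ev g x)" by (intro continuous_intros)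
    show "norm (G' t x *v h) \<le> norm h / 4" "det (mat 1 + G' t x) = 1" "B' t x ** (mat 1 + G' t x) = mat 1"
      "trace (B' t x ** H' t x) = 0" if "\<bar>t\<bar> < R" for t x h
      using Gle[OF that] det1[OF that] BG[OF that] tr_zero[OF that] by auto
    show "real_analytic_on (\<lambda>t. \<xi> t x) {-R<..<R}" for x
      by (rule real_analytic_on_tsum[where a = "\<lambda>i n. ev (disp Q n i) x"])
         (use summable_ev[OF sx(1) R0(1)] ev_tsum_eq[OF sx(1)] in \<open>auto simp: \<xi>_def X_def\<close>)
  qed
  moreover have "V' 0 x = (\<chi> j. ev (U j) x)" for x by (simp add: V'_def v_def vel_def)
  ultimately show ?thesis by blast
qed

end

section \<open>Fourier uniqueness and Sobolev spaces\<close>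

lemma ex_wiener_Re_chr: "\<exists>f. \<forall>x. ev f x = Re (a * chr m x)"
proof -
  \<comment> \<open>The real part is split evenly between m and -m; for m = 0 the two halves fall
    together and add up to Re a.\<close>
  define c where "c = (\<lambda>k. (if k = m then a / 2 else 0) + (if k = - m then cnj a / 2 else 0))"
  have c: "c abs_summable_on UNIV"
    unfolding c_def by (intro abs_summable_add abs_summable_single)
  have herm: "c (- k) = cnj (c k)" for k by (auto simp: c_def minus_equation_iff[of k])
  have "fseries c x = a / 2 * chr m x + cnj a / 2 * chr (- m) x" for x
  proof -
    have "c k * chr k x = (if k = m then a / 2 * chr k x else 0) + (if k = - m then cnj a / 2 * chr k x else 0)" for k
      by (simp only: c_def distrib_right if_distrib[of "\<lambda>y. y * chr k x"] mult_zero_left)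
    then have "fseries c x = (\<Sum>\<^sub>\<infinity>k. (if k = m then a / 2 * chr k x else 0) + (if k = - m then cnj a / 2 * chr k x else 0))"
      by (simp add: fseries_def)
    also have "\<dots> = (\<Sum>\<^sub>\<infinity>k. if k = m then a / 2 * chr k x else 0) + (\<Sum>\<^sub>\<infinity>k. if k = - m then cnj a / 2 * chr k x else 0)"
      by (rule infsum_add; rule finite_nonzero_values_imp_summable_on) auto
    finally show ?thesis by (simp add: infsum_single)
  qed
  then have "ev (Wiener c) x = Re (a * chr m x)" for x
    using coef_Wiener[OF c herm] by (simp add: ev_def evc_def chr_minus)
  then show ?thesis by blast
qed

text \<open>Realizes the torus as a compact subset of complex d-space, so that the theorem of Stone
  and Weierstrass for polynomials applies; a real polynomial restricted to it is an element of the
  Wiener algebra.\<close>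

definition torus_embedding :: "real^'n \<Rightarrow> complex^'n" where
  "torus_embedding x = (\<chi> j. chr (axis j 1) x)"

lemma inner_int_vec_axis: "int_vec (axis j 1) \<bullet> x = x $ j"
proof -
  have "int_vec (axis j 1) = axis j 1" by (simp add: vec_eq_iff axis_def)
  then show ?thesis by (simp add: inner_axis')
qed

lemma torus_embedding_eq:
  assumes "torus_embedding x = torus_embedding y" "torus_fun f"
  shows "f x = f y"
proof -
  have "\<forall>j. \<exists>m. x $ j - y $ j = of_int m"
  proof
    fix j
    have "chr (axis j 1) x = chr (axis j 1) y"
      using assms(1) by (simp add: torus_embedding_def vec_eq_iff)
    then have "cis (2 * pi * (x $ j)) = cis (2 * pi * (y $ j))"
      by (simp add: chr_def inner_int_vec_axis)
    then obtain m :: int where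
      m: "\<i> * complex_of_real (2 * pi * (x $ j)) = \<i> * complex_of_real (2 * pi * (y $ j)) + (of_int (2 * m) * pi) * \<i>"
      unfolding cis_conv_exp exp_eq by blast
    have "2 * pi * (x $ j) = 2 * pi * (y $ j + m)"
      using arg_cong[OF m, of Im] by (simp add: algebra_simps)
    then have "x $ j = y $ j + m" by (simp only: mult_cancel_left) simp
    then show "\<exists>m. x $ j - y $ j = of_int m" by auto
  qed
  then obtain k where "\<And>j. x $ j - y $ j = of_int (k j)" by metis
  then have "x = y + int_vec (\<chi> j. k j)" by (simp add: vec_eq_iff algebra_simps)
  then show ?thesis using torus_fun_int_vec[OF assms(2)] by simp
qed

lemma continuous_on_torus_embedding: "continuous_on S torus_embedding"
  unfolding torus_embedding_def by (intro continuous_intros)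

lemma polynomial_torus_embedding:
  fixes h :: "complex^'n \<Rightarrow> real"
  assumes "real_polynomial_function h"
  shows "\<exists>f. \<forall>x. h (torus_embedding x) = ev f x"
  using assms
proof (induction rule: real_polynomial_function.induct)
  case (linear h)
  have "\<forall>b. \<exists>f. b \<in> Basis \<longrightarrow> (\<forall>x. torus_embedding x \<bullet> b = ev f (x :: real^'n))"
  proof (intro allI)
    fix b :: "complex^'n"
    show "\<exists>f. b \<in> Basis \<longrightarrow> (\<forall>x. torus_embedding x \<bullet> b = ev f x)"
    proof (cases "b \<in> Basis")
      case True
      then obtain j c where b: "b = axis j c" by (auto simp: Basis_vec_def)
      obtain f where "\<And>x. ev f x = Re (cnj c * chr (axis j 1) x)" using ex_wiener_Re_chr by blast
      then show ?thesis by (intro exI[of _ f]) (simp add: b torus_embedding_def inner_axis inner_complex_def)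
    qed simp
  qed
  then obtain f where f: "\<And>b x. b \<in> Basis \<Longrightarrow> torus_embedding x \<bullet> b = ev (f b) (x :: real^'n)" by metis
  have "h (torus_embedding x) = ev (\<Sum>b\<in>Basis. h b *\<^sub>R f b) x" for x
  proof -
    have "h (torus_embedding x) = h (\<Sum>b\<in>Basis. (torus_embedding x \<bullet> b) *\<^sub>R b)"
      by (simp add: euclidean_representation)
    also have "\<dots> = (\<Sum>b\<in>Basis. (torus_embedding x \<bullet> b) * h b)"
      using linear by (simp add: bounded_linear.linear linear_sum linear_scale)
    finally show ?thesis by (simp add: ev_sum f mult.commute)
  qed
  then show ?case by blast
next
  case (const c)
  then show ?case by (intro exI[of _ "c *\<^sub>R 1"]) simp
next
  case (add h1 h2)
  then obtain f1 f2 where "\<forall>x. h1 (torus_embedding x) = ev f1 x" "\<forall>x. h2 (torus_embedding x) = ev f2 x" by blast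
  then show ?case by (intro exI[of _ "f1 + f2"]) simp
next
  case (mult h1 h2)
  then obtain f1 f2 where "\<forall>x. h1 (torus_embedding x) = ev f1 x" "\<forall>x. h2 (torus_embedding x) = ev f2 x" by blast
  then show ?case by (intro exI[of _ "f1 * f2"]) simp
qed

lemma compact_unit_cube: "compact unit_cube"
  by (simp add: unit_cube_def)

lemma ev_dense:
  fixes g :: "real^'n \<Rightarrow> real"
  assumes g: "torus_fun g" "continuous_on UNIV g" and e: "e > 0"
  shows "\<exists>f. \<forall>x\<in>unit_cube. \<bar>g x - ev f x\<bar> < e"
proof -
  let ?S = "torus_embedding ` (unit_cube :: (real^'n) set)"
  define h where "h z = g (SOME x. x \<in> unit_cube \<and> torus_embedding x = z)" for z
  have h: "h (torus_embedding x) = g x" if "x \<in> unit_cube" for x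
  proof -
    have "torus_embedding (SOME y. y \<in> unit_cube \<and> torus_embedding y = torus_embedding x) = torus_embedding x"
      using that by (rule_tac someI2[of _ x]) auto
    then show ?thesis unfolding h_def by (rule torus_embedding_eq[OF _ g(1)])
  qed
  have S: "compact ?S" "compact (g ` unit_cube)"
    by (intro compact_continuous_image continuous_on_torus_embedding compact_unit_cube continuous_on_subset[OF g(2)]; simp)+
  \<comment> \<open>The function induced on the embedded torus is continuous because its graph is a
    continuous image of the compact cube, hence closed.\<close>
  have "continuous_on ?S h"
  proof (rule continuous_from_closed_graph[OF S(2)])
    show "h \<in> ?S \<rightarrow> g ` unit_cube" by (auto simp: h)
    have "(\<lambda>z. (z, h z)) ` ?S = (\<lambda>x. (torus_embedding x, g x)) ` unit_cube"
      by (auto simp: h image_iff)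
    moreover have "compact ((\<lambda>x. (torus_embedding x, g x)) ` unit_cube)"
      by (intro compact_continuous_image continuous_intros continuous_on_torus_embedding compact_unit_cube continuous_on_subset[OF g(2)]) simp
    ultimately show "closed ((\<lambda>z. (z, h z)) ` ?S)" by (simp add: compact_imp_closed)
  qed
  then obtain P where P: "real_polynomial_function P" "\<And>z. z \<in> ?S \<Longrightarrow> \<bar>h z - P z\<bar> < e"
    using Stone_Weierstrass_real_polynomial_function[OF S(1) _ e] by metis
  obtain f where "\<forall>x. P (torus_embedding x) = ev f x" using polynomial_torus_embedding[OF P(1)] by blast
  then show ?thesis using P(2) h by (intro exI[of _ f]) force
qed

text \<open>The Fourier series of f converges uniformly and g is bounded, so the orthogonality to
  characters may be summed under the integral.\<close>

lemma has_integral_mult_ev_zero: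
  fixes g :: "real^'n \<Rightarrow> real"
  assumes g: "torus_fun g" "continuous_on UNIV g"
    and zero: "\<And>k. ((\<lambda>x. of_real (g x) * chr k x) has_integral 0) unit_cube"
  shows "((\<lambda>x. g x * ev f x) has_integral 0) unit_cube"
proof -
  obtain M where M: "M > 0" "\<And>x. norm (g x) \<le> M" using torus_fun_bounded[OF g] by blast
  have "uniform_limit (cbox 0 (\<chi> i. 1)) (\<lambda>F x. \<Sum>k\<in>F. of_real (g x) * (coef f k * chr k x))
      (\<lambda>x. \<Sum>\<^sub>\<infinity>k. of_real (g x) * (coef f k * chr k x)) (finite_subsets_at_top UNIV)"
    by (rule Weierstrass_m_test_general[where M = "\<lambda>k. M * norm (coef f k)"])
       (use M coef_summable[of f] in \<open>auto simp: norm_mult intro!: mult_right_mono summable_on_cmult_right\<close>)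
  then obtain I J where IJ: "\<And>F. ((\<lambda>x. \<Sum>k\<in>F. of_real (g x) * (coef f k * chr k x)) has_integral I F) (cbox 0 (\<chi> i. 1))"
    "((\<lambda>x. \<Sum>\<^sub>\<infinity>k. of_real (g x) * (coef f k * chr k x)) has_integral J) (cbox 0 (\<chi> i. 1))"
    "(I \<longlongrightarrow> J) (finite_subsets_at_top UNIV)"
    by (rule uniform_limit_integral_cbox) (auto intro!: continuous_intros continuous_on_subset[OF g(2)])
  have "I F = 0" if "finite F" for F
  proof -
    have "((\<lambda>x. \<Sum>k\<in>F. coef f k * (of_real (g x) * chr k x)) has_integral (\<Sum>k\<in>F. coef f k * 0)) unit_cube"
      by (intro has_integral_sum has_integral_mult_right zero that)
    then show ?thesis using has_integral_unique[OF IJ(1)[of F, folded unit_cube_def]] by (simp add: mult_ac)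
  qed
  then have "eventually (\<lambda>F. I F = 0) (finite_subsets_at_top UNIV)"
    unfolding eventually_finite_subsets_at_top by (intro exI[of _ "{}"]) auto
  then have "(I \<longlongrightarrow> 0) (finite_subsets_at_top UNIV)" by (rule tendsto_eventually)
  then have "J = 0" using IJ(3) by (metis tendsto_unique finite_subsets_at_top_neq_bot)
  moreover have "(\<Sum>\<^sub>\<infinity>k. of_real (g x) * (coef f k * chr k x)) = of_real (g x * ev f x)" for x
    by (simp add: infsum_cmult_right' evc_real[symmetric] evc_def fseries_def)
  ultimately have "((\<lambda>x. complex_of_real (g x * ev f x)) has_integral 0) unit_cube"
    using IJ(2) by (simp add: unit_cube_def)
  from has_integral_linear[OF this bounded_linear_Re] show ?thesis by (simp add: comp_def)
qed

text \<open>The function g is orthogonal to the whole Wiener algebra, which contains uniform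
  approximations of g; so the integral of g^2 is arbitrarily small.\<close>

theorem torus_fun_eq_zero:
  fixes g :: "real^'n \<Rightarrow> real"
  assumes g: "torus_fun g" "continuous_on UNIV g"
    and zero: "\<And>k. ((\<lambda>x. of_real (g x) * chr k x) has_integral 0) unit_cube"
  shows "g x = 0"
proof -
  obtain M where M: "M > 0" "\<And>x. norm (g x) \<le> M" using torus_fun_bounded[OF g] by blast
  have cont: "continuous_on unit_cube (\<lambda>x. g x * g x)"
    by (intro continuous_intros continuous_on_subset[OF g(2)]) auto
  then obtain I where I: "((\<lambda>x. g x * g x) has_integral I) unit_cube"
    unfolding unit_cube_def using integrable_continuous integrable_on_def by blast
  have "I \<le> e" if e: "e > 0" for e
  proof -
    obtain f where f: "\<And>x. x \<in> unit_cube \<Longrightarrow> \<bar>g x - ev f x\<bar> < e / M"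
      using ev_dense[OF g, of "e / M"] e M(1) by auto
    have 1: "((\<lambda>x. g x * g x - g x * ev f x) has_integral (I - 0)) unit_cube"
      by (intro has_integral_diff I has_integral_mult_ev_zero g zero)
    have 2: "((\<lambda>x. e) has_integral e) (unit_cube :: (real^'n) set)"
      using has_integral_const[of e 0 "(\<chi> i. 1) :: real^'n"]
      by (simp add: unit_cube_def content_cbox_if_cart interval_eq_empty_cart)
    have 3: "g x * g x - g x * ev f x \<le> e" if "x \<in> unit_cube" for x
    proof -
      have "g x * g x - g x * ev f x \<le> \<bar>g x\<bar> * \<bar>g x - ev f x\<bar>"
        unfolding abs_mult[symmetric] right_diff_distrib[symmetric] by simp
      also have "\<dots> \<le> M * (e / M)" using M(2)[of x] f[OF that] M(1) by (intro mult_mono) auto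
      finally show ?thesis using M(1) by simp
    qed
    show ?thesis using has_integral_le[OF 1 2 3] by simp
  qed
  then have "I \<le> 0" by (rule field_le_epsilon[of I 0, simplified])
  moreover have "I \<ge> 0" using has_integral_nonneg[OF I] by simp
  ultimately have "((\<lambda>x. g x * g x) has_integral 0) (cbox 0 (\<chi> i. 1))" using I by (simp add: unit_cube_def)
  then have "g y * g y = 0" if "y \<in> unit_cube" for y
    using has_integral_0_cbox_imp_0[of 0 "\<chi> i. 1" "\<lambda>x. g x * g x" y] cont that
    by (simp add: unit_cube_def interval_eq_empty_cart)
  then show ?thesis using torus_fun_reduce[OF g(1), of x] by (metis mult_eq_0_iff)
qed

section \<open>Sobolev embedding into the weighted algebra\<close>

lemma summable_on_int_powr:
  fixes a :: real
  assumes "a > 1 / 2"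
  shows "(\<lambda>j::int. (1 + (of_int j)\<^sup>2) powr (- a)) summable_on UNIV"
proof -
  let ?t = "\<lambda>j::int. (1 + (real_of_int j)\<^sup>2) powr (- a)"
  have "summable (\<lambda>n. real (Suc n) powr (- 2 * a))"
    unfolding summable_Suc_iff[of "\<lambda>n. real n powr (- 2 * a)"] by (subst summable_real_powr_iff) (use assms in simp)
  then have "summable (\<lambda>n. ?t (int (Suc n)))"
  proof (rule summable_comparison_test')
    fix n
    have "?t (int (Suc n)) \<le> ((real (Suc n))\<^sup>2) powr (- a)"
      by (rule powr_mono2') (use assms in auto)
    also have "\<dots> = real (Suc n) powr (- 2 * a)"
      using powr_powr[of "real (Suc n)" 2 "- a"] by (simp add: powr_numeral del: of_nat_Suc)
    finally show "norm (?t (int (Suc n))) \<le> real (Suc n) powr (- 2 * a)" by simp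
  qed
  then have "summable (\<lambda>n. ?t (int n))"
    by (subst (asm) summable_Suc_iff)
  then have n: "(\<lambda>n. ?t (int n)) summable_on UNIV" "(\<lambda>n. ?t (- int n)) summable_on UNIV"
    by (simp_all add: summable_on_UNIV_nonneg_real_iff)
  have "?t summable_on range int" "?t summable_on range (\<lambda>n. - int n)"
    by (subst summable_on_reindex; use n in \<open>simp add: inj_on_def comp_def\<close>)+
  then have "?t summable_on (range int \<union> range (\<lambda>n. - int n))"
    by (rule summable_on_union)
  moreover have "range int \<union> range (\<lambda>n. - int n) = UNIV"
    by (auto simp: image_iff) (metis int_cases2)
  ultimately show ?thesis by simp
qed

definition sobolev_weight :: "int^'n \<Rightarrow> real" where
  "sobolev_weight k = 1 + (\<Sum>i\<in>UNIV. (of_int (k $ i))\<^sup>2)"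

lemma sobolev_weight_ge_1: "sobolev_weight k \<ge> 1"
  by (simp add: sobolev_weight_def sum_nonneg)

text \<open>Each 1 + k_i^2 is at most the weight, so the power -s of the weight is dominated by a
  product of functions of one coordinate with exponent s/d > 1/2, and the sum over a box
  factorizes.\<close>

lemma summable_on_sobolev_weight:
  assumes "s > real CARD('n) / 2"
  shows "(\<lambda>k::int^'n. sobolev_weight k powr (- s)) summable_on UNIV"
proof -
  let ?d = "real CARD('n)" and ?t = "\<lambda>j::int. (1 + (real_of_int j)\<^sup>2) powr (- (s / real CARD('n)))"
  have t: "?t summable_on UNIV" by (rule summable_on_int_powr) (use assms in \<open>simp add: field_simps\<close>)
  have s: "s > 0" using assms by (rule order.strict_trans1[rotated]) simp
  have le: "sobolev_weight k powr (- s) \<le> (\<Prod>i\<in>UNIV. ?t (k $ i))" for k :: "int^'n"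
  proof -
    have "sobolev_weight k powr (- s) = (\<Prod>i\<in>(UNIV::'n set). sobolev_weight k powr (- (s / ?d)))"
      using sobolev_weight_ge_1[of k] by (simp add: powr_power)
    also have "\<dots> \<le> (\<Prod>i\<in>UNIV. ?t (k $ i))"
    proof (intro prod_mono conjI powr_mono2')
      show "1 + (real_of_int (k $ i))\<^sup>2 \<le> sobolev_weight k" for i
        unfolding sobolev_weight_def by (intro add_left_mono member_le_sum) auto
    qed (use s in \<open>auto intro: add_pos_nonneg\<close>)
    finally show ?thesis .
  qed
  show ?thesis
  proof (rule nonneg_bdd_above_summable_on)
    show "bdd_above (sum (\<lambda>k::int^'n. sobolev_weight k powr (- s)) ` {F. F \<subseteq> UNIV \<and> finite F})"
    proof (rule bdd_aboveI2)
      fix F :: "(int^'n) set" assume "F \<in> {F. F \<subseteq> UNIV \<and> finite F}"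
      then have F: "finite F" by simp
      define B where "B = (\<lambda>i. (\<lambda>k. k $ i) ` F)"
      have fB: "finite (B i)" for i using F by (simp add: B_def)
      have "(\<Sum>k\<in>F. sobolev_weight k powr (- s)) \<le> (\<Sum>k\<in>F. \<Prod>i\<in>UNIV. ?t (k $ i))"
        by (intro sum_mono le)
      also have "\<dots> = (\<Sum>g\<in>(\<lambda>k i. k $ i) ` F. \<Prod>i\<in>UNIV. ?t (g i))"
        by (subst sum.reindex) (auto simp: inj_on_def vec_eq_iff fun_eq_iff)
      also have "\<dots> \<le> (\<Sum>g\<in>PiE UNIV B. \<Prod>i\<in>UNIV. ?t (g i))"
        by (intro sum_mono2 prod_nonneg finite_PiE fB) (auto simp: B_def)
      also have "\<dots> = (\<Prod>i\<in>UNIV. \<Sum>j\<in>B i. ?t j)" by (rule prod_sum_PiE[symmetric]) (auto simp: fB)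
      also have "\<dots> \<le> (\<Prod>i\<in>(UNIV::'n set). infsum ?t UNIV)"
        by (intro prod_mono conjI sum_nonneg finite_sum_le_infsum t) (auto simp: fB)
      finally show "(\<Sum>k\<in>F. sobolev_weight k powr (- s)) \<le> (\<Prod>i\<in>(UNIV::'n set). infsum ?t UNIV)" .
    qed
  qed simp
qed

lemma wt_le_sobolev_weight: "wt k \<le> (1 + real CARD('n)) * sqrt (sobolev_weight k)" for k :: "int^'n"
proof -
  have "\<bar>real_of_int (k $ i)\<bar> \<le> sqrt (sobolev_weight k)" for i
  proof -
    have "(real_of_int (k $ i))\<^sup>2 \<le> (\<Sum>i\<in>UNIV. (real_of_int (k $ i))\<^sup>2)" by (rule member_le_sum) auto
    then have "(real_of_int (k $ i))\<^sup>2 \<le> sobolev_weight k" by (simp add: sobolev_weight_def)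
    then show ?thesis using real_sqrt_le_mono by fastforce
  qed
  then have "freq_norm k \<le> real CARD('n) * sqrt (sobolev_weight k)"
    unfolding freq_norm_def by (rule sum_bounded_above[where A = UNIV, simplified])
  moreover have "1 \<le> sqrt (sobolev_weight k)" using sobolev_weight_ge_1 by simp
  ultimately show ?thesis unfolding distrib_right by linarith
qed

text \<open>Cauchy-Schwarz: 1 + |k| is at most a multiple of the root of the Sobolev weight, which
  splits into the power -s/2, square summable since s > d/2, and the power (s + 1)/2, which belongs
  to the Sobolev norm.\<close>

lemma sobolev_embedding:
  assumes "s > real CARD('n) / 2"
  shows "\<exists>C\<ge>0. \<forall>c :: int^'n \<Rightarrow> complex.
    (\<lambda>k. sobolev_weight k powr (s + 1) * (norm (c k))\<^sup>2) summable_on UNIV \<longrightarrow>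
    (\<lambda>k. wt k * norm (c k)) summable_on UNIV \<and>
    (\<Sum>\<^sub>\<infinity>k. wt k * norm (c k)) \<le> C * sqrt (\<Sum>\<^sub>\<infinity>k. sobolev_weight k powr (s + 1) * (norm (c k))\<^sup>2)"
proof -
  let ?K = "\<Sum>\<^sub>\<infinity>k::int^'n. sobolev_weight k powr (- s)" and ?d = "1 + real CARD('n)"
  have K: "?K \<ge> 0" by (rule infsum_nonneg) simp
  show ?thesis
  proof (intro exI[of _ "?d * sqrt ?K"] conjI[of "_ \<le> _"] allI impI)
    fix c :: "int^'n \<Rightarrow> complex"
    let ?g = "\<lambda>k. sobolev_weight k powr (s + 1) * (norm (c k))\<^sup>2"
    assume g: "?g summable_on UNIV"
    have le: "(\<Sum>k\<in>F. wt k * norm (c k)) \<le> ?d * sqrt ?K * sqrt (infsum ?g UNIV)" if F: "finite F" for F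
    proof -
      have e: "sqrt (sobolev_weight k) * norm (c k) =
          \<bar>sobolev_weight k powr (- s / 2)\<bar> * \<bar>sobolev_weight k powr ((s + 1) / 2) * norm (c k)\<bar>" for k
      proof -
        have "sobolev_weight k powr (- s / 2) * sobolev_weight k powr ((s + 1) / 2) = sobolev_weight k powr (1 / 2)"
          by (simp add: powr_add[symmetric] field_simps)
        also have "\<dots> = sqrt (sobolev_weight k)"
          by (rule powr_half_sqrt) (use sobolev_weight_ge_1[of k] in simp)
        finally have "sqrt (sobolev_weight k) = sobolev_weight k powr (- s / 2) * sobolev_weight k powr ((s + 1) / 2)" by simp
        then show ?thesis by (simp add: abs_mult)
      qed
      have p: "(x powr (y / 2))\<^sup>2 = x powr y" for x y :: real
        by (simp add: power2_eq_square powr_add[symmetric])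
      have "(\<Sum>k\<in>F. wt k * norm (c k)) \<le> (\<Sum>k\<in>F. ?d * (sqrt (sobolev_weight k) * norm (c k)))"
      proof (rule sum_mono)
        show "wt k * norm (c k) \<le> ?d * (sqrt (sobolev_weight k) * norm (c k))" for k
          using mult_right_mono[OF wt_le_sobolev_weight norm_ge_zero[of "c k"]] by (simp only: mult.assoc)
      qed
      also have "\<dots> \<le> ?d * (L2_set (\<lambda>k. sobolev_weight k powr (- s / 2)) F *
          L2_set (\<lambda>k. sobolev_weight k powr ((s + 1) / 2) * norm (c k)) F)"
        unfolding sum_distrib_left[symmetric] e by (intro mult_left_mono L2_set_mult_ineq) simp
      also have "\<dots> \<le> ?d * (sqrt ?K * sqrt (infsum ?g UNIV))"
        unfolding L2_set_def power_mult_distrib p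
        by (intro mult_left_mono mult_mono real_sqrt_le_mono finite_sum_le_infsum g F summable_on_sobolev_weight assms)
           (auto simp: K intro!: sum_nonneg)
      finally show ?thesis by (simp add: mult.assoc)
    qed
    have "(\<lambda>k. wt k * norm (c k)) summable_on UNIV"
      by (rule nonneg_bdd_above_summable_on)
         (use le in \<open>auto simp: bdd_above_def intro!: exI[of _ "?d * sqrt ?K * sqrt (infsum ?g UNIV)"]\<close>)
    then show "(\<lambda>k. wt k * norm (c k)) summable_on UNIV \<and>
        (\<Sum>\<^sub>\<infinity>k. wt k * norm (c k)) \<le> ?d * sqrt ?K * sqrt (infsum ?g UNIV)"
      using infsum_le_finite_sums[OF _ le] by blast
  qed (simp add: K)
qed

section \<open>From Sobolev functions to elements of the Wiener algebra\<close>

lemma has_integral_fourier_coeff: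
  assumes "continuous_on UNIV f"
  shows "((\<lambda>x. of_real (f x) * chr (- k) x) has_integral fourier_coeff f k) unit_cube"
proof -
  have "(\<lambda>x. of_real (f x) * chr (- k) x) absolutely_integrable_on unit_cube"
    unfolding unit_cube_def
    by (intro absolutely_integrable_continuous continuous_intros continuous_on_subset[OF assms]) auto
  then have "((\<lambda>x. of_real (f x) * chr (- k) x) has_integral
      (LINT x:unit_cube|lebesgue. of_real (f x) * chr (- k) x)) unit_cube"
    by (rule has_integral_set_lebesgue)
  moreover have "of_real (f x) * chr (- k) x = cis (- 2 * pi * (\<Sum>i\<in>UNIV. of_int (k $ i) * x $ i)) * of_real (f x)" for x
    by (simp add: chr_def int_vec_simps inner_vec_def mult.commute sum_negf)
  ultimately show ?thesis by (simp only: fourier_coeff_def)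
qed

lemma fourier_coeff_minus:
  assumes "continuous_on UNIV f"
  shows "fourier_coeff f (- k) = cnj (fourier_coeff f k)"
  using has_integral_unique[OF has_integral_fourier_coeff[OF assms, of "- k"]]
    has_integral_linear[OF has_integral_fourier_coeff[OF assms, of k] bounded_linear_cnj]
  by (simp add: comp_def chr_minus)

lemma fourier_coeff_diff:
  assumes "continuous_on UNIV f" "continuous_on UNIV g"
  shows "fourier_coeff (\<lambda>x. f x - g x) k = fourier_coeff f k - fourier_coeff g k"
  using has_integral_unique[OF has_integral_fourier_coeff[OF continuous_on_diff[OF assms], of k]]
    has_integral_diff[OF has_integral_fourier_coeff[OF assms(1), of k] has_integral_fourier_coeff[OF assms(2), of k]]
  by (simp add: left_diff_distrib)

definition wiener_of :: "(real^'n::finite \<Rightarrow> real) \<Rightarrow> 'n wiener" where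
  "wiener_of f = Wiener (fourier_coeff f)"

text \<open>The function and the sum of its Fourier series are continuous with equal coefficients,
  so \<open>torus_fun_eq_zero\<close> identifies them at every point.\<close>

lemma wiener_of:
  fixes f :: "real^'n \<Rightarrow> real"
  assumes f: "torus_fun f" "continuous_on UNIV f" "(\<lambda>k. wt k * norm (fourier_coeff f k)) summable_on UNIV"
  shows "coef (wiener_of f) = fourier_coeff f" "wiener_of f \<in> A1" "ev (wiener_of f) x = f x"
    "norm1 (wiener_of f) = (\<Sum>\<^sub>\<infinity>k. wt k * norm (fourier_coeff f k))"
proof -
  have "fourier_coeff f abs_summable_on UNIV"
  proof (rule summable_on_comparison_test[OF f(3)])
    show "norm (fourier_coeff f k) \<le> wt k * norm (fourier_coeff f k)" for k
      using mult_right_mono[of 1 "wt k" "norm (fourier_coeff f k)"] by simp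
  qed simp
  then show c: "coef (wiener_of f) = fourier_coeff f"
    unfolding wiener_of_def by (rule coef_Wiener) (rule fourier_coeff_minus[OF f(2)])
  then show "wiener_of f \<in> A1" "norm1 (wiener_of f) = (\<Sum>\<^sub>\<infinity>k. wt k * norm (fourier_coeff f k))"
    using f(3) by (simp_all add: A1_def norm1_def)
  have "f x - ev (wiener_of f) x = 0"
  proof (rule torus_fun_eq_zero)
    show "torus_fun (\<lambda>x. f x - ev (wiener_of f) x)" using f(1) torus_fun_ev[of "wiener_of f"] by (simp add: torus_fun_def)
    show "continuous_on UNIV (\<lambda>x. f x - ev (wiener_of f) x)" by (intro continuous_intros f(2))
    show "((\<lambda>x. of_real (f x - ev (wiener_of f) x) * chr k x) has_integral 0) unit_cube" for k
      using has_integral_diff[OF has_integral_fourier_coeff[OF f(2), of "- k"] has_integral_fseries[OF coef_summable[of "wiener_of f"], of "- k"]]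
      by (simp add: c evc_real[unfolded evc_def, symmetric] left_diff_distrib flip: c)
  qed
  then show "ev (wiener_of f) x = f x" by simp
qed


lemma sobolev_term_component:
  assumes "b \<in> Basis"
  shows "sobolev_weight k powr r * (norm (fourier_coeff (\<lambda>x. f x \<bullet> b) k))\<^sup>2 \<le> sobolev_term r f k"
  unfolding sobolev_term_def sobolev_weight_def
  by (intro mult_left_mono member_le_sum assms) auto

lemma sobolev_term_nonneg: "sobolev_term r f k \<ge> 0"
  unfolding sobolev_term_def by (intro mult_nonneg_nonneg sum_nonneg) auto

lemma sobolev_term_diff:
  assumes "continuous_on UNIV f" "continuous_on UNIV g"
  shows "sobolev_term r (\<lambda>x. f x - g x) k \<le> 2 * (sobolev_term r f k + sobolev_term r g k)"
proof -
  have "(norm (fourier_coeff (\<lambda>x. (f x - g x) \<bullet> b) k))\<^sup>2 \<le>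
      2 * ((norm (fourier_coeff (\<lambda>x. f x \<bullet> b) k))\<^sup>2 + (norm (fourier_coeff (\<lambda>x. g x \<bullet> b) k))\<^sup>2)" for b
  proof -
    have le: "(norm (y - z))\<^sup>2 \<le> 2 * ((norm y)\<^sup>2 + (norm z)\<^sup>2)" for y z :: complex
    proof -
      have "(norm (y - z))\<^sup>2 \<le> (norm y + norm z)\<^sup>2" by (intro power_mono norm_triangle_ineq4) simp
      also have "\<dots> \<le> 2 * ((norm y)\<^sup>2 + (norm z)\<^sup>2)" using sum_squares_bound[of "norm y" "norm z"] by (simp add: power2_sum)
      finally show ?thesis .
    qed
    have "fourier_coeff (\<lambda>x. (f x - g x) \<bullet> b) k = fourier_coeff (\<lambda>x. f x \<bullet> b) k - fourier_coeff (\<lambda>x. g x \<bullet> b) k"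
      unfolding inner_diff_left by (rule fourier_coeff_diff; intro continuous_intros assms)
    then show ?thesis using le by simp
  qed
  then have "(\<Sum>b\<in>Basis. (norm (fourier_coeff (\<lambda>x. (f x - g x) \<bullet> b) k))\<^sup>2) \<le>
      (\<Sum>b\<in>Basis. 2 * ((norm (fourier_coeff (\<lambda>x. f x \<bullet> b) k))\<^sup>2 + (norm (fourier_coeff (\<lambda>x. g x \<bullet> b) k))\<^sup>2))"
    by (rule sum_mono)
  then have le: "(\<Sum>b\<in>Basis. (norm (fourier_coeff (\<lambda>x. (f x - g x) \<bullet> b) k))\<^sup>2) \<le>
      2 * ((\<Sum>b\<in>Basis. (norm (fourier_coeff (\<lambda>x. f x \<bullet> b) k))\<^sup>2) + (\<Sum>b\<in>Basis. (norm (fourier_coeff (\<lambda>x. g x \<bullet> b) k))\<^sup>2))"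
    by (simp only: sum_distrib_left[symmetric] sum.distrib)
  have "a * x \<le> 2 * (a * y + a * z)" if "x \<le> 2 * (y + z)" "a \<ge> 0" for a x y z :: real
    using mult_left_mono[OF that] by (simp add: algebra_simps)
  from this[OF le powr_ge_zero] show ?thesis unfolding sobolev_term_def .
qed

text \<open>The embedding, applied to the difference of the functions at two times, turns continuity
  in Sobolev norm into continuity in \<open>norm1\<close>. What is kept is continuity of the curve
  and of its spatial derivatives in the Wiener norm, which dominates suprema.\<close>

lemma wiener_family:
  fixes f :: "real \<Rightarrow> real^'n \<Rightarrow> 'b::euclidean_space"
  assumes s: "s > real CARD('n) / 2" and cs: "continuous_in_sobolev T (s + 1) f"
    and cont: "\<And>t. t \<in> {0..<T} \<Longrightarrow> continuous_on UNIV (f t)"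
  obtains F :: "real \<Rightarrow> 'b \<Rightarrow> 'n wiener" where
    "\<And>t b. t \<in> {0..<T} \<Longrightarrow> b \<in> Basis \<Longrightarrow> F t b \<in> A1"
    "\<And>t b x. t \<in> {0..<T} \<Longrightarrow> b \<in> Basis \<Longrightarrow> ev (F t b) x = f t x \<bullet> b"
    "\<And>b. b \<in> Basis \<Longrightarrow> continuous_on {0..<T} (\<lambda>t. F t b)"
    "\<And>b j. b \<in> Basis \<Longrightarrow> continuous_on {0..<T} (\<lambda>t. der j (F t b))"
proof -
  obtain C where C: "C \<ge> 0" and emb: "\<forall>c :: int^'n \<Rightarrow> complex.
      (\<lambda>k. sobolev_weight k powr (s + 1) * (norm (c k))\<^sup>2) summable_on UNIV \<longrightarrow>
      (\<lambda>k. wt k * norm (c k)) summable_on UNIV \<and>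
      (\<Sum>\<^sub>\<infinity>k. wt k * norm (c k)) \<le> C * sqrt (\<Sum>\<^sub>\<infinity>k. sobolev_weight k powr (s + 1) * (norm (c k))\<^sup>2)"
    using sobolev_embedding[OF s] by blast
  note emb = emb[rule_format]
  have comp: "(\<lambda>k. sobolev_weight k powr (s + 1) * (norm (fourier_coeff (\<lambda>x. h x \<bullet> b) k))\<^sup>2) summable_on UNIV"
    if "sobolev_term (s + 1) h summable_on UNIV" "b \<in> Basis" for b and h :: "real^'n \<Rightarrow> 'b"
    by (rule summable_on_comparison_test[OF that(1)]) (use sobolev_term_component[OF that(2)] in auto)
  define F where "F = (\<lambda>t b. wiener_of (\<lambda>x. f t x \<bullet> b))"
  have tor: "torus_fun (f t)" and st: "sobolev_term (s + 1) (f t) summable_on UNIV" if "t \<in> {0..<T}" for t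
    using cs that by (auto simp: continuous_in_sobolev_def sobolev_space_def)
  have W: "torus_fun (\<lambda>x. f t x \<bullet> b)" "continuous_on UNIV (\<lambda>x. f t x \<bullet> b)"
    "(\<lambda>k. wt k * norm (fourier_coeff (\<lambda>x. f t x \<bullet> b) k)) summable_on UNIV"
    if t: "t \<in> {0..<T}" and b: "b \<in> Basis" for t b
    using tor[OF t] cont[OF t] emb[OF comp[OF st[OF t] b]] by (auto simp: torus_fun_def intro: continuous_intros)
  have A: "F t b \<in> A1" if "t \<in> {0..<T}" "b \<in> Basis" for t b
    unfolding F_def by (rule wiener_of(2)[OF W[OF that]])
  have le: "norm1 (F t b - F t' b) \<le> C * sobolev_norm (s + 1) (\<lambda>x. f t x - f t' x)"
    if t: "t \<in> {0..<T}" "t' \<in> {0..<T}" and b: "b \<in> Basis" for t t' b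
  proof -
    have "coef (F t b - F t' b) k = fourier_coeff (\<lambda>x. (f t x - f t' x) \<bullet> b) k" for k
      unfolding coef_diff F_def inner_diff_left
      by (simp only: wiener_of(1)[OF W[OF t(1) b]] wiener_of(1)[OF W[OF t(2) b]]
            fourier_coeff_diff[OF W(2)[OF t(1) b] W(2)[OF t(2) b]])
    then have n: "norm1 (F t b - F t' b) = (\<Sum>\<^sub>\<infinity>k. wt k * norm (fourier_coeff (\<lambda>x. (f t x - f t' x) \<bullet> b) k))"
      by (simp add: norm1_def)
    \<comment> \<open>The Sobolev norm of the difference is meaningful only after this:
      \<open>infsum\<close> is 0 on a family that is not summable.\<close>
    have d: "sobolev_term (s + 1) (\<lambda>x. f t x - f t' x) summable_on UNIV"
      by (rule summable_on_comparison_test[where f = "\<lambda>k. 2 * (sobolev_term (s + 1) (f t) k + sobolev_term (s + 1) (f t') k)"])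
         (intro summable_on_cmult_right summable_on_add st t sobolev_term_diff cont sobolev_term_nonneg)+
    note c = comp[OF d b]
    have "norm1 (F t b - F t' b) \<le> C * sqrt (\<Sum>\<^sub>\<infinity>k. sobolev_weight k powr (s + 1) *
        (norm (fourier_coeff (\<lambda>x. (f t x - f t' x) \<bullet> b) k))\<^sup>2)"
      unfolding n using emb[OF c] by blast
    also have "\<dots> \<le> C * sobolev_norm (s + 1) (\<lambda>x. f t x - f t' x)"
      unfolding sobolev_norm_def
      by (intro mult_left_mono C real_sqrt_le_mono infsum_mono c d sobolev_term_component b)
    finally show ?thesis .
  qed
  have lim: "((\<lambda>t. norm1 (F t b - F t' b)) \<longlongrightarrow> 0) (at t' within {0..<T})" if t': "t' \<in> {0..<T}" and b: "b \<in> Basis" for t' b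
  proof (rule Lim_null_comparison)
    show "\<forall>\<^sub>F t in at t' within {0..<T}. norm (norm1 (F t b - F t' b)) \<le> C * sobolev_norm (s + 1) (\<lambda>x. f t x - f t' x)"
      unfolding eventually_at_filter using le[OF _ t' b] by (intro always_eventually) auto
    show "((\<lambda>t. C * sobolev_norm (s + 1) (\<lambda>x. f t x - f t' x)) \<longlongrightarrow> 0) (at t' within {0..<T})"
      using cs t' by (intro tendsto_mult_right_zero) (auto simp: continuous_in_sobolev_def)
  qed
  show ?thesis
  proof (rule that[of F])
    show "F t b \<in> A1" if "t \<in> {0..<T}" "b \<in> Basis" for t b by (rule A[OF that])
    show "ev (F t b) x = f t x \<bullet> b" if "t \<in> {0..<T}" "b \<in> Basis" for t b x
      unfolding F_def by (rule wiener_of(3)[OF W[OF that]])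
    show "continuous_on {0..<T} (\<lambda>t. F t b)" if b: "b \<in> Basis" for b
      unfolding continuous_on_def
    proof (intro ballI LIM_zero_cancel[OF Lim_null_comparison[OF _ lim[OF _ b]]])
      show "\<forall>\<^sub>F t in at t' within {0..<T}. norm (F t b - F t' b) \<le> norm1 (F t b - F t' b)" if "t' \<in> {0..<T}" for t'
        unfolding eventually_at_filter using A b that by (intro always_eventually) (auto intro!: norm_le_norm1 A1_diff)
    qed
    show "continuous_on {0..<T} (\<lambda>t. der j (F t b))" if b: "b \<in> Basis" for b j
      unfolding continuous_on_def
    proof (intro ballI LIM_zero_cancel[OF Lim_null_comparison[OF _ tendsto_mult_right_zero[OF lim[OF _ b]]]])
      show "\<forall>\<^sub>F t in at t' within {0..<T}. norm (der j (F t b) - der j (F t' b)) \<le> 2 * pi * norm1 (F t b - F t' b)"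
        if t': "t' \<in> {0..<T}" for t'
        unfolding eventually_at_filter
        using norm_der_le[OF A1_diff(1)[OF A[OF _ b] A[OF t' b]]] der_diff[OF A[OF _ b] A[OF t' b]]
        by (intro always_eventually) auto
    qed
  qed
qed

text \<open>The Wiener norm dominates the supremum, so continuity in time is uniform in space and
  combines with continuity in x.\<close>

lemma continuous_on_ev_family:
  fixes F :: "real \<Rightarrow> 'n::finite wiener"
  assumes "continuous_on S F"
  shows "continuous_on (S \<times> UNIV) (\<lambda>(t, x). ev (F t) x)"
  unfolding continuous_on_iff
proof (intro ballI allI impI)
  fix z :: "real \<times> (real^'n)" and e :: real
  assume z: "z \<in> S \<times> UNIV" and e: "e > 0"
  obtain t0 x0 where z0: "z = (t0, x0)" by (cases z)
  obtain d1 where d1: "d1 > 0" "\<And>t. t \<in> S \<Longrightarrow> dist t t0 < d1 \<Longrightarrow> dist (F t) (F t0) < e / 2"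
    using assms z e unfolding continuous_on_iff z0 by (metis half_gt_zero mem_Sigma_iff)
  obtain d2 where d2: "d2 > 0" "\<And>x. dist x x0 < d2 \<Longrightarrow> dist (ev (F t0) x) (ev (F t0) x0) < e / 2"
    using continuous_on_ev[of UNIV "F t0"] e unfolding continuous_on_iff by (metis half_gt_zero UNIV_I)
  show "\<exists>d>0. \<forall>y\<in>S \<times> UNIV. dist y z < d \<longrightarrow> dist (case y of (t, x) \<Rightarrow> ev (F t) x) (case z of (t, x) \<Rightarrow> ev (F t) x) < e"
  proof (intro exI[of _ "min d1 d2"] conjI ballI impI)
    fix y assume y: "y \<in> S \<times> (UNIV :: (real^'n) set)" "dist y z < min d1 d2"
    obtain t x where y0: "y = (t, x)" by (cases y)
    have t: "t \<in> S" "dist t t0 < d1" and x: "dist x x0 < d2"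
      using y dist_fst_le[of y z] dist_snd_le[of y z] by (auto simp: y0 z0)
    have "\<bar>ev (F t) x - ev (F t0) x\<bar> < e / 2"
      using abs_ev_le[of "F t - F t0" x] d1(2)[OF t] by (simp add: dist_norm)
    then show "dist (case y of (t, x) \<Rightarrow> ev (F t) x) (case z of (t, x) \<Rightarrow> ev (F t) x) < e"
      using d2(2)[OF x] abs_triangle_ineq[of "ev (F t) x - ev (F t0) x" "ev (F t0) x - ev (F t0) x0"]
      by (simp add: y0 z0 dist_real_def)
  qed (use d1 d2 in auto)
qed

section \<open>Comparison with a given solution\<close>

text \<open>The integrating factor exp(-K t) makes the product nonincreasing, by the mean value
  theorem; \<open>K\<close> may have any sign.\<close>

lemma gronwall_nonpos:
  fixes E E' :: "real \<Rightarrow> real"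
  assumes d: "\<And>t. t \<in> {0..T} \<Longrightarrow> (E has_real_derivative E' t) (at t within {0..T})"
    and le: "\<And>t. t \<in> {0..T} \<Longrightarrow> E' t \<le> K * E t" and E0: "E 0 \<le> 0" and t: "t \<in> {0..T}"
  shows "E t \<le> 0"
proof (cases "t = 0")
  case False
  then have t0: "0 < t" using t by simp
  let ?f = "\<lambda>\<tau>. E \<tau> * exp (- (K * \<tau>))"
  have "(?f has_real_derivative (E' \<tau> - K * E \<tau>) * exp (- (K * \<tau>))) (at \<tau> within {0..t})" if "0 \<le> \<tau>" "\<tau> \<le> t" for \<tau>
  proof -
    have "(E has_real_derivative E' \<tau>) (at \<tau> within {0..t})"
      by (rule DERIV_subset[OF d]) (use that t in auto)
    then show ?thesis by (auto intro!: derivative_eq_intros simp: algebra_simps)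
  qed
  then obtain \<tau> where \<tau>: "\<tau> \<in> {0<..<t}" "?f t - ?f 0 = (E' \<tau> - K * E \<tau>) * exp (- (K * \<tau>)) * (t - 0)"
    using mvt_simple[OF t0, of ?f "\<lambda>\<tau>. (*) ((E' \<tau> - K * E \<tau>) * exp (- (K * \<tau>)))"]
    unfolding has_field_derivative_def by blast
  have "E' \<tau> - K * E \<tau> \<le> 0" using le[of \<tau>] \<tau>(1) t by auto
  then have "(E' \<tau> - K * E \<tau>) * (exp (- (K * \<tau>)) * (t - 0)) \<le> 0"
    by (rule mult_nonpos_nonneg) (use t0 in simp)
  then have "?f t \<le> 0" using \<tau>(2) E0 by (simp only: mult.assoc) simp
  then show ?thesis by (simp add: mult_le_0_iff)
qed (use E0 in simp)

text \<open>The time derivative is assumed at the single point \<open>Y t\<close> only. Together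
  with joint continuity of the spatial gradient it gives joint differentiability there, hence the
  chain rule.\<close>

lemma has_real_derivative_along:
  fixes f :: "real \<Rightarrow> real^'n \<Rightarrow> real" and g :: "real \<Rightarrow> real^'n \<Rightarrow> real^'n"
  assumes t: "t \<in> S" and ft: "((\<lambda>\<tau>. f \<tau> (Y t)) has_real_derivative f') (at t within S)"
    and fx: "\<And>\<tau> y. \<tau> \<in> S \<Longrightarrow> (f \<tau> has_derivative (\<lambda>h. g \<tau> y \<bullet> h)) (at y)"
    and cont: "continuous_on (S \<times> UNIV) (\<lambda>z. g (fst z) (snd z))"
    and Y: "(Y has_vector_derivative Y') (at t within S)"
  shows "((\<lambda>\<tau>. f \<tau> (Y \<tau>)) has_real_derivative f' + g t (Y t) \<bullet> Y') (at t within S)"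
proof -
  have 1: "((\<lambda>(\<tau>, y). f \<tau> y) has_derivative (\<lambda>(\<tau>, h). f' * \<tau> + blinfun_inner_right (g t (Y t)) h)) (at (t, Y t) within S \<times> UNIV)"
  proof (rule has_derivative_partialsI[where fy = "\<lambda>\<tau> y. blinfun_inner_right (g \<tau> y)"])
    show "((\<lambda>\<tau>. f \<tau> (Y t)) has_derivative (*) f') (at t within S)" using ft by (simp add: has_field_derivative_def)
    show "(f \<tau> has_derivative blinfun_apply (blinfun_inner_right (g \<tau> y))) (at y within UNIV)" if "\<tau> \<in> S" for \<tau> y
      using fx[OF that] by simp
    have "continuous_on (S \<times> UNIV) (\<lambda>(\<tau>, y). blinfun_inner_right (g \<tau> y))"
      unfolding case_prod_unfold by (rule bounded_linear.continuous_on[OF bounded_linear_blinfun_inner_right cont])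
    then show "continuous (at (t, Y t) within S \<times> UNIV) (\<lambda>(\<tau>, y). blinfun_inner_right (g \<tau> y))"
      using t by (simp add: continuous_on_eq_continuous_within)
  qed auto
  have 2: "((\<lambda>\<tau>. (\<tau>, Y \<tau>)) has_derivative (\<lambda>h. (h, h *\<^sub>R Y'))) (at t within S)"
    by (rule has_derivative_Pair[OF has_derivative_ident Y[unfolded has_vector_derivative_def]])
  have "(\<lambda>\<tau>. (\<tau>, Y \<tau>)) ` S \<subseteq> S \<times> UNIV" by auto
  from has_derivative_in_compose[OF 2 has_derivative_subset[OF 1 this]]
  have "((\<lambda>\<tau>. f \<tau> (Y \<tau>)) has_derivative (\<lambda>h. f' * h + g t (Y t) \<bullet> (h *\<^sub>R Y'))) (at t within S)"
    by simp
  then show ?thesis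
    by (rule has_derivative_imp_has_field_derivative) (simp add: algebra_simps)
qed

lemma continuous_on_matrix_vector_mult:
  fixes A :: "'a::topological_space \<Rightarrow> real^'n^'m"
  assumes "continuous_on S A" "continuous_on S v"
  shows "continuous_on S (\<lambda>z. A z *v v z)"
  unfolding matrix_vector_mult_def by (intro continuous_on_vec_lambda continuous_intros assms)

lemma matrix_sub_ldistrib: "A ** (B - C) = A ** B - A ** C" for A :: "real^'n^'m"
  by (simp add: matrix_matrix_mult_def vec_eq_iff right_diff_distrib sum_subtractf)

lemma continuous_on_compact_le:
  fixes f :: "'a::topological_space \<Rightarrow> real"
  assumes "continuous_on S f" "compact S"
  shows "\<exists>M\<ge>0. \<forall>z\<in>S. f z \<le> M"
proof -
  have "bounded (f ` S)" by (intro compact_imp_bounded compact_continuous_image assms)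
  then obtain M where "\<And>z. z \<in> S \<Longrightarrow> \<bar>f z\<bar> \<le> M" by (auto simp: bounded_iff)
  then show ?thesis by (intro exI[of _ "max M 0"]) (auto simp: le_max_iff_disj intro: order_trans[OF abs_ge_self])
qed

section \<open>Energy estimate in Lagrangian coordinates\<close>

text \<open>A solution with the momentum equation in nonconservative form and a constructed flow
  with the same initial velocity and density, over a closed time interval on which both exist. The
  initial density is \<open>c\<close> times \<open>\<sigma>\<close>, bounded below by the product of
  \<open>c\<close> and \<open>m\<close>.\<close>

locale euler_comparison = euler_flow R \<xi> V W G H B \<phi> \<sigma>
  for R :: real and \<xi> V W :: "real \<Rightarrow> real^'n \<Rightarrow> real^'n" and G H B :: "real \<Rightarrow> real^'n \<Rightarrow> real^'n^'n"
    and \<phi> :: "real \<Rightarrow> real^'n \<Rightarrow> real" and \<sigma> :: "real^'n \<Rightarrow> real" +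
  fixes T c m :: real and u :: "real \<Rightarrow> real^'n \<Rightarrow> real^'n" and Du :: "real \<Rightarrow> real^'n \<Rightarrow> real^'n^'n"
    and \<rho> p :: "real \<Rightarrow> real^'n \<Rightarrow> real" and D\<rho> Dp :: "real \<Rightarrow> real^'n \<Rightarrow> real^'n"
  assumes T: "0 < T" "T < R" and c: "c > 0" and m: "m > 0" "\<And>x. m \<le> \<sigma> x"
    and torus_u: "\<And>t. t \<in> {0..T} \<Longrightarrow> torus_fun (u t)" and torus_p: "\<And>t. t \<in> {0..T} \<Longrightarrow> torus_fun (p t)"
    and D_u: "\<And>t y. t \<in> {0..T} \<Longrightarrow> (u t has_derivative (\<lambda>h. Du t y *v h)) (at y)"
    and D_\<rho>: "\<And>t y. t \<in> {0..T} \<Longrightarrow> (\<rho> t has_derivative (\<lambda>h. D\<rho> t y \<bullet> h)) (at y)"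
    and D_p: "\<And>t y. t \<in> {0..T} \<Longrightarrow> (p t has_derivative (\<lambda>h. Dp t y \<bullet> h)) (at y)"
    and trace_Du: "\<And>t y. t \<in> {0..T} \<Longrightarrow> trace (Du t y) = 0"
    and \<rho>_pos: "\<And>t y. t \<in> {0..T} \<Longrightarrow> \<rho> t y > 0"
    and d_\<rho>: "\<And>t y. t \<in> {0..T} \<Longrightarrow> ((\<lambda>t. \<rho> t y) has_real_derivative - (u t y \<bullet> D\<rho> t y)) (at t within {0..T})"
    and d_u: "\<And>t y. t \<in> {0..T} \<Longrightarrow>
      ((\<lambda>t. u t y) has_vector_derivative - (Du t y *v u t y) - (1 / \<rho> t y) *\<^sub>R Dp t y) (at t within {0..T})"
    and cont_sol: "continuous_on ({0..T} \<times> UNIV) (\<lambda>z. u (fst z) (snd z))"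
      "continuous_on ({0..T} \<times> UNIV) (\<lambda>z. Du (fst z) (snd z))"
      "continuous_on ({0..T} \<times> UNIV) (\<lambda>z. \<rho> (fst z) (snd z))"
      "continuous_on ({0..T} \<times> UNIV) (\<lambda>z. D\<rho> (fst z) (snd z))"
      "continuous_on ({0..T} \<times> UNIV) (\<lambda>z. Dp (fst z) (snd z))"
    and u_0: "\<And>y. u 0 y = V 0 y" and \<rho>_0: "\<And>y. \<rho> 0 y = c * \<sigma> y"
begin

definition Y :: "real \<Rightarrow> real^'n \<Rightarrow> real^'n" where "Y t x = x + \<xi> t x"

definition w :: "real \<Rightarrow> real^'n \<Rightarrow> real^'n" where "w t x = u t (Y t x) - V t x"

text \<open>The given density is transported by u, but \<open>Y\<close> is not yet known to be the
  flow of u; so an error of density arises and has to enter the energy together with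
  \<open>w\<close>.\<close>

definition \<theta> :: "real \<Rightarrow> real^'n \<Rightarrow> real" where "\<theta> t x = \<rho> t (Y t x) - c * \<sigma> x"

lemma abs_less_R: "t \<in> {0..T} \<Longrightarrow> \<bar>t\<bar> < R"
  using T by auto

lemma D_Y: "t \<in> {0..T} \<Longrightarrow> (Y t has_derivative (\<lambda>h. (mat 1 + G t x) *v h)) (at x)"
  unfolding Y_def[abs_def] matrix_vector_mult_add_rdistrib matrix_vector_mul_lid
  by (intro has_derivative_add has_derivative_ident D_\<xi> abs_less_R)

lemma d_Y: "t \<in> {0..T} \<Longrightarrow> ((\<lambda>t. Y t x) has_vector_derivative V t x) (at t within {0..T})"
  unfolding Y_def[abs_def]
  using has_vector_derivative_add[OF has_vector_derivative_const has_vector_derivative_at_within[OF d_\<xi>[OF abs_less_R]]]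
  by simp

lemma cont_flow:
  "continuous_on ({0..T} \<times> UNIV) (\<lambda>z. \<xi> (fst z) (snd z))"
  "continuous_on ({0..T} \<times> UNIV) (\<lambda>z. V (fst z) (snd z))"
  "continuous_on ({0..T} \<times> UNIV) (\<lambda>z. W (fst z) (snd z))"
  "continuous_on ({0..T} \<times> UNIV) (\<lambda>z. G (fst z) (snd z))"
  "continuous_on ({0..T} \<times> UNIV) (\<lambda>z. H (fst z) (snd z))"
  "continuous_on ({0..T} \<times> UNIV) (\<lambda>z. B (fst z) (snd z))"
  using T by (auto intro: continuous_on_subset[OF cont(1)[unfolded case_prod_unfold]] continuous_on_subset[OF cont(2)[unfolded case_prod_unfold]]
    continuous_on_subset[OF cont(3)[unfolded case_prod_unfold]] continuous_on_subset[OF cont(4)[unfolded case_prod_unfold]]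
    continuous_on_subset[OF cont(5)[unfolded case_prod_unfold]] continuous_on_subset[OF cont(6)[unfolded case_prod_unfold]])

lemma cont_Y: "continuous_on ({0..T} \<times> UNIV) (\<lambda>z. Y (fst z) (snd z))"
  unfolding Y_def by (intro continuous_intros cont_flow)

lemma cont_along:
  assumes "continuous_on ({0..T} \<times> UNIV) (\<lambda>z. f (fst z) (snd z))"
  shows "continuous_on ({0..T} \<times> UNIV) (\<lambda>z. f (fst z) (Y (fst z) (snd z)))"
  using continuous_on_compose2[OF assms, of "{0..T} \<times> UNIV" "\<lambda>z. (fst z, Y (fst z) (snd z))"]
  by (force intro: continuous_intros cont_Y)

lemma cont_\<sigma>_snd: "continuous_on S (\<lambda>z. \<sigma> (snd z))"
  by (rule continuous_on_compose2[OF cont_\<sigma>]) (auto intro: continuous_intros)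

lemma cont_slice:
  assumes "continuous_on ({0..T} \<times> UNIV) (\<lambda>z. f (fst z) (snd z))" "t \<in> {0..T}"
  shows "continuous_on UNIV (f t)"
  using continuous_on_compose2[OF assms(1), of UNIV "\<lambda>x. (t, x)"] assms(2) by (force intro: continuous_intros)

text \<open>Along \<open>Y\<close> the transport equation leaves only the error of velocity, since V
  - u is -w there.\<close>

lemma d_\<theta>:
  assumes t: "t \<in> {0..T}"
  shows "((\<lambda>t. \<theta> t x) has_real_derivative - (w t x \<bullet> D\<rho> t (Y t x))) (at t within {0..T})"
  unfolding \<theta>_def
  using DERIV_diff[OF has_real_derivative_along[where Y = "\<lambda>t. Y t x", OF t d_\<rho>[OF t] D_\<rho> cont_sol(4) d_Y[OF t]] DERIV_const]
  by (simp add: w_def inner_diff_right inner_commute)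

lemma d_w:
  assumes t: "t \<in> {0..T}"
  shows "((\<lambda>t. w t x) has_vector_derivative - (Du t (Y t x) *v w t x) - (1 / \<rho> t (Y t x)) *\<^sub>R Dp t (Y t x) - W t x) (at t within {0..T})"
proof (rule has_vector_derivative_vecI)
  fix i
  have "((\<lambda>t. u t (Y t x) $ i) has_real_derivative
      (- (Du t (Y t x) *v u t (Y t x)) - (1 / \<rho> t (Y t x)) *\<^sub>R Dp t (Y t x)) $ i + (Du t (Y t x) $ i) \<bullet> V t x) (at t within {0..T})"
  proof (rule has_real_derivative_along[where f = "\<lambda>t y. u t y $ i" and g = "\<lambda>t y. Du t y $ i" and Y = "\<lambda>t. Y t x", OF t])
    show "((\<lambda>\<tau>. u \<tau> (Y t x) $ i) has_real_derivative
        (- (Du t (Y t x) *v u t (Y t x)) - (1 / \<rho> t (Y t x)) *\<^sub>R Dp t (Y t x)) $ i) (at t within {0..T})"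
      using bounded_linear.has_vector_derivative[OF bounded_linear_vec_nth[of i] d_u[OF t]] by (simp add: has_real_derivative_iff_has_vector_derivative)
    show "((\<lambda>y. u \<tau> y $ i) has_derivative (\<lambda>h. Du \<tau> y $ i \<bullet> h)) (at y)" if "\<tau> \<in> {0..T}" for \<tau> y
      using bounded_linear.has_derivative[OF bounded_linear_vec_nth D_u[OF that, of y], of i]
      by (simp add: matrix_vector_mult_def inner_vec_def)
    show "continuous_on ({0..T} \<times> UNIV) (\<lambda>z. Du (fst z) (snd z) $ i)" by (intro continuous_intros cont_sol)
  qed (rule d_Y[OF t])
  moreover have "((\<lambda>t. V t x $ i) has_real_derivative W t x $ i) (at t within {0..T})"
    using bounded_linear.has_vector_derivative[OF bounded_linear_vec_nth[of i] has_vector_derivative_at_within[OF d_V[OF abs_less_R[OF t]]]]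
    by (simp add: has_real_derivative_iff_has_vector_derivative)
  ultimately have "((\<lambda>t. u t (Y t x) $ i - V t x $ i) has_real_derivative
      (- (Du t (Y t x) *v u t (Y t x)) - (1 / \<rho> t (Y t x)) *\<^sub>R Dp t (Y t x)) $ i + (Du t (Y t x) $ i) \<bullet> V t x - W t x $ i) (at t within {0..T})"
    by (rule DERIV_diff)
  moreover have e: "(- (Du t (Y t x) *v u t (Y t x)) - (1 / \<rho> t (Y t x)) *\<^sub>R Dp t (Y t x)) $ i + (Du t (Y t x) $ i) \<bullet> V t x - W t x $ i
      = (- (Du t (Y t x) *v w t x) - (1 / \<rho> t (Y t x)) *\<^sub>R Dp t (Y t x) - W t x) $ i"
  proof -
    have "(Du t (Y t x) $ i) \<bullet> V t x = (Du t (Y t x) *v V t x) $ i" by (simp add: matrix_vector_mult_def inner_vec_def)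
    then show ?thesis by (simp add: w_def matrix_vector_mult_diff_distrib)
  qed
  ultimately show "((\<lambda>t. w t x $ i) has_real_derivative
      (- (Du t (Y t x) *v w t x) - (1 / \<rho> t (Y t x)) *\<^sub>R Dp t (Y t x) - W t x) $ i) (at t within {0..T})"
    unfolding e by (simp only: w_def vector_minus_component[of "u _ _"])
qed

text \<open>In Eulerian terms, a divergence-free field is orthogonal to a gradient. Here \<pi> is
  the pulled-back pressure plus c \<phi>, and the weak Piola identity is applied to \<pi> w. The
  term with the trace of B Dw drops because both velocities are divergence free.\<close>

lemma pressure_orthogonal:
  assumes t: "t \<in> {0..T}"
  shows "((\<lambda>x. w t x \<bullet> (Dp t (Y t x) + c *\<^sub>R \<sigma> x *\<^sub>R W t x)) has_integral 0) unit_cube"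
proof -
  note tR = abs_less_R[OF t]
  define \<pi> where "\<pi> = (\<lambda>x. p t (Y t x) + c * \<phi> t x)"
  define q where "q = (\<lambda>x. Dp t (Y t x) + c *\<^sub>R \<sigma> x *\<^sub>R W t x)"
  define P where "P = (\<lambda>x. q x v* (mat 1 + G t x))"
  define Dw where "Dw = (\<lambda>x. Du t (Y t x) ** (mat 1 + G t x) - H t x)"
  define D where "D = (\<lambda>x. \<chi> i j. w t x $ i * P x $ j + \<pi> x * Dw x $ i $ j)"
  have D\<pi>: "(\<pi> has_derivative (\<lambda>h. P x \<bullet> h)) (at x)" for x
  proof -
    have "((\<lambda>x. p t (Y t x)) has_derivative (\<lambda>h. Dp t (Y t x) \<bullet> ((mat 1 + G t x) *v h))) (at x)"
      by (rule has_derivative_compose[OF D_Y[OF t] D_p[OF t]])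
    then have "(\<pi> has_derivative (\<lambda>h. Dp t (Y t x) \<bullet> ((mat 1 + G t x) *v h) + c * (((\<sigma> x *\<^sub>R W t x) v* (mat 1 + G t x)) \<bullet> h))) (at x)"
      unfolding \<pi>_def by (intro has_derivative_add has_derivative_mult_right D_\<phi> tR)
    moreover have "Dp t (Y t x) \<bullet> ((mat 1 + G t x) *v h) + c * (((\<sigma> x *\<^sub>R W t x) v* (mat 1 + G t x)) \<bullet> h) = P x \<bullet> h" for h
      unfolding P_def q_def dot_lmul_matrix by (simp add: inner_add_left inner_scaleR_left)
    ultimately show ?thesis by simp
  qed
  have Dw: "(w t has_derivative (\<lambda>h. Dw x *v h)) (at x)" for x
  proof -
    have "((\<lambda>x. u t (Y t x) - V t x) has_derivative (\<lambda>h. Du t (Y t x) *v ((mat 1 + G t x) *v h) - H t x *v h)) (at x)"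
      by (rule has_derivative_diff[OF has_derivative_compose[OF D_Y[OF t] D_u[OF t]] D_V[OF tR]])
    then show ?thesis
      by (simp add: w_def[abs_def] Dw_def matrix_vector_mult_diff_rdistrib matrix_vector_mul_assoc)
  qed
  note along = cont_slice[OF cont_along t]
  have contw: "continuous_on UNIV (w t)"
    using Dw by (meson continuous_at_imp_continuous_on has_derivative_continuous)
  have cont\<pi>: "continuous_on UNIV \<pi>"
    using D\<pi> by (meson continuous_at_imp_continuous_on has_derivative_continuous)
  have contP: "continuous_on UNIV P"
    unfolding P_def vector_matrix_mult_def q_def
    by (intro continuous_on_vec_lambda continuous_intros along cont_sol cont_\<sigma> cont_slice[OF cont_flow(3) t] cont_slice[OF cont_flow(4) t])
  have contDw: "continuous_on UNIV Dw"
    unfolding Dw_def matrix_matrix_mult_def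
    by (intro continuous_on_vec_lambda continuous_intros along cont_sol cont_slice[OF cont_flow(4) t] cont_slice[OF cont_flow(5) t])
  have torY: "Y t (x + axis i 1) = Y t x + axis i 1" for x i
    using torus(1)[OF tR] by (simp add: Y_def torus_fun_def)
  have "((\<lambda>x. trace (B t x ** D x)) has_integral 0) unit_cube"
  proof (rule has_integral_trace_piola[where V = "\<xi> t" and G = "G t" and W = "\<lambda>x. \<pi> x *\<^sub>R w t x"])
    show "torus_fun (\<xi> t)" "torus_fun (B t)" by (rule torus[OF tR])+
    show "(\<xi> t has_derivative (\<lambda>h. G t x *v h)) (at x)" "norm (G t x *v h) \<le> norm h / 4" "det (mat 1 + G t x) = 1"
      "B t x ** (mat 1 + G t x) = mat 1" for x h
      by (rule D_\<xi> G det B; rule tR)+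
    show "continuous_on UNIV (B t)" by (rule cont_slice[OF cont_flow(6) t])
    show "torus_fun (\<lambda>x. \<pi> x *\<^sub>R w t x)"
      using torus_p[OF t] torus_u[OF t] torus(2)[OF tR] torus(4)[OF tR] torY
      by (simp add: torus_fun_def \<pi>_def w_def)
    show "continuous_on UNIV D"
      unfolding D_def by (intro continuous_on_vec_lambda continuous_intros contw cont\<pi> contP contDw)
    show "((\<lambda>x. \<pi> x *\<^sub>R w t x) has_derivative (\<lambda>h. D x *v h)) (at x)" for x
    proof -
      have "D x *v h = \<pi> x *\<^sub>R (Dw x *v h) + (P x \<bullet> h) *\<^sub>R w t x" for h
        by (simp add: vec_eq_iff D_def matrix_vector_mult_def inner_vec_def distrib_left sum.distrib
              sum_distrib_left mult_ac)
      then show ?thesis using has_derivative_scaleR[OF D\<pi>[of x] Dw[of x]] by simp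
    qed
  qed
  moreover have "trace (B t x ** D x) = w t x \<bullet> q x" for x
  proof -
    let ?M = "mat 1 + G t x" and ?A = "Du t (Y t x)"
    have MB: "?M ** B t x = mat 1" using B[OF tR] by (simp add: matrix_left_right_inverse)
    have "trace (B t x ** (?A ** ?M)) = trace ((?A ** ?M) ** B t x)" by (rule trace_mul_sym)
    also have "\<dots> = trace ?A" by (simp add: matrix_mul_assoc[symmetric] MB)
    finally have "trace (B t x ** (?A ** ?M)) = 0" using trace_Du[OF t] by simp
    then have tr: "trace (B t x ** Dw x) = 0"
      by (simp add: Dw_def matrix_sub_ldistrib trace_sub trace_BH[OF tR])
    have "P x v* B t x = q x"
      unfolding P_def vector_matrix_mul_assoc MB by simp
    then have q: "q x $ i = (\<Sum>j\<in>UNIV. P x $ j * B t x $ j $ i)" for i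
      by (simp add: vec_eq_iff vector_matrix_mult_def mult.commute)
    have "trace (B t x ** D x) = (\<Sum>j\<in>UNIV. \<Sum>i\<in>UNIV. B t x $ j $ i * (w t x $ i * P x $ j)) + \<pi> x * trace (B t x ** Dw x)"
      by (simp add: trace_def matrix_matrix_mult_def D_def distrib_left sum.distrib sum_distrib_left mult_ac)
    also have "(\<Sum>j\<in>UNIV. \<Sum>i\<in>UNIV. B t x $ j $ i * (w t x $ i * P x $ j)) = w t x \<bullet> q x"
      by (subst sum.swap) (simp add: inner_vec_def q sum_distrib_left mult_ac)
    finally show ?thesis using tr by simp
  qed
  ultimately show ?thesis by (simp add: q_def)
qed

text \<open>The energy is the kinetic energy of \<open>w\<close>, weighted by the transported
  initial density, plus the squared density error. Writing c \<sigma> as \<rho> - \<theta> turns the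
  pressure term into a gradient orthogonal to \<open>w\<close> plus a product of \<theta> and
  \<open>w\<close>, so the difference of the two pressures never has to be estimated.\<close>

theorem velocity_along_flow:
  assumes t: "t \<in> {0..T}"
  shows "u t (Y t x) = V t x"
proof -
  let ?Q = "\<lambda>t x. w t x \<bullet> (Dp t (Y t x) + c *\<^sub>R \<sigma> x *\<^sub>R W t x)"
  define w' where "w' = (\<lambda>t x. - (Du t (Y t x) *v w t x) - (1 / \<rho> t (Y t x)) *\<^sub>R Dp t (Y t x) - W t x)"
  define e where "e = (\<lambda>t x. c * \<sigma> x * (w t x \<bullet> w t x) + (\<theta> t x)\<^sup>2)"
  define e' where "e' = (\<lambda>t x. c * \<sigma> x * (2 * (w t x \<bullet> w' t x)) + 2 * \<theta> t x * (- (w t x \<bullet> D\<rho> t (Y t x))))"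
  have \<sigma>_pos: "\<sigma> x > 0" for x using m(1) m(2)[of x] by linarith
  have e_nonneg: "e t x \<ge> 0" for t x using c \<sigma>_pos[of x] by (simp add: e_def)
  have cw: "continuous_on ({0..T} \<times> UNIV) (\<lambda>z. w (fst z) (snd z))"
    unfolding w_def by (intro continuous_intros cont_along cont_sol cont_flow)
  have c\<theta>: "continuous_on ({0..T} \<times> UNIV) (\<lambda>z. \<theta> (fst z) (snd z))"
    unfolding \<theta>_def by (intro continuous_intros cont_along cont_sol cont_\<sigma>_snd)
  have \<rho>_nz: "\<rho> t y \<noteq> 0" if "t \<in> {0..T}" for t y using \<rho>_pos[OF that, of y] by simp
  have cq: "continuous_on ({0..T} \<times> UNIV) (\<lambda>z. (1 / \<rho> (fst z) (Y (fst z) (snd z))) *\<^sub>R Dp (fst z) (Y (fst z) (snd z)))"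
    by (intro continuous_intros cont_along cont_sol) (auto simp: \<rho>_nz)
  have ce: "continuous_on ({0..T} \<times> UNIV) (\<lambda>z. e (fst z) (snd z))"
    unfolding e_def by (intro continuous_intros cw c\<theta> cont_\<sigma>_snd)
  have cw': "continuous_on ({0..T} \<times> UNIV) (\<lambda>z. w' (fst z) (snd z))"
    unfolding w'_def
    by (intro continuous_on_diff continuous_on_minus continuous_on_matrix_vector_mult cont_along[OF cont_sol(2)] cw cont_flow(3) cq)
  have ce': "continuous_on ({0..T} \<times> UNIV) (\<lambda>z. e' (fst z) (snd z))"
    unfolding e'_def by (intro continuous_intros cw c\<theta> cw' cont_along[OF cont_sol(4)] cont_\<sigma>_snd)
  have int: "f t integrable_on unit_cube" if "continuous_on ({0..T} \<times> UNIV) (\<lambda>z. f (fst z) (snd z))" "t \<in> {0..T}"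
    for f :: "real \<Rightarrow> real^'n \<Rightarrow> real" and t
    unfolding unit_cube_def
    by (intro integrable_continuous continuous_on_subset[OF cont_slice[OF that]]) simp
  have d_e: "((\<lambda>t. e t x) has_real_derivative e' t x) (at t within {0..T})" if t: "t \<in> {0..T}" for t x
  proof -
    have dw: "((\<lambda>t. w t x) has_derivative (\<lambda>h. h *\<^sub>R w' t x)) (at t within {0..T})"
      using d_w[OF t] by (simp add: has_vector_derivative_def w'_def)
    have "((\<lambda>t. w t x \<bullet> w t x) has_real_derivative 2 * (w t x \<bullet> w' t x)) (at t within {0..T})"
      by (rule has_derivative_imp_has_field_derivative[OF has_derivative_inner[OF dw dw]]) (simp add: inner_commute)
    from DERIV_add[OF DERIV_cmult[OF this, of "c * \<sigma> x"] DERIV_power[OF d_\<theta>[OF t, of x], of 2]] show ?thesis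
      by (simp add: e_def e'_def mult_ac)
  qed
  define E where "E = (\<lambda>t. integral unit_cube (e t))"
  define E' where "E' = (\<lambda>t. integral unit_cube (e' t))"
  have d_E: "(E has_real_derivative E' t) (at t within {0..T})" if t: "t \<in> {0..T}" for t
    unfolding E_def E'_def unit_cube_def
  proof (rule leibniz_rule_field_derivative[OF d_e])
    show "e t integrable_on cbox 0 (\<chi> i. 1)" if "t \<in> {0..T}" for t
      using int[OF ce that] by (simp add: unit_cube_def)
    show "continuous_on ({0..T} \<times> cbox 0 (\<chi> i. 1)) (\<lambda>(t, x). e' t x)"
      unfolding case_prod_unfold by (rule continuous_on_subset[OF ce']) auto
  qed (use t in auto)
  let ?K = "{0..T} \<times> (unit_cube :: (real^'n) set)"
  have K: "compact ?K" by (intro compact_Times compact_unit_cube compact_Icc)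
  have bdd: "\<exists>M\<ge>0. \<forall>z\<in>?K. f z \<le> M" if "continuous_on ({0..T} \<times> UNIV) f" for f :: "real \<times> (real^'n) \<Rightarrow> real"
    by (rule continuous_on_compact_le[OF continuous_on_subset[OF that] K]) auto
  have "continuous_on ({0..T} \<times> UNIV) (\<lambda>z. \<Sum>i\<in>UNIV. \<Sum>j\<in>UNIV. \<bar>Du (fst z) (Y (fst z) (snd z)) $ i $ j\<bar>)"
    by (intro continuous_intros cont_along[OF cont_sol(2)])
  from bdd[OF this] obtain M1 where M1: "M1 \<ge> 0"
    "\<And>z. z \<in> ?K \<Longrightarrow> (\<Sum>i\<in>UNIV. \<Sum>j\<in>UNIV. \<bar>Du (fst z) (Y (fst z) (snd z)) $ i $ j\<bar>) \<le> M1" by blast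
  from bdd[OF continuous_on_norm[OF cq]] obtain M2 where M2: "M2 \<ge> 0"
    "\<And>z. z \<in> ?K \<Longrightarrow> norm ((1 / \<rho> (fst z) (Y (fst z) (snd z))) *\<^sub>R Dp (fst z) (Y (fst z) (snd z))) \<le> M2" by blast
  from bdd[OF continuous_on_norm[OF cont_along[OF cont_sol(4)]]] obtain M3 where M3: "M3 \<ge> 0"
    "\<And>z. z \<in> ?K \<Longrightarrow> norm (D\<rho> (fst z) (Y (fst z) (snd z))) \<le> M3" by blast
  \<comment> \<open>\<open>M1\<close> accounts for the term with Du, \<open>M2\<close> and
    \<open>M3\<close> for the products of \<theta> and \<open>w\<close>; the factor 1 / (c m) passes
    from |w|^2 to the weighted energy.\<close>
  define L where "L = 2 * M1 + (M2 + M3) * (1 + 1 / (c * m))"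
  \<comment> \<open>Adding twice \<open>?Q\<close>, which integrates to zero, removes the terms that
    are only linear in \<open>w\<close>; what is left is quadratic in \<open>w\<close> and \<theta>,
    hence bounded by the energy density.\<close>
  have bound: "e' t x + 2 * ?Q t x \<le> L * e t x" if t: "t \<in> {0..T}" and x: "x \<in> unit_cube" for t x
  proof -
    let ?A = "Du t (Y t x)" and ?q = "(1 / \<rho> t (Y t x)) *\<^sub>R Dp t (Y t x)" and ?r = "D\<rho> t (Y t x)"
    let ?N = "norm (w t x)" and ?T = "\<bar>\<theta> t x\<bar>" and ?s = "c * \<sigma> x"
    have z: "(t, x) \<in> ?K" using t x by simp
    have s: "?s > 0" "c * m \<le> ?s" using c \<sigma>_pos m(2)[of x] by simp_all
    have N: "?N\<^sup>2 \<le> (1 / (c * m)) * (?s * ?N\<^sup>2)"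
      using mult_right_mono[OF s(2), of "?N\<^sup>2"] c m(1) by (simp add: field_simps)
    have "w t x \<bullet> Dp t (Y t x) = \<rho> t (Y t x) * (w t x \<bullet> ?q)" by (simp add: \<rho>_nz[OF t])
    then have sq: "?s * (w t x \<bullet> ?q) = w t x \<bullet> Dp t (Y t x) - \<theta> t x * (w t x \<bullet> ?q)"
      by (simp only: \<theta>_def) (simp only: left_diff_distrib diff_diff_eq2 add_diff_cancel_left')
    have "e' t x + 2 * ?Q t x = 2 * (?s * - (w t x \<bullet> (?A *v w t x))) - 2 * (?s * (w t x \<bullet> ?q)) + 2 * (w t x \<bullet> Dp t (Y t x))
        - 2 * (\<theta> t x * (w t x \<bullet> ?r))"
      by (simp add: e'_def w'_def inner_diff_right inner_add_right algebra_simps)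
    also have "\<dots> = 2 * (?s * - (w t x \<bullet> (?A *v w t x))) + 2 * (\<theta> t x * (w t x \<bullet> ?q)) - 2 * (\<theta> t x * (w t x \<bullet> ?r))"
      unfolding sq by (simp add: algebra_simps)
    also have "\<dots> \<le> 2 * (?s * (M1 * ?N\<^sup>2)) + M2 * (?T\<^sup>2 + ?N\<^sup>2) + M3 * (?T\<^sup>2 + ?N\<^sup>2)"
    proof -
      have "- (w t x \<bullet> (?A *v w t x)) \<le> ?N * norm (?A *v w t x)"
        using Cauchy_Schwarz_ineq2[of "w t x" "?A *v w t x"] by linarith
      also have "\<dots> \<le> ?N * (M1 * ?N)"
        by (intro mult_left_mono order_trans[OF norm_matrix_vector_le] mult_right_mono) (use M1(2)[OF z] in auto)
      finally have 1: "?s * - (w t x \<bullet> (?A *v w t x)) \<le> ?s * (M1 * ?N\<^sup>2)"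
        using s by (intro mult_left_mono) (simp_all add: power2_eq_square mult_ac)
      have 2: "2 * \<bar>\<theta> t x * (w t x \<bullet> v)\<bar> \<le> M * (?T\<^sup>2 + ?N\<^sup>2)" if "norm v \<le> M" "M \<ge> 0" for v M
      proof -
        have "\<bar>\<theta> t x * (w t x \<bullet> v)\<bar> \<le> ?T * (?N * M)"
          unfolding abs_mult using that
          by (intro mult_left_mono order_trans[OF Cauchy_Schwarz_ineq2] mult_left_mono) auto
        then have "2 * \<bar>\<theta> t x * (w t x \<bullet> v)\<bar> \<le> M * (2 * ?T * ?N)" by (simp add: mult_ac)
        also have "\<dots> \<le> M * (?T\<^sup>2 + ?N\<^sup>2)" by (intro mult_left_mono sum_squares_bound that)
        finally show ?thesis .
      qed
      have q: "norm ?q \<le> M2" "norm ?r \<le> M3" using M2(2)[OF z] M3(2)[OF z] by (simp_all only: fst_conv snd_conv)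
      show ?thesis
        using 1 2[OF q(1) M2(1)] 2[OF q(2) M3(1)] abs_ge_self[of "\<theta> t x * (w t x \<bullet> ?q)"]
          abs_ge_minus_self[of "\<theta> t x * (w t x \<bullet> ?r)"] by linarith
    qed
    also have "\<dots> = 2 * M1 * (?s * ?N\<^sup>2) + (M2 + M3) * (?T\<^sup>2 + ?N\<^sup>2)" by (simp add: algebra_simps)
    also have "\<dots> \<le> 2 * M1 * e t x + (M2 + M3) * ((1 + 1 / (c * m)) * e t x)"
    proof (intro add_mono mult_left_mono)
      show le: "?s * ?N\<^sup>2 \<le> e t x" by (simp add: e_def power2_norm_eq_inner)
      have "?T\<^sup>2 \<le> e t x" using s(1) by (simp add: e_def)
      moreover have "?N\<^sup>2 \<le> 1 / (c * m) * e t x"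
        using N mult_left_mono[OF le, of "1 / (c * m)"] c m(1) by simp
      ultimately show "?T\<^sup>2 + ?N\<^sup>2 \<le> (1 + 1 / (c * m)) * e t x" by (simp add: distrib_right)
    qed (use M1 M2 M3 in auto)
    finally show ?thesis by (simp only: L_def distrib_right mult.assoc)
  qed
  have "E t \<le> 0"
  proof (rule gronwall_nonpos[OF d_E _ _ t])
    show "E' t \<le> L * E t" if t: "t \<in> {0..T}" for t
    proof -
      have "((\<lambda>x. e' t x + 2 * ?Q t x) has_integral E' t + 2 * 0) unit_cube"
        unfolding E'_def
        by (intro has_integral_add has_integral_mult_right pressure_orthogonal t integrable_integral int[OF ce' t])
      moreover have "((\<lambda>x. L * e t x) has_integral L * E t) unit_cube"
        unfolding E_def by (intro has_integral_mult_right integrable_integral int[OF ce t])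
      ultimately have "E' t + 2 * 0 \<le> L * E t" by (rule has_integral_le) (rule bound[OF t])
      then show ?thesis by simp
    qed
    have "e 0 = (\<lambda>x. 0)" by (simp add: fun_eq_iff e_def w_def \<theta>_def Y_def \<xi>_0 u_0 \<rho>_0)
    then show "E 0 \<le> 0" by (simp add: E_def)
  qed
  moreover have eE: "(e t has_integral E t) unit_cube" unfolding E_def by (rule integrable_integral[OF int[OF ce t]])
  moreover have "E t \<ge> 0" by (rule has_integral_nonneg[OF eE]) (rule e_nonneg)
  ultimately have "(e t has_integral 0) (cbox 0 (\<chi> i. 1))" by (simp add: unit_cube_def)
  then have "e t y = 0" if "y \<in> unit_cube" for y
    using has_integral_0_cbox_imp_0[of 0 "\<chi> i. 1" "e t" y] continuous_on_subset[OF cont_slice[OF ce t]] e_nonneg that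
    by (simp add: unit_cube_def interval_eq_empty_cart)
  then have "w t y = 0" if "y \<in> unit_cube" for y
    using that c \<sigma>_pos[of y] by (fastforce simp: e_def add_nonneg_eq_0_iff)
  moreover have "torus_fun (w t)"
    using torus_u[OF t] torus(1,2)[OF abs_less_R[OF t]] by (simp add: torus_fun_def w_def Y_def add.commute[of _ "axis _ _"] add.assoc)
  ultimately have "w t x = 0" by (metis torus_fun_reduce)
  then show ?thesis by (simp add: w_def)
qed

text \<open>Once u along \<open>Y\<close> equals \<open>V\<close>, the constructed trajectory solves
  the same equation as \<open>X\<close>; the Lipschitz bound and Gronwall for the squared distance
  give uniqueness.\<close>

theorem flow_unique:
  assumes X: "X 0 = x" "\<And>t. t \<in> {0..T} \<Longrightarrow> (X has_vector_derivative u t (X t)) (at t within {0..T})"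
    and L: "\<And>t y z. t \<in> {0..T} \<Longrightarrow> norm (u t y - u t z) \<le> L * norm (y - z)" and t: "t \<in> {0..T}"
  shows "X t = x + \<xi> t x"
proof -
  let ?d = "\<lambda>t. X t - Y t x"
  have "?d t \<bullet> ?d t \<le> 0"
  proof (rule gronwall_nonpos[OF _ _ _ t])
    fix t assume t: "t \<in> {0..T}"
    have d: "(?d has_derivative (\<lambda>h. h *\<^sub>R (u t (X t) - u t (Y t x)))) (at t within {0..T})"
      using has_vector_derivative_diff[OF X(2)[OF t] d_Y[OF t, of x]]
      by (simp add: has_vector_derivative_def velocity_along_flow[OF t])
    show "((\<lambda>t. ?d t \<bullet> ?d t) has_real_derivative 2 * (?d t \<bullet> (u t (X t) - u t (Y t x)))) (at t within {0..T})"
      by (rule has_derivative_imp_has_field_derivative[OF has_derivative_inner[OF d d]]) (simp add: inner_commute)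
    have "?d t \<bullet> (u t (X t) - u t (Y t x)) \<le> norm (?d t) * (L * norm (?d t))"
      by (rule order_trans[OF norm_cauchy_schwarz mult_left_mono[OF L[OF t]]]) simp
    then show "2 * (?d t \<bullet> (u t (X t) - u t (Y t x))) \<le> (2 * L) * (?d t \<bullet> ?d t)"
      by (simp add: dot_square_norm power2_eq_square mult_ac)
  qed (simp add: X(1) Y_def \<xi>_0)
  then have "?d t \<bullet> ?d t = 0" by (rule antisym) simp
  then show ?thesis by (simp add: Y_def)
qed

end

section \<open>Pointwise form of the equations and transfer of analyticity\<close>

lemma partial_deriv_eq:
  assumes "(f has_derivative (\<lambda>h. v \<bullet> h)) (at x)"
  shows "partial_deriv i f x = v $ i"
  unfolding partial_deriv_def frechet_derivative_at[OF assms, symmetric] by (simp add: inner_axis)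

lemma grad_eq: "(f has_derivative (\<lambda>h. v \<bullet> h)) (at x) \<Longrightarrow> grad f x = v"
  by (simp add: grad_def vec_eq_iff partial_deriv_eq)

lemma has_derivative_grad:
  assumes "f differentiable (at x)"
  shows "(f has_derivative (\<lambda>h. grad f x \<bullet> h)) (at x)"
proof -
  let ?f' = "frechet_derivative f (at x)"
  have f': "(f has_derivative ?f') (at x)" using assms by (simp add: frechet_derivative_works)
  have "?f' h = grad f x \<bullet> h" for h
  proof -
    have "?f' h = ?f' (\<Sum>i\<in>UNIV. h $ i *\<^sub>R axis i 1)"
      using basis_expansion[of h] by (simp add: scalar_mult_eq_scaleR)
    also have "\<dots> = (\<Sum>i\<in>UNIV. h $ i * ?f' (axis i 1))"
      using has_derivative_linear[OF f'] by (simp add: linear_sum linear_scale)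
    finally show ?thesis by (simp add: grad_def partial_deriv_def inner_vec_def mult.commute)
  qed
  then show ?thesis using f' by (metis (no_types, lifting) ext)
qed

lemma has_derivative_component:
  assumes "(v has_derivative (\<lambda>h. A *v h)) (at x)"
  shows "((\<lambda>y. v y $ i) has_derivative (\<lambda>h. A $ i \<bullet> h)) (at x)"
  using bounded_linear.has_derivative[OF bounded_linear_vec_nth[of i] assms]
  by (simp add: matrix_vector_mult_def inner_vec_def)

lemma divergence_eq_trace:
  assumes "(v has_derivative (\<lambda>h. A *v h)) (at x)"
  shows "divergence v x = trace A"
  by (simp add: divergence_def trace_def partial_deriv_eq[OF has_derivative_component[OF assms]])

text \<open>By the product rule the only further term is r v times the divergence of v, which is
  \<open>trace A\<close>.\<close>

lemma matrix_divergence_tensor: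
  fixes v :: "real^'n \<Rightarrow> real^'n"
  assumes v: "(v has_derivative (\<lambda>h. A *v h)) (at x)" and r: "(r has_derivative (\<lambda>h. b \<bullet> h)) (at x)"
    and A: "trace A = 0"
  shows "matrix_divergence (\<lambda>y. r y *\<^sub>R tensor (v y) (v y)) x = (v x \<bullet> b) *\<^sub>R v x + r x *\<^sub>R (A *v v x)"
proof -
  have "partial_deriv j (\<lambda>y. (r y *\<^sub>R tensor (v y) (v y)) $ i $ j) x =
      b $ j * (v x $ i * v x $ j) + r x * (A $ i $ j * v x $ j + v x $ i * A $ j $ j)" for i j
  proof -
    have "((\<lambda>y. r y * (v y $ i * v y $ j)) has_derivative
        (\<lambda>h. r x * (v x $ i * (A $ j \<bullet> h) + (A $ i \<bullet> h) * v x $ j) + (b \<bullet> h) * (v x $ i * v x $ j))) (at x)"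
      by (intro has_derivative_mult r has_derivative_component v)
    then have "((\<lambda>y. r y * (v y $ i * v y $ j)) has_derivative
        (\<lambda>h. (r x *\<^sub>R (v x $ i *\<^sub>R A $ j + v x $ j *\<^sub>R A $ i) + (v x $ i * v x $ j) *\<^sub>R b) \<bullet> h)) (at x)"
      by (simp add: inner_add_left algebra_simps)
    from partial_deriv_eq[OF this, of j] show ?thesis by (simp add: tensor_def algebra_simps)
  qed
  moreover have "(\<Sum>j\<in>UNIV. b $ j * (v x $ i * v x $ j) + r x * (A $ i $ j * v x $ j + v x $ i * A $ j $ j)) =
      (v x \<bullet> b) * v x $ i + r x * (A *v v x) $ i + r x * (v x $ i * trace A)" for i
    by (simp add: inner_vec_def matrix_vector_mult_def trace_def distrib_left sum.distrib sum_distrib_left sum_distrib_right mult_ac)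
  ultimately show ?thesis
    by (simp add: vec_eq_iff matrix_divergence_def divergence_def A)
qed

text \<open>Only the momentum r v is known to be differentiable in time, so v is recovered as 1/r
  times it; the mass equation then cancels the terms with \<open>a\<close>.\<close>

lemma velocity_equation:
  fixes v :: "real \<Rightarrow> real^'n" and q b :: "real^'n"
  assumes r: "(r has_real_derivative - a) (at t within S)" and pos: "\<And>\<tau>. \<tau> \<in> S \<Longrightarrow> r \<tau> > 0" and t: "t \<in> S"
    and rv: "((\<lambda>\<tau>. r \<tau> *\<^sub>R v \<tau>) has_vector_derivative - (a *\<^sub>R v t + r t *\<^sub>R b) - q) (at t within S)"
  shows "(v has_vector_derivative - b - (1 / r t) *\<^sub>R q) (at t within S)"
proof -
  have r0: "r t \<noteq> 0" using pos[OF t] by simp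
  have "((\<lambda>\<tau>. 1 / r \<tau>) has_real_derivative a / (r t)\<^sup>2) (at t within S)"
    using r r0 by (auto intro!: derivative_eq_intros simp: power2_eq_square)
  from has_vector_derivative_scaleR[OF this rv]
  have d: "((\<lambda>\<tau>. (1 / r \<tau>) *\<^sub>R r \<tau> *\<^sub>R v \<tau>) has_vector_derivative
      (1 / r t) *\<^sub>R (- (a *\<^sub>R v t + r t *\<^sub>R b) - q) + (a / (r t)\<^sup>2) *\<^sub>R r t *\<^sub>R v t) (at t within S)" .
  have e: "(1 / r t) *\<^sub>R (- (a *\<^sub>R v t + r t *\<^sub>R b) - q) + (a / (r t)\<^sup>2) *\<^sub>R r t *\<^sub>R v t = - b - (1 / r t) *\<^sub>R q"
    using r0 by (simp add: vec_eq_iff power2_eq_square field_simps)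
  have "v \<tau> = (1 / r \<tau>) *\<^sub>R r \<tau> *\<^sub>R v \<tau>" if "\<tau> \<in> S" for \<tau> using pos[OF that] by simp
  from has_vector_derivative_transform[OF t this d[unfolded e]] show ?thesis .
qed

lemma lipschitz_ev_family:
  fixes F :: "real \<Rightarrow> 'n::finite \<Rightarrow> 'n wiener"
  assumes A: "\<And>t i. t \<in> {a..b} \<Longrightarrow> F t i \<in> A1"
    and cont: "\<And>i j. continuous_on {a..b} (\<lambda>t. der j (F t i))"
  shows "\<exists>L. \<forall>t\<in>{a..b}. \<forall>y z. norm ((\<chi> i. ev (F t i) y) - (\<chi> i. ev (F t i) z)) \<le> L * norm (y - z)"
proof -
  have "continuous_on {a..b} (\<lambda>t. \<Sum>i\<in>UNIV. \<Sum>j\<in>UNIV. norm (der j (F t i)))"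
    by (intro continuous_intros cont)
  then obtain L where L: "\<And>t. t \<in> {a..b} \<Longrightarrow> (\<Sum>i\<in>UNIV. \<Sum>j\<in>UNIV. norm (der j (F t i))) \<le> L"
    using continuous_on_compact_le[OF _ compact_Icc] by blast
  have "norm ((\<chi> i. ev (F t i) y) - (\<chi> i. ev (F t i) z)) \<le> L * norm (y - z)" if t: "t \<in> {a..b}" for t y z
  proof (rule differentiable_bound[OF convex_UNIV _ _ UNIV_I UNIV_I])
    show "((\<lambda>y. \<chi> i. ev (F t i) y) has_derivative (\<lambda>h. (\<chi> i j. ev (der j (F t i)) y) *v h)) (at y within UNIV)" for y
      by (rule has_derivative_vec_ev[OF A[OF t]])
    show "onorm (\<lambda>h. (\<chi> i j. ev (der j (F t i)) y) *v h) \<le> L" for y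
    proof (rule onorm_le)
      fix h
      have "(\<Sum>i\<in>UNIV. \<Sum>j\<in>UNIV. \<bar>ev (der j (F t i)) y\<bar>) \<le> L"
        by (rule order_trans[OF _ L[OF t]]) (intro sum_mono abs_ev_le)
      then show "norm ((\<chi> i j. ev (der j (F t i)) y) *v h) \<le> L * norm h"
        by (intro order_trans[OF norm_matrix_vector_le] mult_right_mono) simp_all
    qed
  qed
  then show ?thesis by blast
qed

lemma ev_inject:
  assumes "\<And>x. ev f x = ev g x"
  shows "f = g"
  by (rule evc_inject) (simp add: evc_real assms)

lemma real_analytic_on_cong_subset:
  assumes f: "real_analytic_on f S" and sub: "S' \<subseteq> S" "open S'" and eq: "\<And>t. t \<in> S' \<Longrightarrow> g t = f t"
  shows "real_analytic_on g S'"
  unfolding real_analytic_on_def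
proof
  fix t0 assume t0: "t0 \<in> S'"
  then obtain c e where e: "e > 0" "\<And>t. \<bar>t - t0\<bar> < e \<Longrightarrow> (\<lambda>n. (t - t0) ^ n *\<^sub>R c n) sums f t"
    using f sub(1) unfolding real_analytic_on_def by blast
  obtain d where d: "d > 0" "\<And>t. \<bar>t - t0\<bar> < d \<Longrightarrow> t \<in> S'"
    using sub(2) t0 unfolding open_dist dist_real_def by blast
  show "\<exists>c. \<exists>\<epsilon>>0. \<forall>t. \<bar>t - t0\<bar> < \<epsilon> \<longrightarrow> (\<lambda>n. (t - t0) ^ n *\<^sub>R c n) sums g t"
    using e d eq by (intro exI[of _ c] exI[of _ "min e d"]) auto
qed

text \<open>Analyticity is inherited: for small positive times the displacement coincides with that
  of the constructed flow, which is analytic on a larger interval symmetric about 0.\<close>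

theorem theorem4p1:
  fixes s C\<^sub>1 T :: real
    and u\<^sub>0 :: "real^'n \<Rightarrow> real^'n" and \<rho>\<^sub>0 :: "real^'n \<Rightarrow> real"
    and u :: "real \<Rightarrow> real^'n \<Rightarrow> real^'n" and \<rho> p :: "real \<Rightarrow> real^'n \<Rightarrow> real"
    and X :: "real \<Rightarrow> real^'n \<Rightarrow> real^'n"
  assumes "s > real CARD('n) / 2"
    and "u\<^sub>0 \<in> sobolev_space (s + 1)" and "divergence_free u\<^sub>0"
    and "\<rho>\<^sub>0 \<in> sobolev_space (s + 1)" and "(LINT x:unit_cube|lebesgue. \<rho>\<^sub>0 x) = 1"
    and "C\<^sub>1 > 1" and "\<And>a. inverse C\<^sub>1 \<le> \<rho>\<^sub>0 a \<and> \<rho>\<^sub>0 a \<le> C\<^sub>1"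
    and "T > 0" and "inhomogeneous_euler_solution (s + 1) T u \<rho> p"
    and "u 0 = u\<^sub>0" and "\<rho> 0 = \<rho>\<^sub>0"
    and "lagrangian_flow T u X"
  shows "\<exists>T'>0. T' \<le> T \<and> (\<forall>a. real_analytic_on (\<lambda>t. X t a - a) {0<..<T'})"
proof -
  note s = assms(1) and C1 = assms(6) and \<rho>0 = assms(7) and T = assms(8)
  let ?C = C\<^sub>1
  have sol: "continuous_in_sobolev T (s + 1) u" "continuous_in_sobolev T (s + 1) \<rho>"
    "continuous_on ({0..<T} \<times> UNIV) (\<lambda>z. grad (p (fst z)) (snd z))"
    and solt: "\<And>t. t \<in> {0..<T} \<Longrightarrow> torus_fun (p t)" "\<And>t. t \<in> {0..<T} \<Longrightarrow> divergence_free (u t)"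
      "\<And>t x. t \<in> {0..<T} \<Longrightarrow> \<rho> t differentiable (at x)" "\<And>t x. t \<in> {0..<T} \<Longrightarrow> p t differentiable (at x)"
      "\<And>t x. t \<in> {0..<T} \<Longrightarrow> ((\<lambda>\<tau>. \<rho> \<tau> x *\<^sub>R u \<tau> x) has_vector_derivative
         - matrix_divergence (\<lambda>y. \<rho> t y *\<^sub>R tensor (u t y) (u t y)) x - grad (p t) x) (at t within {0..<T})"
      "\<And>t x. t \<in> {0..<T} \<Longrightarrow> ((\<lambda>\<tau>. \<rho> \<tau> x) has_real_derivative - (u t x \<bullet> grad (\<rho> t) x)) (at t within {0..<T})"
    using assms(9) unfolding inhomogeneous_euler_solution_def case_prod_unfold by blast+
  have cont_u: "continuous_on UNIV (u t)" and cont_\<rho>: "continuous_on UNIV (\<rho> t)" if "t \<in> {0..<T}" for t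
    using solt(2)[OF that] solt(3)[OF that]
    by (auto simp: divergence_free_def intro!: differentiable_imp_continuous_within continuous_at_imp_continuous_on)
  obtain F where F: "\<And>t b. t \<in> {0..<T} \<Longrightarrow> b \<in> Basis \<Longrightarrow> F t b \<in> A1"
    "\<And>t b x. t \<in> {0..<T} \<Longrightarrow> b \<in> Basis \<Longrightarrow> ev (F t b) x = u t x \<bullet> b"
    "\<And>b. b \<in> Basis \<Longrightarrow> continuous_on {0..<T} (\<lambda>t. F t b)"
    "\<And>b j. b \<in> Basis \<Longrightarrow> continuous_on {0..<T} (\<lambda>t. der j (F t b))"
    by (rule wiener_family[OF s sol(1) cont_u], assumption, rule that) simp_all
  obtain K where K: "\<And>t b. t \<in> {0..<T} \<Longrightarrow> b \<in> Basis \<Longrightarrow> K t b \<in> A1"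
    "\<And>t b x. t \<in> {0..<T} \<Longrightarrow> b \<in> Basis \<Longrightarrow> ev (K t b) x = \<rho> t x \<bullet> b"
    "\<And>b. b \<in> Basis \<Longrightarrow> continuous_on {0..<T} (\<lambda>t. K t b)"
    "\<And>b j. b \<in> Basis \<Longrightarrow> continuous_on {0..<T} (\<lambda>t. der j (K t b))"
    by (rule wiener_family[OF s sol(2) cont_\<rho>], assumption, rule that) simp_all
  define fu where "fu = (\<lambda>t i. F t (axis i 1))"
  define fr where "fr = (\<lambda>t. K t 1)"
  have fu: "fu t i \<in> A1" "ev (fu t i) x = u t x $ i" if "t \<in> {0..<T}" for t i x
    using F(1,2)[OF that] by (auto simp: fu_def axis_in_Basis_iff inner_axis)
  have fr: "fr t \<in> A1" "ev (fr t) x = \<rho> t x" if "t \<in> {0..<T}" for t x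
    using K(1,2)[OF that] by (auto simp: fr_def)
  have c_fu: "continuous_on {0..<T} (\<lambda>t. fu t i)" "continuous_on {0..<T} (\<lambda>t. der j (fu t i))" for i j
    unfolding fu_def by (intro F; simp add: axis_in_Basis_iff)+
  have c_fr: "continuous_on {0..<T} fr" "continuous_on {0..<T} (\<lambda>t. der j (fr t))" for j
    unfolding fr_def by (intro K; simp)+
  define Du where "Du = (\<lambda>t y. \<chi> i j. ev (der j (fu t i)) y)"
  define D\<rho> where "D\<rho> = (\<lambda>t y. \<chi> j. ev (der j (fr t)) y)"
  have u_eq: "u t = (\<lambda>y. \<chi> i. ev (fu t i) y)" if "t \<in> {0..<T}" for t
    by (simp add: fun_eq_iff vec_eq_iff fu(2)[OF that])
  have Du: "(u t has_derivative (\<lambda>h. Du t y *v h)) (at y)" if "t \<in> {0..<T}" for t y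
    unfolding u_eq[OF that] Du_def by (rule has_derivative_vec_ev[OF fu(1)[OF that]])
  have D\<rho>: "(\<rho> t has_derivative (\<lambda>h. D\<rho> t y \<bullet> h)) (at y)" if "t \<in> {0..<T}" for t y
  proof -
    have "ev (fr t) = \<rho> t" using fr(2)[OF that] by (simp add: fun_eq_iff)
    then show ?thesis using has_derivative_ev[OF fr(1)[OF that], of y] by (simp add: D\<rho>_def inner_vec_def)
  qed
  have tr: "trace (Du t y) = 0" if "t \<in> {0..<T}" for t y
    using solt(2)[OF that] divergence_eq_trace[OF Du[OF that]] by (simp add: divergence_free_def)
  have T0: "0 \<in> {0..<T}" using T by simp
  \<comment> \<open>Normalization of the initial density as C (1 - g): from 1/C \<le> \<rho>_0 \<le>
    C follows 0 \<le> g \<le> 1 - 1/C^2, a bound below 1.\<close>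
  define g where "g = 1 - (1 / ?C) *\<^sub>R fr 0"
  have ev_g: "1 - ev g x = \<rho> 0 x / ?C" for x by (simp add: g_def fr(2)[OF T0])
  interpret series: lagrangian_series g "1 - 1 / ?C\<^sup>2" "fu 0"
  proof
    show "g \<in> A1" unfolding g_def by (intro A1_diff A1_scaleR A1_one fr T0)
    show "1 - 1 / ?C\<^sup>2 < 1" using C1 by simp
    show "fu 0 j \<in> A1" for j by (rule fu[OF T0])
    show "\<bar>ev g x\<bar> \<le> 1 - 1 / ?C\<^sup>2" for x
    proof -
      have "inverse ?C \<le> \<rho> 0 x" "\<rho> 0 x \<le> ?C" using \<rho>0[of x] assms(11) by auto
      then have "inverse ?C / ?C \<le> \<rho> 0 x / ?C" "\<rho> 0 x / ?C \<le> ?C / ?C"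
        using C1 by (auto intro!: divide_right_mono)
      then have "1 / ?C\<^sup>2 \<le> \<rho> 0 x / ?C" "\<rho> 0 x / ?C \<le> 1"
        using C1 by (auto simp: power2_eq_square inverse_eq_divide)
      then show ?thesis using ev_g[of x] by linarith
    qed
  qed
  have "(\<Sum>j\<in>UNIV. der j (fu 0 j)) = 0"
    by (rule ev_inject) (use tr[OF T0] in \<open>simp add: ev_sum trace_def Du_def\<close>)
  from series.ex_euler_flow[OF this] obtain R \<xi> V W G H B \<phi>
    where flow: "euler_flow R \<xi> V W G H B \<phi> (\<lambda>x. 1 - ev g x)" and V0: "\<And>x. V 0 x = u 0 x"
    by (auto simp: u_eq[OF T0])
  interpret flow: euler_flow R \<xi> V W G H B \<phi> "\<lambda>x. \<rho> 0 x / ?C" using flow unfolding ev_g .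
  \<comment> \<open>A density that moves by less than 1/(2C) from values of at least 1/C stays
    positive; continuity in the Wiener norm secures this for a short time.\<close>
  obtain \<delta> where \<delta>: "\<delta> > 0" "\<And>t. t \<in> {0..<T} \<Longrightarrow> dist t 0 < \<delta> \<Longrightarrow> dist (fr t) (fr 0) < 1 / (2 * ?C)"
    using c_fr(1)[unfolded continuous_on_iff, rule_format, OF T0, of "1 / (2 * ?C)"] C1 by auto
  \<comment> \<open>Halving keeps the closed interval up to \<open>T'\<close> inside the domains of
    the solution and of the constructed flow, and in the range where the density is known to be
    positive.\<close>
  define T' where "T' = min (\<delta> / 2) (min (R / 2) (T / 2))"
  have T': "0 < T'" "T' < \<delta>" "T' < R" "T' < T" using \<delta>(1) flow.R T by (auto simp: T'_def)
  have sub: "{0..T'} \<subseteq> {0..<T}" using T' by auto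
  have tT: "t \<in> {0..<T}" if "t \<in> {0..T'}" for t using that sub by blast
  have sub2: "{0..T'} \<times> UNIV \<subseteq> {0..<T} \<times> UNIV" using sub by auto
  have pos: "\<rho> t y > 0" if t: "t \<in> {0..T'}" for t y
  proof -
    have "\<bar>ev (fr t - fr 0) y\<bar> < 1 / (2 * ?C)"
      using abs_ev_le[of "fr t - fr 0" y] \<delta>(2)[OF tT[OF t]] t T'(2) by (simp add: dist_norm)
    then have "\<bar>\<rho> t y - \<rho> 0 y\<bar> < 1 / (2 * ?C)" by (simp add: fr(2)[OF tT[OF t]] fr(2)[OF T0])
    moreover have "1 / ?C \<le> \<rho> 0 y" using \<rho>0[of y] assms(11) by (simp add: inverse_eq_divide)
    moreover have "1 / (2 * ?C) < 1 / ?C" using C1 by (simp add: field_simps)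
    ultimately show ?thesis by linarith
  qed
  interpret comparison: euler_comparison R \<xi> V W G H B \<phi> "\<lambda>x. \<rho> 0 x / ?C" T' ?C "1 / ?C\<^sup>2" u Du \<rho> p D\<rho> "\<lambda>t. grad (p t)"
  proof
    show "0 < T'" "T' < R" by (rule T')+
    show "?C > 0" "1 / ?C\<^sup>2 > 0" using C1 by simp_all
    show "1 / ?C\<^sup>2 \<le> \<rho> 0 x / ?C" for x using series.r(1)[of x] ev_g[of x] by linarith
    show "torus_fun (u t)" if "t \<in> {0..T'}" for t
      using sol(1) tT[OF that] by (auto simp: continuous_in_sobolev_def sobolev_space_def)
    show "torus_fun (p t)" if "t \<in> {0..T'}" for t by (rule solt(1)[OF tT[OF that]])
    show "(u t has_derivative (\<lambda>h. Du t y *v h)) (at y)" "(\<rho> t has_derivative (\<lambda>h. D\<rho> t y \<bullet> h)) (at y)"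
      "(p t has_derivative (\<lambda>h. grad (p t) y \<bullet> h)) (at y)" "trace (Du t y) = 0" "\<rho> t y > 0" if "t \<in> {0..T'}" for t y
      by (intro Du D\<rho> tr has_derivative_grad solt(4) tT pos that)+
    show d_\<rho>: "((\<lambda>t. \<rho> t y) has_real_derivative - (u t y \<bullet> D\<rho> t y)) (at t within {0..T'})" if "t \<in> {0..T'}" for t y
      using DERIV_subset[OF solt(6)[OF tT[OF that]] sub] by (simp add: grad_eq[OF D\<rho>[OF tT[OF that]]])
    show "((\<lambda>t. u t y) has_vector_derivative - (Du t y *v u t y) - (1 / \<rho> t y) *\<^sub>R grad (p t) y) (at t within {0..T'})"
      if t: "t \<in> {0..T'}" for t y
    proof (rule velocity_equation[where r = "\<lambda>t. \<rho> t y", OF d_\<rho>[OF t] pos t])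
      show "((\<lambda>\<tau>. \<rho> \<tau> y *\<^sub>R u \<tau> y) has_vector_derivative
          - ((u t y \<bullet> D\<rho> t y) *\<^sub>R u t y + \<rho> t y *\<^sub>R (Du t y *v u t y)) - grad (p t) y) (at t within {0..T'})"
        using has_vector_derivative_within_subset[OF solt(5)[OF tT[OF t]] sub]
        by (simp only: matrix_divergence_tensor[OF Du[OF tT[OF t]] D\<rho>[OF tT[OF t]] tr[OF tT[OF t]]])
    qed
    have fam: "continuous_on ({0..T'} \<times> UNIV) (\<lambda>z. ev (f (fst z)) (snd z))" if "continuous_on {0..<T} f" for f :: "real \<Rightarrow> 'n wiener"
      using continuous_on_ev_family[OF continuous_on_subset[OF that sub]] by (simp add: case_prod_unfold)
    have "continuous_on ({0..T'} \<times> UNIV) (\<lambda>z. \<chi> i. ev (fu (fst z) i) (snd z))"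
      by (intro continuous_on_vec_lambda fam c_fu)
    then show "continuous_on ({0..T'} \<times> UNIV) (\<lambda>z. u (fst z) (snd z))"
      by (rule continuous_on_eq) (use u_eq tT in auto)
    show "continuous_on ({0..T'} \<times> UNIV) (\<lambda>z. \<rho> (fst z) (snd z))"
      by (rule continuous_on_eq[OF fam[OF c_fr(1)]]) (use fr(2) tT in auto)
    show "continuous_on ({0..T'} \<times> UNIV) (\<lambda>z. Du (fst z) (snd z))" "continuous_on ({0..T'} \<times> UNIV) (\<lambda>z. D\<rho> (fst z) (snd z))"
      unfolding Du_def D\<rho>_def by (intro continuous_on_vec_lambda fam c_fu c_fr)+
    show "continuous_on ({0..T'} \<times> UNIV) (\<lambda>z. grad (p (fst z)) (snd z))"
      by (rule continuous_on_subset[OF sol(3) sub2])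
    show "u 0 y = V 0 y" "\<rho> 0 y = ?C * (\<rho> 0 y / ?C)" for y using C1 by (simp_all add: V0)
  qed
  obtain L where L: "\<And>t y z. t \<in> {0..T'} \<Longrightarrow> norm ((\<chi> i. ev (fu t i) y) - (\<chi> i. ev (fu t i) z)) \<le> L * norm (y - z)"
    using lipschitz_ev_family[of 0 T' fu] fu(1) tT continuous_on_subset[OF c_fu(2) sub] by blast
  have X: "X t a - a = \<xi> t a" if t: "t \<in> {0..T'}" for t a
  proof -
    have "X 0 a = a" and "\<And>t. t \<in> {0..<T} \<Longrightarrow> ((\<lambda>\<tau>. X \<tau> a) has_vector_derivative u t (X t a)) (at t within {0..<T})"
      using assms(12) by (auto simp: lagrangian_flow_def)
    then have "X t a = a + \<xi> t a"
      by (intro comparison.flow_unique[where X = "\<lambda>t. X t a", OF _ _ _ t] has_vector_derivative_within_subset[OF _ sub])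
         (use L u_eq tT in auto)
    then show ?thesis by simp
  qed
  have "real_analytic_on (\<lambda>t. X t a - a) {0<..<T'}" for a
    by (rule real_analytic_on_cong_subset[OF flow.analytic]) (use X T' in auto)
  then show ?thesis using T' by (intro exI[of _ T']) auto
qed

end
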